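(* Let $d\in\mathbb{N}$, $p\in[1,\infty]$, $m\in\mathbb{N}_0$, $\alpha\in(0,1]$, and set $r:=m+\alpha$. Let $$\mathscr{C}:=\big\{f\in C^{m,\alpha}([0,1]^d):\|f\|_{C^{m,\alpha}}\le1\big\},$$ considered as a subset of $\mathbb{X}=L^p([0,1]^d)$. Then: (a) the power-exponential Minkowski dimension of $\mathscr{C}$ exists and $\dim_{\mathrm{M},\exp}(\mathscr{C})=\frac dr$; (b) there exists a Borel probability measure on $L^p([0,1]^d)$ that is critical for $\mathscr{C}$; (c) the family of neural network sets $(\mathcal{A}_n)_{n\in\mathbb{N}}=(\mathcal{NN}_n(3,\mathbb{R}^d))_{n\in\mathbb{N}}$ (restricted to $[0,1]^d$) is optimal for $\mathscr{C}$ in the class of families of controlled complexity in $L^p([0,1]^d)$. In particular, the following phase transition occurs. For every $0\le t<\frac rd$ there is $C(t)>0$ with $\sup_{f\in\mathscr{C}}\operatorname{dist}(f,\mathcal{NN}_n(3,\mathbb{R}^d))\le C(t)\,n^{-t}$ for all $n\in\mathbb{N}$. Conversely, for every Borel probability measure $\mu$ on $L^p([0,1]^d)$ that is critical for $\mathscr{C}$ and every family $(\mathcal{B}_n)_{n\in\mathbb{N}}$ of controlled complexity in $L^p([0,1]^d)$, $$\mu^{\ast}\Big(\bigcup_{t>r/d}\big\{f\in\mathscr{C}:\sup_{n\in\mathbb{N}}\,n^t\operatorname{dist}(f,\mathcal{B}_n)<\infty\big\}\Big)=0.$$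
   Context: Hölder space. $f:[0,1]^d\to\mathbb{R}$ belongs to $C^{m,\alpha}([0,1]^d)$ if it is $m$ times continuously differentiable and $\|f\|_{C^{m,\alpha}}:=\max\big\{\|f\|_{L^\infty},\ \max_{|\beta|=m}\sup_{x\ne y}\frac{|\partial^\beta f(x)-\partial^\beta f(y)|}{\|x-y\|^\alpha}\big\}<\infty$, with $\|\cdot\|$ the Euclidean norm. Neural networks. Neural network weights are a tuple $\mathcal{W}=((A_1,b_1),\dots,(A_L,b_L))$ with $A_\ell\in\mathbb{R}^{N_\ell\times N_{\ell-1}}$, $b_\ell\in\mathbb{R}^{N_\ell}$, $L\in\mathbb{N}$, $N_0,\dots,N_L\in\mathbb{N}$. Put $d_{\mathrm{in}}(\mathcal{W})=N_0$, $d_{\mathrm{out}}(\mathcal{W})=N_L$, $L(\mathcal{W})=L$. With the ReLU $\varrho(x)=\max\{0,x\}$ acting componentwise and $T_\ell x=A_\ell x+b_\ell$, $R_\varrho(\mathcal{W}):=T_L\circ(\varrho\circ T_{L-1})\circ\cdots\circ(\varrho\circ T_1)$. $\|A\|_{\ell^0}$ is the number of non-zero entries and $\|A\|_{\ell^\infty}$ the maximal absolute entry; $\|\mathcal{W}\|_{\ell^0}=\sum_j(\|A_j\|_{\ell^0}+\|b_j\|_{\ell^0})$, $\|\mathcal{W}\|_{\ell^\infty}=\max_j(\|A_j\|_{\ell^\infty}+\|b_j\|_{\ell^\infty})$. For $g\in\mathbb{N}$, $\mathcal{NN}_n(g,\mathbb{R}^d)$ is the set of all $R_\varrho(\mathcal{W})$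 with $d_{\mathrm{in}}(\mathcal{W})=d$, $d_{\mathrm{out}}(\mathcal{W})=1$, $\|\mathcal{W}\|_{\ell^0}\le n$, $\|\mathcal{W}\|_{\ell^\infty}\le g\,n^g$, $L(\mathcal{W})\le(\ln(en))^g$. General notions in a (quasi-)metric space $(\mathbb{X},d)$. $B(x,r)=\{y:d(x,y)\le r\}$; $\operatorname{dist}(x,\mathcal{A})=\inf_{a\in\mathcal{A}}d(x,a)$. $\mathcal{N}(S,\varepsilon)$ is the least number of closed $\varepsilon$-balls with centers in $S$ covering $S\ne\emptyset$ ($\infty$ if there is no finite one); $\mathcal{N}(\emptyset,\varepsilon)=0$. For totally bounded $\mathscr{C}$ with at least two elements, $\underline{\dim}_{\mathrm{M},\exp}(\mathscr{C})$ and $\overline{\dim}_{\mathrm{M},\exp}(\mathscr{C})$ are the $\liminf$ and $\limsup$ as $\varepsilon\downarrow0$ of $\frac{\log_2\log_2\mathcal{N}(\mathscr{C},\varepsilon)}{\log_2(1/\varepsilon)}$ (both are $\infty$ if $\mathscr{C}$ is not totally bounded). If they coincide, the power-exponential Minkowski dimension $\dim_{\mathrm{M},\exp}(\mathscr{C})$ is said to exist and is the common value. For a measure $\mu$, $\mu^{\ast}(M)=\inf\{\mu(A):A\supseteq M\text{ measurable}\}$. $\mu$ is critical for $\mathscr{C}$ if $\mu^{\ast}(\mathscr{C})>0$ and for every $0<s<\underline{\dim}_{\mathrm{M},\exp}(\mathscr{C})$ there are $c,r_0>0$ with $\mu^{\ast}(B(x,\rho))\le\exp(-c(1/\rho)^s)$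 for all $x\in\mathbb{X}$, $0<\rho<r_0$. A family $(\mathcal{A}_n)_{n\in\mathbb{N}}$ of sets $\emptyset\ne\mathcal{A}_n\subseteq\mathbb{X}$ is of controlled complexity in $\mathbb{X}$ if for every $a>0$, $x\in\mathbb{X}$, $R>0$ there are $n_0\in\mathbb{N}$ and $\eta:\mathbb{N}\to[0,\infty)$ with $\sup_n\eta(n)/n^{1+\delta}<\infty$ for every $\delta>0$ and $\mathcal{N}(B(x,R)\cap\mathcal{A}_n,n^{-a})\le\exp(\eta(n))$ for all $n\ge n_0$. For bounded $\mathscr{C}\neq\emptyset$, a family $(\mathcal{A}_n)$ of controlled complexity is optimal for $\mathscr{C}$ in the class of families of controlled complexity in $\mathbb{X}$ if for every $0\le t<(\overline{\dim}_{\mathrm{M},\exp}(\mathscr{C}))^{-1}$ there is $C(t)>0$ with $\sup_{x\in\mathscr{C}}\operatorname{dist}(x,\mathcal{A}_n)\le C(t)n^{-t}$ for all $n\in\mathbb{N}$. *)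

theory Defs
  imports "HOL-Probability.Probability" "Jordan_Normal_Form.Matrix"
begin

section \<open>Notions in a metric space\<close>

definition metric_ball :: "'a metric \<Rightarrow> 'a \<Rightarrow> real \<Rightarrow> 'a set" where
  "metric_ball X = Metric_space.mcball (mspace X) (mdist X)"

definition metric_borel :: "'a metric \<Rightarrow> 'a measure" where
  "metric_borel X = sigma (mspace X) {U. openin (mtopology_of X) U}"

definition totally_bounded_in :: "'a metric \<Rightarrow> 'a set \<Rightarrow> bool" where
  "totally_bounded_in X = Metric_space.mtotally_bounded (mspace X) (mdist X)"

definition bounded_in :: "'a metric \<Rightarrow> 'a set \<Rightarrow> bool" where
  "bounded_in X = Metric_space.mbounded (mspace X) (mdist X)"

definition dist_to :: "'a metric \<Rightarrow> 'a \<Rightarrow> 'a set \<Rightarrow> real" where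
  "dist_to X x A = (INF a\<in>A. mdist X x a)"

text \<open>The infimum is taken in \<^typ>\<open>enat\<close>: it is \<open>\<infinity>\<close> if there is no finite cover, and \<open>0\<close> for
  the empty set.\<close>
definition covering_number :: "'a metric \<Rightarrow> 'a set \<Rightarrow> real \<Rightarrow> enat" where
  "covering_number X S \<epsilon> =
     (INF K\<in>{K. finite K \<and> K \<subseteq> S \<and> S \<subseteq> (\<Union>x\<in>K. metric_ball X x \<epsilon>)}. enat (card K))"

text \<open>The two dimensions below are meaningful for sets with at least two elements. On totally
  bounded sets all covering numbers at radius \<open>\<epsilon> > 0\<close> are finite, so \<^const>\<open>the_enat\<close> is harmless.\<close>
definition loglog_ratio :: "'a metric \<Rightarrow> 'a set \<Rightarrow> real \<Rightarrow> real" where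
  "loglog_ratio X S \<epsilon> =
     log 2 (log 2 (real (the_enat (covering_number X S \<epsilon>)))) / log 2 (1 / \<epsilon>)"

definition lower_dim_exp :: "'a metric \<Rightarrow> 'a set \<Rightarrow> ereal" where
  "lower_dim_exp X S = (if totally_bounded_in X S
     then Liminf (at_right 0) (\<lambda>\<epsilon>. ereal (loglog_ratio X S \<epsilon>)) else \<infinity>)"

definition upper_dim_exp :: "'a metric \<Rightarrow> 'a set \<Rightarrow> ereal" where
  "upper_dim_exp X S = (if totally_bounded_in X S
     then Limsup (at_right 0) (\<lambda>\<epsilon>. ereal (loglog_ratio X S \<epsilon>)) else \<infinity>)"

definition dim_exp_exists :: "'a metric \<Rightarrow> 'a set \<Rightarrow> bool" where
  "dim_exp_exists X S \<longleftrightarrow> lower_dim_exp X S = upper_dim_exp X S"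

text \<open>Only meaningful if \<^const>\<open>dim_exp_exists\<close> holds.\<close>
definition dim_exp :: "'a metric \<Rightarrow> 'a set \<Rightarrow> ereal" where
  "dim_exp X S = upper_dim_exp X S"

definition borel_prob_on :: "'a metric \<Rightarrow> 'a measure \<Rightarrow> bool" where
  "borel_prob_on X \<mu> \<longleftrightarrow> prob_space \<mu> \<and> sets \<mu> = sets (metric_borel X)"

definition critical :: "'a metric \<Rightarrow> 'a measure \<Rightarrow> 'a set \<Rightarrow> bool" where
  "critical X \<mu> S \<longleftrightarrow> outer_measure_of \<mu> S > 0 \<and>
     (\<forall>s::real. 0 < s \<and> ereal s < lower_dim_exp X S \<longrightarrow>
        (\<exists>c>0. \<exists>r0>0. \<forall>x\<in>mspace X. \<forall>\<rho>. 0 < \<rho> \<and> \<rho> < r0 \<longrightarrow>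
           outer_measure_of \<mu> (metric_ball X x \<rho>) \<le> ennreal (exp (- c * (1 / \<rho>) powr s))))"

text \<open>Families are indexed by \<open>n \<ge> 1\<close>; the set at index \<open>0\<close> is ignored throughout.\<close>
definition controlled_complexity :: "'a metric \<Rightarrow> (nat \<Rightarrow> 'a set) \<Rightarrow> bool" where
  "controlled_complexity X A \<longleftrightarrow>
     (\<forall>n\<ge>1. A n \<noteq> {} \<and> A n \<subseteq> mspace X) \<and>
     (\<forall>a>0. \<forall>x\<in>mspace X. \<forall>R>0. \<exists>n0\<ge>1. \<exists>\<eta>::nat \<Rightarrow> real.
        (\<forall>n\<ge>1. 0 \<le> \<eta> n) \<and>
        (\<forall>\<delta>>0. bdd_above ((\<lambda>n. \<eta> n / real n powr (1 + \<delta>)) ` {1..})) \<and>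
        (\<forall>n\<ge>n0. ereal_of_enat (covering_number X (metric_ball X x R \<inter> A n) (real n powr (- a)))
           \<le> ereal (exp (\<eta> n))))"

definition approximates_at_rate ::
    "'a metric \<Rightarrow> 'a set \<Rightarrow> (nat \<Rightarrow> 'a set) \<Rightarrow> real \<Rightarrow> bool" where
  "approximates_at_rate X S A t \<longleftrightarrow>
     (\<exists>C>0. \<forall>n\<ge>1. (SUP x\<in>S. ereal (dist_to X x (A n))) \<le> ereal (C * real n powr (- t)))"

definition optimal_for :: "'a metric \<Rightarrow> 'a set \<Rightarrow> (nat \<Rightarrow> 'a set) \<Rightarrow> bool" where
  "optimal_for X S A \<longleftrightarrow> bounded_in X S \<and> S \<noteq> {} \<and> controlled_complexity X A \<and>
     (\<forall>t\<ge>0. ereal t < inverse (upper_dim_exp X S) \<longrightarrow> approximates_at_rate X S A t)"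


section \<open>The space $L^p([0,1]^d)$\<close>

abbreviation unit_cube :: "(real ^ 'd::finite) set" where
  "unit_cube \<equiv> cbox 0 1"

abbreviation cube_measure :: "(real ^ 'd::finite) measure" where
  "cube_measure \<equiv> lebesgue_on unit_cube"

definition Lp_functions :: "ennreal \<Rightarrow> (real ^ 'd::finite \<Rightarrow> real) set" where
  "Lp_functions p = {f \<in> borel_measurable cube_measure.
     if p = \<infinity> then esssup cube_measure (\<lambda>x. ennreal \<bar>f x\<bar>) < \<infinity>
     else integrable cube_measure (\<lambda>x. \<bar>f x\<bar> powr enn2real p)}"

definition Lp_norm :: "ennreal \<Rightarrow> (real ^ 'd::finite \<Rightarrow> real) \<Rightarrow> real" where
  "Lp_norm p f =
     (if p = \<infinity> then enn2real (esssup cube_measure (\<lambda>x. ennreal \<bar>f x\<bar>))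
      else (LINT x|cube_measure. \<bar>f x\<bar> powr enn2real p) powr (1 / enn2real p))"

text \<open>Functions on the cube are represented by functions on the whole space whose values outside
  the cube are irrelevant. Equivalence is equality almost everywhere on the cube.\<close>
definition Lp_class :: "ennreal \<Rightarrow> (real ^ 'd::finite \<Rightarrow> real) \<Rightarrow> (real ^ 'd \<Rightarrow> real) set" where
  "Lp_class p f = {g \<in> Lp_functions p. AE x in cube_measure. g x = f x}"

definition Lp_space :: "ennreal \<Rightarrow> (real ^ 'd::finite \<Rightarrow> real) set set" where
  "Lp_space p = Lp_class p ` Lp_functions p"

definition Lp_dist ::
    "ennreal \<Rightarrow> (real ^ 'd::finite \<Rightarrow> real) set \<Rightarrow> (real ^ 'd \<Rightarrow> real) set \<Rightarrow> real" where
  "Lp_dist p F G = Lp_norm p (\<lambda>x. (SOME f. f \<in> F) x - (SOME g. g \<in> G) x)"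

text \<open>Lemmas \<open>mspace_Lp\<close>, \<open>mdist_Lp\<close> and \<open>Lp_dist_class\<close> below show that, for \<open>p \<ge> 1\<close>, this is the
  set of classes with the usual metric.\<close>
definition Lp :: "ennreal \<Rightarrow> (real ^ 'd::finite \<Rightarrow> real) set metric" where
  "Lp p = metric (Lp_space p, Lp_dist p)"

lemma powr_convex_nonneg:
  fixes x y t q :: real
  assumes "q \<ge> 1" "x \<ge> 0" "y \<ge> 0" "0 \<le> t" "t \<le> 1"
  shows "(t * x + (1 - t) * y) powr q \<le> t * x powr q + (1 - t) * y powr q"
proof -
  have s: "s powr q \<le> s" if "0 \<le> s" "s \<le> 1" for s :: real
  proof (cases "s = 0")
    case False
    then have "s powr q \<le> s powr 1" using that assms(1) by (intro powr_mono') auto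
    then show ?thesis using that False by simp
  qed (use assms in auto)
  consider "x = 0" | "y = 0" | "x > 0" "y > 0" using assms by linarith
  then show ?thesis
  proof cases
    case 1
    have "((1 - t) * y) powr q = (1 - t) powr q * y powr q"
      using assms by (simp add: powr_mult)
    also have "\<dots> \<le> (1 - t) * y powr q"
      using s[of "1 - t"] assms by (intro mult_right_mono) auto
    finally show ?thesis using 1 assms by simp
  next
    case 2
    have "(t * x) powr q = t powr q * x powr q"
      using assms by (simp add: powr_mult)
    also have "\<dots> \<le> t * x powr q"
      using s[of "t"] assms by (intro mult_right_mono) auto
    finally show ?thesis using 2 assms by simp
  next
    case 3
    have "convex_on {0<..} (\<lambda>x. x powr q)" by (rule powr_convex[OF assms(1)])
    from convex_onD[OF this, of "1 - t" x y] 3 assms show ?thesis by (simp add: algebra_simps)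
  qed
qed

lemma enn2real_ge_1: "1 \<le> p \<Longrightarrow> p \<noteq> \<infinity> \<Longrightarrow> 1 \<le> enn2real p"
  by (cases p) (auto simp flip: ennreal_1)

lemma Lp_norm_nonneg: "0 \<le> Lp_norm p f"
  by (simp add: Lp_norm_def)

lemma Lp_norm_le_iff:
  assumes "1 \<le> p" "p \<noteq> \<infinity>" "f \<in> Lp_functions p" "c > 0"
  shows "Lp_norm p f \<le> c \<longleftrightarrow>
    (LINT x|cube_measure. (\<bar>f x\<bar> / c) powr enn2real p) \<le> 1"
proof -
  let ?q = "enn2real p"
  let ?I = "LINT x|cube_measure. \<bar>f x\<bar> powr ?q"
  have q: "?q \<ge> 1" using enn2real_ge_1 assms by auto
  have I: "?I \<ge> 0" by (intro integral_nonneg_AE) auto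
  have "(LINT x|cube_measure. (\<bar>f x\<bar> / c) powr ?q) = ?I / c powr ?q"
    using assms(4) by (simp add: powr_divide)
  moreover have "Lp_norm p f \<le> c \<longleftrightarrow> ?I \<le> c powr ?q"
  proof -
    have 1: "c = (c powr ?q) powr (1 / ?q)" using assms(4) q by (simp add: powr_powr)
    have "?I powr (1 / ?q) \<le> (c powr ?q) powr (1 / ?q) \<longleftrightarrow> ?I \<le> c powr ?q"
    proof
      assume "?I powr (1 / ?q) \<le> (c powr ?q) powr (1 / ?q)"
      then have "(?I powr (1 / ?q)) powr ?q \<le> ((c powr ?q) powr (1 / ?q)) powr ?q"
        using q by - (rule powr_mono2, simp, simp, assumption)
      then show "?I \<le> c powr ?q" unfolding powr_powr using q I assms(4) by simp
    next
      assume "?I \<le> c powr ?q"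
      then show "?I powr (1 / ?q) \<le> (c powr ?q) powr (1 / ?q)"
        using q I by (intro powr_mono2) auto
    qed
    then show ?thesis using assms(2) 1 by (simp add: Lp_norm_def)
  qed
  ultimately show ?thesis using assms(4) by (simp add: divide_le_eq)
qed

lemma Lp_functions_uminus: "f \<in> Lp_functions p \<Longrightarrow> (\<lambda>x. - f x) \<in> Lp_functions p"
  by (auto simp: Lp_functions_def)

lemma Lp_norm_cong_AE:
  assumes [measurable]: "f \<in> borel_measurable cube_measure" "g \<in> borel_measurable cube_measure"
    and "AE x in cube_measure. f x = g x"
  shows "Lp_norm p f = Lp_norm p g"
proof -
  have "esssup cube_measure (\<lambda>x. ennreal \<bar>f x\<bar>) = esssup cube_measure (\<lambda>x. ennreal \<bar>g x\<bar>)"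
    using assms(3) by (intro esssup_AE_cong) auto
  moreover have "(LINT x|cube_measure. \<bar>f x\<bar> powr enn2real p)
      = (LINT x|cube_measure. \<bar>g x\<bar> powr enn2real p)"
    using assms(3) by (intro integral_cong_AE) auto
  ultimately show ?thesis by (simp add: Lp_norm_def)
qed

lemma esssup_abs_add_le:
  assumes [measurable]: "f \<in> borel_measurable M" "g \<in> borel_measurable M"
  shows "esssup M (\<lambda>x. ennreal \<bar>f x + g x :: real\<bar>) \<le>
    esssup M (\<lambda>x. ennreal \<bar>f x\<bar>) + esssup M (\<lambda>x. ennreal \<bar>g x\<bar>)"
proof (rule esssup_I)
  show "AE x in M. ennreal \<bar>f x + g x\<bar> \<le>
    esssup M (\<lambda>x. ennreal \<bar>f x\<bar>) + esssup M (\<lambda>x. ennreal \<bar>g x\<bar>)"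
    using esssup_AE[of "\<lambda>x. ennreal \<bar>f x\<bar>" M] esssup_AE[of "\<lambda>x. ennreal \<bar>g x\<bar>" M]
  proof eventually_elim
    case (elim x)
    have "ennreal \<bar>f x + g x\<bar> \<le> ennreal \<bar>f x\<bar> + ennreal \<bar>g x\<bar>"
      by (simp flip: ennreal_plus add: ennreal_leI)
    also have "\<dots> \<le> esssup M (\<lambda>x. ennreal \<bar>f x\<bar>) + esssup M (\<lambda>x. ennreal \<bar>g x\<bar>)"
      using elim by (intro add_mono)
    finally show ?case .
  qed
qed auto

lemma Lp_functions_add:
  assumes "1 \<le> p" "f \<in> Lp_functions p" "g \<in> Lp_functions p"
  shows "(\<lambda>x. f x + g x) \<in> Lp_functions p"
proof -
  have [measurable]: "f \<in> borel_measurable cube_measure" "g \<in> borel_measurable cube_measure"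
    using assms by (auto simp: Lp_functions_def)
  show ?thesis
  proof (cases "p = \<infinity>")
    case True
    have "esssup cube_measure (\<lambda>x. ennreal \<bar>f x + g x\<bar>) < \<infinity>"
      using assms True
      by (intro le_less_trans[OF esssup_abs_add_le]) (auto simp: Lp_functions_def)
    then show ?thesis using True by (auto simp: Lp_functions_def)
  next
    case False
    let ?q = "enn2real p"
    have q: "?q \<ge> 1" using enn2real_ge_1 assms False by auto
    have i: "integrable cube_measure (\<lambda>x. \<bar>f x\<bar> powr ?q)" "integrable cube_measure (\<lambda>x. \<bar>g x\<bar> powr ?q)"
      using assms False by (auto simp: Lp_functions_def)
    have "integrable cube_measure (\<lambda>x. \<bar>f x + g x\<bar> powr ?q)"
    proof (rule Bochner_Integration.integrable_bound)
      show "integrable cube_measure (\<lambda>x. 2 powr ?q * (\<bar>f x\<bar> powr ?q + \<bar>g x\<bar> powr ?q))"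
        using i by auto
      show "AE x in cube_measure. norm (\<bar>f x + g x\<bar> powr ?q) \<le>
        norm (2 powr ?q * (\<bar>f x\<bar> powr ?q + \<bar>g x\<bar> powr ?q))"
      proof (rule AE_I2)
        fix x
        have "\<bar>f x + g x\<bar> powr ?q \<le> (2 * (1/2 * \<bar>f x\<bar> + (1 - 1/2) * \<bar>g x\<bar>)) powr ?q"
          using q by (intro powr_mono2) auto
        also have "\<dots> = 2 powr ?q * (1/2 * \<bar>f x\<bar> + (1 - 1/2) * \<bar>g x\<bar>) powr ?q"
          by (rule powr_mult)
        also have "\<dots> \<le> 2 powr ?q * (1/2 * \<bar>f x\<bar> powr ?q + (1 - 1/2) * \<bar>g x\<bar> powr ?q)"
          using q by (intro mult_left_mono powr_convex_nonneg) auto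
        also have "\<dots> \<le> 2 powr ?q * (\<bar>f x\<bar> powr ?q + \<bar>g x\<bar> powr ?q)"
          by (intro mult_left_mono add_mono) auto
        finally show "norm (\<bar>f x + g x\<bar> powr ?q) \<le>
          norm (2 powr ?q * (\<bar>f x\<bar> powr ?q + \<bar>g x\<bar> powr ?q))" by simp
      qed
    qed auto
    then show ?thesis using False by (auto simp: Lp_functions_def)
  qed
qed

lemma Lp_functions_diff:
  assumes "1 \<le> p" "f \<in> Lp_functions p" "g \<in> Lp_functions p"
  shows "(\<lambda>x. f x - g x) \<in> Lp_functions p"
  using Lp_functions_add[OF assms(1,2) Lp_functions_uminus[OF assms(3)]] by simp

lemma Lp_norm_triangle:
  fixes f g :: "real ^ 'd::finite \<Rightarrow> real"
  assumes "1 \<le> p" "f \<in> Lp_functions p" "g \<in> Lp_functions p"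
  shows "Lp_norm p (\<lambda>x. f x + g x) \<le> Lp_norm p f + Lp_norm p g"
proof -
  have [measurable]: "f \<in> borel_measurable cube_measure" "g \<in> borel_measurable cube_measure"
    using assms by (auto simp: Lp_functions_def)
  show ?thesis
  proof (cases "p = \<infinity>")
    case True
    then have fin: "esssup cube_measure (\<lambda>x. ennreal \<bar>f x\<bar>) < \<infinity>"
      "esssup cube_measure (\<lambda>x. ennreal \<bar>g x\<bar>) < \<infinity>"
      using assms by (auto simp: Lp_functions_def)
    have "enn2real (esssup cube_measure (\<lambda>x. ennreal \<bar>f x + g x\<bar>)) \<le>
       enn2real (esssup cube_measure (\<lambda>x. ennreal \<bar>f x\<bar>) + esssup cube_measure (\<lambda>x. ennreal \<bar>g x\<bar>))"
      using fin by (intro enn2real_mono esssup_abs_add_le) auto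
    then show ?thesis using True fin by (auto simp: Lp_norm_def enn2real_plus)
  next
    case False
    let ?q = "enn2real p"
    have q: "?q \<ge> 1" using enn2real_ge_1 assms False by auto
    have fg: "(\<lambda>x. f x + g x) \<in> Lp_functions p" by (rule Lp_functions_add[OF assms])
    have int: "integrable cube_measure (\<lambda>x. (\<bar>h x\<bar> / c) powr ?q)"
      if "h \<in> Lp_functions p" "c > 0" for h :: "real ^ 'd \<Rightarrow> real" and c
      using that False by (auto simp: Lp_functions_def powr_divide)
    show ?thesis
    proof (rule field_le_epsilon)
      fix e :: real assume e: "e > 0"
      define a where "a = Lp_norm p f + e / 2"
      define b where "b = Lp_norm p g + e / 2"
      have a: "a > 0" and b: "b > 0"
        using e Lp_norm_nonneg[of p f] Lp_norm_nonneg[of p g] by (auto simp: a_def b_def)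
      have A: "(LINT x|cube_measure. (\<bar>f x\<bar> / a) powr ?q) \<le> 1"
        using Lp_norm_le_iff[OF assms(1) False assms(2) a] e by (simp add: a_def)
      have B: "(LINT x|cube_measure. (\<bar>g x\<bar> / b) powr ?q) \<le> 1"
        using Lp_norm_le_iff[OF assms(1) False assms(3) b] e by (simp add: b_def)
      define t where "t = a / (a + b)"
      have t: "0 \<le> t" "t \<le> 1" and t1: "1 - t = b / (a + b)"
        using a b by (auto simp: t_def field_simps)
      have "(LINT x|cube_measure. (\<bar>f x + g x\<bar> / (a + b)) powr ?q) \<le>
          (LINT x|cube_measure. t * (\<bar>f x\<bar> / a) powr ?q + (1 - t) * (\<bar>g x\<bar> / b) powr ?q)"
      proof (rule integral_mono)
        fix x
        have "t * (\<bar>f x\<bar> / a) + (1 - t) * (\<bar>g x\<bar> / b) = (\<bar>f x\<bar> + \<bar>g x\<bar>) / (a + b)"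
          unfolding t1 using a b by (simp add: t_def add_divide_distrib)
        then have "(\<bar>f x + g x\<bar> / (a + b)) powr ?q \<le> (t * (\<bar>f x\<bar> / a) + (1 - t) * (\<bar>g x\<bar> / b)) powr ?q"
          using a b q by (auto intro!: powr_mono2 divide_right_mono)
        also have "\<dots> \<le> t * (\<bar>f x\<bar> / a) powr ?q + (1 - t) * (\<bar>g x\<bar> / b) powr ?q"
          using a b q t by (intro powr_convex_nonneg) auto
        finally show "(\<bar>f x + g x\<bar> / (a + b)) powr ?q \<le>
          t * (\<bar>f x\<bar> / a) powr ?q + (1 - t) * (\<bar>g x\<bar> / b) powr ?q" .
      next
        show "integrable cube_measure (\<lambda>x. (\<bar>f x + g x\<bar> / (a + b)) powr ?q)"
          using int[OF fg] a b by simp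
        show "integrable cube_measure (\<lambda>x. t * (\<bar>f x\<bar> / a) powr ?q + (1 - t) * (\<bar>g x\<bar> / b) powr ?q)"
          using int[OF assms(2) a] int[OF assms(3) b] by auto
      qed
      also have "\<dots> = t * (LINT x|cube_measure. (\<bar>f x\<bar> / a) powr ?q) +
          (1 - t) * (LINT x|cube_measure. (\<bar>g x\<bar> / b) powr ?q)"
        using int[OF assms(2) a] int[OF assms(3) b] by simp
      also have "\<dots> \<le> t * 1 + (1 - t) * 1"
        using A B t by (intro add_mono mult_left_mono) auto
      finally have "Lp_norm p (\<lambda>x. f x + g x) \<le> a + b"
        using Lp_norm_le_iff[OF assms(1) False fg, of "a + b"] a b by simp
      then show "Lp_norm p (\<lambda>x. f x + g x) \<le> Lp_norm p f + Lp_norm p g + e"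
        by (simp add: a_def b_def)
    qed
  qed
qed

lemma Lp_norm_eq_0_iff:
  assumes "1 \<le> p" "f \<in> Lp_functions p"
  shows "Lp_norm p f = 0 \<longleftrightarrow> (AE x in cube_measure. f x = 0)"
proof -
  have [measurable]: "f \<in> borel_measurable cube_measure"
    using assms by (auto simp: Lp_functions_def)
  show ?thesis
  proof (cases "p = \<infinity>")
    case True
    then have fin: "esssup cube_measure (\<lambda>x. ennreal \<bar>f x\<bar>) < \<infinity>"
      using assms by (auto simp: Lp_functions_def)
    have "esssup cube_measure (\<lambda>x. ennreal \<bar>f x\<bar>) = 0 \<longleftrightarrow> (AE x in cube_measure. f x = 0)"
    proof
      assume "esssup cube_measure (\<lambda>x. ennreal \<bar>f x\<bar>) = 0"
      then show "AE x in cube_measure. f x = 0"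
        using esssup_AE[of "\<lambda>x. ennreal \<bar>f x\<bar>" cube_measure] by simp
    next
      assume "AE x in cube_measure. f x = 0"
      then have "esssup cube_measure (\<lambda>x. ennreal \<bar>f x\<bar>) \<le> 0"
        by (intro esssup_I) auto
      then show "esssup cube_measure (\<lambda>x. ennreal \<bar>f x\<bar>) = 0" by simp
    qed
    then show ?thesis using True fin by (auto simp: Lp_norm_def enn2real_eq_0_iff)
  next
    case False
    let ?q = "enn2real p"
    have "integrable cube_measure (\<lambda>x. \<bar>f x\<bar> powr ?q)"
      using assms False by (auto simp: Lp_functions_def)
    from integral_nonneg_eq_0_iff_AE[OF this] show ?thesis
      using False by (simp add: Lp_norm_def)
  qed
qed

lemma Lp_class_self: "f \<in> Lp_functions p \<Longrightarrow> f \<in> Lp_class p f"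
  by (simp add: Lp_class_def)

lemma Lp_class_eq_iff:
  assumes "f \<in> Lp_functions p" "g \<in> Lp_functions p"
  shows "Lp_class p f = Lp_class p g \<longleftrightarrow> (AE x in cube_measure. f x = g x)"
proof
  assume "Lp_class p f = Lp_class p g"
  then show "AE x in cube_measure. f x = g x"
    using Lp_class_self[OF assms(1)] by (auto simp: Lp_class_def)
next
  assume *: "AE x in cube_measure. f x = g x"
  have "(AE x in cube_measure. h x = f x) \<longleftrightarrow> (AE x in cube_measure. h x = g x)" for h
  proof
    assume "AE x in cube_measure. h x = f x"
    then show "AE x in cube_measure. h x = g x" using * by eventually_elim simp
  next
    assume "AE x in cube_measure. h x = g x"
    then show "AE x in cube_measure. h x = f x" using * by eventually_elim simp
  qed
  then show "Lp_class p f = Lp_class p g" by (simp add: Lp_class_def)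
qed

lemma Lp_dist_class:
  assumes "1 \<le> p" "f \<in> Lp_functions p" "g \<in> Lp_functions p"
  shows "Lp_dist p (Lp_class p f) (Lp_class p g) = Lp_norm p (\<lambda>x. f x - g x)"
proof -
  define f' where "f' = (SOME f'. f' \<in> Lp_class p f)"
  define g' where "g' = (SOME g'. g' \<in> Lp_class p g)"
  have f': "f' \<in> Lp_class p f"
    unfolding f'_def
    by (rule someI[where P = "\<lambda>h. h \<in> Lp_class p f", OF Lp_class_self[OF assms(2)]])
  have g': "g' \<in> Lp_class p g"
    unfolding g'_def
    by (rule someI[where P = "\<lambda>h. h \<in> Lp_class p g", OF Lp_class_self[OF assms(3)]])
  have "AE x in cube_measure. f' x = f x" "AE x in cube_measure. g' x = g x"
    using f' g' by (auto simp: Lp_class_def)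
  then have *: "AE x in cube_measure. f' x - g' x = f x - g x"
    by eventually_elim simp
  have [measurable]: "f \<in> borel_measurable cube_measure" "g \<in> borel_measurable cube_measure"
    "f' \<in> borel_measurable cube_measure" "g' \<in> borel_measurable cube_measure"
    using assms f' g' by (auto simp: Lp_functions_def Lp_class_def)
  show ?thesis
    unfolding Lp_dist_def f'_def[symmetric] g'_def[symmetric]
    by (rule Lp_norm_cong_AE) (use * in auto)
qed

lemma Metric_space_Lp:
  assumes "1 \<le> p"
  shows "Metric_space (Lp_space p) (Lp_dist p)"
proof
  show "0 \<le> Lp_dist p F G" for F G :: "(real ^ 'a \<Rightarrow> real) set"
    by (simp add: Lp_dist_def Lp_norm_nonneg)
  show "Lp_dist p F G = Lp_dist p G F" for F G :: "(real ^ 'a \<Rightarrow> real) set"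
    by (simp add: Lp_dist_def Lp_norm_def abs_minus_commute)
next
  fix F G :: "(real ^ 'a \<Rightarrow> real) set"
  assume "F \<in> Lp_space p" "G \<in> Lp_space p"
  then obtain f g where f: "f \<in> Lp_functions p" "F = Lp_class p f"
    and g: "g \<in> Lp_functions p" "G = Lp_class p g" by (auto simp: Lp_space_def)
  show "Lp_dist p F G = 0 \<longleftrightarrow> F = G"
    unfolding f(2) g(2) Lp_dist_class[OF assms f(1) g(1)] Lp_class_eq_iff[OF f(1) g(1)]
    using Lp_norm_eq_0_iff[OF assms Lp_functions_diff[OF assms f(1) g(1)]] by simp
next
  fix F G H :: "(real ^ 'a \<Rightarrow> real) set"
  assume "F \<in> Lp_space p" "G \<in> Lp_space p" "H \<in> Lp_space p"
  then obtain f g h where f: "f \<in> Lp_functions p" "F = Lp_class p f"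
    and g: "g \<in> Lp_functions p" "G = Lp_class p g"
    and h: "h \<in> Lp_functions p" "H = Lp_class p h" by (auto simp: Lp_space_def)
  show "Lp_dist p F H \<le> Lp_dist p F G + Lp_dist p G H"
    unfolding f(2) g(2) h(2) Lp_dist_class[OF assms f(1) g(1)]
      Lp_dist_class[OF assms f(1) h(1)] Lp_dist_class[OF assms g(1) h(1)]
    using Lp_norm_triangle[OF assms Lp_functions_diff[OF assms f(1) g(1)]
        Lp_functions_diff[OF assms g(1) h(1)]] by simp
qed

lemma mspace_Lp: "1 \<le> p \<Longrightarrow> mspace (Lp p) = Lp_space p"
  and mdist_Lp: "1 \<le> p \<Longrightarrow> mdist (Lp p) = Lp_dist p"
  unfolding Lp_def
  by (simp_all add: Metric_space.mspace_metric Metric_space.mdist_metric Metric_space_Lp)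


section \<open>Hoelder functions on the cube\<close>

text \<open>A fixed enumeration of the coordinates. Neither the Hoelder spaces nor the network sets below
  depend on its choice: partial derivatives of continuously differentiable functions commute, and
  permuting the input coordinates amounts to permuting the columns of the first matrix.\<close>
definition coord :: "nat \<Rightarrow> 'd::finite" where
  "coord = from_nat_into UNIV"

lemma bij_betw_coord: "bij_betw (coord :: nat \<Rightarrow> 'd::finite) {..<CARD('d)} UNIV"
  unfolding coord_def by (rule bij_betw_from_nat_into_finite) simp

text \<open>Derivatives are taken within the closed cube, hence are one-sided on its boundary.\<close>
definition partial_deriv :: "'d::finite \<Rightarrow> (real ^ 'd \<Rightarrow> real) \<Rightarrow> real ^ 'd \<Rightarrow> real" where
  "partial_deriv i f = (\<lambda>x. frechet_derivative f (at x within unit_cube) (axis i 1))"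

primrec cont_diff :: "nat \<Rightarrow> (real ^ 'd::finite \<Rightarrow> real) \<Rightarrow> bool" where
  "cont_diff 0 f \<longleftrightarrow> continuous_on unit_cube f"
| "cont_diff (Suc m) f \<longleftrightarrow> (\<forall>x\<in>unit_cube. f differentiable (at x within unit_cube)) \<and>
     (\<forall>i. cont_diff m (partial_deriv i f))"

text \<open>The derivative $\partial^\beta f$ for a multi-index $\beta$.\<close>
definition multi_deriv ::
    "('d::finite \<Rightarrow> nat) \<Rightarrow> (real ^ 'd \<Rightarrow> real) \<Rightarrow> real ^ 'd \<Rightarrow> real" where
  "multi_deriv \<beta> f =
     foldr (\<lambda>k g. (partial_deriv (coord k) ^^ \<beta> (coord k)) g) [0..<CARD('d)] f"

definition holder_norm :: "nat \<Rightarrow> real \<Rightarrow> (real ^ 'd::finite \<Rightarrow> real) \<Rightarrow> ennreal" where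
  "holder_norm m \<alpha> f = max (esssup cube_measure (\<lambda>x. ennreal \<bar>f x\<bar>))
     (SUP \<beta>\<in>{\<beta>::'d \<Rightarrow> nat. (\<Sum>i\<in>UNIV. \<beta> i) = m}.
        SUP (x, y)\<in>{(x, y). x \<in> unit_cube \<and> y \<in> unit_cube \<and> x \<noteq> y}.
          ennreal (\<bar>multi_deriv \<beta> f x - multi_deriv \<beta> f y\<bar> / norm (x - y) powr \<alpha>))"

definition holder_space :: "nat \<Rightarrow> real \<Rightarrow> (real ^ 'd::finite \<Rightarrow> real) set" where
  "holder_space m \<alpha> = {f. cont_diff m f \<and> holder_norm m \<alpha> f < \<infinity>}"


section \<open>ReLU networks\<close>

type_synonym weights = "(real mat \<times> real Matrix.vec) list"

definition valid_weights :: "weights \<Rightarrow> bool" where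
  "valid_weights W \<longleftrightarrow> W \<noteq> [] \<and> (\<exists>N::nat \<Rightarrow> nat. (\<forall>l\<le>length W. 1 \<le> N l) \<and>
     (\<forall>l<length W. fst (W ! l) \<in> carrier_mat (N (Suc l)) (N l) \<and>
                   snd (W ! l) \<in> carrier_vec (N (Suc l))))"

definition d_in :: "weights \<Rightarrow> nat" where
  "d_in W = dim_col (fst (hd W))"

definition d_out :: "weights \<Rightarrow> nat" where
  "d_out W = dim_row (fst (last W))"

definition relu :: "real \<Rightarrow> real" where
  "relu x = max 0 x"

fun realization :: "weights \<Rightarrow> real Matrix.vec \<Rightarrow> real Matrix.vec" where
  "realization [] x = x"
| "realization [(A, b)] x = A *\<^sub>v x + b"
| "realization ((A, b) # W) x = realization W (map_vec relu (A *\<^sub>v x + b))"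

definition mat_l0 :: "real mat \<Rightarrow> nat" where
  "mat_l0 A = card {(i, j). i < dim_row A \<and> j < dim_col A \<and> A $$ (i, j) \<noteq> 0}"

definition vec_l0 :: "real Matrix.vec \<Rightarrow> nat" where
  "vec_l0 b = card {i. i < dim_vec b \<and> vec_index b i \<noteq> 0}"

definition mat_linf :: "real mat \<Rightarrow> real" where
  "mat_linf A = Max {\<bar>A $$ (i, j)\<bar> | i j. i < dim_row A \<and> j < dim_col A}"

definition vec_linf :: "real Matrix.vec \<Rightarrow> real" where
  "vec_linf b = Max {\<bar>vec_index b i\<bar> | i. i < dim_vec b}"

definition weights_l0 :: "weights \<Rightarrow> nat" where
  "weights_l0 W = (\<Sum>(A, b)\<leftarrow>W. mat_l0 A + vec_l0 b)"

definition weights_linf :: "weights \<Rightarrow> real" where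
  "weights_linf W = Max ((\<lambda>(A, b). mat_linf A + vec_linf b) ` set W)"

definition to_vec :: "real ^ 'd::finite \<Rightarrow> real Matrix.vec" where
  "to_vec x = Matrix.vec CARD('d) (\<lambda>k. vec_nth x (coord k))"

definition NN :: "nat \<Rightarrow> nat \<Rightarrow> (real ^ 'd::finite \<Rightarrow> real) set" where
  "NN g n = {(\<lambda>x. vec_index (realization W (to_vec x)) 0) | W.
     valid_weights W \<and> d_in W = CARD('d) \<and> d_out W = 1 \<and>
     weights_l0 W \<le> n \<and> weights_linf W \<le> real g * real n ^ g \<and>
     real (length W) \<le> (ln (exp 1 * real n)) ^ g}"

end

theory Submission
  imports Defs "HOL-Real_Asymp.Real_Asymp"
begin

text \<open>
  After renaming neurons, a network with \<open>n\<close> nonzero weights is described by \<open>n\<close> bounded parameters and their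
  positions, and it depends on the parameters in a Lipschitz way with constant \<open>exp (polylog n)\<close>. Hence its
  covering numbers at scale \<open>n powr - a\<close> are at most \<open>exp (n * polylog n)\<close>. Networks multiply approximately,
  by iterating the tent map, so they imitate tensor products of piecewise polynomial interpolants, which
  approximate the Hoelder ball at every rate \<open>t < r / d\<close>. Covering the approximants bounds the upper dimension
  by \<open>d / r\<close>.

  For the lower bound take the random series of the bumps \<open>\<beta> (2 ^ j * x - k)\<close> with coefficients
  \<open>2 powr (- r * j) / (j + 1)\<^sup>2\<close> and fair random signs. It lies in the Hoelder ball. Two outcomes that differ
  in an eighth of the signs of level \<open>J\<close> are far apart, so flipping the signs of this level shows that a
  ball of radius about \<open>2 powr (- r * J)\<close> has probability at most \<open>q ^ (2 ^ (J * d))\<close> with \<open>q < 1\<close>.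
  A cover by few such balls could not have full measure.

  For the converse, the functions approximable at a rate \<open>t > r / d\<close> are, for each \<open>n\<close>, covered by
  \<open>exp (n powr (1 + \<delta>))\<close> balls of radius about \<open>n powr - t\<close>, each of outer measure at most
  \<open>exp (- c * n powr (t * s))\<close> with \<open>t * s > 1 + \<delta>\<close>.
\<close>

section \<open>Covering numbers and dimensions\<close>

text \<open>Logarithmic losses are free: controlled complexity tolerates exp (n powr (1 +
  \<delta>)), and only rates and exponents strictly inside the critical range are claimed. The
  networks therefore use about n powr (t / r) cells per axis: since t * d / r < 1, a power of n is
  left over to pay for depth and for the accuracy of the products. For the same reason the random
  series may carry the factor 1 / (j + 1)^2, which puts one random function into the Hoelder ball
  while every dyadic level stays visible. All p are treated alike: the cube has measure 1, so upper
  estimates are made in the sup norm, and lower estimates use height times measure of a set. One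
  measure serves twice. Its small-ball bound forces the lower bound d / r on the dimension, and once
  the upper bound has identified the dimension, the same bound is what criticality asks for. Only
  finitely many derivatives matter, so the bump is a product of truncated powers, and derivatives
  are tracked through explicit families of candidates instead of being computed from
  \<open>frechet_derivative\<close>.\<close>

lemma in_metric_ball [simp]:
  "y \<in> metric_ball X x r \<longleftrightarrow> x \<in> mspace X \<and> y \<in> mspace X \<and> mdist X x y \<le> r"
  by (simp add: metric_ball_def Metric_space.in_mcball)

lemma covering_number_le:
  assumes "finite K" "K \<subseteq> S" "S \<subseteq> (\<Union>x\<in>K. metric_ball X x \<epsilon>)"
  shows "covering_number X S \<epsilon> \<le> enat (card K)"
  unfolding covering_number_def using assms by (intro INF_lower) auto

lemma covering_number_attained:
  assumes "covering_number X S \<epsilon> \<noteq> \<infinity>"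
  obtains K where "finite K" "K \<subseteq> S" "S \<subseteq> (\<Union>x\<in>K. metric_ball X x \<epsilon>)"
    "covering_number X S \<epsilon> = enat (card K)"
proof -
  let ?C = "{K. finite K \<and> K \<subseteq> S \<and> S \<subseteq> (\<Union>x\<in>K. metric_ball X x \<epsilon>)}"
  obtain N where N: "covering_number X S \<epsilon> = enat N" using assms by auto
  \<comment> \<open>An infimum that is a natural number N is attained: some cover has cardinality
    below \<open>Suc N\<close>.\<close>
  have "covering_number X S \<epsilon> < enat (Suc N)" using N by simp
  then obtain K where K: "K \<in> ?C" "enat (card K) < enat (Suc N)"
    unfolding covering_number_def INF_less_iff by blast
  moreover have "covering_number X S \<epsilon> \<le> enat (card K)" using K by (intro covering_number_le) auto
  ultimately show ?thesis using N by (intro that[of K]) auto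
qed

text \<open>Covering numbers demand centers inside S. Each cell \<open>P _ k\<close> that meets S
  has diameter at most \<epsilon>, so any of its members can serve as the center of an
  \<epsilon>-ball containing the cell. The labels k need not be points of the space; for networks
  they are rounded parameters.\<close>

lemma internal_cover:
  assumes "finite K" "S \<subseteq> mspace X" "\<And>s. s \<in> S \<Longrightarrow> \<exists>k\<in>K. P s k"
    and "\<And>s t k. s \<in> S \<Longrightarrow> t \<in> S \<Longrightarrow> k \<in> K \<Longrightarrow> P s k \<Longrightarrow> P t k \<Longrightarrow> mdist X s t \<le> \<epsilon>"
  obtains C where "finite C" "C \<subseteq> S" "S \<subseteq> (\<Union>x\<in>C. metric_ball X x \<epsilon>)" "card C \<le> card K"
proof -
  define K' where "K' = {k\<in>K. \<exists>s\<in>S. P s k}"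
  define c where "c k = (SOME s. s \<in> S \<and> P s k)" for k
  have c: "c k \<in> S" "P (c k) k" if "k \<in> K'" for k
    using that someI_ex[of "\<lambda>s. s \<in> S \<and> P s k"] by (auto simp: K'_def c_def)
  have "S \<subseteq> (\<Union>x\<in>c ` K'. metric_ball X x \<epsilon>)"
  proof
    fix s assume s: "s \<in> S"
    then obtain k where k: "k \<in> K" "P s k" using assms(3) by blast
    then have "k \<in> K'" using s by (auto simp: K'_def)
    then show "s \<in> (\<Union>x\<in>c ` K'. metric_ball X x \<epsilon>)"
      using c[of k] s k assms(2,4) by (intro UN_I[of "c k"]) auto
  qed
  moreover have "finite K'" "card K' \<le> card K" using assms(1) by (auto simp: K'_def intro: card_mono)
  ultimately show ?thesis
    using c by (intro that[of "c ` K'"]) (auto intro: order_trans[OF card_image_le])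
qed

text \<open>For one fixed \<delta> the function \<eta> is dominated by a single multiple of
  \<open>n powr (1 + \<delta>)\<close>; this is the quantitative form that the covering arguments
  use.\<close>

lemma controlled_complexity_cover:
  assumes "controlled_complexity X A" "a > 0" "x \<in> mspace X" "R > 0" "\<delta> > 0"
  obtains n0 H where "n0 \<ge> 1" "H \<ge> 0"
    "\<forall>n\<ge>n0. \<exists>K. finite K \<and> K \<subseteq> A n \<and>
      metric_ball X x R \<inter> A n \<subseteq> (\<Union>k\<in>K. metric_ball X k (real n powr - a)) \<and>
      real (card K) \<le> exp (H * real n powr (1 + \<delta>))"
proof -
  have "\<exists>n0\<ge>1. \<exists>\<eta>::nat \<Rightarrow> real. (\<forall>n\<ge>1. 0 \<le> \<eta> n) \<and>
    (\<forall>\<delta>>0. bdd_above ((\<lambda>n. \<eta> n / real n powr (1 + \<delta>)) ` {1..})) \<and>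
    (\<forall>n\<ge>n0. ereal_of_enat (covering_number X (metric_ball X x R \<inter> A n) (real n powr (- a)))
           \<le> ereal (exp (\<eta> n)))"
    using assms(1)[unfolded controlled_complexity_def, THEN conjunct2, THEN spec, THEN mp,
        OF assms(2), THEN bspec, OF assms(3), THEN spec, THEN mp, OF assms(4)] .
  then show ?thesis
  proof (elim exE conjE)
  fix n0 \<eta>
  assume n0: "n0 \<ge> 1" "\<forall>n\<ge>1. 0 \<le> \<eta> n"
    "\<forall>\<delta>>0. bdd_above ((\<lambda>n. \<eta> n / real n powr (1 + \<delta>)) ` {1..})"
    "\<forall>n\<ge>n0. ereal_of_enat (covering_number X (metric_ball X x R \<inter> A n) (real n powr (- a)))
           \<le> ereal (exp (\<eta> n))"
  obtain H0 where "\<forall>y\<in>(\<lambda>n. \<eta> n / real n powr (1 + \<delta>)) ` {1..}. y \<le> H0"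
    using n0(3) assms(5) unfolding bdd_above_def by blast
  then have H0: "\<eta> n / real n powr (1 + \<delta>) \<le> H0" if "n \<ge> 1" for n
    using that by auto
  show ?thesis
  proof (rule that[of n0 "max H0 0"], safe)
    fix n assume n: "n \<ge> n0"
    let ?B = "metric_ball X x R \<inter> A n" and ?e = "real n powr - a"
    have le: "ereal_of_enat (covering_number X ?B ?e) \<le> ereal (exp (\<eta> n))" using n0(4) n by auto
    then have "covering_number X ?B ?e \<noteq> \<infinity>" by (intro notI) simp
    from covering_number_attained[OF this] obtain K where K: "finite K" "K \<subseteq> ?B"
      "?B \<subseteq> (\<Union>x\<in>K. metric_ball X x ?e)" "covering_number X ?B ?e = enat (card K)" .
    have "real (card K) \<le> exp (\<eta> n)" using le K(4) by simp
    also have "\<eta> n \<le> max H0 0 * real n powr (1 + \<delta>)"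
      using H0[of n] n n0(1) by (simp add: divide_le_eq max_mult_distrib_right)
    finally show "\<exists>K. finite K \<and> K \<subseteq> A n \<and> ?B \<subseteq> (\<Union>k\<in>K. metric_ball X k ?e) \<and>
      real (card K) \<le> exp (max H0 0 * real n powr (1 + \<delta>))"
      using K by (intro exI[of _ K]) auto
  qed (use n0 in auto)
  qed
qed

lemma dist_to_less_obtains:
  assumes "dist_to X x A < e" "A \<noteq> {}"
  obtains a where "a \<in> A" "mdist X x a < e"
proof -
  have bdd: "bdd_below (mdist X x ` A)"
    by (intro bdd_belowI[of _ 0]) auto
  have "\<exists>a\<in>A. mdist X x a < e"
    using assms bdd unfolding dist_to_def by (subst (asm) cINF_less_iff) auto
  then show ?thesis using that by blast
qed

lemma dist_to_le: "a \<in> A \<Longrightarrow> dist_to X x A \<le> mdist X x a"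
  unfolding dist_to_def by (intro cINF_lower bdd_belowI[of _ 0]) auto

section \<open>Outer measure of covered sets, and null sets of quickly approximable
  functions\<close>

lemma borel_prob_on_space: "borel_prob_on X \<mu> \<Longrightarrow> space \<mu> = mspace X"
proof -
  assume "borel_prob_on X \<mu>"
  then have "space \<mu> = space (metric_borel X)"
    unfolding borel_prob_on_def by (intro sets_eq_imp_space_eq) auto
  then show ?thesis by (simp add: metric_borel_def space_measure_of_conv)
qed

text \<open>Measurability is not at stake: each set is enclosed in a measurable set of the same
  measure, and ordinary subadditivity applies to these hulls.\<close>

lemma outer_measure_of_finite_UN_le:
  assumes "finite K" "\<And>k. k \<in> K \<Longrightarrow> A k \<subseteq> space M" "\<And>k. k \<in> K \<Longrightarrow> outer_measure_of M (A k) \<le> c"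
  shows "outer_measure_of M (\<Union>k\<in>K. A k) \<le> of_nat (card K) * c"
proof -
  have "\<exists>E\<in>sets M. A k \<subseteq> E \<and> outer_measure_of M (A k) = emeasure M E" if "k \<in> K" for k
    by (rule outer_measure_of_attain) (use assms that in auto)
  then obtain E where E: "\<And>k. k \<in> K \<Longrightarrow> E k \<in> sets M \<and> A k \<subseteq> E k \<and> outer_measure_of M (A k) = emeasure M (E k)"
    by metis
  have "outer_measure_of M (\<Union>k\<in>K. A k) \<le> outer_measure_of M (\<Union>k\<in>K. E k)"
    using E by (intro outer_measure_of_mono) blast
  also have "\<dots> = emeasure M (\<Union>k\<in>K. E k)"
    using E assms(1) by (intro outer_measure_of_eq) auto
  also have "\<dots> \<le> (\<Sum>k\<in>K. emeasure M (E k))"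
    using E assms(1) by (intro emeasure_subadditive_finite) auto
  also have "\<dots> \<le> (\<Sum>k\<in>K. c)" using E assms(3) by (intro sum_mono) auto
  finally show ?thesis by simp
qed

lemma outer_measure_of_UN_null:
  fixes A :: "nat \<Rightarrow> 'a set"
  assumes "\<And>k. A k \<subseteq> space M" "\<And>k. outer_measure_of M (A k) = 0"
  shows "outer_measure_of M (\<Union>k. A k) = 0"
proof -
  have "\<exists>E\<in>sets M. A k \<subseteq> E \<and> outer_measure_of M (A k) = emeasure M E" for k
    by (rule outer_measure_of_attain) (use assms in auto)
  then obtain E where E: "\<And>k. E k \<in> sets M \<and> A k \<subseteq> E k \<and> emeasure M (E k) = 0"
    using assms(2) by metis
  have "outer_measure_of M (\<Union>k. A k) \<le> outer_measure_of M (\<Union>k. E k)"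
    using E by (intro outer_measure_of_mono) blast
  also have "\<dots> = 0"
    using E by (subst outer_measure_of_eq) (auto intro!: emeasure_UN_eq_0)
  finally show ?thesis by simp
qed

lemma outer_measure_of_le_1: "prob_space M \<Longrightarrow> outer_measure_of M A \<le> 1" if "A \<subseteq> space M"
  using outer_measure_of_mono[OF that, of M] by (simp add: prob_space.emeasure_space_1)

text \<open>The covering argument needs one constant for all functions, so the set is split into the
  countably many pieces \<open>E M\<close> on which the supremum is at most the natural number M.
  Each piece is null, since its bound holds for all large n and tends to 0.\<close>

lemma null_rate_set:
  assumes \<mu>: "borel_prob_on X \<mu>" and S: "S \<subseteq> metric_ball X x0 R0" and R0: "R0 > 0" "x0 \<in> mspace X"
    and st: "s > 0" "t > 0" "s * t > 1"
    and small: "c > 0" "r0 > 0" "\<And>x \<rho>. x \<in> mspace X \<Longrightarrow> 0 < \<rho> \<Longrightarrow> \<rho> < r0 \<Longrightarrow>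
       outer_measure_of \<mu> (metric_ball X x \<rho>) \<le> ennreal (exp (- c * (1 / \<rho>) powr s))"
    and B: "controlled_complexity X B"
  shows "outer_measure_of \<mu> {f\<in>S. bdd_above ((\<lambda>n. real n powr t * dist_to X f (B n)) ` {1..})} = 0"
proof -
  interpret M: Metric_space "mspace X" "mdist X" by simp
  have sp: "space \<mu> = mspace X" using borel_prob_on_space[OF \<mu>] .
  define E where "E (M::nat) = {f\<in>S. \<forall>n\<ge>1. real n powr t * dist_to X f (B n) \<le> real M}" for M
  have SX: "S \<subseteq> mspace X" using S by auto
  have null: "outer_measure_of \<mu> (E M) = 0" for M
  proof -
    \<comment> \<open>Half of the gap between 1 and s * t. With \<delta> = u the number of balls
      grows more slowly than the reciprocal of their measure.\<close>
    define u where "u = (s * t - 1) / 2"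
    have u: "u > 0" "1 + u < s * t" using st by (auto simp: u_def field_simps)
    \<comment> \<open>A near-best approximant of a point of \<open>E M\<close> is within M + 1 of
      it, hence in this larger ball around x0.\<close>
    have R1: "R0 + real M + 1 > 0" using R0 by simp
    obtain n0 H where n0: "n0 \<ge> 1" and H: "H \<ge> 0"
      and cov: "\<forall>n\<ge>n0. \<exists>K. finite K \<and> K \<subseteq> B n \<and>
        metric_ball X x0 (R0 + real M + 1) \<inter> B n \<subseteq> (\<Union>k\<in>K. metric_ball X k (real n powr - t)) \<and>
        real (card K) \<le> exp (H * real n powr (1 + u))"
      by (rule controlled_complexity_cover[OF B st(2) R0(2) R1 u(1)])
    \<comment> \<open>Radius after recentering, in units of n powr - t: M + 1 from a near-best
      approximant and 1 from the cover.\<close>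
    define M2 where "M2 = real M + 2"
    have M2: "M2 > 0" by (simp add: M2_def)
    define g where "g n = exp (H * real n powr (1 + u)) * exp (- c * (1 / (M2 * real n powr - t)) powr s)" for n
    have "g \<longlonglongrightarrow> 0"
    proof -
      have "g = (\<lambda>n::nat. exp (H * real n powr (1 + u) - (c * M2 powr - s) * real n powr (s * t)))"
        unfolding g_def exp_add[symmetric]
      proof
        fix n :: nat
        have "(1 / (M2 * real n powr - t)) powr s = M2 powr - s * real n powr (s * t)"
          using M2 by (simp add: powr_divide powr_mult powr_powr powr_minus field_simps)
        then show "exp (H * real n powr (1 + u) + - c * (1 / (M2 * real n powr - t)) powr s) =
          exp (H * real n powr (1 + u) - (c * M2 powr - s) * real n powr (s * t))" by simp
      qed
      moreover have "(\<lambda>n::nat. exp (H * real n powr (1 + u) - (c * M2 powr - s) * real n powr (s * t))) \<longlonglongrightarrow> 0"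
      proof -
        define c' where "c' = c * M2 powr - s"
        have "c' > 0" using small M2 by (simp add: c'_def)
        moreover define v where "v = s * t"
        ultimately show ?thesis using u H unfolding c'_def[symmetric] v_def[symmetric]
          by (cases "H = 0") (real_asymp, real_asymp)
      qed
      ultimately show ?thesis by simp
    qed
    have bound: "eventually (\<lambda>n. outer_measure_of \<mu> (E M) \<le> ennreal (g n)) sequentially"
    proof -
      have "(\<lambda>n. M2 * real n powr - t) \<longlonglongrightarrow> 0" using st by real_asymp
      then have "eventually (\<lambda>n. M2 * real n powr - t < r0) sequentially"
        using small(2) by (simp add: order_tendsto_iff)
      then show ?thesis using eventually_ge_at_top[of n0]
      proof eventually_elim
        case (elim n)
        then have n1: "n \<ge> 1" using n0 by simp
        let ?e = "real n powr - t"
        have e: "0 < ?e" "?e \<le> 1" using n1 st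
          by (auto simp: powr_minus inverse_le_1_iff intro!: ge_one_powr_ge_zero)
        obtain K where K: "finite K" "K \<subseteq> B n"
          "metric_ball X x0 (R0 + real M + 1) \<inter> B n \<subseteq> (\<Union>k\<in>K. metric_ball X k ?e)"
          "real (card K) \<le> exp (H * real n powr (1 + u))" using cov elim(2) by metis
        have Bn: "B n \<noteq> {}" "B n \<subseteq> mspace X" using B n1 by (auto simp: controlled_complexity_def)
        have "E M \<subseteq> (\<Union>k\<in>K. metric_ball X k (M2 * ?e))"
        proof
          fix f assume f: "f \<in> E M"
          then have fS: "f \<in> S" "f \<in> mspace X" using SX by (auto simp: E_def)
          have "real n powr t * dist_to X f (B n) \<le> real M" using f n1 by (auto simp: E_def)
          then have "dist_to X f (B n) \<le> real M * ?e"
            using e n1 by (simp add: powr_minus field_simps)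
          also have "\<dots> < (real M + 1) * ?e" using e by simp
          finally obtain b where b: "b \<in> B n" "mdist X f b < (real M + 1) * ?e"
            using dist_to_less_obtains Bn by metis
          have bX: "b \<in> mspace X" using b Bn by auto
          have "mdist X x0 b \<le> mdist X x0 f + mdist X f b"
            using fS bX R0 by (intro M.triangle) auto
          also have "\<dots> \<le> R0 + (real M + 1) * ?e" using S fS b by (auto intro!: add_mono)
          also have "(real M + 1) * ?e \<le> real M + 1" using e by (simp add: mult_left_le)
          finally have "b \<in> metric_ball X x0 (R0 + real M + 1) \<inter> B n" using b bX R0 by auto
          then obtain k where k: "k \<in> K" "b \<in> metric_ball X k ?e" using K(3) by blast
          have "mdist X k f \<le> mdist X k b + mdist X b f"
            using k bX fS by (intro M.triangle) auto
          also have "\<dots> \<le> ?e + (real M + 1) * ?e" using k b by (auto simp: M.commute)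
          also have "\<dots> = M2 * ?e" by (simp add: M2_def algebra_simps)
          finally show "f \<in> (\<Union>k\<in>K. metric_ball X k (M2 * ?e))" using k fS by auto
        qed
        then have "outer_measure_of \<mu> (E M) \<le> outer_measure_of \<mu> (\<Union>k\<in>K. metric_ball X k (M2 * ?e))"
          by (rule outer_measure_of_mono)
        also have "\<dots> \<le> of_nat (card K) * ennreal (exp (- c * (1 / (M2 * ?e)) powr s))"
          using K Bn e M2 elim(1) sp
          by (intro outer_measure_of_finite_UN_le small(3)) auto
        also have "\<dots> = ennreal (real (card K) * exp (- c * (1 / (M2 * ?e)) powr s))"
          by (simp add: ennreal_mult' flip: ennreal_of_nat_eq_real_of_nat)
        also have "\<dots> \<le> ennreal (g n)"
          unfolding g_def using K(4) by (intro ennreal_leI mult_right_mono) auto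
        finally show ?case .
      qed
    qed
    have "(\<lambda>n. ennreal (g n)) \<longlonglongrightarrow> ennreal 0" using \<open>g \<longlonglongrightarrow> 0\<close> by (rule tendsto_ennrealI)
    then have "outer_measure_of \<mu> (E M) \<le> ennreal 0"
      by (rule tendsto_lowerbound[OF _ bound sequentially_bot])
    then show ?thesis by simp
  qed
  have "{f\<in>S. bdd_above ((\<lambda>n. real n powr t * dist_to X f (B n)) ` {1..})} \<subseteq> (\<Union>M. E M)"
  proof
    fix f assume f: "f \<in> {f\<in>S. bdd_above ((\<lambda>n. real n powr t * dist_to X f (B n)) ` {1..})}"
    then obtain b where b: "\<forall>y\<in>(\<lambda>n. real n powr t * dist_to X f (B n)) ` {1..}. y \<le> b"
      unfolding bdd_above_def by blast
    obtain M :: nat where "b \<le> real M" using real_arch_simple[of b] ..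
    have "real n powr t * dist_to X f (B n) \<le> real M" if "n \<ge> 1" for n
      using b that \<open>b \<le> real M\<close> by (intro order_trans[OF _ \<open>b \<le> real M\<close>]) auto
    then have "f \<in> E M" using f unfolding E_def by simp
    then show "f \<in> (\<Union>M. E M)" by blast
  qed
  then have "outer_measure_of \<mu> {f\<in>S. bdd_above ((\<lambda>n. real n powr t * dist_to X f (B n)) ` {1..})} \<le>
      outer_measure_of \<mu> (\<Union>M. E M)" by (rule outer_measure_of_mono)
  also have "\<dots> = 0"
  proof (rule outer_measure_of_UN_null)
    show "E k \<subseteq> space \<mu>" for k using SX unfolding E_def sp by blast
  qed (rule null)
  finally show ?thesis by simp
qed

text \<open>The union over t is uncountable, but the sets shrink as t grows, because n \<ge> 1; the
  rates 1 / D + 1 / (k + 1) therefore exhaust it. For each t > 1 / D there is room for an exponent s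
  with 1 / t < s < D, at which criticality supplies the small-ball bound.\<close>

lemma null_superrate_set:
  assumes \<mu>: "borel_prob_on X \<mu>" "critical X \<mu> S" and S: "S \<subseteq> metric_ball X x0 R0" and R0: "R0 > 0"
      "x0 \<in> mspace X"
    and D: "lower_dim_exp X S = ereal D" "D > 0" and B: "controlled_complexity X B"
  shows "outer_measure_of \<mu> (\<Union>t\<in>{1 / D<..}.
        {f \<in> S. bdd_above ((\<lambda>n. real n powr t * dist_to X f (B n)) ` {1..})}) = 0"
proof -
  define F where "F t = {f \<in> S. bdd_above ((\<lambda>n. real n powr t * dist_to X f (B n)) ` {1..})}" for t
  have mono: "F t \<subseteq> F t'" if "t' \<le> t" for t t'
  proof
    fix f assume f: "f \<in> F t"
    then obtain b where b: "\<forall>y\<in>(\<lambda>n. real n powr t * dist_to X f (B n)) ` {1..}. y \<le> b"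
      unfolding bdd_above_def F_def by blast
    have "real n powr t' * dist_to X f (B n) \<le> b" if "n \<ge> 1" for n
    proof -
      have "0 \<le> dist_to X f (B n)" unfolding dist_to_def
        using B that by (intro cINF_greatest) (auto simp: controlled_complexity_def)
      then have "real n powr t' * dist_to X f (B n) \<le> real n powr t * dist_to X f (B n)"
        using \<open>t' \<le> t\<close> \<open>n \<ge> 1\<close> by (intro mult_right_mono powr_mono) auto
      also have "\<dots> \<le> b" using b that by auto
      finally show ?thesis .
    qed
    then show "f \<in> F t'" using f unfolding F_def by (auto simp: bdd_above_def intro!: exI[of _ b])
  qed
  have null: "outer_measure_of \<mu> (F t) = 0" if t: "t > 1 / D" for t
  proof -
    have "1 / D > 0" using D by simp
    then have t0: "t > 0" using t by linarith
    have tD: "1 / t < D" using t t0 D by (simp add: field_simps)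
    define s where "s = (1 / t + D) / 2"
    have "1 / t > 0" using t0 by simp
    have s: "s > 0" "s < D" "1 / t < s" 
      using tD add_pos_pos[OF \<open>1 / t > 0\<close> D(2)] by (auto simp: s_def)
    then have "s * t > 1" using t0 by (simp add: field_simps)
    moreover have "\<exists>c>0. \<exists>r0>0. \<forall>x\<in>mspace X. \<forall>\<rho>. 0 < \<rho> \<and> \<rho> < r0 \<longrightarrow>
       outer_measure_of \<mu> (metric_ball X x \<rho>) \<le> ennreal (exp (- c * (1 / \<rho>) powr s))"
      using \<mu>(2)[unfolded critical_def, THEN conjunct2, THEN spec, THEN mp, of s] s(1,2) D by simp
    then obtain c r0 where "c > 0" "r0 > 0" "\<forall>x\<in>mspace X. \<forall>\<rho>. 0 < \<rho> \<and> \<rho> < r0 \<longrightarrow>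
       outer_measure_of \<mu> (metric_ball X x \<rho>) \<le> ennreal (exp (- c * (1 / \<rho>) powr s))"
      by metis
    ultimately show ?thesis unfolding F_def using s t0
      by (intro null_rate_set[OF \<mu>(1) S R0, of s t c r0 B] B) auto
  qed
  have "(\<Union>t\<in>{1 / D<..}. F t) \<subseteq> (\<Union>k::nat. F (1 / D + 1 / real (Suc k)))"
  proof
    fix f assume "f \<in> (\<Union>t\<in>{1 / D<..}. F t)"
    then obtain t where t: "t > 1 / D" "f \<in> F t" by auto
    obtain k :: nat where "1 / real (Suc k) < t - 1 / D"
      using t(1) nat_approx_posE[of "t - 1 / D"] by auto
    then have "F t \<subseteq> F (1 / D + 1 / real (Suc k))" by (intro mono) auto
    then show "f \<in> (\<Union>k::nat. F (1 / D + 1 / real (Suc k)))" using t by blast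
  qed
  then have "outer_measure_of \<mu> (\<Union>t\<in>{1 / D<..}. F t) \<le>
      outer_measure_of \<mu> (\<Union>k::nat. F (1 / D + 1 / real (Suc k)))"
    by (rule outer_measure_of_mono)
  also have "\<dots> = 0"
    using null S by (intro outer_measure_of_UN_null) (auto simp: F_def borel_prob_on_space[OF \<mu>(1)])
  finally show ?thesis by (simp add: F_def)
qed

text \<open>Mass distribution principle: any cover by \<epsilon>-balls carries the outer measure
  \<theta> of S, so it has at least \<theta> * exp (c * (1 / \<epsilon>)^s) members, and the double
  logarithm forgets \<theta> and c. A set that is not totally bounded has infinite dimension by
  definition.\<close>

lemma lower_dim_exp_ge:
  assumes \<mu>: "borel_prob_on X \<mu>" and S: "S \<subseteq> mspace X" "outer_measure_of \<mu> S > 0"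
    and s: "s > 0"
    and small: "c > 0" "r0 > 0" "\<And>x \<rho>. x \<in> mspace X \<Longrightarrow> 0 < \<rho> \<Longrightarrow> \<rho> < r0 \<Longrightarrow>
       outer_measure_of \<mu> (metric_ball X x \<rho>) \<le> ennreal (exp (- c * (1 / \<rho>) powr s))"
  shows "ereal s \<le> lower_dim_exp X S"
proof (cases "totally_bounded_in X S")
  case True
  interpret M: Metric_space "mspace X" "mdist X" by simp
  have sp: "space \<mu> = mspace X" using borel_prob_on_space[OF \<mu>] .
  have "outer_measure_of \<mu> S \<le> 1"
    using \<mu> S sp by (intro outer_measure_of_le_1) (auto simp: borel_prob_on_def)
  then obtain \<theta> where \<theta>: "outer_measure_of \<mu> S = ennreal \<theta>" "\<theta> > 0"
    using S(2) by (cases "outer_measure_of \<mu> S") (auto simp: top_unique)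
  have N: "\<theta> * exp (c * (1 / \<epsilon>) powr s) \<le> real (the_enat (covering_number X S \<epsilon>))"
    if \<epsilon>: "0 < \<epsilon>" "\<epsilon> < r0" for \<epsilon>
  proof -
    have "\<exists>K. finite K \<and> K \<subseteq> S \<and> S \<subseteq> (\<Union>x\<in>K. M.mball x \<epsilon>)"
      using True \<epsilon>(1) unfolding totally_bounded_in_def M.mtotally_bounded_def by simp
    then obtain K0 where "finite K0" "K0 \<subseteq> S" "S \<subseteq> (\<Union>x\<in>K0. M.mball x \<epsilon>)" by metis
    then have "covering_number X S \<epsilon> \<le> enat (card K0)"
      by (intro covering_number_le) (auto 0 4)
    then have "covering_number X S \<epsilon> \<noteq> \<infinity>" by (intro notI) simp
    then obtain K where K: "finite K" "K \<subseteq> S" "S \<subseteq> (\<Union>x\<in>K. metric_ball X x \<epsilon>)"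
      "covering_number X S \<epsilon> = enat (card K)" by (rule covering_number_attained)
    have "ennreal \<theta> \<le> outer_measure_of \<mu> (\<Union>x\<in>K. metric_ball X x \<epsilon>)"
      unfolding \<theta>(1)[symmetric] using K(3) by (rule outer_measure_of_mono)
    also have "\<dots> \<le> of_nat (card K) * ennreal (exp (- c * (1 / \<epsilon>) powr s))"
      using K S \<epsilon> sp by (intro outer_measure_of_finite_UN_le small(3)) auto
    also have "\<dots> = ennreal (real (card K) * exp (- c * (1 / \<epsilon>) powr s))"
      by (simp add: ennreal_mult' flip: ennreal_of_nat_eq_real_of_nat)
    finally have "\<theta> \<le> real (card K) * exp (- c * (1 / \<epsilon>) powr s)"
      by (subst (asm) ennreal_le_iff) auto
    then show ?thesis using K(4) by (simp add: exp_minus field_simps)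
  qed
  define h where "h \<epsilon> = log 2 (log 2 (\<theta> * exp (c * (1 / \<epsilon>) powr s))) / log 2 (1 / \<epsilon>)" for \<epsilon>
  have lim: "(h \<longlongrightarrow> s) (at_right 0)"
    unfolding h_def using \<theta>(2) s small(1) by real_asymp
  have "eventually (\<lambda>\<epsilon>. \<epsilon> < r0) (at_right 0)" "eventually (\<lambda>\<epsilon>::real. \<epsilon> < 1) (at_right 0)"
    using small(2) by (auto simp: eventually_at_right intro: exI[of _ 1])
  \<comment> \<open>The outer logarithm is monotone on positive arguments only, so the inner one has
    to be positive.\<close>
  moreover have "eventually (\<lambda>\<epsilon>. log 2 (\<theta> * exp (c * (1 / \<epsilon>) powr s)) > 0) (at_right 0)"
    using \<theta>(2) s small(1) by real_asymp
  moreover have "eventually (\<lambda>\<epsilon>::real. \<epsilon> > 0) (at_right 0)"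
    by (simp add: eventually_at_right_less)
  ultimately have ev: "eventually (\<lambda>\<epsilon>. h \<epsilon> \<le> loglog_ratio X S \<epsilon>) (at_right 0)"
  proof eventually_elim
    case (elim \<epsilon>)
    have "log 2 (\<theta> * exp (c * (1 / \<epsilon>) powr s)) \<le> log 2 (real (the_enat (covering_number X S \<epsilon>)))"
      using N[of \<epsilon>] elim \<theta>(2) by (intro log_mono mult_pos_pos) auto
    then have "log 2 (log 2 (\<theta> * exp (c * (1 / \<epsilon>) powr s))) \<le>
        log 2 (log 2 (real (the_enat (covering_number X S \<epsilon>))))"
      using elim by (subst log_le_cancel_iff) auto
    then show ?case unfolding h_def loglog_ratio_def using elim by (intro divide_right_mono) auto
  qed
  show ?thesis
  proof -
    have "ereal y \<le> lower_dim_exp X S" if "y < s" for y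
    proof -
      have "eventually (\<lambda>\<epsilon>. y < h \<epsilon>) (at_right 0)" using lim that by (simp add: order_tendsto_iff)
      then have "eventually (\<lambda>\<epsilon>. ereal y \<le> ereal (loglog_ratio X S \<epsilon>)) (at_right 0)"
        using ev by eventually_elim simp
      then show ?thesis unfolding lower_dim_exp_def using True by (simp add: Liminf_bounded)
    qed
    then show "ereal s \<le> lower_dim_exp X S"
      by (cases "lower_dim_exp X S") (auto intro: dense_le, meson gt_ex lt_ex)
  qed
qed (simp add: lower_dim_exp_def)

section \<open>Upper bound for the dimension from approximation rates\<close>

definition is_cover :: "'a metric \<Rightarrow> 'a set \<Rightarrow> real \<Rightarrow> 'a set \<Rightarrow> bool" where
  "is_cover X S \<epsilon> C \<longleftrightarrow> finite C \<and> C \<subseteq> S \<and> S \<subseteq> (\<Union>x\<in>C. metric_ball X x \<epsilon>)"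

text \<open>At scale \<epsilon> take n of order \<epsilon>^(-1/t): then \<open>A n\<close>
  approximates S well within \<epsilon>, and covering it costs exp (H * n^(1 + \<delta>)), which is
  the exponential of a multiple of \<epsilon>^(-(1 + \<delta>) / t). Letting \<delta> tend to 0 and
  t to T gives the exponent 1 / T.\<close>

lemma upper_dim_exp_le:
  assumes S: "S \<subseteq> metric_ball X x0 R0" and R0: "R0 > 0" "x0 \<in> mspace X"
    and A: "controlled_complexity X A" and T: "T > 0"
    and appr: "\<And>t. 0 < t \<Longrightarrow> t < T \<Longrightarrow> approximates_at_rate X S A t"
  shows "totally_bounded_in X S" "upper_dim_exp X S \<le> ereal (1 / T)"
proof -
  interpret M: Metric_space "mspace X" "mdist X" by simp
  have SX: "S \<subseteq> mspace X" using S by auto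
  have key: "\<exists>\<epsilon>0>0. \<exists>H\<ge>0. \<forall>\<epsilon>. 0 < \<epsilon> \<and> \<epsilon> < \<epsilon>0 \<longrightarrow> (\<exists>C. is_cover X S \<epsilon> C \<and>
      real (card C) \<le> exp (H * (1 / \<epsilon>) powr ((1 + \<delta>) / t)))"
    if t: "0 < t" "t < T" and \<delta>: "\<delta> > 0" for t \<delta>
  proof -
    obtain C0 where C0: "C0 > 0" "\<forall>n\<ge>1. (SUP x\<in>S. ereal (dist_to X x (A n))) \<le> ereal (C0 * real n powr (- t))"
      using appr[OF t] unfolding approximates_at_rate_def by blast
    have R1: "R0 + 1 > 0" and t1: "t + 1 > 0" using R0 t by auto
    \<comment> \<open>The cover uses the scale n powr - (t + 1); the extra factor 1 / n absorbs the
      unknown constant C0 as soon as n \<ge> 1 / C0.\<close>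
    obtain n0 H where n0: "n0 \<ge> 1" and H: "H \<ge> 0"
      and cov: "\<forall>n\<ge>n0. \<exists>K. finite K \<and> K \<subseteq> A n \<and>
        metric_ball X x0 (R0 + 1) \<inter> A n \<subseteq> (\<Union>k\<in>K. metric_ball X k (real n powr - (t + 1))) \<and>
        real (card K) \<le> exp (H * real n powr (1 + \<delta>))"
      by (rule controlled_complexity_cover[OF A t1 R0(2) R1 \<delta>])
    define N0 where "N0 = max (max 1 (real n0)) (1 / C0)"
    \<comment> \<open>Solves C0 * z powr - t = \<epsilon> / 8. Since z will be at least 1, rounding
      it up to n at most doubles it.\<close>
    define z where "z \<epsilon> = (8 * C0 / \<epsilon>) powr (1 / t)" for \<epsilon>
    have "filterlim z at_top (at_right 0)" unfolding z_def using C0 t by real_asymp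
    then have "eventually (\<lambda>\<epsilon>. N0 \<le> z \<epsilon>) (at_right 0)" by (simp add: filterlim_at_top)
    then obtain e1 where e1: "e1 > 0" "\<And>\<epsilon>. 0 < \<epsilon> \<Longrightarrow> \<epsilon> < e1 \<Longrightarrow> N0 \<le> z \<epsilon>"
      by (auto simp: eventually_at_right_field)
    define H2 where "H2 = H * (2 powr (1 + \<delta>) * (8 * C0) powr ((1 + \<delta>) / t))"
    have "\<exists>C. is_cover X S \<epsilon> C \<and>
        real (card C) \<le> exp (H2 * (1 / \<epsilon>) powr ((1 + \<delta>) / t))"
      if \<epsilon>: "0 < \<epsilon> \<and> \<epsilon> < min e1 1" for \<epsilon>
    proof -
      have z: "N0 \<le> z \<epsilon>" using e1 \<epsilon> by auto
      define n where "n = nat \<lceil>z \<epsilon>\<rceil>"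
      have z1: "z \<epsilon> \<ge> 1" "z \<epsilon> \<ge> real n0" "z \<epsilon> \<ge> 1 / C0" using z by (auto simp: N0_def)
      have nz: "z \<epsilon> \<le> real n" "real n \<le> 2 * z \<epsilon>" using z1(1) unfolding n_def by linarith+
      have n1: "n \<ge> 1" "n \<ge> n0" "1 / C0 \<le> real n" using nz z1 by linarith+
      have "(z \<epsilon>) powr t = 8 * C0 / \<epsilon>" unfolding z_def using t C0 \<epsilon> by (simp add: powr_powr)
      then have "8 * C0 / \<epsilon> \<le> real n powr t" using nz z1 t
          by (metis powr_mono2 less_imp_le order_trans zero_le_one)
      then have rate: "C0 * real n powr - t \<le> \<epsilon> / 8"
        using n1 \<epsilon> by (simp add: powr_minus field_simps)
      have rate2: "real n powr - (t + 1) \<le> \<epsilon> / 8"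
      proof -
        have "real n powr - (t + 1) = real n powr - t * (1 / real n)"
          using n1 by (simp add: powr_diff)
        also have "\<dots> \<le> real n powr - t * C0"
          using n1 C0 by (intro mult_left_mono) (auto simp: field_simps)
        also have "\<dots> \<le> \<epsilon> / 8" using rate by (simp add: mult.commute)
        finally show ?thesis .
      qed
      obtain K where K: "finite K" "K \<subseteq> A n"
        "metric_ball X x0 (R0 + 1) \<inter> A n \<subseteq> (\<Union>k\<in>K. metric_ball X k (real n powr - (t + 1)))"
        "real (card K) \<le> exp (H * real n powr (1 + \<delta>))" using cov n1(2) by metis
      have An: "A n \<noteq> {}" "A n \<subseteq> mspace X" using A n1 by (auto simp: controlled_complexity_def)
      have near: "\<exists>k\<in>K. mdist X s k \<le> \<epsilon> / 2" if s: "s \<in> S" for s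
      proof -
        have sX: "s \<in> mspace X" using s SX by auto
        have "ereal (dist_to X s (A n)) \<le> (SUP x\<in>S. ereal (dist_to X x (A n)))"
          using s by (intro SUP_upper)
        also have "\<dots> \<le> ereal (C0 * real n powr - t)" using C0(2) n1 by auto
        finally have "dist_to X s (A n) \<le> C0 * real n powr - t" by simp
        also have "\<dots> < \<epsilon> / 4" using rate \<epsilon> by simp
        finally obtain b where b: "b \<in> A n" "mdist X s b < \<epsilon> / 4"
          using dist_to_less_obtains An by metis
        have bX: "b \<in> mspace X" using b An by auto
        have "mdist X x0 b \<le> mdist X x0 s + mdist X s b"
          using sX bX R0 by (intro M.triangle) auto
        also have "\<dots> \<le> R0 + 1" using S s b \<epsilon> by (intro add_mono) auto
        finally have "b \<in> metric_ball X x0 (R0 + 1) \<inter> A n" using b bX R0 by auto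
        then obtain k where k: "k \<in> K" "b \<in> metric_ball X k (real n powr - (t + 1))" using K(3) by blast
        have "mdist X s k \<le> mdist X s b + mdist X b k"
          using k bX sX by (intro M.triangle) auto
        also have "\<dots> \<le> \<epsilon> / 4 + \<epsilon> / 8" using k b rate2 by (intro add_mono) (auto simp: M.commute)
        also have "\<dots> \<le> \<epsilon> / 2" using \<epsilon> by simp
        finally show ?thesis using k by auto
      qed
      obtain C where C: "finite C" "C \<subseteq> S" "S \<subseteq> (\<Union>x\<in>C. metric_ball X x \<epsilon>)" "card C \<le> card K"
      proof (rule internal_cover[OF K(1) SX, of "\<lambda>s k. mdist X s k \<le> \<epsilon> / 2" \<epsilon>])
        fix s t k assume st: "s \<in> S" "t \<in> S" "k \<in> K" "mdist X s k \<le> \<epsilon> / 2" "mdist X t k \<le> \<epsilon> / 2"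
        have "mdist X s t \<le> mdist X s k + mdist X k t"
          using st SX K(2) An by (intro M.triangle) auto
        then show "mdist X s t \<le> \<epsilon>" using st by (simp add: M.commute)
      qed (use near in auto)
      have "real (card C) \<le> exp (H * real n powr (1 + \<delta>))" using C(4) K(4) by linarith
      also have "\<dots> \<le> exp (H2 * (1 / \<epsilon>) powr ((1 + \<delta>) / t))"
      proof -
        have "real n powr (1 + \<delta>) \<le> (2 * z \<epsilon>) powr (1 + \<delta>)" using nz \<delta> by (intro powr_mono2) auto
        also have "\<dots> = 2 powr (1 + \<delta>) * ((8 * C0) * (1 / \<epsilon>)) powr ((1 + \<delta>) / t)"
          using z1 by (simp add: powr_mult z_def powr_powr mult.commute)
        also have "\<dots> = 2 powr (1 + \<delta>) * ((8 * C0) powr ((1 + \<delta>) / t) * (1 / \<epsilon>) powr ((1 + \<delta>) / t))"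
          using C0 \<epsilon> by (subst powr_mult) auto
        finally show ?thesis using H by (simp add: H2_def mult_left_mono mult.assoc)
      qed
      finally show ?thesis using C unfolding is_cover_def by metis
    qed
    moreover have "0 < min e1 1" "0 \<le> H2" using e1 H by (simp_all add: H2_def)
    ultimately show ?thesis by metis
  qed
  show tb: "totally_bounded_in X S"
    unfolding totally_bounded_in_def M.mtotally_bounded_def
  proof (intro allI impI)
    fix \<epsilon> :: real assume \<epsilon>: "0 < \<epsilon>"
    \<comment> \<open>Total boundedness asks only for the existence of covers, so T / 2 and 1 are
      arbitrary admissible values of t and \<delta>.\<close>
    obtain e0 where e0: "e0 > 0" "\<And>\<epsilon>. 0 < \<epsilon> \<and> \<epsilon> < e0 \<Longrightarrow> \<exists>C. is_cover X S \<epsilon> C"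
      using key[of "T / 2" 1] T by force
    define e where "e = min (e0 / 2) (\<epsilon> / 2)"
    have "0 < e \<and> e < e0" using e0 \<epsilon> by (auto simp: e_def)
    then obtain C where C: "finite C" "C \<subseteq> S" "S \<subseteq> (\<Union>x\<in>C. metric_ball X x e)"
      using e0(2) unfolding is_cover_def by metis
    have "metric_ball X x e \<subseteq> M.mball x \<epsilon>" for x using \<epsilon> by (auto simp: e_def)
    then show "\<exists>K. finite K \<and> K \<subseteq> S \<and> S \<subseteq> (\<Union>x\<in>K. M.mball x \<epsilon>)" 
      using C by (intro exI[of _ C] conjI order_trans[OF C(3)] UN_mono) auto
  qed
  have le: "upper_dim_exp X S \<le> ereal y" if y: "y > (1 + \<delta>) / t" and t: "0 < t" "t < T" and \<delta>: "\<delta> > 0" for t \<delta> y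
  proof -
    obtain e0 H where e0: "e0 > 0" "H \<ge> 0" "\<And>\<epsilon>. 0 < \<epsilon> \<Longrightarrow> \<epsilon> < e0 \<Longrightarrow> (\<exists>C. is_cover X S \<epsilon> C \<and>
        real (card C) \<le> exp (H * (1 / \<epsilon>) powr ((1 + \<delta>) / t)))"
      using key[OF t \<delta>] by blast
    define q where "q = (1 + \<delta>) / t"
    \<comment> \<open>H may be 0; a positive H' makes the inner logarithm of the comparison function
      tend to infinity.\<close>
    define H' where "H' = H + 1"
    have q: "q > 0" "H' > 0" using \<delta> t e0 by (auto simp: q_def H'_def)
    \<comment> \<open>The cut-off at 1 makes the numerator nonnegative, which covers the degenerate
      covering numbers 0 and 1; for small \<epsilon> it is inactive.\<close>
    define h where "h \<epsilon> = log 2 (max 1 (log 2 (exp (H' * (1 / \<epsilon>) powr q)))) / log 2 (1 / \<epsilon>)" for \<epsilon>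
    have "((\<lambda>\<epsilon>. log 2 (log 2 (exp (H' * (1 / \<epsilon>) powr q))) / log 2 (1 / \<epsilon>)) \<longlongrightarrow> q) (at_right 0)"
      unfolding log_def using q by real_asymp
    moreover have "eventually (\<lambda>\<epsilon>. log 2 (exp (H' * (1 / \<epsilon>) powr q)) > 1) (at_right 0)"
      using q by real_asymp
    then have "eventually (\<lambda>\<epsilon>. log 2 (log 2 (exp (H' * (1 / \<epsilon>) powr q))) / log 2 (1 / \<epsilon>) = h \<epsilon>) (at_right 0)"
      unfolding h_def by eventually_elim (simp add: max_def)
    ultimately have lim: "(h \<longlongrightarrow> q) (at_right 0)" by (rule Lim_transform_eventually)
    have "eventually (\<lambda>\<epsilon>. h \<epsilon> < y) (at_right 0)" using lim y by (simp add: order_tendsto_iff q_def)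
    moreover have "eventually (\<lambda>\<epsilon>. \<epsilon> < e0) (at_right 0)" "eventually (\<lambda>\<epsilon>::real. \<epsilon> < 1) (at_right 0)"
      using e0(1) by (auto simp: eventually_at_right intro: exI[of _ 1])
    moreover have "eventually (\<lambda>\<epsilon>::real. \<epsilon> > 0) (at_right 0)"
      by (simp add: eventually_at_right_less)
    ultimately have "eventually (\<lambda>\<epsilon>. ereal (loglog_ratio X S \<epsilon>) \<le> ereal y) (at_right 0)"
    proof eventually_elim
      case (elim \<epsilon>)
      obtain C where "is_cover X S \<epsilon> C"
        and C4: "real (card C) \<le> exp (H * (1 / \<epsilon>) powr q)" using e0(3)[of \<epsilon>] elim unfolding q_def by blast
      then have C: "finite C" "C \<subseteq> S" "S \<subseteq> (\<Union>x\<in>C. metric_ball X x \<epsilon>)" by (simp_all add: is_cover_def)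
      define N where "N = the_enat (covering_number X S \<epsilon>)"
      have "covering_number X S \<epsilon> \<le> enat (card C)" using C by (intro covering_number_le)
      then have "N \<le> card C" unfolding N_def
        by (cases "covering_number X S \<epsilon>") auto
      then have "real N \<le> exp (H * (1 / \<epsilon>) powr q)" using C4 by simp
      also have "\<dots> \<le> exp (H' * (1 / \<epsilon>) powr q)" by (simp add: H'_def mult_right_mono)
      finally have N: "real N \<le> exp (H' * (1 / \<epsilon>) powr q)" .
      have "log 2 (log 2 (real N)) \<le> log 2 (max 1 (log 2 (exp (H' * (1 / \<epsilon>) powr q))))"
      proof (cases "N \<le> 1")
        case True
        \<comment> \<open>For N = 0 and N = 1 the inner logarithm is 0, and the total logarithm
          returns \<open>log 2 0 = 0\<close>.\<close>
        then have "log 2 (log 2 (real N)) = 0" by (cases N) (auto simp: log_def)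
        then show ?thesis by (simp add: zero_le_log_cancel_iff)
      next
        case False
        then have "log 2 (real N) > 0" by simp
        moreover have "log 2 (real N) \<le> log 2 (exp (H' * (1 / \<epsilon>) powr q))"
          using N False by (intro log_mono) auto
        ultimately show ?thesis by (intro log_mono) auto
      qed
      then have "loglog_ratio X S \<epsilon> \<le> h \<epsilon>" unfolding loglog_ratio_def h_def N_def
        using elim by (intro divide_right_mono) auto
      then show ?case using elim by simp
    qed
    then show ?thesis unfolding upper_dim_exp_def using tb by (simp add: Limsup_bounded)
  qed
  show "upper_dim_exp X S \<le> ereal (1 / T)"
  proof (rule ereal_le_epsilon2)
    fix e :: real assume e: "0 < e"
    \<comment> \<open>One small x serves both limits: \<delta> = x and t = T - x give the exponent
      (1 + x) / (T - x).\<close>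
    have "((\<lambda>x. (1 + x) / (T - x)) \<longlongrightarrow> (1 + 0) / (T - 0)) (at_right 0)"
      using T by (intro tendsto_intros) auto
    then have "eventually (\<lambda>x. (1 + x) / (T - x) < 1 / T + e) (at_right 0)"
      using e by (simp add: order_tendsto_iff)
    moreover have "eventually (\<lambda>x. x < T) (at_right 0)" "eventually (\<lambda>x::real. x > 0) (at_right 0)"
      using T by (auto simp: eventually_at_right eventually_at_right_less)
    ultimately have "eventually (\<lambda>x. (1 + x) / (T - x) < 1 / T + e \<and> x < T \<and> x > 0) (at_right 0)"
      by eventually_elim auto
    then obtain x where x: "(1 + x) / (T - x) < 1 / T + e" "x < T" "x > 0"
      using eventually_happens' trivial_limit_at_right_real by blast
    show "upper_dim_exp X S \<le> ereal (1 / T) + ereal e"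
      using le[of x "T - x" "1 / T + e"] x by simp
  qed
qed

section \<open>Norms of bounded functions on the cube\<close>

lemma emeasure_cube_measure: "emeasure (cube_measure :: (real ^ 'd::finite) measure) (space cube_measure) = 1"
proof -
  have ne: "(0 :: real^'d) \<in> cbox 0 1" by (simp add: mem_box_cart)
  have "measure lborel (cbox 0 1 :: (real^'d) set) = 1"
    using ne by (subst content_cbox_cart) auto
  moreover have "emeasure lborel (cbox 0 1 :: (real^'d) set) =
      ennreal (measure lborel (cbox 0 1 :: (real^'d) set))"
    by (rule emeasure_eq_ennreal_measure) (auto simp: emeasure_lborel_cbox_eq)
  moreover have "emeasure cube_measure (unit_cube :: (real^'d) set) =
      emeasure lebesgue (unit_cube :: (real^'d) set)"
    by (rule emeasure_restrict_space) auto
  moreover have "emeasure lebesgue (unit_cube :: (real^'d) set) = emeasure lborel (unit_cube :: (real^'d) set)"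
    by simp
  moreover have "space cube_measure = (unit_cube :: (real^'d) set)" by (simp add: space_restrict_space)
  ultimately show ?thesis by (metis ennreal_1)
qed

lemma prob_space_cube_measure: "prob_space (cube_measure :: (real ^ 'd::finite) measure)"
  by (rule prob_spaceI) (rule emeasure_cube_measure)

lemma space_cube_measure [simp]: "space cube_measure = unit_cube"
  by (simp add: space_restrict_space)

text \<open>The cube has measure 1, so every p-norm is dominated by the supremum. This reduces all
  upper estimates to pointwise ones, for finite and infinite p alike.\<close>

lemma Lp_bounded:
  fixes f :: "real ^ 'd::finite \<Rightarrow> real"
  assumes p: "1 \<le> p" and f: "f \<in> borel_measurable cube_measure" and a: "0 \<le> a"
    and le: "\<And>x. x \<in> unit_cube \<Longrightarrow> \<bar>f x\<bar> \<le> a"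
  shows "f \<in> Lp_functions p" "Lp_norm p f \<le> a"
proof -
  interpret prob_space "cube_measure :: (real^'d) measure" by (rule prob_space_cube_measure)
  note [measurable] = f
  have "f \<in> Lp_functions p \<and> Lp_norm p f \<le> a"
  proof (cases "p = \<infinity>")
    case True
    have "esssup cube_measure (\<lambda>x. ennreal \<bar>f x\<bar>) \<le> ennreal a"
      using le by (intro esssup_I AE_I2) (auto intro!: ennreal_leI)
    then show ?thesis using True a f
      by (auto simp: Lp_functions_def Lp_norm_def intro!: enn2real_leI elim!: le_less_trans)
  next
    case False
    let ?q = "enn2real p"
    have q: "?q \<ge> 1" using enn2real_ge_1 p False by auto
    have ae: "AE x in cube_measure. \<bar>f x\<bar> powr ?q \<le> a powr ?q"
      using le q by (intro AE_I2 powr_mono2) auto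
    have i: "integrable cube_measure (\<lambda>x. \<bar>f x\<bar> powr ?q)"
      using ae by (intro integrable_const_bound[where B = "a powr ?q"]) auto
    have "(LINT x|cube_measure. \<bar>f x\<bar> powr ?q) \<le> (LINT x|(cube_measure :: (real^'d) measure). a powr ?q)"
      using i ae by (intro integral_mono_AE) auto
    also have "\<dots> = a powr ?q" using prob_space by (simp del: space_cube_measure)
    finally have "(LINT x|cube_measure. \<bar>f x\<bar> powr ?q) powr (1 / ?q) \<le> (a powr ?q) powr (1 / ?q)"
      using q by (intro powr_mono2 integral_nonneg_AE) auto
    also have "\<dots> = a" using a q by (simp add: powr_powr)
    finally show ?thesis using i False f by (simp add: Lp_functions_def Lp_norm_def)
  qed
  then show "f \<in> Lp_functions p" "Lp_norm p f \<le> a" by auto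
qed

text \<open>Chebyshev gives a * (measure S)^(1/p), and measure S \<le> 1 allows the exponent 1 / p
  to be replaced by 1. This weaker form is the same for all p and loses only a constant when S fills
  a fixed proportion of the cube.\<close>

lemma Lp_norm_ge:
  fixes f :: "real ^ 'd::finite \<Rightarrow> real"
  assumes p: "1 \<le> p" and f: "f \<in> Lp_functions p" and a: "0 \<le> a"
    and S: "S \<in> sets lebesgue" "S \<subseteq> unit_cube" and ge: "\<And>x. x \<in> S \<Longrightarrow> a \<le> \<bar>f x\<bar>"
  shows "a * measure lebesgue S \<le> Lp_norm p f"
proof -
  interpret prob_space "cube_measure :: (real^'d) measure" by (rule prob_space_cube_measure)
  have [measurable]: "f \<in> borel_measurable cube_measure" using f by (simp add: Lp_functions_def)
  have SS: "S \<in> sets cube_measure" using S by (subst sets_restrict_space_iff) auto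
  have mS: "measure cube_measure S = measure lebesgue S"
    using S by (subst measure_restrict_space) auto
  show ?thesis
  proof (cases "measure lebesgue S = 0 \<or> a = 0")
    case True
    then show ?thesis using Lp_norm_nonneg[of p f] by auto
  next
    case False
    then have pos: "measure cube_measure S > 0" and a0: "a > 0" using mS a zero_less_measure_iff by auto
    have le1: "measure cube_measure S \<le> 1" by (rule prob_le_1)
    show ?thesis
    proof (cases "p = \<infinity>")
      case True
      let ?E = "esssup cube_measure (\<lambda>x. ennreal \<bar>f x\<bar>)"
      have fin: "?E < \<infinity>" using f True by (auto simp: Lp_functions_def)
      have "ennreal a \<le> ?E"
      proof (rule ccontr)
        assume "\<not> ennreal a \<le> ?E"
        then have lt: "?E < ennreal a" by simp
        have "AE x in cube_measure. x \<notin> S"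
          using esssup_AE[of "\<lambda>x. ennreal \<bar>f x\<bar>" cube_measure]
        proof eventually_elim
          case (elim x)
          then have "ennreal \<bar>f x\<bar> < ennreal a" using lt by (rule le_less_trans)
          then show ?case using ge[of x] by (auto simp: ennreal_less_iff)
        qed
        then have "measure cube_measure S = 0"
          using SS by (metis measure_eq_0_null_sets AE_iff_null_sets)
        then show False using pos by simp
      qed
      then have "a \<le> enn2real ?E" using fin a by (metis enn2real_ennreal enn2real_mono infinity_ennreal_def)
      moreover have "a * measure lebesgue S \<le> a" using le1 mS a0 by (simp add: mult_left_le)
      ultimately show ?thesis using True by (simp add: Lp_norm_def)
    next
      case False
      let ?q = "enn2real p" and ?m = "measure cube_measure S"
      have q: "?q \<ge> 1" using enn2real_ge_1 p False by auto
      have i: "integrable cube_measure (\<lambda>x. \<bar>f x\<bar> powr ?q)" using f False by (simp add: Lp_functions_def)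
      have "a powr ?q * ?m = (LINT x|cube_measure. a powr ?q * indicator S x)"
        using SS S by (simp add: Int_absorb2)
      also have "\<dots> \<le> (LINT x|cube_measure. \<bar>f x\<bar> powr ?q)"
      proof (rule integral_mono)
        show "integrable cube_measure (\<lambda>x. a powr ?q * indicator S x)"
          using SS by (intro integrable_mult_right) (auto simp: integrable_indicator_iff emeasure_eq_measure)
        show "a powr ?q * indicator S x \<le> \<bar>f x\<bar> powr ?q" for x
          using ge[of x] a q by (auto simp: indicator_def intro!: powr_mono2)
      qed (rule i)
      finally have "(a powr ?q * ?m) powr (1 / ?q) \<le> Lp_norm p f"
        using False q by (simp add: Lp_norm_def powr_mono2)
      moreover have "(a powr ?q * ?m) powr (1 / ?q) = a * ?m powr (1 / ?q)"
        using q a0 by (simp add: powr_mult powr_powr)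
      moreover have "?m powr 1 \<le> ?m powr (1 / ?q)"
        using pos le1 q by (intro powr_mono') auto
      then have "a * ?m \<le> a * ?m powr (1 / ?q)" using a0 pos by simp
      ultimately show ?thesis using mS by simp
    qed
  qed
qed

lemma continuous_on_cube_measurable:
  fixes f :: "real ^ 'd::finite \<Rightarrow> real"
  shows "continuous_on unit_cube f \<Longrightarrow> f \<in> borel_measurable cube_measure"
  by (rule continuous_imp_measurable_on_sets_lebesgue) auto

lemma continuous_on_cube_Lp:
  fixes f :: "real ^ 'd::finite \<Rightarrow> real"
  assumes "1 \<le> p" "continuous_on unit_cube f"
  shows "f \<in> Lp_functions p"
proof -
  have "compact (f ` unit_cube)" using assms(2) by (intro compact_continuous_image) auto
  then obtain a where "\<forall>y\<in>f ` unit_cube. norm y \<le> a"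
    using compact_imp_bounded bounded_iff by blast
  then have "\<bar>f x\<bar> \<le> max a 0" if "x \<in> unit_cube" for x using that by fastforce
  then show ?thesis using assms by (intro Lp_bounded(1)[of p f "max a 0"] continuous_on_cube_measurable) auto
qed

lemma Lp_class_mem: "1 \<le> p \<Longrightarrow> f \<in> Lp_functions p \<Longrightarrow> Lp_class p f \<in> mspace (Lp p)"
  by (simp add: mspace_Lp Lp_space_def)

lemma mdist_Lp_class_le:
  assumes "1 \<le> p" "f \<in> Lp_functions p" "g \<in> Lp_functions p" "0 \<le> a"
    and "\<And>x. x \<in> unit_cube \<Longrightarrow> \<bar>f x - g x\<bar> \<le> a"
  shows "mdist (Lp p) (Lp_class p f) (Lp_class p g) \<le> a"
proof -
  have "(\<lambda>x. f x - g x) \<in> borel_measurable cube_measure"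
    using assms(2,3) by (auto simp: Lp_functions_def)
  then show ?thesis using assms by (simp add: mdist_Lp Lp_dist_class Lp_bounded(2))
qed

section \<open>The Hoelder ball\<close>

lemma cont_diff_imp_continuous_on: "cont_diff m f \<Longrightarrow> continuous_on unit_cube f"
  by (cases m) (auto simp: continuous_on_eq_continuous_within intro: differentiable_imp_continuous_within)

text \<open>The Hoelder norm contains an essential supremum; continuity turns it into a pointwise
  bound. A violation at x persists on a neighborhood of x in the cube, which has positive
  measure.\<close>

lemma continuous_on_cube_AE_bound:
  fixes f :: "real ^ 'd::finite \<Rightarrow> real"
  assumes f: "continuous_on unit_cube f" and ae: "AE x in cube_measure. \<bar>f x\<bar> \<le> a" and x: "x \<in> unit_cube"
  shows "\<bar>f x\<bar> \<le> a"
proof (rule ccontr)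
  assume "\<not> \<bar>f x\<bar> \<le> a"
  then have gt: "a < \<bar>f x\<bar>" by simp
  have ae': "AE x in lebesgue. x \<in> unit_cube \<longrightarrow> \<bar>f x\<bar> \<le> a"
    using ae by (subst (asm) AE_restrict_space_iff) auto
  have "continuous_on unit_cube (\<lambda>x. \<bar>f x\<bar>)" using f by (intro continuous_intros)
  then obtain e where e: "e > 0" "\<And>y. y \<in> unit_cube \<Longrightarrow> dist y x < e \<Longrightarrow> dist \<bar>f y\<bar> \<bar>f x\<bar> < \<bar>f x\<bar> - a"
    using x gt unfolding continuous_on_iff by (metis diff_gt_0_iff_gt)
  have ea: "a < \<bar>f y\<bar>" if "y \<in> unit_cube" "dist y x < e" for y
    using e(2)[OF that] by (simp add: dist_real_def)
  \<comment> \<open>The point x may lie on the boundary. Intersecting with the open box still gives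
    a nonempty open set, because the cube is the closure of its interior.\<close>
  define U where "U = ball x e \<inter> box 0 (1 :: real^'d)"
  have "open U" by (auto simp: U_def)
  have "x \<in> closure (box 0 1)"
    using x by (subst closure_box) (auto simp: box_ne_empty Basis_vec_def inner_axis)
  then have "U \<noteq> {}" unfolding U_def closure_approachable using e(1)
    by (auto simp: dist_commute disjoint_iff)
  have sub: "U \<subseteq> {x. \<not> (x \<in> unit_cube \<longrightarrow> \<bar>f x\<bar> \<le> a)}"
    using ea box_subset_cbox[of 0 "1::real^'d"] by (force simp: U_def dist_commute)
  have "AE x in lebesgue. x \<notin> U" using ae' by eventually_elim (use sub in auto)
  moreover have "U \<in> sets lebesgue" using \<open>open U\<close> by auto
  ultimately have "negligible U" by (simp add: negligible_iff_null_sets AE_iff_null_sets)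
  then show False using \<open>open U\<close> \<open>U \<noteq> {}\<close> open_not_negligible by blast
qed

lemma foldr_pure:
  fixes D :: "'b \<Rightarrow> 'a \<Rightarrow> 'a" and c :: "nat \<Rightarrow> 'b"
  assumes "inj_on c (set ks)" "distinct ks"
  shows "foldr (\<lambda>k g. (D (c k) ^^ (if c k = i then m else 0)) g) ks f =
      (if i \<in> c ` set ks then (D i ^^ m) f else f)"
  using assms
proof (induction ks)
  case (Cons k ks)
  show ?case
  proof (cases "c k = i")
    case True
    then have "i \<notin> c ` set ks" using Cons.prems by (auto simp: inj_on_def)
    then show ?thesis using Cons True by auto
  qed (use Cons in auto)
qed simp

text \<open>From the Hoelder norm only derivatives in a single coordinate are extracted, since the
  interpolation proceeds one coordinate at a time.\<close>

lemma multi_deriv_pure: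
  fixes f :: "real ^ 'd::finite \<Rightarrow> real"
  shows "multi_deriv (\<lambda>j. if j = i then m else 0) f = (partial_deriv i ^^ m) f"
proof -
  have "inj_on (coord :: nat \<Rightarrow> 'd) (set [0..<CARD('d)])"
    using bij_betw_coord by (auto simp: bij_betw_def lessThan_atLeast0)
  moreover have "i \<in> coord ` set [0..<CARD('d)]"
    using bij_betw_coord[where 'd='d] by (auto simp: bij_betw_def lessThan_atLeast0)
  ultimately show ?thesis unfolding multi_deriv_def by (subst foldr_pure) auto
qed

definition holder_ball :: "nat \<Rightarrow> real \<Rightarrow> (real ^ 'd::finite \<Rightarrow> real) set" where
  "holder_ball m \<alpha> = {f \<in> holder_space m \<alpha>. holder_norm m \<alpha> f \<le> 1}"

lemma holder_ballD:
  fixes f :: "real ^ 'd::finite \<Rightarrow> real"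
  assumes f: "f \<in> holder_ball m \<alpha>"
  shows "cont_diff m f" "continuous_on unit_cube f" "x \<in> unit_cube \<Longrightarrow> \<bar>f x\<bar> \<le> 1"
    "x \<in> unit_cube \<Longrightarrow> y \<in> unit_cube \<Longrightarrow>
       \<bar>(partial_deriv i ^^ m) f x - (partial_deriv i ^^ m) f y\<bar> \<le> norm (x - y) powr \<alpha>"
proof -
  show cd: "cont_diff m f" using f by (simp add: holder_ball_def holder_space_def)
  then show c: "continuous_on unit_cube f" by (rule cont_diff_imp_continuous_on)
  have "esssup cube_measure (\<lambda>x. ennreal \<bar>f x\<bar>) \<le> 1"
    using f by (simp add: holder_ball_def holder_norm_def)
  then have "AE x in cube_measure. \<bar>f x\<bar> \<le> 1"
    using esssup_AE[of "\<lambda>x. ennreal \<bar>f x\<bar>" cube_measure]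
    by (auto elim!: eventually_mono dest: order_trans simp flip: ennreal_1)
  then show "\<bar>f x\<bar> \<le> 1" if "x \<in> unit_cube" for x
    using c that by (intro continuous_on_cube_AE_bound)
  show "\<bar>(partial_deriv i ^^ m) f x - (partial_deriv i ^^ m) f y\<bar> \<le> norm (x - y) powr \<alpha>"
    if xy: "x \<in> unit_cube" "y \<in> unit_cube" for x y
  proof (cases "x = y")
    case False
    define \<beta> :: "'d \<Rightarrow> nat" where "\<beta> = (\<lambda>j. if j = i then m else 0)"
    have \<beta>: "(\<Sum>i\<in>UNIV. \<beta> i) = m" by (simp add: \<beta>_def)
    have "ennreal (\<bar>multi_deriv \<beta> f x - multi_deriv \<beta> f y\<bar> / norm (x - y) powr \<alpha>) \<le>
      (SUP (x, y)\<in>{(x, y). x \<in> unit_cube \<and> y \<in> unit_cube \<and> x \<noteq> y}.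
          ennreal (\<bar>multi_deriv \<beta> f x - multi_deriv \<beta> f y\<bar> / norm (x - y) powr \<alpha>))"
      using xy False by (intro SUP_upper2[of "(x, y)"]) auto
    also have "\<dots> \<le> (SUP \<beta>\<in>{\<beta>::'d \<Rightarrow> nat. (\<Sum>i\<in>UNIV. \<beta> i) = m}.
        SUP (x, y)\<in>{(x, y). x \<in> unit_cube \<and> y \<in> unit_cube \<and> x \<noteq> y}.
          ennreal (\<bar>multi_deriv \<beta> f x - multi_deriv \<beta> f y\<bar> / norm (x - y) powr \<alpha>))"
      using \<beta> by (intro SUP_upper) auto
    also have "\<dots> \<le> 1" using f by (simp add: holder_ball_def holder_norm_def)
    finally have "\<bar>multi_deriv \<beta> f x - multi_deriv \<beta> f y\<bar> / norm (x - y) powr \<alpha> \<le> 1" by simp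
    then show ?thesis using False unfolding \<beta>_def multi_deriv_pure by (simp add: divide_le_eq)
  qed simp
qed

lemma holder_ballI:
  fixes f :: "real ^ 'd::finite \<Rightarrow> real"
  assumes "cont_diff m f" "\<And>x. x \<in> unit_cube \<Longrightarrow> \<bar>f x\<bar> \<le> 1"
    "\<And>\<beta> x y. (\<Sum>i\<in>UNIV. \<beta> i) = m \<Longrightarrow> x \<in> unit_cube \<Longrightarrow> y \<in> unit_cube \<Longrightarrow>
       \<bar>multi_deriv \<beta> f x - multi_deriv \<beta> f y\<bar> \<le> norm (x - y) powr \<alpha>"
  shows "f \<in> holder_ball m \<alpha>"
proof -
  have "f \<in> borel_measurable cube_measure"
    using assms(1) by (intro continuous_on_cube_measurable cont_diff_imp_continuous_on)
  then have "esssup cube_measure (\<lambda>x. ennreal \<bar>f x\<bar>) \<le> 1"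
    using assms(2) by (intro esssup_I AE_I2) (auto simp flip: ennreal_1 intro!: ennreal_leI)
  moreover have "(SUP \<beta>\<in>{\<beta>::'d \<Rightarrow> nat. (\<Sum>i\<in>UNIV. \<beta> i) = m}.
        SUP (x, y)\<in>{(x, y). x \<in> unit_cube \<and> y \<in> unit_cube \<and> x \<noteq> y}.
          ennreal (\<bar>multi_deriv \<beta> f x - multi_deriv \<beta> f y\<bar> / norm (x - y) powr \<alpha>)) \<le> 1"
    using assms(3) by (auto intro!: SUP_least simp: divide_le_eq simp flip: ennreal_1 intro!: ennreal_leI)
  ultimately have "holder_norm m \<alpha> f \<le> 1" by (simp add: holder_norm_def)
  then show ?thesis using assms(1) by (auto simp: holder_ball_def holder_space_def elim: le_less_trans)
qed

text \<open>The last letter of the word is applied first.\<close>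
definition word_deriv :: "'d::finite list \<Rightarrow> (real ^ 'd \<Rightarrow> real) \<Rightarrow> real ^ 'd \<Rightarrow> real" where
  "word_deriv ws f = foldr partial_deriv ws f"

lemma multi_deriv_eq_word_deriv:
  "multi_deriv \<beta> (f :: real ^ 'd::finite \<Rightarrow> real) =
    word_deriv (concat (map (\<lambda>k. replicate (\<beta> (coord k)) (coord k)) [0..<CARD('d)])) f"
proof -
  have "foldr (\<lambda>k g. (partial_deriv (coord k) ^^ \<beta> (coord k)) g) ks f =
      foldr partial_deriv (concat (map (\<lambda>k. replicate (\<beta> (coord k)) (coord k)) ks)) f" for ks
    by (induction ks) (auto simp: foldr_replicate)
  then show ?thesis by (simp add: multi_deriv_def word_deriv_def)
qed

lemma length_multi_index_word:
  fixes \<beta> :: "'d::finite \<Rightarrow> nat"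
  shows "length (concat (map (\<lambda>k. replicate (\<beta> (coord k)) (coord k)) [0..<CARD('d)])) = (\<Sum>i\<in>UNIV. \<beta> i)"
proof -
  have "length (concat (map (\<lambda>k. replicate (\<beta> (coord k)) (coord k)) [0..<CARD('d)])) =
      (\<Sum>k<CARD('d). \<beta> (coord k))"
    by (simp add: length_concat comp_def interv_sum_list_conv_sum_set_nat lessThan_atLeast0)
  also have "\<dots> = (\<Sum>i\<in>UNIV. \<beta> i)"
    by (rule sum.reindex_bij_betw[OF bij_betw_coord])
  finally show ?thesis .
qed

text \<open>\<open>frechet_derivative\<close> is a choice; within the closed cube the derivative is
  unique, also at boundary points, because the cube is nondegenerate in every direction.\<close>

lemma partial_deriv_eq:
  fixes f :: "real ^ 'd::finite \<Rightarrow> real"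
  assumes "(f has_derivative f') (at x within unit_cube)" "x \<in> unit_cube"
  shows "partial_deriv i f x = f' (axis i 1)"
proof -
  have "(f has_derivative frechet_derivative f (at x within unit_cube)) (at x within unit_cube)"
    using assms(1) by (metis differentiableI frechet_derivative_works)
  then have "frechet_derivative f (at x within unit_cube) = f'"
    using assms by (intro frechet_derivative_unique_within_closed_interval[of 0 1 x f]) (auto simp:
        Basis_vec_def inner_axis)
  then show ?thesis by (simp add: partial_deriv_def)
qed

lemma has_derivative_cube_cong:
  fixes f g :: "real ^ 'd::finite \<Rightarrow> real"
  assumes "\<And>x. x \<in> unit_cube \<Longrightarrow> f x = g x" "x \<in> unit_cube"
  shows "(f has_derivative f') (at x within unit_cube) \<longleftrightarrow> (g has_derivative f') (at x within unit_cube)"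
  using has_derivative_transform[OF assms(2), of g f] has_derivative_transform[OF assms(2), of f g] assms(1)
      by metis

lemma partial_deriv_cong:
  assumes "\<And>x. x \<in> unit_cube \<Longrightarrow> f x = g x" "x \<in> unit_cube"
  shows "partial_deriv i f x = partial_deriv i g x"
proof -
  have "(f has_derivative f') (at x within unit_cube) \<longleftrightarrow> (g has_derivative f') (at x within unit_cube)" for f'
    using assms by (rule has_derivative_cube_cong)
  then show ?thesis by (simp add: partial_deriv_def frechet_derivative_def)
qed

text \<open>Functions live on the whole space, but derivatives within the cube see only its points.
  So a function may be replaced by one that is known to agree with it there.\<close>

lemma cont_diff_cong:
  assumes "\<And>x. x \<in> unit_cube \<Longrightarrow> f x = g x"
  shows "cont_diff m f \<longleftrightarrow> cont_diff m g"
  using assms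
proof (induction m arbitrary: f g)
  case 0
  then show ?case by (simp cong: continuous_on_cong)
next
  case (Suc m)
  have "f differentiable (at x within unit_cube) \<longleftrightarrow> g differentiable (at x within unit_cube)" if "x \<in> unit_cube"
      for x
    unfolding differentiable_def using has_derivative_cube_cong[OF Suc.prems that] by simp
  moreover have "cont_diff m (partial_deriv i f) \<longleftrightarrow> cont_diff m (partial_deriv i g)" for i
    using Suc.prems by (intro Suc.IH partial_deriv_cong) auto
  ultimately show ?case by simp
qed

text \<open>A family of candidates for all derivatives up to order m, indexed by words, where
  prefixing i stands for one more derivative in direction i. Checking this recursion is easier than
  computing iterated Frechet derivatives, and words spare any argument about the order of
  differentiation. Continuity is demanded at top order only, since the lower orders are
  differentiable.\<close>

locale jet =
  fixes m :: nat and F :: "'d::finite list \<Rightarrow> real ^ 'd \<Rightarrow> real"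
  assumes deriv: "\<And>ws x. length ws < m \<Longrightarrow> x \<in> unit_cube \<Longrightarrow>
      (F ws has_derivative (\<lambda>h. \<Sum>i\<in>UNIV. F (i # ws) x * vec_nth h i)) (at x within unit_cube)"
    and cont: "\<And>ws. length ws = m \<Longrightarrow> continuous_on unit_cube (F ws)"
begin

lemma partial_deriv_jet: "length ws < m \<Longrightarrow> x \<in> unit_cube \<Longrightarrow> partial_deriv i (F ws) x = F (i # ws) x"
  using partial_deriv_eq[OF deriv] by (simp add: axis_def if_distrib cong: if_cong)

lemma cont_diff_jet: "length ws + k = m \<Longrightarrow> cont_diff k (F ws)"
proof (induction k arbitrary: ws)
  case (Suc k)
  have "cont_diff k (partial_deriv i (F ws)) \<longleftrightarrow> cont_diff k (F (i # ws))" for i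
    using Suc.prems by (intro cont_diff_cong partial_deriv_jet) auto
  then show ?case using Suc deriv[of ws] by (auto simp: differentiable_def)
qed (use cont in auto)

lemma word_deriv_jet: "length vs + length ws \<le> m \<Longrightarrow> x \<in> unit_cube \<Longrightarrow> word_deriv vs (F ws) x = F (vs @ ws) x"
proof (induction vs arbitrary: x)
  case (Cons v vs)
  have "word_deriv (v # vs) (F ws) x = partial_deriv v (F (vs @ ws)) x"
    unfolding word_deriv_def foldr.simps comp_def
    by (rule partial_deriv_cong) (use Cons in \<open>auto simp: word_deriv_def\<close>)
  then show ?case using Cons.prems by (simp add: partial_deriv_jet)
qed (simp add: word_deriv_def)

lemma holder_ball_jet:
  assumes "\<And>x. x \<in> unit_cube \<Longrightarrow> \<bar>F [] x\<bar> \<le> 1"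
    and "\<And>ws x y. length ws = m \<Longrightarrow> x \<in> unit_cube \<Longrightarrow> y \<in> unit_cube \<Longrightarrow> \<bar>F ws x - F ws y\<bar> \<le> norm (x - y) powr \<alpha>"
  shows "F [] \<in> holder_ball m \<alpha>"
proof (rule holder_ballI)
  show "cont_diff m (F [])" by (rule cont_diff_jet) simp
  fix \<beta> :: "'d \<Rightarrow> nat" and x y :: "real ^ 'd"
  assume "(\<Sum>i\<in>UNIV. \<beta> i) = m" "x \<in> unit_cube" "y \<in> unit_cube"
  then show "\<bar>multi_deriv \<beta> (F []) x - multi_deriv \<beta> (F []) y\<bar> \<le> norm (x - y) powr \<alpha>"
    unfolding multi_deriv_eq_word_deriv
    by (subst (1 2) word_deriv_jet) (auto simp: length_multi_index_word intro!: assms(2))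
qed (use assms(1) in auto)

end

lemma zero_in_holder_ball: "(\<lambda>_ :: real ^ 'd::finite. 0) \<in> holder_ball m \<alpha>"
proof -
  interpret jet m "\<lambda>(_ :: 'd list) _. 0" by standard auto
  show ?thesis by (rule holder_ball_jet) auto
qed

section \<open>The complexity of the network sets\<close>

lemma abs_relu_le: "\<bar>relu x\<bar> \<le> \<bar>x\<bar>"
  by (simp add: relu_def)

lemma abs_relu_diff_le: "\<bar>relu x - relu y\<bar> \<le> \<bar>x - y\<bar>"
  by (simp add: relu_def max_def)

lemma continuous_on_relu [continuous_intros]: "continuous_on S f \<Longrightarrow> continuous_on S (\<lambda>x. relu (f x))"
  unfolding relu_def by (intro continuous_intros)

text \<open>Networks of a fixed width \<open>w\<close>: \<open>a (l, i, j)\<close> is the weight from neuron \<open>j\<close> of layer \<open>l\<close> to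
  neuron \<open>i\<close> of the next layer, and \<open>a (l, i, w)\<close> is the bias.\<close>
definition preact :: "(nat \<times> nat \<times> nat \<Rightarrow> real) \<Rightarrow> nat \<Rightarrow> nat \<Rightarrow> (nat \<Rightarrow> real) \<Rightarrow> nat \<Rightarrow> real" where
  "preact a w l v i = (\<Sum>j<w. a (l, i, j) * v j) + a (l, i, w)"

primrec act :: "(nat \<times> nat \<times> nat \<Rightarrow> real) \<Rightarrow> nat \<Rightarrow> (nat \<Rightarrow> real) \<Rightarrow> nat \<Rightarrow> nat \<Rightarrow> real" where
  "act a w z 0 = z"
| "act a w z (Suc l) = (\<lambda>i. relu (preact a w l (act a w z l) i))"

definition wide_net :: "(nat \<times> nat \<times> nat \<Rightarrow> real) \<Rightarrow> nat \<Rightarrow> nat \<Rightarrow> nat \<Rightarrow> (nat \<Rightarrow> real) \<Rightarrow> real" where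
  "wide_net a w L k z = preact a w (L - 1) (act a w z (L - 1)) k"

text \<open>Each layer multiplies the bound by (w + 1) * B; as B \<ge> 1 this factor is at least 1,
  so that the bias is absorbed as well.\<close>

lemma act_bound:
  assumes "\<And>p. \<bar>a p\<bar> \<le> B" "1 \<le> B" "\<And>j. \<bar>z j\<bar> \<le> 1"
  shows "\<bar>act a w z l i\<bar> \<le> ((real w + 1) * B) ^ l"
proof (induction l arbitrary: i)
  case (Suc l)
  let ?M = "(real w + 1) * B"
  have M: "1 \<le> ?M" using mult_mono[of 1 "real w + 1" 1 B] assms(2) by simp
  have "\<bar>act a w z (Suc l) i\<bar> \<le> \<bar>preact a w l (act a w z l) i\<bar>" by (simp add: abs_relu_le)
  also have "\<dots> \<le> (\<Sum>j<w. \<bar>a (l, i, j)\<bar> * \<bar>act a w z l j\<bar>) + \<bar>a (l, i, w)\<bar>"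
    unfolding preact_def by (intro order_trans[OF abs_triangle_ineq] add_mono order_trans[OF sum_abs] sum_mono)
        (auto simp: abs_mult)
  also have "\<dots> \<le> (\<Sum>j<w. B * ?M ^ l) + B * ?M ^ l"
  proof (intro add_mono sum_mono mult_mono)
    show "\<bar>a (l, i, w)\<bar> \<le> B * ?M ^ l"
    proof -
      have "B * 1 \<le> B * ?M ^ l" using one_le_power[OF M, of l] assms(2) by (intro mult_left_mono) auto
      then show ?thesis using assms(1)[of "(l, i, w)"] by linarith
    qed
  qed (use assms Suc in auto)
  also have "\<dots> = ?M ^ Suc l" by (simp add: algebra_simps)
  finally show ?case .
qed (use assms in simp)

text \<open>One step of the perturbation recursion: new parameter errors enter at each layer while
  old ones are amplified by (w + 1) * B, whence the factor \<open>Suc l\<close>. It is stated before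
  the activation, so that it serves the hidden layers, where ReLU is 1-Lipschitz, and the output
  layer alike.\<close>

lemma act_diff_bound:
  assumes a: "\<And>p. \<bar>a p\<bar> \<le> B" "\<And>p. \<bar>a' p\<bar> \<le> B" "1 \<le> B" "\<And>j. \<bar>z j\<bar> \<le> 1"
    and \<delta>: "\<And>p. \<bar>a p - a' p\<bar> \<le> \<delta>"
    and v: "\<And>j. \<bar>v j\<bar> \<le> ((real w + 1) * B) ^ l" "\<And>j. \<bar>v j - v' j\<bar> \<le> \<delta> * real l * ((real w + 1) * B) ^ l"
  shows "\<bar>preact a w l v i - preact a' w l v' i\<bar> \<le> \<delta> * real (Suc l) * ((real w + 1) * B) ^ Suc l"
proof -
  let ?M = "(real w + 1) * B"
  have d0: "0 \<le> \<delta>" using \<delta>[of undefined] by simp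
  have M: "1 \<le> ?M" using mult_mono[of 1 "real w + 1" 1 B] assms(3) by simp
  have summand: "\<bar>a (l, i, j) * v j - a' (l, i, j) * v' j\<bar> \<le> \<delta> * ?M ^ l + B * (\<delta> * real l * ?M ^ l)" for j
  proof -
    have "a (l, i, j) * v j - a' (l, i, j) * v' j =
        (a (l, i, j) - a' (l, i, j)) * v j + a' (l, i, j) * (v j - v' j)"
      by (simp add: algebra_simps)
    also have "\<bar>\<dots>\<bar> \<le> \<bar>a (l, i, j) - a' (l, i, j)\<bar> * \<bar>v j\<bar> + \<bar>a' (l, i, j)\<bar> * \<bar>v j - v' j\<bar>"
      by (rule order_trans[OF abs_triangle_ineq]) (simp add: abs_mult)
    also have "\<dots> \<le> \<delta> * ?M ^ l + B * (\<delta> * real l * ?M ^ l)"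
      using assms d0 by (intro add_mono mult_mono) auto
    finally show ?thesis .
  qed
  have "preact a w l v i - preact a' w l v' i =
      (\<Sum>j<w. a (l, i, j) * v j - a' (l, i, j) * v' j) + (a (l, i, w) - a' (l, i, w))"
    by (simp add: preact_def sum_subtractf)
  also have "\<bar>\<dots>\<bar> \<le> (\<Sum>j<w. \<delta> * ?M ^ l + B * (\<delta> * real l * ?M ^ l)) + \<delta>"
    using summand \<delta> by (intro order_trans[OF abs_triangle_ineq] add_mono order_trans[OF sum_abs] sum_mono) auto
  also have "\<dots> \<le> (\<Sum>j<w. \<delta> * ?M ^ l + B * (\<delta> * real l * ?M ^ l)) + (\<delta> * ?M ^ l + B * (\<delta> * real l * ?M ^ l))"
  proof (rule add_left_mono)
    have "\<delta> * 1 \<le> \<delta> * ?M ^ l" using one_le_power[OF M] d0 by (intro mult_left_mono) auto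
    moreover have "0 \<le> B * (\<delta> * real l * ?M ^ l)" using assms(3) d0 by simp
    ultimately show "\<delta> \<le> \<delta> * ?M ^ l + B * (\<delta> * real l * ?M ^ l)" by simp
  qed
  also have "\<dots> = (real w + 1) * (\<delta> * ?M ^ l) + \<delta> * real l * ?M ^ Suc l"
    by (simp add: algebra_simps)
  also have "(real w + 1) * (\<delta> * ?M ^ l) \<le> ?M * (\<delta> * ?M ^ l)"
    using assms(3) d0 by (intro mult_right_mono) auto
  also have "?M * (\<delta> * ?M ^ l) + \<delta> * real l * ?M ^ Suc l = \<delta> * real (Suc l) * ?M ^ Suc l"
    by (simp add: algebra_simps)
  finally show ?thesis by simp
qed

lemma wide_net_diff_bound:
  assumes a: "\<And>p. \<bar>a p\<bar> \<le> B" "\<And>p. \<bar>a' p\<bar> \<le> B" "1 \<le> B" "\<And>j. \<bar>z j\<bar> \<le> 1"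
    and \<delta>: "\<And>p. \<bar>a p - a' p\<bar> \<le> \<delta>" and L: "L \<ge> 1"
  shows "\<bar>wide_net a w L k z - wide_net a' w L k z\<bar> \<le> \<delta> * real L * ((real w + 1) * B) ^ L"
proof -
  have A: "\<bar>act a w z l i - act a' w z l i\<bar> \<le> \<delta> * real l * ((real w + 1) * B) ^ l" for l i
  proof (induction l arbitrary: i)
    case (Suc l)
    show ?case unfolding act.simps
      by (rule order_trans[OF abs_relu_diff_le act_diff_bound[OF a \<delta>]])
        (use act_bound[OF a(1,3,4)] Suc in auto)
  qed simp
  show ?thesis
    using act_diff_bound[OF a \<delta>, where l = "L - 1" and v = "act a w z (L - 1)" and v' = "act a' w z (L - 1)"
        and i = k, OF act_bound[OF a(1,3,4)] A] L
    by (simp add: wide_net_def)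
qed

lemma continuous_on_wide_net:
  assumes "\<And>j. continuous_on S (\<lambda>x. z x j)"
  shows "continuous_on S (\<lambda>x. wide_net a w L k (z x))"
proof -
  have "continuous_on S (\<lambda>x. act a w (z x) l i)" for l i
    by (induction l arbitrary: i) (auto intro!: continuous_intros simp: preact_def assms)
  then show ?thesis unfolding wide_net_def preact_def by (intro continuous_intros)
qed

section \<open>Renaming the neurons of a sparse network into a fixed width\<close>

definition hidden :: "weights \<Rightarrow> real Matrix.vec \<Rightarrow> real Matrix.vec" where
  "hidden W x = foldl (\<lambda>v (A, b). map_vec relu (A *\<^sub>v v + b)) x W"

lemma realization_snoc: "realization (W @ [(A, b)]) x = A *\<^sub>v hidden W x + b"
proof (induction W arbitrary: x)
  case (Cons p W)
  obtain A' b' where p: "p = (A', b')" by (cases p)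
  have "W @ [(A, b)] \<noteq> []" by simp
  then have "realization (p # (W @ [(A, b)])) x = realization (W @ [(A, b)]) (map_vec relu (A' *\<^sub>v x + b'))"
    unfolding p by (cases "W @ [(A, b)]") simp_all
  then show ?case using Cons.IH by (simp add: hidden_def p)
qed (simp add: hidden_def)

lemma mat_linf_ge:
  assumes "i < dim_row A" "j < dim_col A"
  shows "\<bar>A $$ (i, j)\<bar> \<le> mat_linf A"
proof -
  have "{\<bar>A $$ (i, j)\<bar> | i j. i < dim_row A \<and>
      j < dim_col A} = (\<lambda>(i, j). \<bar>A $$ (i, j)\<bar>) ` ({..<dim_row A} \<times> {..<dim_col A})"
    by auto
  then have "finite {\<bar>A $$ (i, j)\<bar> | i j. i < dim_row A \<and> j < dim_col A}" by simp
  then show ?thesis unfolding mat_linf_def using assms by (intro Max_ge) auto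
qed

lemma vec_linf_ge:
  assumes "i < dim_vec b"
  shows "\<bar>vec_index b i\<bar> \<le> vec_linf b"
proof -
  have "{\<bar>vec_index b i\<bar> | i. i < dim_vec b} = (\<lambda>i. \<bar>vec_index b i\<bar>) ` {..<dim_vec b}" by auto
  then have "finite {\<bar>vec_index b i\<bar> | i. i < dim_vec b}" by simp
  then show ?thesis unfolding vec_linf_def using assms by (intro Max_ge) auto
qed

text \<open>A neuron with zero bias and zero incoming weights is constantly zero. Hence at most \<open>n\<close> neurons
  per layer matter, and they can be renamed into a fixed index range.\<close>
lemma realization_wide_net:
  fixes W :: weights
  assumes W: "valid_weights W" "d_in W = d" "d_out W = 1" "weights_l0 W \<le> n" "weights_linf W \<le> B"
    and w: "w = n + d + 1" and B: "0 \<le> B"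
  obtains a k where "k < w" "\<And>p. \<bar>a p\<bar> \<le> B"
    "{p. a p \<noteq> 0} \<subseteq> {..<length W} \<times> {..<w} \<times> {..w}" "card {p. a p \<noteq> 0} \<le> n"
    "\<And>x. dim_vec x = d \<Longrightarrow> vec_index (realization W x) 0 = wide_net a w (length W) k (\<lambda>j. if j <
        d then vec_index x j else 0)"
proof -
  define L where "L = length W"
  define A where "A l = fst (W ! l)" for l
  define b where "b l = snd (W ! l)" for l
  have Wl: "W ! l = (A l, b l)" for l by (simp add: A_def b_def)
  obtain N where N: "\<And>l. l \<le> L \<Longrightarrow> 1 \<le> N l" "\<And>l. l < L \<Longrightarrow> A l \<in> carrier_mat (N (Suc l)) (N l)"
      "\<And>l. l < L \<Longrightarrow> b l \<in> carrier_vec (N (Suc l))" and L0: "W \<noteq> []"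
    using W(1) unfolding valid_weights_def L_def A_def b_def by auto
  have L1: "L \<ge> 1" using L0 by (simp add: L_def Suc_le_eq)
  have N0: "N 0 = d" using W(2) L1 N(2)[of 0] L0 by (simp add: d_in_def hd_conv_nth A_def)
  have dims: "dim_row (A l) = N (Suc l)" "dim_col (A l) = N l" "dim_vec (b l) = N (Suc l)" if "l < L" for l
    using N that by auto
  have linf: "\<bar>A l $$ (i, j)\<bar> \<le> B" "\<bar>vec_index (b l) i\<bar> \<le> B" if "l < L" "i < N (Suc l)" "j < N l" for l i j
  proof -
    have "mat_linf (A l) + vec_linf (b l) \<le> weights_linf W"
      unfolding weights_linf_def using that by (intro Max_ge) (auto simp: L_def A_def b_def intro!:
          image_eqI[of _ _ "W ! l"] split: prod.splits)
    moreover have "\<bar>A l $$ (i, j)\<bar> \<le> mat_linf (A l)" "\<bar>vec_index (b l) i\<bar> \<le> vec_linf (b l)"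
      using that dims by (auto intro!: mat_linf_ge vec_linf_ge)
    ultimately show "\<bar>A l $$ (i, j)\<bar> \<le> B" "\<bar>vec_index (b l) i\<bar> \<le> B" using W(5) by linarith+
  qed
  define NZ where "NZ l = {(i, j). i < N (Suc l) \<and> j < N l \<and> A l $$ (i, j) \<noteq> 0}" for l
  define NB where "NB l = {i. i < N (Suc l) \<and> vec_index (b l) i \<noteq> 0}" for l
  have fin: "finite (NZ l)" "finite (NB l)" for l
    by (rule finite_subset[of _ "{..<N (Suc l)} \<times> {..<N l}"]) (auto simp: NZ_def NB_def)
  have l0: "(\<Sum>l<L. card (NZ l) + card (NB l)) \<le> n"
  proof -
    have "weights_l0 W = (\<Sum>l<L. (\<lambda>(A, b). mat_l0 A + vec_l0 b) (W ! l))"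
      unfolding weights_l0_def by (simp add: sum_list_sum_nth L_def lessThan_atLeast0)
    also have "\<dots> = (\<Sum>l<L. card (NZ l) + card (NB l))"
      by (intro sum.cong) (auto simp: Wl mat_l0_def vec_l0_def NZ_def NB_def dims)
    finally show ?thesis using W(4) by simp
  qed
  have l0l: "card (NZ l) + card (NB l) \<le> n" if "l < L" for l
    using l0 member_le_sum[of l "{..<L}" "\<lambda>l. card (NZ l) + card (NB l)"] that by simp
  \<comment> \<open>The neurons of layer l that can be nonzero. From layer 1 on, index 0 is kept in
    any case, because the output is neuron 0 of the last layer.\<close>
  define S where "S l = (case l of 0 \<Rightarrow> {..<d} | Suc l \<Rightarrow> insert 0 (fst ` NZ l \<union> NB l))" for l
  have S0: "S 0 = {..<d}" and SSuc: "S (Suc l) = insert 0 (fst ` NZ l \<union> NB l)" for l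
    by (auto simp: S_def)
  have finS: "finite (S l)" for l by (cases l) (auto simp: S0 SSuc fin)
  have SN: "S l \<subseteq> {..<N l}" if "l \<le> L" for l
    using N(1)[of l] that by (cases l) (auto simp: S0 SSuc N0 NZ_def NB_def)
  \<comment> \<open>The width n + d + 1 accommodates the d inputs as well as n live neurons together
    with neuron 0.\<close>
  have cardS: "card (S l) \<le> w" if "l \<le> L" for l
  proof (cases l)
    case (Suc l')
    have "card (S l) \<le> Suc (card (fst ` NZ l' \<union> NB l'))" using fin unfolding Suc SSuc
        by (intro card_insert_le_m1) auto
    also have "\<dots> \<le> Suc (card (NZ l') + card (NB l'))"
      using card_Un_le[of "fst ` NZ l'" "NB l'"] card_image_le[OF fin(1), of fst l'] by simp
    finally show ?thesis using l0l[of l'] that Suc w by simp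
  qed (simp add: S0 w)
  \<comment> \<open>Renamings of the live neurons. The input layer keeps its numbering, so that the
    input vector is unchanged.\<close>
  have "\<exists>e. inj_on e (S l) \<and> e ` S l \<subseteq> {..<w} \<and> (l = 0 \<longrightarrow> e = id)" if "l \<le> L" for l
  proof (cases "l = 0")
    case True
    then show ?thesis by (intro exI[of _ id]) (auto simp: S0 w)
  next
    case False
    have "\<exists>e. e ` S l \<subseteq> {..<w} \<and> inj_on e (S l)"
      using cardS[OF that] finS by (intro card_le_inj) auto
    then show ?thesis using False by auto
  qed
  then obtain e where e: "\<And>l. l \<le> L \<Longrightarrow> inj_on (e l) (S l)" "\<And>l. l \<le> L \<Longrightarrow> e l ` S l \<subseteq> {..<w}" "e 0 = id"
    by (metis le0)
  define g where "g l = the_inv_into (S l) (e l)" for l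
  have ge: "g l (e l i) = i" if "l \<le> L" "i \<in> S l" for l i
    unfolding g_def using e(1) that by (simp add: the_inv_into_f_f)
  define a where "a = (\<lambda>(l, i, j). if l < L \<and> i \<in> e (Suc l) ` S (Suc l) then
      (if j = w then vec_index (b l) (g (Suc l) i)
       else if j \<in> e l ` S l then A l $$ (g (Suc l) i, g l j) else 0) else 0)"
  have supp: "{p. a p \<noteq> 0} \<subseteq> (\<Union>l<L. (\<lambda>(i, j). (l, e (Suc l) i, e l j)) ` NZ l \<union> (\<lambda>i. (l, e (Suc l) i,
      w)) ` NB l)"
  proof
    fix p assume "p \<in> {p. a p \<noteq> 0}"
    moreover obtain l i j where p: "p = (l, i, j)" by (cases p)
    ultimately have nz: "a (l, i, j) \<noteq> 0" by simp
    then have l: "l < L" "i \<in> e (Suc l) ` S (Suc l)" by (auto simp: a_def split: if_splits)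
    then obtain i' where i': "i' \<in> S (Suc l)" "i = e (Suc l) i'" by auto
    have iN: "i' < N (Suc l)" using SN[of "Suc l"] i' l by auto
    show "p \<in> (\<Union>l<L. (\<lambda>(i, j). (l, e (Suc l) i, e l j)) ` NZ l \<union> (\<lambda>i. (l, e (Suc l) i, w)) ` NB l)"
    proof (cases "j = w")
      case True
      then have "i' \<in> NB l" using nz l i' iN by (auto simp: a_def ge NB_def)
      then show ?thesis using l p i' True by auto
    next
      case False
      then obtain j' where j': "j' \<in> S l" "j = e l j'" using nz l by (auto simp: a_def split: if_splits)
      have "j' < N l" using SN[of l] j' l by auto
      then have "(i', j') \<in> NZ l" using nz l i' iN j' False by (auto simp: a_def ge NZ_def)
      then show ?thesis using l p i' j' by force
    qed
  qed
  show thesis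
  proof (rule that[of "e L 0" a])
    have S0L: "0 \<in> S L" using L1 by (cases L) (auto simp: SSuc)
    show "e L 0 < w" using e(2)[of L] S0L by auto
    show "\<bar>a p\<bar> \<le> B" for p
    proof (cases p)
      case (fields l i j)
      show ?thesis
      proof (cases "l < L \<and> i \<in> e (Suc l) ` S (Suc l)")
        case True
        then obtain i' where i': "i' \<in> S (Suc l)" "i = e (Suc l) i'" by auto
        have iN: "i' < N (Suc l)" using SN[of "Suc l"] i' True by auto
        have N1: "0 < N l" using N(1)[of l] True by auto
        consider "j = w" | "j \<noteq> w" "j \<in> e l ` S l" | "j \<noteq> w" "j \<notin> e l ` S l" by blast
        then show ?thesis
        proof cases
          case 1
          then show ?thesis using linf(2)[OF _ iN N1] True i' by (simp add: a_def fields ge)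
        next
          case 2
          then obtain j' where j': "j' \<in> S l" "j = e l j'" by auto
          have "j' < N l" using SN[of l] j' True by auto
          then show ?thesis using linf(1)[OF _ iN] True i' j' 2 by (simp add: a_def fields ge)
        qed (use B True in \<open>simp add: a_def fields\<close>)
      qed (use B in \<open>auto simp: a_def fields\<close>)
    qed
    show "{p. a p \<noteq> 0} \<subseteq> {..<length W} \<times> {..<w} \<times> {..w}"
    proof
      fix p assume "p \<in> {p. a p \<noteq> 0}"
      moreover obtain l i j where p: "p = (l, i, j)" by (cases p)
      ultimately have nz: "a (l, i, j) \<noteq> 0" by simp
      then have l: "l < L" "i \<in> e (Suc l) ` S (Suc l)" "j = w \<or> j \<in> e l ` S l"
        by (auto simp: a_def split: if_splits)
      have "i < w" using l(1,2) e(2)[of "Suc l"] by auto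
      moreover have "j \<le> w" using l(1,3) e(2)[of l] by auto
      ultimately show "p \<in> {..<length W} \<times> {..<w} \<times> {..w}" using p l(1) by (simp add: L_def)
    qed
    have "card {p. a p \<noteq> 0} \<le> card (\<Union>l<L. (\<lambda>(i, j). (l, e (Suc l) i, e l j)) ` NZ l \<union> (\<lambda>i. (l, e (Suc l) i,
        w)) ` NB l)"
      using fin by (intro card_mono supp) auto
    also have "\<dots> \<le> (\<Sum>l<L. card ((\<lambda>(i, j). (l, e (Suc l) i, e l j)) ` NZ l \<union> (\<lambda>i. (l, e (Suc l) i, w)) ` NB l))"
      by (rule card_UN_le) simp
    also have "\<dots> \<le> (\<Sum>l<L. card (NZ l) + card (NB l))"
      by (intro sum_mono order_trans[OF card_Un_le] add_mono card_image_le fin)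
    finally show "card {p. a p \<noteq> 0} \<le> n" using l0 by simp
    fix x :: "real Matrix.vec" assume x: "dim_vec x = d"
    define z where "z j = (if j < d then vec_index x j else 0)" for j
    define h where "h l = hidden (take l W) x" for l
    have hSuc: "h (Suc l) = map_vec relu (A l *\<^sub>v h l + b l)" if "l < L" for l
      using that by (simp add: h_def hidden_def take_Suc_conv_app_nth L_def Wl)
    have h0: "h 0 = x" by (simp add: h_def hidden_def)
    have dimh: "dim_vec (h l) = N l" if "l \<le> L" for l
      using that by (cases l) (auto simp: h0 x N0 hSuc dims)
    \<comment> \<open>Neurons outside \<open>S l\<close> hold 0, so summing over the live ones loses
      nothing, and the columns of \<open>a\<close> that belong to no live neuron are 0.\<close>
    have pre: "preact a w l v (e (Suc l) i) = vec_index (A l *\<^sub>v h l + b l) i"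
      if l: "l < L" and i: "i \<in> S (Suc l)" and v: "\<And>j. j \<in> S l \<Longrightarrow> v (e l j) = vec_index (h l) j"
        and zero: "\<And>j. j < N l \<Longrightarrow> j \<notin> S l \<Longrightarrow> vec_index (h l) j = 0" for l i v
    proof -
      have iN: "i < N (Suc l)" using SN[of "Suc l"] i l by auto
      have "vec_index (A l *\<^sub>v h l + b l) i = (\<Sum>j<N l. A l $$ (i, j) * vec_index (h l) j) + vec_index (b l) i"
        using iN l dims dimh[of l] by (simp add: scalar_prod_def lessThan_atLeast0)
      also have "(\<Sum>j<N l. A l $$ (i, j) * vec_index (h l) j) = (\<Sum>j\<in>S l. A l $$ (i, j) * vec_index (h l) j)"
        using SN[of l] l zero by (intro sum.mono_neutral_right) auto
      also have "\<dots> = (\<Sum>j\<in>S l. a (l, e (Suc l) i, e l j) * v (e l j))"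
      proof (rule sum.cong)
        fix j assume j: "j \<in> S l"
        then have "e l j \<noteq> w" using e(2)[of l] l by auto
        then show "A l $$ (i, j) * vec_index (h l) j = a (l, e (Suc l) i, e l j) * v (e l j)"
          using j l i v by (simp add: a_def ge)
      qed simp
      also have "\<dots> = (\<Sum>j\<in>e l ` S l. a (l, e (Suc l) i, j) * v j)"
        using e(1)[of l] l by (simp add: sum.reindex)
      also have "\<dots> = (\<Sum>j<w. a (l, e (Suc l) i, j) * v j)"
        using e(2)[of l] l by (intro sum.mono_neutral_left) (auto simp: a_def)
      also have "vec_index (b l) i = a (l, e (Suc l) i, w)" using l i by (simp add: a_def ge)
      finally show ?thesis by (simp add: preact_def)
    qed
    \<comment> \<open>A dropped neuron has a zero row and zero bias, and ReLU fixes 0.\<close>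
    have zero: "vec_index (h l) j = 0" if "l \<le> L" "j < N l" "j \<notin> S l" for l j
    proof (cases l)
      case 0
      then show ?thesis using that by (simp add: S0 N0)
    next
      case (Suc l')
      have l': "l' < L" using that Suc by simp
      have "A l' $$ (j, i) = 0" if "i < N l'" for i
        using \<open>j \<notin> S l\<close> \<open>j < N l\<close> that unfolding Suc SSuc NZ_def by force
      moreover have "vec_index (b l') j = 0"
        using \<open>j \<notin> S l\<close> \<open>j < N l\<close> unfolding Suc SSuc NB_def by auto
      ultimately show ?thesis using that l' dims[OF l'] dimh[of l'] unfolding Suc hSuc[OF l']
        by (simp add: scalar_prod_def relu_def)
    qed
    have act: "act a w z l (e l j) = vec_index (h l) j" if "l \<le> L" "j \<in> S l" for l j
      using that
    proof (induction l arbitrary: j)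
      case 0
      then show ?case by (simp add: e(3) h0 z_def S0)
    next
      case (Suc l)
      have "j < N (Suc l)" using SN[of "Suc l"] Suc.prems by auto
      then show ?case using Suc zero dims[of l] by (simp add: pre hSuc)
    qed
    have WL: "W = take (L - 1) W @ [(A (L - 1), b (L - 1))]"
      using L1 take_Suc_conv_app_nth[of "L - 1" W] by (simp add: L_def Wl)
    have "realization W x = A (L - 1) *\<^sub>v h (L - 1) + b (L - 1)"
      by (subst WL) (simp add: realization_snoc h_def)
    moreover have "preact a w (L - 1) (act a w z (L - 1)) (e (Suc (L - 1)) 0) =
        vec_index (A (L - 1) *\<^sub>v h (L - 1) + b (L - 1)) 0"
      using L1 S0L by (intro pre act zero) auto
    ultimately show "vec_index (realization W x) 0 = wide_net a w (length W) (e L 0) (\<lambda>j. if j <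
        d then vec_index x j else 0)"
      using L1 by (simp add: wide_net_def L_def[symmetric] z_def[abs_def])
  qed
qed


text \<open>A function with at most n nonzero values is recovered from a list of n pairs of position
  and value, so the number of such lists bounds the number of functions.\<close>

lemma card_sparse_functions:
  fixes I :: "'i set" and T :: "'v::zero set"
  assumes "finite I" "finite T" "0 \<in> T" "I \<noteq> {}"
  shows "finite {f. {p. f p \<noteq> 0} \<subseteq> I \<and> card {p. f p \<noteq> 0} \<le> n \<and> range f \<subseteq> T}"
    "card {f. {p. f p \<noteq> 0} \<subseteq> I \<and> card {p. f p \<noteq> 0} \<le> n \<and> range f \<subseteq> T} \<le> (card I * card T) ^ n"
proof -
  let ?F = "{f. {p. f p \<noteq> 0} \<subseteq> I \<and> card {p. f p \<noteq> 0} \<le> n \<and> range f \<subseteq> T}"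
  let ?X = "{xs. set xs \<subseteq> I \<times> T \<and> length xs = n}"
  define \<Phi> where "\<Phi> xs = (\<lambda>p. case map_of xs p of None \<Rightarrow> 0 | Some v \<Rightarrow> v)" for xs :: "('i \<times> 'v) list"
  obtain p0 where p0: "p0 \<in> I" using assms by auto
  have "?F \<subseteq> \<Phi> ` ?X"
  proof
    fix f assume f: "f \<in> ?F"
    then have fin: "finite {p. f p \<noteq> 0}" using assms(1) finite_subset by blast
    obtain ps where ps: "set ps = {p. f p \<noteq> 0}" "distinct ps" using fin finite_distinct_list by blast
    \<comment> \<open>Shorter supports are padded with copies of one correct pair. This leaves the
      decoded function unchanged, also if p0 is outside the support.\<close>
    define xs where "xs = map (\<lambda>p. (p, f p)) ps @ replicate (n - length ps) (p0, f p0)"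
    have len: "length ps \<le> n" using f ps distinct_card[of ps] by auto
    have "set xs \<subseteq> I \<times> T" using f ps p0 by (auto simp: xs_def)
    moreover have "length xs = n" using len by (simp add: xs_def)
    moreover have "\<Phi> xs = f"
    proof
      fix p
      have *: "map_of (map (\<lambda>p. (p, f p)) ps) p = (if p \<in> set ps then Some (f p) else None)"
        by (induction ps) auto
      have **: "map_of (replicate k (p0, f p0)) p = (if p = p0 \<and> k > 0 then Some (f p0) else None)" for k
        by (induction k) auto
      show "\<Phi> xs p = f p"
        using ps(1) by (auto simp: \<Phi>_def xs_def map_add_def * ** split: option.splits)
    qed
    ultimately show "f \<in> \<Phi> ` ?X" by blast
  qed
  moreover have X: "finite ?X" "card ?X = (card I * card T) ^ n"
    using assms by (auto simp: finite_lists_length_eq card_lists_length_eq card_cartesian_product)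
  ultimately show "finite ?F" "card ?F \<le> (card I * card T) ^ n"
    using finite_surj[OF X(1)] surj_card_le[OF X(1)] X(2) by auto
qed

section \<open>Finite covers of the network sets\<close>

definition cube_input :: "real ^ 'd::finite \<Rightarrow> nat \<Rightarrow> real" where
  "cube_input x j = (if j < CARD('d) then vec_nth x (coord j) else 0)"

lemma cube_input_bound: "x \<in> unit_cube \<Longrightarrow> \<bar>cube_input x j\<bar> \<le> 1"
  by (auto simp: cube_input_def mem_box_cart)

lemma NN_wide_net:
  fixes f :: "real ^ 'd::finite \<Rightarrow> real"
  assumes f: "f \<in> NN g n" and w: "w = n + CARD('d) + 1"
  obtains L a k where "1 \<le> L" "real L \<le> ln (exp 1 * real n) ^ g" "k < w" "\<And>p. \<bar>a p\<bar> \<le> real g * real n ^ g"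
    "{p. a p \<noteq> 0} \<subseteq> {..<L} \<times> {..<w} \<times> {..w}" "card {p. a p \<noteq> 0} \<le> n"
    "f = (\<lambda>x. wide_net a w L k (cube_input x))"
proof -
  obtain W where W: "f = (\<lambda>x. vec_index (realization W (to_vec x)) 0)" "valid_weights W" "d_in W = CARD('d)"
    "d_out W = 1" "weights_l0 W \<le> n" "weights_linf W \<le> real g * real n ^ g"
    "real (length W) \<le> ln (exp 1 * real n) ^ g" using f unfolding NN_def by blast
  have "0 \<le> real g * real n ^ g" by simp
  have in_eq: "(\<lambda>j. if j < CARD('d) then vec_index (to_vec x) j else 0) = cube_input x" for x :: "real ^ 'd"
    by (auto simp: cube_input_def to_vec_def)
  have dim: "dim_vec (to_vec x) = CARD('d)" for x :: "real ^ 'd" by (simp add: to_vec_def)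
  show thesis
  proof (rule realization_wide_net[OF W(2-6) w])
    fix a k
    assume a: "k < w" "\<And>p. \<bar>a p\<bar> \<le> real g * real n ^ g"
      "{p. a p \<noteq> 0} \<subseteq> {..<length W} \<times> {..<w} \<times> {..w}" "card {p. a p \<noteq> 0} \<le> n"
      "\<And>x. dim_vec x = CARD('d) \<Longrightarrow>
        vec_index (realization W x) 0 = wide_net a w (length W) k (\<lambda>j. if j <
            CARD('d) then vec_index x j else 0)"
    have "f = (\<lambda>x. wide_net a w (length W) k (cube_input x))"
      unfolding W(1) a(5)[OF dim] in_eq ..
    moreover have "1 \<le> length W" using W(2) by (auto simp: valid_weights_def Suc_le_eq)
    ultimately show thesis using a W(7) by (intro that) auto
  qed simp
qed

lemma continuous_on_cube_input: "continuous_on S (\<lambda>x :: real ^ 'd::finite. cube_input x j)"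
  by (cases "j < CARD('d)") (auto simp: cube_input_def intro!: continuous_intros)

lemma NN_continuous: "f \<in> NN g n \<Longrightarrow> continuous_on S (f :: real ^ 'd::finite \<Rightarrow> real)"
  by (erule NN_wide_net[OF _ refl]) (auto intro!: continuous_on_wide_net continuous_on_cube_input)

lemma zero_in_NN:
  assumes "n \<ge> 1"
  shows "(\<lambda>_. 0) \<in> (NN g n :: (real ^ 'd::finite \<Rightarrow> real) set)"
proof -
  define A :: "real mat" where "A = 0\<^sub>m 1 CARD('d)"
  define b :: "real Matrix.vec" where "b = 0\<^sub>v 1"
  have A0: "A $$ (i, j) = 0" if "i < dim_row A" "j < dim_col A" for i j using that by (simp add: A_def)
  have b0: "vec_index b i = 0" if "i < dim_vec b" for i using that by (simp add: b_def)
  have "{(i, j). i < dim_row A \<and> j < dim_col A \<and> A $$ (i, j) \<noteq> 0} = {}" using A0 by blast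
  then have "mat_l0 A = 0" unfolding mat_l0_def by (simp only: card.empty)
  moreover have "{i. i < dim_vec b \<and> vec_index b i \<noteq> 0} = {}" using b0 by blast
  then have "vec_l0 b = 0" unfolding vec_l0_def by (simp only: card.empty)
  ultimately have l0: "weights_l0 [(A, b)] = 0" by (simp add: weights_l0_def)
  have "{\<bar>A $$ (i, j)\<bar> | i j. i < dim_row A \<and> j < dim_col A} = {0}"
    by (auto simp: A_def intro!: exI[of _ 0])
  moreover have "{\<bar>vec_index b i\<bar> | i. i < dim_vec b} = {0}" by (auto simp: b_def)
  ultimately have linf: "weights_linf [(A, b)] = 0" by (simp add: weights_linf_def mat_linf_def vec_linf_def)
  have "1 \<le> ln (exp 1 * real n) ^ g"
    using assms by (intro one_le_power) (simp add: ln_mult)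
  moreover have "valid_weights [(A, b)]"
    unfolding valid_weights_def by (auto intro!: exI[of _ "\<lambda>l. if l =
        0 then CARD('d) else 1"] simp: A_def b_def Suc_le_eq)
  moreover have "vec_index (realization [(A, b)] (to_vec x)) 0 = 0" for x :: "real ^ 'd"
    by (simp add: A_def b_def to_vec_def scalar_prod_def)
  ultimately show ?thesis
    unfolding NN_def using l0 linf
    by (intro CollectI exI[of _ "[(A, b)]"]) (auto simp: d_in_def d_out_def A_def)
qed

text \<open>Networks with the same depth, output neuron and rounded parameters form a cell, and the
  Lipschitz estimate in the parameters bounds its diameter by \<epsilon>. The set S is an arbitrary
  subset because centers are later required to lie in the intersection with a ball.\<close>

lemma NN_finite_cover:
  fixes p :: ennreal and n :: nat
  assumes p: "1 \<le> p" and n: "n \<ge> 1" and \<epsilon>: "0 < \<epsilon>" "\<epsilon> \<le> 1" and g: "g \<ge> 1"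
    and S: "S \<subseteq> Lp_class p ` (NN g n :: (real ^ 'd::finite \<Rightarrow> real) set)"
  defines "l \<equiv> (1 + ln (real n)) ^ g" and "w \<equiv> real n + real CARD('d) + 1" and "B \<equiv> real g * real n ^ g"
  shows "\<exists>C. finite C \<and> C \<subseteq> S \<and> S \<subseteq> (\<Union>x\<in>C. metric_ball (Lp p) x \<epsilon>) \<and>
    real (card C) \<le> exp (ln (2 * l) + ln w + real n * (2 * ln l + 2 * ln (w + 1)
        + ln 7 + ln B + l * ln ((w + 1) * B) - ln \<epsilon>))"
proof -
  define w' where "w' = n + CARD('d) + 1"
  have w: "w = real w'" by (simp add: w_def w'_def)
  define Lm where "Lm = nat \<lfloor>l\<rfloor>"
  have l1: "l \<ge> 1" unfolding l_def using n by (intro one_le_power) simp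
  have Lm: "real Lm \<le> l" "Lm \<ge> 1"
  proof -
    show "real Lm \<le> l" unfolding Lm_def by (rule of_nat_floor) (use l1 in simp)
    have "1 \<le> \<lfloor>l\<rfloor>" using l1 by simp
    then show "Lm \<ge> 1" by (simp add: Lm_def le_nat_iff)
  qed
  have w1: "w \<ge> 1" by (simp add: w_def)
  have B1: "B \<ge> 1" unfolding B_def using mult_mono[of 1 "real g" 1 "real n ^ g"] one_le_power[of "real n" g] n
      g by simp
  define M where "M = (w + 1) * B"
  have M1: "M \<ge> 1" unfolding M_def using mult_mono[of 1 "w + 1" 1 B] w1 B1 by simp
  \<comment> \<open>The rounding step: \<delta> times the Lipschitz constant l * M powr l is exactly
    \<epsilon>.\<close>
  define \<delta> where "\<delta> = \<epsilon> / (l * M powr l)"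
  have MP: "M powr l \<ge> 1" using M1 l1 by (intro ge_one_powr_ge_zero) auto
  have lM: "l * M powr l \<ge> 1" using mult_mono[of 1 l 1 "M powr l"] l1 MP by simp
  have \<delta>: "\<delta> > 0" "\<delta> \<le> 1" unfolding \<delta>_def using \<epsilon> lM by (auto simp: divide_le_eq)
  define V where "V = B / \<delta>"
  have V1: "V \<ge> 1" unfolding V_def using B1 \<delta> by (simp add: le_divide_eq)
  \<comment> \<open>A margin of 1 over the ceiling holds the floors of all admissible quotients a /
    \<delta>. This leaves 2 * v + 1 integers, at most 7 * V because V \<ge> 1.\<close>
  define v where "v = \<lceil>V\<rceil> + 1"
  define T where "T = {-v..v}"
  have v0: "v \<ge> 0" using V1 unfolding v_def by linarith
  have cardT: "real (card T) \<le> 7 * V"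
  proof -
    have "real (card T) = 2 * real_of_int v + 1" using v0 by (simp add: T_def)
    also have "\<dots> \<le> 7 * V"
    proof -
      define c where "c = real_of_int v"
      have "c = real_of_int \<lceil>V\<rceil> + 1" by (simp add: c_def v_def)
      moreover have "real_of_int \<lceil>V\<rceil> \<le> V + 1" by (rule of_int_ceiling_le_add_one)
      ultimately have "c \<le> V + 2" by linarith
      then show ?thesis using V1 by (simp flip: c_def)
    qed
    finally show ?thesis .
  qed
  define I where "I = {..<Lm} \<times> {..<w'} \<times> {..w'}"
  define F where "F = {f. {p. f p \<noteq> 0} \<subseteq> I \<and> card {p. f p \<noteq> 0} \<le> n \<and> range f \<subseteq> T}"
  have "(0, 0, 0) \<in> I" using Lm(2) by (simp add: I_def w'_def)
  then have I: "finite I" "I \<noteq> {}" by (auto simp: I_def)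
  have T: "finite T" "0 \<in> T" using v0 by (auto simp: T_def)
  note F = card_sparse_functions[OF I(1) T I(2), of n, folded F_def]
  define K where "K = {..Lm} \<times> {..<w'} \<times> F"
  \<comment> \<open>The label records the integer parts of the parameters in units of \<delta>, so
    parameter families with equal labels differ by at most \<delta> everywhere.\<close>
  define P where "P c = (\<lambda>(L, k, \<phi>). \<exists>a. c = Lp_class p (\<lambda>x :: real ^ 'd. wide_net a w' L k (cube_input x)) \<and>
      1 \<le> L \<and> L \<le> Lm \<and> (\<forall>p. \<bar>a p\<bar> \<le> B) \<and> \<phi> = (\<lambda>p. \<lfloor>a p / \<delta>\<rfloor>))" for c
  have cont: "(\<lambda>x :: real ^ 'd. wide_net a w' L k (cube_input x)) \<in> Lp_functions p" for a L k
    by (intro continuous_on_cube_Lp p continuous_on_wide_net continuous_on_cube_input)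
  have "finite K" using F by (simp add: K_def)
  moreover have "S \<subseteq> mspace (Lp p)"
  proof
    fix c assume "c \<in> S"
    then obtain f where "f \<in> (NN g n :: (real ^ 'd \<Rightarrow> real) set)" "c = Lp_class p f" using S by auto
    then show "c \<in> mspace (Lp p)" by (simp add: Lp_class_mem p continuous_on_cube_Lp NN_continuous)
  qed
  moreover have "\<exists>k\<in>K. P c k" if c: "c \<in> S" for c
  proof -
    obtain f where f: "f \<in> (NN g n :: (real ^ 'd \<Rightarrow> real) set)" "c = Lp_class p f" using S c by auto
    show ?thesis
    proof (rule NN_wide_net[OF f(1) w'_def])
      fix L a k
      assume a: "1 \<le> L" "real L \<le> ln (exp 1 * real n) ^ g" "k < w'" "\<And>p. \<bar>a p\<bar> \<le> real g * real n ^ g"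
        "{p. a p \<noteq> 0} \<subseteq> {..<L} \<times> {..<w'} \<times> {..w'}" "card {p. a p \<noteq> 0} \<le> n"
        "f = (\<lambda>x. wide_net a w' L k (cube_input x))"
      have LLm: "L \<le> Lm" using a(2) n unfolding Lm_def l_def by (simp add: ln_mult le_nat_floor)
      define \<phi> where "\<phi> = (\<lambda>p. \<lfloor>a p / \<delta>\<rfloor>)"
      have sub: "{p. \<phi> p \<noteq> 0} \<subseteq> {p. a p \<noteq> 0}" by (auto simp: \<phi>_def)
      have finI: "finite {p. a p \<noteq> 0}" using a(5) by (rule finite_subset) auto
      have "{p. \<phi> p \<noteq> 0} \<subseteq> I" using sub a(5) LLm by (force simp: I_def)
      moreover have "card {p. \<phi> p \<noteq> 0} \<le> n" using card_mono[OF finI sub] a(6) by simp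
      moreover have "\<phi> p \<in> T" for p
      proof -
        have "\<bar>a p / \<delta>\<bar> \<le> V" unfolding V_def B_def using a(4)[of p] \<delta> by (simp add: divide_right_mono)
        then have "a p / \<delta> \<le> V" "- (a p / \<delta>) \<le> V" using abs_le_D1 abs_le_D2 by blast+
        then have "- \<lceil>V\<rceil> - 1 \<le> \<lfloor>a p / \<delta>\<rfloor>" "\<lfloor>a p / \<delta>\<rfloor> \<le> \<lceil>V\<rceil> + 1" by linarith+
        then show ?thesis unfolding \<phi>_def T_def v_def by simp
      qed
      ultimately have "\<phi> \<in> F" by (auto simp: F_def)
      then have "(L, k, \<phi>) \<in> K" using LLm a(3) by (simp add: K_def)
      moreover have "P c (L, k, \<phi>)" unfolding P_def using a LLm f(2) by (auto simp: \<phi>_def B_def)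
      ultimately show ?thesis by blast
    qed
  qed
  moreover have "mdist (Lp p) c c' \<le> \<epsilon>" if Pk: "P c k" "P c' k" for c c' k
  proof -
    obtain L i \<phi> where k: "k = (L, i, \<phi>)" by (cases k)
    obtain a where a: "c = Lp_class p (\<lambda>x :: real ^ 'd. wide_net a w' L i (cube_input x))"
      "1 \<le> L" "L \<le> Lm" "\<forall>p. \<bar>a p\<bar> \<le> B" "\<phi> = (\<lambda>p. \<lfloor>a p / \<delta>\<rfloor>)" using Pk(1) k by (auto simp: P_def)
    obtain a' where a': "c' = Lp_class p (\<lambda>x :: real ^ 'd. wide_net a' w' L i (cube_input x))"
      "\<forall>p. \<bar>a' p\<bar> \<le> B" "\<phi> = (\<lambda>p. \<lfloor>a' p / \<delta>\<rfloor>)" using Pk(2) k by (auto simp: P_def)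
    have d: "\<bar>a p - a' p\<bar> \<le> \<delta>" for p
    proof -
      have "\<lfloor>a p / \<delta>\<rfloor> = \<lfloor>a' p / \<delta>\<rfloor>" using a(5) a'(3) by metis
      then have "\<bar>a p / \<delta> - a' p / \<delta>\<bar> \<le> 1" by linarith
      then show ?thesis using \<delta> by (simp add: field_simps abs_le_iff)
    qed
    have "\<bar>wide_net a w' L i (cube_input x) - wide_net a' w' L i (cube_input x)\<bar> \<le> \<epsilon>"
      if x: "x \<in> unit_cube" for x :: "real ^ 'd"
    proof -
      have "\<bar>wide_net a w' L i (cube_input x) - wide_net a' w' L i (cube_input x)\<bar> \<le>
          \<delta> * real L * ((real w' + 1) * B) ^ L"
        using a a' d B1 cube_input_bound[OF x] by (intro wide_net_diff_bound) auto
      also have "\<dots> = \<delta> * (real L * M powr real L)"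
        using M1 by (simp add: M_def w powr_realpow)
      also have "\<dots> \<le> \<delta> * (l * M powr l)"
        using \<delta> a(3) Lm M1 l1 by (intro mult_left_mono mult_mono powr_mono) auto
      also have "\<dots> = \<epsilon>" unfolding \<delta>_def using lM by auto
      finally show ?thesis .
    qed
    then show ?thesis unfolding a(1) a'(1) using \<epsilon> cont by (intro mdist_Lp_class_le p) auto
  qed
  ultimately obtain C where C: "finite C" "C \<subseteq> S" "S \<subseteq> (\<Union>x\<in>C. metric_ball (Lp p) x \<epsilon>)" "card C \<le> card K"
    using internal_cover[of K S "Lp p" P \<epsilon>] by metis
  have "real (card K) \<le> (2 * l) * (w * ((l * (w + 1)) * (w + 1) * (7 * V)) ^ n)"
  proof -
    have "real (card K) = real (Suc Lm) * (w * real (card F))"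
      by (simp add: K_def card_cartesian_product w algebra_simps)
    also have "\<dots> \<le> (2 * l) * (w * ((l * (w + 1)) * (w + 1) * (7 * V)) ^ n)"
    proof (intro mult_mono)
      show "real (Suc Lm) \<le> 2 * l" using Lm l1 by simp
      have "real (card F) \<le> (real (card I) * real (card T)) ^ n" using F(2)
          by (metis of_nat_le_iff of_nat_mult of_nat_power)
      also have "\<dots> \<le> ((l * (w + 1)) * (w + 1) * (7 * V)) ^ n"
      proof (intro power_mono mult_mono cardT)
        have "real (card I) = real Lm * w * (w + 1)"
          by (simp add: I_def w card_cartesian_product algebra_simps)
        also have "\<dots> \<le> (l * (w + 1)) * (w + 1)" using Lm w1 l1 by (intro mult_mono) auto
        finally show "real (card I) \<le> (l * (w + 1)) * (w + 1)" .
      qed (use l1 w1 in auto)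
      finally show "real (card F) \<le> ((l * (w + 1)) * (w + 1) * (7 * V)) ^ n" .
    qed (use l1 w1 in auto)
    finally show ?thesis .
  qed
  also have "\<dots> = exp (ln (2 * l) + ln w + real n * (2 * ln l + 2 * ln (w + 1) + ln 7 + ln B + l * ln M - ln \<epsilon>))"
  proof -
    have pos: "l > 0" "w > 0" "w + 1 > 0" "V > 0" "M > 0" "B > 0" "\<delta> > 0" "M powr l > 0"
        using l1 w1 V1 M1 B1 \<delta> by auto
    have "ln V = ln B - ln \<delta>" using pos by (simp add: V_def ln_div)
    also have "ln \<delta> = ln \<epsilon> - (ln l + l * ln M)" using pos \<epsilon> by (simp add: \<delta>_def ln_div ln_mult)
    finally have V: "ln V = ln B + ln l + l * ln M - ln \<epsilon>" by simp
    have "ln (l * (w + 1) * (w + 1) * (7 * V)) = 2 * ln l + 2 * ln (w + 1) + ln 7 + ln B + l * ln M - ln \<epsilon>"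
      using pos V by (simp add: ln_mult)
    then have "((l * (w + 1)) * (w + 1) * (7 * V)) ^ n =
        exp (real n * (2 * ln l + 2 * ln (w + 1) + ln 7 + ln B + l * ln M - ln \<epsilon>))"
      using pos by (simp add: exp_of_nat_mult flip: \<open>ln (l * (w + 1) * (w + 1) * (7 * V)) = _\<close>)
    then show ?thesis using pos by (simp add: exp_add)
  qed
  finally show ?thesis using C unfolding M_def by (intro exI[of _ C]) auto
qed

lemma controlled_complexity_NN:
  assumes p: "1 \<le> p" and g: "g \<ge> 1"
  shows "controlled_complexity (Lp p) (\<lambda>n. Lp_class p ` (NN g n :: (real ^ 'd::finite \<Rightarrow> real) set))"
  unfolding controlled_complexity_def
proof (intro conjI allI impI ballI)
  fix n :: nat assume n: "1 \<le> n"
  show "Lp_class p ` (NN g n :: (real ^ 'd::finite \<Rightarrow> real) set) \<noteq> {}" using zero_in_NN[OF n] by auto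
  show "Lp_class p ` (NN g n :: (real ^ 'd::finite \<Rightarrow> real) set) \<subseteq> mspace (Lp p)"
    by (auto intro!: Lp_class_mem p continuous_on_cube_Lp NN_continuous)
next
  fix a R :: real and x :: "(real ^ 'd \<Rightarrow> real) set"
  assume a: "0 < a" and R: "0 < R"
  define D where "D = real CARD('d)"
  define G where "G = real g"
  have D: "D > 0" and G: "G > 0" using g by (auto simp: D_def G_def)
  \<comment> \<open>The exponent of the preceding cover bound at \<epsilon> = n powr - a, where - ln
    \<epsilon> = a * ln n. It is of order n times a power of ln n, hence below n powr (1 + \<delta>)
    asymptotically for every \<delta> > 0.\<close>
  define \<eta> where "\<eta> n = (let l = (1 + ln (real n)) ^ g; w = real n + D + 1; B = G * real n ^ g in
    ln (2 * l) + ln w + real n * (2 * ln l + 2 * ln (w + 1) + ln 7 + ln B + l * ln ((w + 1) * B)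
        + a * ln (real n)))" for n
  have \<eta>0: "\<eta> n \<ge> 0" if n: "n \<ge> 1" for n
  proof -
    have nonneg: "0 \<le> ln (2 * l) + ln w + real n * (2 * ln l + 2 * ln (w + 1) + ln 7 + ln B + l * ln ((w + 1)
        * B) + a * ln (real n))"
      if "1 \<le> l" "1 \<le> w" "1 \<le> B" for l w B
    proof -
      have "1 \<le> 2 * l" "1 \<le> (w + 1) * B" using that mult_mono[of 1 "w + 1" 1 B] by auto
      then show ?thesis using that n a
        by (intro add_nonneg_nonneg mult_nonneg_nonneg ln_ge_zero) auto
    qed
    show ?thesis unfolding \<eta>_def Let_def
    proof (rule nonneg)
      show "1 \<le> (1 + ln (real n)) ^ g" using n by (intro one_le_power) simp
      show "1 \<le> G * real n ^ g"
        using mult_mono[of 1 G 1 "real n ^ g"] one_le_power[of "real n" g] n g by (simp add: G_def)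
    qed (use D in simp)
  qed
  have bdd: "bdd_above ((\<lambda>n. \<eta> n / real n powr (1 + \<delta>)) ` {1..})" if \<delta>: "\<delta> > 0" for \<delta>
  proof -
    have "(\<lambda>n. \<eta> n / real n powr (1 + \<delta>)) \<longlonglongrightarrow> 0"
      unfolding \<eta>_def Let_def using \<delta> D G a by real_asymp
    then have "Bseq (\<lambda>n. \<eta> n / real n powr (1 + \<delta>))" by (intro convergent_imp_Bseq convergentI)
    then obtain K where "\<forall>n. norm (\<eta> n / real n powr (1 + \<delta>)) \<le> K" unfolding Bseq_def by blast
    then have "\<eta> n / real n powr (1 + \<delta>) \<le> K" for n by (metis abs_le_D1 real_norm_def)
    then show ?thesis by (intro bdd_aboveI[of _ K]) auto
  qed
  show "\<exists>n0\<ge>1. \<exists>\<eta>. (\<forall>n\<ge>1. 0 \<le> \<eta> n) \<and> (\<forall>\<delta>>0. bdd_above ((\<lambda>n. \<eta> n / real n powr (1 + \<delta>)) ` {1..})) \<and>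
     (\<forall>n\<ge>n0. ereal_of_enat (covering_number (Lp p) (metric_ball (Lp p) x R \<inter> Lp_class p ` NN g n) (real n powr
         - a)) \<le> ereal (exp (\<eta> n)))"
  proof (rule exI[of _ 1], intro conjI, simp, rule exI[of _ \<eta>], intro conjI allI impI)
    fix n :: nat assume n: "1 \<le> n"
    let ?S = "metric_ball (Lp p) x R \<inter> Lp_class p ` (NN g n :: (real ^ 'd \<Rightarrow> real) set)"
    have e: "0 < real n powr - a" "real n powr - a \<le> 1"
      using n a by (auto simp: powr_minus inverse_le_1_iff intro!: ge_one_powr_ge_zero)
    have "\<exists>C. finite C \<and> C \<subseteq> ?S \<and> ?S \<subseteq> (\<Union>x\<in>C. metric_ball (Lp p) x (real n powr - a)) \<and>
      real (card C) \<le> exp (\<eta> n)"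
      using NN_finite_cover[OF p n e g, of ?S] n
      by (simp add: \<eta>_def Let_def D_def G_def ln_powr)
    then obtain C where C: "finite C" "C \<subseteq> ?S" "?S \<subseteq> (\<Union>x\<in>C. metric_ball (Lp p) x (real n powr - a))"
      "real (card C) \<le> exp (\<eta> n)" by metis
    have "ereal_of_enat (covering_number (Lp p) ?S (real n powr - a)) \<le> ereal_of_enat (enat (card C))"
      using covering_number_le[OF C(1-3)] by (simp only: ereal_of_enat_le_iff)
    also have "\<dots> \<le> ereal (exp (\<eta> n))" using C(4) by simp
    finally show "ereal_of_enat (covering_number (Lp p) ?S (real n powr - a)) \<le> ereal (exp (\<eta> n))" .
  qed (use \<eta>0 bdd in auto)
qed

section \<open>Building networks layer by layer\<close>

text \<open>A layer is represented by the set of functions that its neurons compute on the cube. This makes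
  parallel composition a plain union.\<close>
definition aff_comb :: "nat \<Rightarrow> real \<Rightarrow> (real ^ 'd::finite \<Rightarrow> real) set \<Rightarrow> (real ^ 'd \<Rightarrow> real) \<Rightarrow> bool" where
  "aff_comb k B G f \<longleftrightarrow> (\<exists>A c b. A \<subseteq> G \<and> finite A \<and> card A \<le> k \<and> (\<forall>g\<in>A. \<bar>c g\<bar> \<le> B) \<and> \<bar>b\<bar> \<le> B \<and>
     (\<forall>x\<in>unit_cube. f x = (\<Sum>g\<in>A. c g * g x) + b))"

lemma aff_comb_mono: "aff_comb k B G f \<Longrightarrow> k \<le> k' \<Longrightarrow> B \<le> B' \<Longrightarrow> G \<subseteq> G' \<Longrightarrow> aff_comb k' B' G' f"
  unfolding aff_comb_def by (meson order_trans)

lemma aff_comb_cong: "aff_comb k B G f \<Longrightarrow> (\<And>x. x \<in> unit_cube \<Longrightarrow> f x = f' x) \<Longrightarrow> aff_comb k B G f'"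
  unfolding aff_comb_def by simp

lemma aff_comb_gen: "g \<in> G \<Longrightarrow> aff_comb 1 1 G g"
  unfolding aff_comb_def by (intro exI[of _ "{g}"] exI[of _ "\<lambda>_. 1"] exI[of _ 0]) auto

lemma aff_comb_const: "\<bar>b\<bar> \<le> B \<Longrightarrow> aff_comb 0 B G (\<lambda>_. b)"
  unfolding aff_comb_def by (intro exI[of _ "{}"] exI[of _ "\<lambda>_. 0"] exI[of _ b]) auto

lemma aff_comb_scale:
  assumes "aff_comb k B G f"
  shows "aff_comb k (\<bar>c\<bar> * B) G (\<lambda>x. c * f x)"
proof -
  obtain A c' b where "A \<subseteq> G" "finite A" "card A \<le> k" "\<forall>g\<in>A. \<bar>c' g\<bar> \<le> B" "\<bar>b\<bar> \<le> B"
    "\<forall>x\<in>unit_cube. f x = (\<Sum>g\<in>A. c' g * g x) + b" using assms unfolding aff_comb_def by blast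
  then show ?thesis unfolding aff_comb_def
    by (intro exI[of _ A] exI[of _ "\<lambda>g. c * c' g"] exI[of _ "c * b"])
      (auto simp: abs_mult mult_left_mono distrib_left sum_distrib_left mult.assoc)
qed

lemma aff_comb_add:
  assumes "aff_comb k B G f" "aff_comb k' B' G f'"
  shows "aff_comb (k + k') (B + B') G (\<lambda>x. f x + f' x)"
proof -
  obtain A c b where A: "A \<subseteq> G" "finite A" "card A \<le> k" "\<forall>g\<in>A. \<bar>c g\<bar> \<le> B" "\<bar>b\<bar> \<le> B"
    "\<forall>x\<in>unit_cube. f x = (\<Sum>g\<in>A. c g * g x) + b" using assms(1) unfolding aff_comb_def by blast
  obtain A' c' b' where A': "A' \<subseteq> G" "finite A'" "card A' \<le> k'" "\<forall>g\<in>A'. \<bar>c' g\<bar> \<le> B'" "\<bar>b'\<bar> \<le> B'"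
    "\<forall>x\<in>unit_cube. f' x = (\<Sum>g\<in>A'. c' g * g x) + b'" using assms(2) unfolding aff_comb_def by blast
  \<comment> \<open>A function used by both combinations collects both coefficients; therefore the
    bounds B and B' are added.\<close>
  define e where "e g = (if g \<in> A then c g else 0) + (if g \<in> A' then c' g else 0)" for g
  have "f x + f' x = (\<Sum>g\<in>A \<union> A'. e g * g x) + (b + b')" if "x \<in> unit_cube" for x
  proof -
    have "(\<Sum>g\<in>A \<union> A'. e g * g x) = (\<Sum>g\<in>A \<union> A'. (if g \<in> A then c g * g x else 0))
        + (\<Sum>g\<in>A \<union> A'. (if g \<in> A' then c' g * g x else 0))"
      unfolding sum.distrib[symmetric] by (intro sum.cong) (auto simp: e_def distrib_right)
    also have "\<dots> = (\<Sum>g\<in>A. c g * g x) + (\<Sum>g\<in>A'. c' g * g x)"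
      using A(2) A'(2) by (intro arg_cong2[where f = "(+)"] sum.mono_neutral_cong_right) auto
    finally show ?thesis using A(6) A'(6) that by simp
  qed
  moreover have "\<forall>g\<in>A \<union> A'. \<bar>e g\<bar> \<le> B + B'"
  proof
    fix g assume "g \<in> A \<union> A'"
    have "0 \<le> B" "0 \<le> B'" using A(5) A'(5) by linarith+
    then have "\<bar>if g \<in> A then c g else 0\<bar> \<le> B" "\<bar>if g \<in> A' then c' g else 0\<bar> \<le> B'" using A(4) A'(4) by auto
    then show "\<bar>e g\<bar> \<le> B + B'" unfolding e_def by linarith
  qed
  moreover have "card (A \<union> A') \<le> k + k'" using card_Un_le[of A A'] A A' by linarith
  moreover have "\<bar>b + b'\<bar> \<le> B + B'" using A(5) A'(5) by linarith
  ultimately show ?thesis unfolding aff_comb_def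
      using A A' by (intro exI[of _ "A \<union> A'"] exI[of _ e] exI[of _ "b + b'"]) auto
qed

lemma aff_comb_sum:
  assumes "finite I" "\<And>i. i \<in> I \<Longrightarrow> aff_comb k B G (f i)"
  shows "aff_comb (card I * k) (real (card I) * B) G (\<lambda>x. \<Sum>i\<in>I. f i x)"
  using assms
proof (induction I rule: finite_induct)
  case empty
  then show ?case using aff_comb_const[of 0 0 G] by simp
next
  case (insert i I)
  then have "aff_comb (k + card I * k) (B + real (card I) * B) G (\<lambda>x. f i x + (\<Sum>i\<in>I. f i x))"
    by (intro aff_comb_add) auto
  then show ?case using insert by (simp add: algebra_simps)
qed

text \<open>k bounds the number of incoming connections per neuron, B the weights and w the width.
  Layer 0 consists of exactly the coordinate functions and the depth is exact, so nets have to be of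
  equal depth to be put side by side. Off the cube the functions of the later layers are
  unconstrained.\<close>

primrec net :: "nat \<Rightarrow> real \<Rightarrow> nat \<Rightarrow> nat \<Rightarrow> (real ^ 'd::finite \<Rightarrow> real) set \<Rightarrow> bool" where
  "net k B w 0 F \<longleftrightarrow> F = range (\<lambda>i x. vec_nth x i)"
| "net k B w (Suc l) F \<longleftrightarrow> finite F \<and> F \<noteq> {} \<and> card F \<le> w \<and>
     (\<exists>G. net k B w l G \<and> (\<forall>f\<in>F. \<exists>h. aff_comb k B G h \<and> (\<forall>x\<in>unit_cube. f x = relu (h x))))"

lemma net_finite: "net k B w l F \<Longrightarrow> finite F \<and> F \<noteq> {}"
  by (cases l) auto

lemma net_UN:
  assumes "finite I" "I \<noteq> {}" "\<And>i. i \<in> I \<Longrightarrow> net k B w l (F i)"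
  shows "net k B (card I * w) l (\<Union>i\<in>I. F i)"
  using assms(3)
proof (induction l arbitrary: F)
  case 0
  then show ?case using assms(2) by auto
next
  case (Suc l)
  have "\<forall>i\<in>I. \<exists>G. net k B w l G \<and> (\<forall>f\<in>F i. \<exists>h. aff_comb k B G h \<and> (\<forall>x\<in>unit_cube. f x = relu (h x)))"
    using Suc.prems by simp
  then obtain G where G: "\<And>i. i \<in> I \<Longrightarrow> net k B w l (G i)"
    "\<And>i f. i \<in> I \<Longrightarrow> f \<in> F i \<Longrightarrow> \<exists>h. aff_comb k B (G i) h \<and> (\<forall>x\<in>unit_cube. f x = relu (h x))"
    by metis
  have "\<exists>h. aff_comb k B (\<Union>i\<in>I. G i) h \<and> (\<forall>x\<in>unit_cube. f x = relu (h x))" if f: "f \<in> (\<Union>i\<in>I. F i)" for f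
  proof -
    obtain i where i: "i \<in> I" "f \<in> F i" using f by auto
    then obtain h where "aff_comb k B (G i) h" "\<forall>x\<in>unit_cube. f x = relu (h x)" using G(2) by metis
    then show ?thesis using i by (intro exI[of _ h]) (auto intro: aff_comb_mono)
  qed
  moreover have "card (\<Union>i\<in>I. F i) \<le> card I * w"
    using card_UN_le[OF assms(1), of F] sum_mono[of I "\<lambda>i. card (F i)" "\<lambda>_. w"] Suc.prems by auto
  moreover have "net k B (card I * w) l (\<Union>i\<in>I. G i)" using G(1) by (rule Suc.IH)
  moreover have "finite (\<Union>i\<in>I. F i)" "(\<Union>i\<in>I. F i) \<noteq> {}" using Suc.prems assms(1,2) by auto
  ultimately show ?case unfolding net.simps by blast
qed

section \<open>From sets of functions to weight matrices\<close>

lemma d_in_append: "W \<noteq> [] \<Longrightarrow> d_in (W @ V) = d_in W"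
  by (simp add: d_in_def)

lemma realization_append_layer:
  "W \<noteq> [] \<Longrightarrow> realization (W @ [(A, b)]) x = A *\<^sub>v map_vec relu (realization W x) + b"
proof (induction W arbitrary: x)
  case (Cons p W)
  obtain A' b' where p: "p = (A', b')" by (cases p)
  show ?case
  proof (cases "W = []")
    case False
    then obtain q V where "W = q # V" by (cases W) auto
    then show ?thesis using Cons.IH[of "map_vec relu (A' *\<^sub>v x + b')"] p by simp
  qed (simp add: p)
qed simp

lemma mat_linf_le:
  assumes "0 < dim_row A" "0 < dim_col A" "\<And>i j. i < dim_row A \<Longrightarrow> j < dim_col A \<Longrightarrow> \<bar>A $$ (i, j)\<bar> \<le> B"
  shows "mat_linf A \<le> B"
proof -
  have "{\<bar>A $$ (i, j)\<bar> | i j. i < dim_row A \<and>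
      j < dim_col A} = (\<lambda>(i, j). \<bar>A $$ (i, j)\<bar>) ` ({..<dim_row A} \<times> {..<dim_col A})"
    by auto
  then show ?thesis unfolding mat_linf_def using assms by (intro Max.boundedI) auto
qed

lemma vec_linf_le:
  assumes "0 < dim_vec b" "\<And>i. i < dim_vec b \<Longrightarrow> \<bar>vec_index b i\<bar> \<le> B"
  shows "vec_linf b \<le> B"
proof -
  have "{\<bar>vec_index b i\<bar> | i. i < dim_vec b} = (\<lambda>i. \<bar>vec_index b i\<bar>) ` {..<dim_vec b}" by auto
  then show ?thesis unfolding vec_linf_def using assms by (intro Max.boundedI) auto
qed

text \<open>Enumerating the generators by a distinct list turns affine combinations into matrix rows
  with at most k nonzero entries and one bias each. The bound 2 * B arises because the weight norm
  adds the maxima of the matrix and of the bias.\<close>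

lemma aff_layer:
  fixes fs gs :: "(real ^ 'd::finite \<Rightarrow> real) list"
  assumes gs: "\<And>g. g \<in> set gs \<Longrightarrow> aff_comb k B (set fs) g" and fs: "distinct fs" "fs \<noteq> []" and "gs \<noteq> []"
  obtains A b where "A \<in> carrier_mat (length gs) (length fs)" "b \<in> carrier_vec (length gs)"
    "mat_l0 A + vec_l0 b \<le> length gs * (k + 1)" "mat_linf A + vec_linf b \<le> 2 * B"
    "\<And>x. x \<in> unit_cube \<Longrightarrow> A *\<^sub>v Matrix.vec (length fs) (\<lambda>j. (fs ! j) x) + b =
        Matrix.vec (length gs) (\<lambda>i. (gs ! i) x)"
proof -
  define Q where "Q g A c b \<longleftrightarrow> A \<subseteq> set fs \<and> finite A \<and> card A \<le> k \<and> (\<forall>f\<in>A. \<bar>c f\<bar> \<le> B) \<and> \<bar>b\<bar> \<le> B \<and>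
     (\<forall>x\<in>unit_cube. g x = (\<Sum>f\<in>A. c f * f x) + b)" for g A c b
  have "\<forall>g\<in>set gs. \<exists>A c b. Q g A c b" using gs unfolding aff_comb_def Q_def by blast
  then obtain S c e where "\<And>g. g \<in> set gs \<Longrightarrow> Q g (S g) (c g) (e g)" by metis
  then have S: "S g \<subseteq> set fs \<and> card (S g) \<le> k \<and> (\<forall>f\<in>S g. \<bar>c g f\<bar> \<le> B) \<and> \<bar>e g\<bar> \<le> B \<and>
     (\<forall>x\<in>unit_cube. g x = (\<Sum>f\<in>S g. c g f * f x) + e g)" if "g \<in> set gs" for g
    using that unfolding Q_def by blast
  have "hd gs \<in> set gs" using \<open>gs \<noteq> []\<close> by simp
  then have "\<bar>e (hd gs)\<bar> \<le> B" using S by blast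
  then have B0: "0 \<le> B" by linarith
  define A where "A = mat (length gs) (length fs) (\<lambda>(i,
      j). if fs ! j \<in> S (gs ! i) then c (gs ! i) (fs ! j) else 0)"
  define b where "b = Matrix.vec (length gs) (\<lambda>i. e (gs ! i))"
  have "mat_l0 A \<le> length gs * k"
  proof -
    have "{(i, j). i < dim_row A \<and> j < dim_col A \<and> A $$ (i, j) \<noteq> 0} \<subseteq>
        (SIGMA i:{..<length gs}. {j. j < length fs \<and> fs ! j \<in> S (gs ! i)})"
      by (auto simp: A_def split: if_splits)
    then have "mat_l0 A \<le> card (SIGMA i:{..<length gs}. {j. j < length fs \<and> fs ! j \<in> S (gs ! i)})"
      unfolding mat_l0_def by (intro card_mono) auto
    also have "\<dots> = (\<Sum>i<length gs. card {j. j < length fs \<and> fs ! j \<in> S (gs ! i)})" by (subst card_SigmaI) auto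
    also have "\<dots> \<le> (\<Sum>i<length gs. k)"
    proof (rule sum_mono)
      fix i assume "i \<in> {..<length gs}"
      then have Si: "S (gs ! i) \<subseteq> set fs" "card (S (gs ! i)) \<le> k" using S[of "gs ! i"] by auto
      have "card {j. j < length fs \<and> fs ! j \<in> S (gs ! i)} \<le> card (S (gs ! i))"
        using fs(1) finite_subset[OF Si(1)]
        by (intro card_inj_on_le[of "\<lambda>j. fs ! j"]) (auto simp: inj_on_def nth_eq_iff_index_eq)
      then show "card {j. j < length fs \<and> fs ! j \<in> S (gs ! i)} \<le> k" using Si by simp
    qed
    finally show ?thesis by simp
  qed
  moreover have "vec_l0 b \<le> length gs"
    unfolding vec_l0_def by (rule order_trans[OF card_mono[of "{..<length gs}"]]) (auto simp: b_def)
  moreover have "mat_linf A \<le> B"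
    using S B0 fs \<open>gs \<noteq> []\<close> by (intro mat_linf_le) (auto simp: A_def)
  moreover have "vec_linf b \<le> B"
    using S B0 \<open>gs \<noteq> []\<close> by (intro vec_linf_le) (auto simp: b_def)
  moreover have "A *\<^sub>v Matrix.vec (length fs) (\<lambda>j. (fs ! j) x) + b = Matrix.vec (length gs) (\<lambda>i. (gs ! i) x)"
    if x: "x \<in> unit_cube" for x
  proof (rule eq_vecI)
    fix i assume "i < dim_vec (Matrix.vec (length gs) (\<lambda>i. (gs ! i) x))"
    then have i: "i < length gs" by simp
    then have Si: "S (gs ! i) \<subseteq> set fs" "(gs ! i) x = (\<Sum>f\<in>S (gs ! i). c (gs ! i) f * f x) + e (gs ! i)"
      using S[of "gs ! i"] x by auto
    have "vec_index (A *\<^sub>v Matrix.vec (length fs) (\<lambda>j. (fs ! j) x) + b) i =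
        (\<Sum>j<length fs. (if fs ! j \<in> S (gs ! i) then c (gs ! i) (fs ! j) else 0) * (fs ! j) x) + e (gs ! i)"
      using i by (simp add: A_def b_def scalar_prod_def lessThan_atLeast0)
    also have "(\<Sum>j<length fs. (if fs ! j \<in> S (gs ! i) then c (gs ! i) (fs ! j) else 0) * (fs ! j) x) =
        (\<Sum>f\<in>set fs. (if f \<in> S (gs ! i) then c (gs ! i) f else 0) * f x)"
      by (rule sum.reindex_bij_betw[OF bij_betw_nth[OF fs(1) refl refl],
          of "\<lambda>f. (if f \<in> S (gs ! i) then c (gs ! i) f else 0) * f x"])
    also have "\<dots> = (\<Sum>f\<in>S (gs ! i). c (gs ! i) f * f x)"
      using Si(1) by (intro sum.mono_neutral_cong_right) auto
    finally show "vec_index (A *\<^sub>v Matrix.vec (length fs) (\<lambda>j. (fs ! j) x) + b) i =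
        vec_index (Matrix.vec (length gs) (\<lambda>i. (gs ! i) x)) i"
      using i Si(2) by simp
  qed (simp add: A_def b_def)
  ultimately show thesis by (intro that[of A b]) (auto simp: A_def b_def)
qed

text \<open>The induction runs over all lists gs of outputs: with gs the list of preactivations, the
  affine output layer of a network becomes the next hidden layer. The fan-in k' of the last layer is
  separate from k, because the final sum combines far more functions than a hidden neuron
  does.\<close>

lemma net_realization:
  fixes F :: "(real ^ 'd::finite \<Rightarrow> real) set"
  assumes "net k B w l F" "gs \<noteq> []" "\<And>g. g \<in> set gs \<Longrightarrow> aff_comb k' B F g"
  shows "\<exists>W. valid_weights W \<and> length W = Suc l \<and> d_in W = CARD('d) \<and> d_out W = length gs \<and>
    weights_l0 W \<le> l * (w * (k + 1)) + length gs * (k' + 1) \<and> weights_linf W \<le> 2 * B \<and>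
    (\<forall>x\<in>unit_cube. realization W (to_vec x) = Matrix.vec (length gs) (\<lambda>i. (gs ! i) x))"
  using assms
proof (induction l arbitrary: F gs k')
  case 0
  define fs :: "(real ^ 'd \<Rightarrow> real) list" where "fs = map (\<lambda>j x. vec_nth x (coord j)) [0..<CARD('d)]"
  have inj: "inj (\<lambda>i (x :: real ^ 'd). vec_nth x i)"
  proof (rule injI)
    fix i j :: 'd assume "(\<lambda>x :: real ^ 'd. vec_nth x i) = (\<lambda>x. vec_nth x j)"
    then have "vec_nth (axis i 1 :: real ^ 'd) i = vec_nth (axis i 1 :: real ^ 'd) j" by meson
    then show "i = j" by (auto simp: axis_def split: if_splits)
  qed
  have bij: "bij_betw (coord :: nat \<Rightarrow> 'd) {0..<CARD('d)} UNIV" using bij_betw_coord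
      by (simp add: lessThan_atLeast0)
  have "distinct fs" unfolding fs_def distinct_map
    using bij inj by (auto simp: inj_on_def bij_betw_def)
  have "set fs = (\<lambda>i x. vec_nth x i) ` coord ` {0..<CARD('d)}" by (auto simp: fs_def)
  also have "\<dots> = F" using 0 bij by (simp add: bij_betw_def)
  finally have setfs: "set fs = F" .
  have "fs \<noteq> []" by (simp add: fs_def)
  obtain A b where A: "A \<in> carrier_mat (length gs) (length fs)" "b \<in> carrier_vec (length gs)"
    "mat_l0 A + vec_l0 b \<le> length gs * (k' + 1)" "mat_linf A + vec_linf b \<le> 2 * B"
    "\<And>x. x \<in> unit_cube \<Longrightarrow> A *\<^sub>v Matrix.vec (length fs) (\<lambda>j. (fs ! j) x) + b =
        Matrix.vec (length gs) (\<lambda>i. (gs ! i) x)"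
    using aff_layer[of gs k' B fs] 0 setfs \<open>distinct fs\<close> \<open>fs \<noteq> []\<close> by metis
  have tv: "Matrix.vec (length fs) (\<lambda>j. (fs ! j) x) = to_vec x" for x
    by (auto simp: fs_def to_vec_def intro!: eq_vecI)
  have "valid_weights [(A, b)]"
    unfolding valid_weights_def using A(1,2) 0(2) \<open>fs \<noteq> []\<close>
    by (auto intro!: exI[of _ "\<lambda>l. if l = 0 then length fs else length gs"] simp: Suc_le_eq)
  then show ?case using A tv
    by (intro exI[of _ "[(A, b)]"]) (auto simp: d_in_def d_out_def weights_l0_def weights_linf_def fs_def)
next
  case (Suc l)
  then obtain G where G: "net k B w l G" "\<forall>f\<in>F. \<exists>h. aff_comb k B G h \<and> (\<forall>x\<in>unit_cube. f x = relu (h x))"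
    by auto
  then obtain h where h: "\<And>f. f \<in> F \<Longrightarrow> aff_comb k B G (h f) \<and> (\<forall>x\<in>unit_cube. f x = relu (h f x))" by metis
  have F: "finite F" "F \<noteq> {}" "card F \<le> w" using Suc.prems(1) by auto
  obtain fs where fs: "set fs = F" "distinct fs" using finite_distinct_list[OF F(1)] by blast
  have fs0: "fs \<noteq> []" "length fs \<le> w" using fs F distinct_card[of fs] by auto
  obtain W where W: "valid_weights W" "length W = Suc l" "d_in W = CARD('d)" "d_out W = length fs"
    "weights_l0 W \<le> l * (w * (k + 1)) + length fs * (k + 1)" "weights_linf W \<le> 2 * B"
    "\<forall>x\<in>unit_cube. realization W (to_vec x) = Matrix.vec (length fs) (\<lambda>i. (map h fs ! i) x)"
    using Suc.IH[OF G(1), of "map h fs" k] h fs fs0 by auto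
  obtain A b where A: "A \<in> carrier_mat (length gs) (length fs)" "b \<in> carrier_vec (length gs)"
    "mat_l0 A + vec_l0 b \<le> length gs * (k' + 1)" "mat_linf A + vec_linf b \<le> 2 * B"
    "\<And>x. x \<in> unit_cube \<Longrightarrow> A *\<^sub>v Matrix.vec (length fs) (\<lambda>j. (fs ! j) x) + b =
        Matrix.vec (length gs) (\<lambda>i. (gs ! i) x)"
    using aff_layer[of gs k' B fs] Suc.prems fs fs0 by metis
  have W0: "W \<noteq> []" using W(2) by auto
  obtain N where N: "\<forall>l\<le>length W. 1 \<le> N l" "\<forall>l<length W. fst (W ! l) \<in> carrier_mat (N (Suc l)) (N l) \<and>
       snd (W ! l) \<in> carrier_vec (N (Suc l))" using W(1) unfolding valid_weights_def by blast
  have NL: "N (length W) = length fs"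
    using N(2) W(4) W0 by (cases W rule: rev_cases) (auto simp: d_out_def)
  have "valid_weights (W @ [(A, b)])"
    unfolding valid_weights_def
    using N NL A(1,2) Suc.prems(2)
    by (intro conjI exI[of _ "\<lambda>l. if l \<le> length W then N l else length gs"]) (auto simp: nth_append less_Suc_eq
        Suc_le_eq)
  moreover have "weights_l0 (W @ [(A, b)]) \<le> Suc l * (w * (k + 1)) + length gs * (k' + 1)"
  proof -
    have "length fs * (k + 1) \<le> w * (k + 1)" using fs0 by (intro mult_right_mono) auto
    moreover have "weights_l0 (W @ [(A, b)]) = weights_l0 W + (mat_l0 A + vec_l0 b)"
        by (simp add: weights_l0_def)
    moreover have "Suc l * (w * (k + 1)) = l * (w * (k + 1)) + w * (k + 1)" by simp
    ultimately show ?thesis using A(3) W(5) by linarith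
  qed
  moreover have "weights_linf (W @ [(A, b)]) \<le> 2 * B"
    using W(6) A(4) W0 unfolding weights_linf_def by (subst set_append, subst image_Un, subst Max_Un) auto
  moreover have "realization (W @ [(A, b)]) (to_vec x) = Matrix.vec (length gs) (\<lambda>i. (gs ! i) x)"
      if x: "x \<in> unit_cube" for x
  proof -
    have "map_vec relu (realization W (to_vec x)) = Matrix.vec (length fs) (\<lambda>j. (fs ! j) x)"
      using W(7) h fs x by (auto intro!: eq_vecI)
    then show ?thesis using A(5)[OF x] by (simp add: realization_append_layer W0)
  qed
  ultimately show ?case using W A(1)
    by (intro exI[of _ "W @ [(A, b)]"]) (auto simp: d_in_append W0 d_out_def)
qed

section \<open>Approximate multiplication\<close>

text \<open>On [0, 1] this is the tent map with peak 1 at 1/2, written so that one step is an affine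
  combination of two neurons.\<close>

definition tent :: "real \<Rightarrow> real" where
  "tent y = 2 * relu y - 4 * relu (y - 1 / 2)"

text \<open>On [0, 1] this is the piecewise linear interpolant of the square at the dyadic points of
  level s; each further term refines it and costs one layer.\<close>

primrec square_approx :: "nat \<Rightarrow> real \<Rightarrow> real" where
  "square_approx 0 y = y"
| "square_approx (Suc s) y = square_approx s y - (tent ^^ Suc s) y / 4 ^ Suc s"

lemma tent_range: "0 \<le> y \<Longrightarrow> y \<le> 1 \<Longrightarrow> 0 \<le> tent y \<and> tent y \<le> 1"
  by (auto simp: tent_def relu_def max_def)

lemma tent_iter_range: "0 \<le> y \<Longrightarrow> y \<le> 1 \<Longrightarrow> 0 \<le> (tent ^^ s) y \<and> (tent ^^ s) y \<le> 1"
  by (induction s) (auto simp: tent_range)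

text \<open>\<open>S y = y - y\<^sup>2\<close> satisfies \<open>S y = (tent y + S (tent y)) / 4\<close>; iterating this gives the error term.\<close>
lemma square_approx_eq:
  assumes "0 \<le> y" "y \<le> 1"
  shows "square_approx s y = y\<^sup>2 + ((tent ^^ s) y - ((tent ^^ s) y)\<^sup>2) / 4 ^ s"
proof (induction s)
  case (Suc s)
  define z where "z = (tent ^^ s) y"
  have z: "0 \<le> z" "z \<le> 1" using tent_iter_range[OF assms] by (auto simp: z_def)
  have "z - z\<^sup>2 = (tent z + (tent z - (tent z)\<^sup>2)) / 4"
    using z by (auto simp: tent_def relu_def max_def power2_eq_square field_simps)
  then have "(z - z\<^sup>2) / 4 ^ s = (tent z + (tent z - (tent z)\<^sup>2)) / 4 / 4 ^ s" by (rule arg_cong)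
  also have "\<dots> = tent z / 4 ^ Suc s + (tent z - (tent z)\<^sup>2) / 4 ^ Suc s"
    by (simp only: divide_divide_eq_left power_Suc add_divide_distrib)
  finally show ?case using Suc by (simp only: square_approx.simps z_def funpow.simps comp_apply)
qed simp

text \<open>By the error identity the approximation exceeds the square by z * (1 - z) / 4^s with z
  in [0, 1], and z * (1 - z) \<le> 1/4. The bounds 0 and 1 keep differences of two such values in
  [-1, 1].\<close>

lemma square_approx_bounds:
  assumes "0 \<le> y" "y \<le> 1"
  shows "y\<^sup>2 \<le> square_approx s y" "square_approx s y \<le> y\<^sup>2 + 1 / 4 ^ Suc s" "0 \<le> square_approx s y"
      "square_approx s y \<le> 1"
proof -
  define z where "z = (tent ^^ s) y"
  have z: "0 \<le> z" "z \<le> 1" using tent_iter_range[OF assms] by (auto simp: z_def)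
  have "z - z\<^sup>2 = z * (1 - z)" by (simp add: power2_eq_square algebra_simps)
  then have 0: "0 \<le> z - z\<^sup>2" using z by simp
  have "0 \<le> (z - 1 / 2)\<^sup>2" by simp
  then have 1: "z - z\<^sup>2 \<le> 1 / 4" by (simp add: power2_eq_square algebra_simps)
  show 2: "y\<^sup>2 \<le> square_approx s y" using square_approx_eq[OF assms] 0 by (simp add: z_def)
  show "square_approx s y \<le> y\<^sup>2 + 1 / 4 ^ Suc s"
    using square_approx_eq[OF assms, of s] divide_right_mono[OF 1, of "4 ^ s"] by (simp add: z_def)
  show "0 \<le> square_approx s y" using 2 by (rule order_trans[rotated]) simp
  have "square_approx s y \<le> y"
  proof (induction s)
    case (Suc s)
    have "0 \<le> (tent ^^ Suc s) y / 4 ^ Suc s" using tent_iter_range[OF assms, of "Suc s"] by simp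
    then show ?case using Suc unfolding square_approx.simps by linarith
  qed simp
  then show "square_approx s y \<le> 1" using assms by simp
qed

lemma relu_nonneg: "0 \<le> x \<Longrightarrow> relu x = x"
  by (simp add: relu_def)

lemma relu_abs: "relu x + relu (- x) = \<bar>x\<bar>"
  by (simp add: relu_def)

text \<open>Nonnegative functions are fixed by ReLU, so one neuron each carries them to the next layer.\<close>
lemma net_extend:
  assumes "net k B w l F" and S: "S \<subseteq> F" "\<And>f x. f \<in> S \<Longrightarrow> x \<in> unit_cube \<Longrightarrow> 0 \<le> f x" "1 \<le> k" "1 \<le> B"
    and H: "finite H" "S \<union> H \<noteq> {}" "card S + card H \<le> w"
        "\<And>f. f \<in> H \<Longrightarrow> \<exists>h. aff_comb k B F h \<and> (\<forall>x\<in>unit_cube. f x = relu (h x))"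
  shows "net k B w (Suc l) (S \<union> H)"
proof -
  have "finite S" using net_finite[OF assms(1)] S(1) finite_subset by blast
  moreover have "card (S \<union> H) \<le> w" using card_Un_le[of S H] H(3) by linarith
  moreover have "\<exists>h. aff_comb k B F h \<and> (\<forall>x\<in>unit_cube. f x = relu (h x))" if "f \<in> S \<union> H" for f
  proof (cases "f \<in> S")
    case True
    then have "aff_comb k B F f" using S by (intro aff_comb_mono[OF aff_comb_gen]) auto
    then show ?thesis using S(2) True by (intro exI[of _ f]) (auto simp: relu_nonneg)
  qed (use that H(4) in auto)
  ultimately show ?thesis using assms(1) H(1,2) by auto
qed

text \<open>The Boolean b runs two squarings in parallel, as polarization requires. Per channel a
  layer holds the tent iterate, its ReLU shifted by 1/2 and the partial sum, hence six neurons
  besides S. The coefficient bounds that occur are at most 7, which B \<ge> 8 covers.\<close>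

lemma net_square_step:
  fixes S :: "(real ^ 'd::finite \<Rightarrow> real) set"
  assumes S: "\<And>f x. f \<in> S \<Longrightarrow> x \<in> unit_cube \<Longrightarrow> 0 \<le> f x" and k: "3 \<le> k" "8 \<le> B" and w: "card S + 6 \<le> w"
    and y: "\<And>b x. x \<in> unit_cube \<Longrightarrow> 0 \<le> y b x \<and> y b x \<le> (1 :: real)"
  defines "G \<equiv> \<lambda>s. S \<union> ((\<lambda>b :: bool. \<lambda>x. (tent ^^ s) (y b x)) ` UNIV \<union> (\<lambda>b x. relu ((tent ^^ s) (y b x)
      - 1 / 2)) ` UNIV
      \<union> (\<lambda>b x. square_approx s (y b x)) ` UNIV)"
  assumes net0: "net k B w l (G 0)"
  shows "net k B w (l + s) (G s)"
proof (induction s)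
  case (Suc s)
  let ?g = "\<lambda>s (b :: bool) x. (tent ^^ s) (y b x)"
      and ?k = "\<lambda>s (b :: bool) x. relu ((tent ^^ s) (y b x) - 1 / 2)"
    and ?a = "\<lambda>s (b :: bool) x. square_approx s (y b x)"
  have U: "UNIV = {True, False}" by auto
  have t: "aff_comb 2 6 (G s) (\<lambda>x. ?g (Suc s) b x)" for b
  proof (rule aff_comb_cong)
    have "aff_comb (1 + 1) (\<bar>2\<bar> * 1 + \<bar>- 4\<bar> * 1) (G s) (\<lambda>x. 2 * ?g s b x + (- 4) * ?k s b x)"
      by (intro aff_comb_add aff_comb_scale aff_comb_gen) (auto simp: G_def)
    then show "aff_comb 2 6 (G s) (\<lambda>x. 2 * ?g s b x + (- 4) * ?k s b x)" by (simp add: numeral_eq_Suc)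
    fix x :: "real ^ 'd" assume "x \<in> unit_cube"
    then have "0 \<le> ?g s b x" using y tent_iter_range by blast
    then show "2 * ?g s b x + (- 4) * ?k s b x = ?g (Suc s) b x" by (simp add: tent_def relu_nonneg)
  qed
  have H: "\<exists>h. aff_comb k B (G s) h \<and> (\<forall>x\<in>unit_cube. f x = relu (h x))"
    if f: "f \<in> range (?g (Suc s)) \<union> range (?k (Suc s)) \<union> range (?a (Suc s))" for f
  proof -
    consider b where "f = ?g (Suc s) b" | b where "f = ?k (Suc s) b" | b where "f = ?a (Suc s) b"
      using f by auto
    then show ?thesis
    proof cases
      case 1
      have "aff_comb k B (G s) (?g (Suc s) b)" using k by (intro aff_comb_mono[OF t]) auto
      moreover have "0 \<le> ?g (Suc s) b x" if "x \<in> unit_cube" for x using y[OF that] tent_iter_range by blast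
      ultimately show ?thesis unfolding 1 by (intro exI[of _ "?g (Suc s) b"]) (simp add: relu_nonneg)
    next
      case 2
      have "aff_comb (2 + 0) (6 + 1 / 2) (G s) (\<lambda>x. ?g (Suc s) b x + (- 1 / 2))"
        by (intro aff_comb_add t aff_comb_const) simp
      then have "aff_comb k B (G s) (\<lambda>x. ?g (Suc s) b x + (- 1 / 2))" using k by (elim aff_comb_mono) auto
      then show ?thesis unfolding 2 by (intro exI[of _ "\<lambda>x. ?g (Suc s) b x + (- 1 / 2)"]) simp
    next
      case 3
      have "aff_comb (1 + 2) (1 + \<bar>- 1 / 4 ^ Suc s\<bar> * 6) (G s) (\<lambda>x. ?a s b x + (- 1 / 4 ^ Suc s)
          * ?g (Suc s) b x)"
        by (intro aff_comb_add aff_comb_scale t aff_comb_gen) (auto simp: G_def)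
      moreover have "\<bar>- 1 / 4 ^ Suc s\<bar> * 6 \<le> (6 :: real)" 
        using one_le_power[of "4 :: real" "Suc s"] by (simp add: divide_le_eq del: power_Suc)
      ultimately have "aff_comb k B (G s) (\<lambda>x. ?a s b x + (- 1 / 4 ^ Suc s) * ?g (Suc s) b x)"
        using k by (elim aff_comb_mono) auto
      moreover have "0 \<le> ?a (Suc s) b x" if "x \<in> unit_cube" for x using y[OF that] square_approx_bounds(3)
          by blast
      then have "\<forall>x\<in>unit_cube. ?a (Suc s) b x = relu (?a s b x + (- 1 / 4 ^ Suc s) * ?g (Suc s) b x)"
        by (simp add: relu_nonneg)
      ultimately show ?thesis unfolding 3 by blast
    qed
  qed
  have "card (range (?g (Suc s)) \<union> range (?k (Suc s)) \<union> range (?a (Suc s))) \<le> 2 + 2 + 2"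
    by (intro order_trans[OF card_Un_le] add_mono order_trans[OF card_image_le]) (auto simp: U)
  then have c: "card S + card (range (?g (Suc s)) \<union> range (?k (Suc s)) \<union> range (?a (Suc s))) \<le> w" using w
      by simp
  have "net k B w (Suc (l + s)) (S \<union> (range (?g (Suc s)) \<union> range (?k (Suc s)) \<union> range (?a (Suc s))))"
    using k by (intro net_extend[OF Suc] S H c) (auto simp: G_def)
  then show ?case by (simp only: G_def add_Suc_right)
qed (use net0 in simp)

text \<open>Polarization: p * q = ((p + q) / 2)^2 - ((p - q) / 2)^2. One layer forms the ReLUs of
  both signs, the next the absolute values, since squares are approximated on [0, 1] only, and T
  layers do the squaring. Both squares are overestimated by at most 1 / 4^(T + 1), so the errors do
  not add up, and the result stays in [-1, 1] for the next product. S is carried along as the supply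
  of further factors.\<close>

lemma net_product_step:
  fixes S :: "(real ^ 'd::finite \<Rightarrow> real) set"
  assumes net: "net k B w l F" and SF: "S \<subseteq> F" and S: "\<And>f x. f \<in> S \<Longrightarrow> x \<in> unit_cube \<Longrightarrow> 0 \<le> f x" "S \<noteq> {}"
    and k: "2 * k1 \<le> k" "2 \<le> k1" "B1 \<le> B" "2 \<le> B1" "8 \<le> B" and w: "card S + 6 \<le> w"
    and p: "aff_comb k1 B1 F p" "\<And>x. x \<in> unit_cube \<Longrightarrow> \<bar>p x\<bar> \<le> 1"
    and q: "aff_comb k1 B1 S q" "\<And>x. x \<in> unit_cube \<Longrightarrow> \<bar>q x\<bar> \<le> 1"
  shows "\<exists>F' p'. net k B w (l + (T + 2)) F' \<and> S \<subseteq> F' \<and> aff_comb k1 B1 F' p' \<and>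
    (\<forall>x\<in>unit_cube. \<bar>p' x\<bar> \<le> 1 \<and> \<bar>p' x - p x * q x\<bar> \<le> 1 / 4 ^ Suc T)"
proof -
  define u where "u b x = (p x + (if b then q x else - q x)) / 2" for b x
  define y where "y b x = \<bar>u b x\<bar>" for b x
  have y: "0 \<le> y b x \<and> y b x \<le> 1" if "x \<in> unit_cube" for b x
    using p(2)[OF that] q(2)[OF that] by (auto simp: y_def u_def abs_le_iff)
  have qF: "aff_comb k1 B1 F q" using q(1) SF by (elim aff_comb_mono) auto
  have us: "aff_comb k B F (\<lambda>x. \<sigma> * u b x)" if "\<bar>\<sigma>\<bar> = 1" for \<sigma> b
  proof -
    have "aff_comb (k1 + k1) (\<bar>\<sigma> / 2\<bar> * B1 + \<bar>if b then \<sigma> / 2 else - \<sigma> / 2\<bar> * B1) F (\<lambda>x. (\<sigma> / 2)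
        * p x + (if b then \<sigma> / 2 else - \<sigma> / 2) * q x)"
      by (intro aff_comb_add aff_comb_scale p qF)
    moreover have "\<bar>\<sigma> / 2\<bar> * B1 + \<bar>if b then \<sigma> / 2 else - \<sigma> / 2\<bar> * B1 = B1" using that by auto
    ultimately have "aff_comb (k1 + k1) B1 F (\<lambda>x. (\<sigma> / 2) * p x + (if b then \<sigma> / 2 else - \<sigma> / 2) * q x)" by simp
    then have "aff_comb k B F (\<lambda>x. (\<sigma> / 2) * p x + (if b then \<sigma> / 2 else - \<sigma> / 2) * q x)"
      using k by (elim aff_comb_mono) auto
    then show ?thesis by (rule aff_comb_cong) (auto simp: u_def field_simps)
  qed
  define R where "R = (\<lambda>(b, \<sigma>) x. relu (\<sigma> * u b x)) ` (UNIV \<times> {1, - 1 :: real})"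
  have UB: "UNIV = {True, False}" by auto
  have cardR: "card R \<le> 4"
    unfolding R_def by (rule order_trans[OF card_image_le]) (auto simp: UB card_cartesian_product)
  have net1: "net k B w (Suc l) (S \<union> R)"
  proof (rule net_extend[OF net SF])
    fix f assume "f \<in> R"
    then obtain b \<sigma> where "\<sigma> \<in> {1, - 1}" "f = (\<lambda>x. relu (\<sigma> * u b x))" by (auto simp: R_def)
    then show "\<exists>h. aff_comb k B F h \<and> (\<forall>x\<in>unit_cube. f x = relu (h x))"
      using us[of \<sigma> b] by (intro exI[of _ "\<lambda>x. \<sigma> * u b x"]) auto
  qed (use k S cardR w in \<open>auto simp: R_def\<close>)
  define G where "G s = S \<union> ((\<lambda>b :: bool. \<lambda>x. (tent ^^ s) (y b x)) ` UNIV \<union> (\<lambda>b x. relu ((tent ^^ s) (y b x)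
      - 1 / 2)) ` UNIV
      \<union> (\<lambda>b x. square_approx s (y b x)) ` UNIV)" for s
  have yc: "aff_comb 2 2 (S \<union> R) (y b)" for b
  proof (rule aff_comb_cong)
    have "aff_comb (1 + 1) (1 + 1) (S \<union> R) (\<lambda>x. relu (1 * u b x) + relu (- 1 * u b x))"
      by (intro aff_comb_add aff_comb_gen) (force simp: R_def)+
    then show "aff_comb 2 2 (S \<union> R) (\<lambda>x. relu (1 * u b x) + relu (- 1 * u b x))" by (simp add: numeral_eq_Suc)
  qed (simp add: relu_abs y_def)
  have net2: "net k B w (Suc (Suc l)) (G 0)"
    unfolding G_def
  proof (rule net_extend[OF net1])
    fix f assume "f \<in> range (\<lambda>b x. (tent ^^ 0) (y b x)) \<union> range (\<lambda>b x. relu ((tent ^^ 0) (y b x)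
        - 1 / 2)) \<union> range (\<lambda>b x. square_approx 0 (y b x))"
    then consider b where "f = y b" | b where "f = (\<lambda>x. relu (y b x - 1 / 2))" by auto
    then show "\<exists>h. aff_comb k B (S \<union> R) h \<and> (\<forall>x\<in>unit_cube. f x = relu (h x))"
    proof cases
      case 1
      have "aff_comb k B (S \<union> R) (y b)" using k by (intro aff_comb_mono[OF yc]) auto
      then show ?thesis unfolding 1 using y by (intro exI[of _ "y b"]) (simp add: relu_nonneg)
    next
      case 2
      have "aff_comb (2 + 0) (2 + 1 / 2) (S \<union> R) (\<lambda>x. y b x + (- 1 / 2))"
        by (intro aff_comb_add yc aff_comb_const) simp
      then have "aff_comb k B (S \<union> R) (\<lambda>x. y b x + (- 1 / 2))" using k by (elim aff_comb_mono) auto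
      then show ?thesis unfolding 2 by (intro exI[of _ "\<lambda>x. y b x + (- 1 / 2)"]) simp
    qed
  next
    have "card (range (\<lambda>b x. (tent ^^ 0) (y b x)) \<union> range (\<lambda>b x. relu ((tent ^^ 0) (y b x)
        - 1 / 2)) \<union> range (\<lambda>b x. square_approx 0 (y b x))) \<le> 2 + 2 + 2"
      by (intro order_trans[OF card_Un_le] add_mono order_trans[OF card_image_le]) (auto simp: UB)
    then show "card S + card (range (\<lambda>b x. (tent ^^ 0) (y b x)) \<union> range (\<lambda>b x. relu ((tent ^^ 0) (y b x)
        - 1 / 2)) \<union> range (\<lambda>b x. square_approx 0 (y b x))) \<le> w"
      using w by simp
  qed (use k S in auto)
  have "net k B w (Suc (Suc l) + T) (G T)"
    unfolding G_def by (rule net_square_step) (use S k w y net2 in \<open>auto simp: G_def\<close>)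
  then have net3: "net k B w (l + (T + 2)) (G T)" by (simp add: add.commute add.left_commute)
  define p' where "p' x = square_approx T (y True x) + (- 1) * square_approx T (y False x)" for x
  have "aff_comb (1 + 1) (1 + \<bar>- 1\<bar> * 1) (G T) p'"
    unfolding p'_def by (intro aff_comb_add aff_comb_scale aff_comb_gen) (auto simp: G_def)
  then have p'c: "aff_comb k1 B1 (G T) p'" using k by (elim aff_comb_mono) auto
  have "\<bar>p' x\<bar> \<le> 1 \<and> \<bar>p' x - p x * q x\<bar> \<le> 1 / 4 ^ Suc T" if x: "x \<in> unit_cube" for x
  proof -
    have "p x * q x = (y True x)\<^sup>2 - (y False x)\<^sup>2"
      by (simp add: y_def u_def power2_eq_square field_simps)
    then show ?thesis
      using square_approx_bounds[of "y True x" T] square_approx_bounds[of "y False x" T] y[OF x,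
          of True] y[OF x, of False]
      unfolding p'_def abs_le_iff by auto
  qed
  then show ?thesis using net3 p'c by (intro exI[of _ "G T"] exI[of _ p']) (auto simp: G_def)
qed

text \<open>Factors are multiplied in one at a time. All factors are bounded by 1, so earlier errors
  are not amplified and simply add up.\<close>

lemma net_product:
  fixes S :: "(real ^ 'd::finite \<Rightarrow> real) set"
  assumes net: "net k B w l S" and S: "\<And>f x. f \<in> S \<Longrightarrow> x \<in> unit_cube \<Longrightarrow> 0 \<le> f x"
    and k: "2 * k1 \<le> k" "2 \<le> k1" "B1 \<le> B" "2 \<le> B1" "8 \<le> B" and w: "card S + 6 \<le> w"
    and qs: "qs \<noteq> []" "\<And>q. q \<in> set qs \<Longrightarrow> aff_comb k1 B1 S q" "\<And>q x. q \<in> set qs \<Longrightarrow> x \<in> unit_cube \<Longrightarrow> \<bar>q x\<bar> \<le> 1"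
  shows "\<exists>F p. net k B w (l + (length qs - 1) * (T + 2)) F \<and> aff_comb k1 B1 F p \<and>
    (\<forall>x\<in>unit_cube. \<bar>p x - (\<Prod>q\<leftarrow>qs. q x)\<bar> \<le> real (length qs) / 4 ^ Suc T)"
proof -
  have "\<exists>F p. net k B w (l + (length qs - 1) * (T + 2)) F \<and> S \<subseteq> F \<and> aff_comb k1 B1 F p \<and>
    (\<forall>x\<in>unit_cube. \<bar>p x\<bar> \<le> 1 \<and> \<bar>p x - (\<Prod>q\<leftarrow>qs. q x)\<bar> \<le> real (length qs) / 4 ^ Suc T)"
    using qs
  proof (induction qs)
    case (Cons q qs)
    show ?case
    proof (cases "qs = []")
      case True
      then show ?thesis using net Cons.prems by (intro exI[of _ S] exI[of _ q]) auto
    next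
      case False
      obtain F p where F: "net k B w (l + (length qs - 1) * (T + 2)) F" "S \<subseteq> F" "aff_comb k1 B1 F p"
        "\<And>x. x \<in> unit_cube \<Longrightarrow> \<bar>p x\<bar> \<le> 1"
        "\<And>x. x \<in> unit_cube \<Longrightarrow> \<bar>p x - (\<Prod>q\<leftarrow>qs. q x)\<bar> \<le> real (length qs) / 4 ^ Suc T"
        using Cons.IH[OF False] Cons.prems by (auto simp del: power_Suc)
      have S0: "S \<noteq> {}" using net_finite[OF net] by auto
      have q: "aff_comb k1 B1 S q" "\<And>x. x \<in> unit_cube \<Longrightarrow> \<bar>q x\<bar> \<le> 1" using Cons.prems by auto
      have "\<exists>F' p'. net k B w (l + (length qs - 1) * (T + 2) + (T + 2)) F' \<and> S \<subseteq> F' \<and> aff_comb k1 B1 F' p' \<and>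
          (\<forall>x\<in>unit_cube. \<bar>p' x\<bar> \<le> 1 \<and> \<bar>p' x - p x * q x\<bar> \<le> 1 / 4 ^ Suc T)"
        by (rule net_product_step[OF F(1,2) _ S0 k w F(3,4) q]) (rule S)
      then obtain F' p' where F': "net k B w (l + (length qs - 1) * (T + 2) + (T + 2)) F'" "S \<subseteq> F'"
          "aff_comb k1 B1 F' p'"
        "\<And>x. x \<in> unit_cube \<Longrightarrow> \<bar>p' x\<bar> \<le> 1 \<and> \<bar>p' x - p x * q x\<bar> \<le> 1 / 4 ^ Suc T" by blast
      have level: "l + (length qs - 1) * (T + 2) + (T + 2) = l + (length (q # qs) - 1) * (T + 2)"
        using False by (cases qs) auto
      have err: "\<bar>p' x - (\<Prod>q\<leftarrow>q # qs. q x)\<bar> \<le> real (length (q # qs)) / 4 ^ Suc T" if x: "x \<in> unit_cube" for x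
      proof -
        let ?P = "\<Prod>q\<leftarrow>qs. q x"
        have "p' x - (\<Prod>q\<leftarrow>q # qs. q x) = (p' x - p x * q x) + q x * (p x - ?P)" by (simp add: algebra_simps)
        also have "\<bar>\<dots>\<bar> \<le> \<bar>p' x - p x * q x\<bar> + \<bar>q x\<bar> * \<bar>p x - ?P\<bar>"
          by (rule order_trans[OF abs_triangle_ineq]) (simp add: abs_mult)
        also have "\<dots> \<le> 1 / 4 ^ Suc T + 1 * (real (length qs) / 4 ^ Suc T)"
          using F'(4)[OF x] F(5)[OF x] q(2)[OF x] by (intro add_mono mult_mono) auto
        also have "\<dots> = real (length (q # qs)) / 4 ^ Suc T" by (simp add: add_divide_distrib del: power_Suc)
        finally show ?thesis .
      qed
      have "\<forall>x\<in>unit_cube. \<bar>p' x\<bar> \<le> 1 \<and> \<bar>p' x - (\<Prod>q\<leftarrow>q # qs. q x)\<bar> \<le> real (length (q # qs)) / 4 ^ Suc T"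
        using F'(4) err by blast
      then show ?thesis using F'(1)[unfolded level] F'(2,3) by blast
    qed
  qed simp
  then show ?thesis by blast
qed

section \<open>Piecewise polynomial interpolation on an interval\<close>

lemma poly_antiderivative:
  fixes Q :: "real poly"
  assumes "degree Q \<le> m"
  obtains P where "pderiv P = Q" "degree P \<le> Suc m" "poly P z = c"
proof -
  define P0 where "P0 = (\<Sum>i\<le>m. monom (coeff Q i / real (Suc i)) (Suc i))"
  have "pderiv P0 = (\<Sum>i\<le>m. monom (coeff Q i) i)"
    unfolding P0_def by (induction m) (simp_all add: pderiv_add pderiv_monom del: of_nat_Suc)
  also have "\<dots> = Q" using assms by (rule poly_as_sum_of_monoms')
  finally have "pderiv P0 = Q" .
  moreover have "degree P0 \<le> Suc m"
    unfolding P0_def by (intro degree_sum_le) (auto intro: order_trans[OF degree_monom_le])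
  ultimately show thesis
    by (intro that[of "P0 + [:c - poly P0 z:]"]) (auto simp: pderiv_add pderiv_pCons intro!: degree_add_le)
qed

text \<open>Taylor expansion with a Hoelder continuous highest derivative; the polynomial is found by
  integrating the one for the derivative.\<close>
lemma taylor_holder:
  fixes G :: "nat \<Rightarrow> real \<Rightarrow> real"
  assumes "\<And>k y. k < m \<Longrightarrow> y \<in> {z..t} \<Longrightarrow> (G k has_field_derivative G (Suc k) y) (at y within {z..t})"
    and "\<And>y. y \<in> {z..t} \<Longrightarrow> \<bar>G m y - G m z\<bar> \<le> (y - z) powr \<alpha>" and \<alpha>: "0 < \<alpha>"
  obtains P where "degree P \<le> m" "\<And>y. y \<in> {z..t} \<Longrightarrow> \<bar>G 0 y - poly P y\<bar> \<le> (y - z) ^ m * (y - z) powr \<alpha>"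
proof -
  have "\<exists>P. degree P \<le> m \<and> (\<forall>y\<in>{z..t}. \<bar>G 0 y - poly P y\<bar> \<le> (y - z) ^ m * (y - z) powr \<alpha>)"
    using assms(1,2)
  proof (induction m arbitrary: G)
    case 0
    then show ?case by (intro exI[of _ "[:G 0 z:]"]) auto
  next
    case (Suc m)
    have "\<exists>P. degree P \<le> m \<and> (\<forall>y\<in>{z..t}. \<bar>G (Suc 0) y - poly P y\<bar> \<le> (y - z) ^ m * (y - z) powr \<alpha>)"
      using Suc.IH[of "\<lambda>k. G (Suc k)"] Suc.prems by simp
    then obtain Q where Q: "degree Q \<le> m" "\<And>y. y \<in> {z..t} \<Longrightarrow>
        \<bar>G (Suc 0) y - poly Q y\<bar> \<le> (y - z) ^ m * (y - z) powr \<alpha>"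
      by blast
    obtain P where P: "pderiv P = Q" "degree P \<le> Suc m" "poly P z = G 0 z" using poly_antiderivative[OF Q(1)] .
    have "\<bar>G 0 y - poly P y\<bar> \<le> (y - z) ^ Suc m * (y - z) powr \<alpha>" if y: "y \<in> {z..t}" for y
    proof -
      have "norm ((G 0 y - poly P y) - (G 0 z - poly P z)) \<le> ((y - z) ^ m * (y - z) powr \<alpha>) * norm (y - z)"
      proof (rule field_differentiable_bound[of "{z..y}"])
        fix x assume x: "x \<in> {z..y}"
        have "((\<lambda>x. G 0 x - poly P x) has_field_derivative G (Suc 0) x - poly Q x) (at x within {z..t})"
          using Suc.prems(1)[of 0 x] x y P(1)
              by (auto intro!: derivative_eq_intros poly_DERIV[THEN DERIV_subset])
        then show "((\<lambda>x. G 0 x - poly P x) has_field_derivative G (Suc 0) x - poly Q x) (at x within {z..y})"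
          by (rule DERIV_subset) (use y in auto)
        have "norm (G (Suc 0) x - poly Q x) \<le> (x - z) ^ m * (x - z) powr \<alpha>" using Q(2)[of x] x y by simp
        also have "\<dots> \<le> (y - z) ^ m * (y - z) powr \<alpha>"
          using x \<alpha> by (intro mult_mono power_mono powr_mono2) auto
        finally show "norm (G (Suc 0) x - poly Q x) \<le> (y - z) ^ m * (y - z) powr \<alpha>" .
      qed (use y in auto)
      then show ?thesis using P(3) y by (simp add: mult_ac)
    qed
    then show ?case using P(2) by blast
  qed
  then show thesis using that by blast
qed

text \<open>Lagrange basis for the nodes k / (m + 1), k \<le> m, in [0, 1). Arguments up to 2 occur,
  because a hat function spans two cells.\<close>

definition lagrange :: "nat \<Rightarrow> nat \<Rightarrow> real \<Rightarrow> real" where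
  "lagrange m j w = (\<Prod>k\<in>{..m} - {j}. (w - real k / real (m + 1)) / (real j / real (m + 1)
      - real k / real (m + 1)))"

text \<open>Both sides are polynomials of degree at most m that agree at m + 1 nodes.\<close>

lemma lagrange_reproduces:
  assumes "degree P \<le> m"
  shows "poly P w = (\<Sum>j\<le>m. poly P (real j / real (m + 1)) * lagrange m j w)"
proof -
  let ?s = "\<lambda>k. real k / real (m + 1)"
  define L where "L j = (\<Prod>k\<in>{..m} - {j}. [:- ?s k / (?s j - ?s k), 1 / (?s j - ?s k):])" for j
  have L: "poly (L j) w = lagrange m j w" for j w
    unfolding L_def lagrange_def poly_prod by (intro prod.cong) (auto simp: diff_divide_distrib)
  have inj: "?s j = ?s k \<longleftrightarrow> j = k" for j k by (simp add: divide_cancel_right del: of_nat_add)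
  define Q where "Q = (\<Sum>j\<le>m. Polynomial.smult (poly P (?s j)) (L j))"
  have degL: "degree (L j) \<le> m" if "j \<le> m" for j
  proof -
    have "degree (L j) \<le> (\<Sum>k\<in>{..m} - {j}. degree [:- ?s k / (?s j - ?s k), 1 / (?s j - ?s k):])"
      unfolding L_def using degree_prod_sum_le[of "{..m} - {j}"
          "\<lambda>k. [:- ?s k / (?s j - ?s k), 1 / (?s j - ?s k):]"] by (simp add: comp_def)
    also have "\<dots> \<le> (\<Sum>k\<in>{..m} - {j}. 1)" by (intro sum_mono) (simp add: degree_pCons_le[THEN order_trans])
    also have "\<dots> = m" using that by simp
    finally show ?thesis .
  qed
  have degQ: "degree Q \<le> m"
    unfolding Q_def by (intro degree_sum_le) (auto intro: order_trans[OF degree_smult_le] degL)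
  have "P = Q"
  proof (rule poly_eqI_degree)
    fix x assume "x \<in> ?s ` {..m}"
    then obtain i where i: "i \<le> m" "x = ?s i" by auto
    have lag: "lagrange m j (?s i) = (if j = i then 1 else 0)" if "j \<le> m" for j
    proof (cases "j = i")
      case True
      have "lagrange m i (?s i) = (\<Prod>k\<in>{..m} - {i}. 1)"
        unfolding lagrange_def by (intro prod.cong) (use inj in \<open>auto simp del: of_nat_add\<close>)
      then show ?thesis using True by simp
    next
      case False
      then show ?thesis unfolding lagrange_def using i by (auto intro!: prod_zero bexI[of _ i])
    qed
    have "poly Q x = (\<Sum>j\<le>m. if j = i then poly P (?s j) else 0)"
      unfolding Q_def poly_sum poly_smult L i(2) by (intro sum.cong) (use lag in auto)
    then show "poly P x = poly Q x" using i by simp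
  next
    have "card (?s ` {..m}) = Suc m" using inj
        by (subst card_image) (auto simp: inj_on_def simp del: of_nat_add)
    then show "degree P < card (?s ` {..m})" "degree Q < card (?s ` {..m})" using assms degQ by auto
  qed
  then have "poly P w = poly Q w" by simp
  then show ?thesis by (simp only: Q_def poly_sum poly_smult L)
qed

lemma abs_lagrange_le:
  assumes "0 \<le> w" "w \<le> 2" "j \<le> m"
  shows "\<bar>lagrange m j w\<bar> \<le> (2 * real (m + 1)) ^ m"
proof -
  have "\<bar>lagrange m j w\<bar> = (\<Prod>k\<in>{..m} - {j}. \<bar>(w - real k / real (m + 1)) / (real j / real (m + 1)
      - real k / real (m + 1))\<bar>)"
    unfolding lagrange_def by (rule abs_prod)
  also have "\<dots> \<le> (\<Prod>k\<in>{..m} - {j}. 2 * real (m + 1))"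
  proof (rule prod_mono)
    fix k assume k: "k \<in> {..m} - {j}"
    have s: "0 \<le> real k / real (m + 1)" "real k / real (m + 1) \<le> 1" using k by auto
    have "1 \<le> \<bar>real j - real k\<bar>" using k by (auto simp: abs_if)
    then have "1 / real (m + 1) \<le> \<bar>real j / real (m + 1) - real k / real (m + 1)\<bar>"
      by (simp add: divide_right_mono flip: diff_divide_distrib)
    moreover have "\<bar>w - real k / real (m + 1)\<bar> \<le> 2" 
      unfolding abs_le_iff using s assms by linarith
    ultimately have "\<bar>(w - real k / real (m + 1)) / (real j / real (m + 1) - real k / real (m + 1))\<bar> \<le>
        2 / (1 / real (m + 1))"
      unfolding abs_divide by (intro frac_le) auto
    then show "0 \<le> \<bar>(w - real k / real (m + 1)) / (real j / real (m + 1) - real k / real (m + 1))\<bar> \<and>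
      \<bar>(w - real k / real (m + 1)) / (real j / real (m + 1) - real k / real (m + 1))\<bar> \<le> 2 * real (m + 1)"
          by simp
  qed
  also have "\<dots> = (2 * real (m + 1)) ^ m" using assms(3) by (simp add: card_Diff_singleton)
  finally show ?thesis .
qed

section \<open>Hat functions and local interpolation\<close>

definition hat :: "real \<Rightarrow> real" where
  "hat t = max 0 (1 - \<bar>t\<bar>)"

lemma sum_hat: "0 \<le> x \<Longrightarrow> x \<le> real N \<Longrightarrow> (\<Sum>\<nu>\<le>N. hat (x - real \<nu>)) = 1"
proof (induction N)
  case (Suc N)
  show ?case
  proof (cases "x \<le> real N")
    case True
    then show ?thesis using Suc by (simp add: hat_def)
  next
    case False
    have "(\<Sum>\<nu><N. hat (x - real \<nu>)) = 0"
      using False by (intro sum.neutral ballI) (auto simp: hat_def)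
    then have "(\<Sum>\<nu>\<le>N. hat (x - real \<nu>)) = hat (x - real N)" by (simp flip: lessThan_Suc_atMost)
    then show ?thesis using False Suc.prems by (simp add: hat_def)
  qed
qed (simp add: hat_def)

text \<open>Interpolation nodes and basis functions are indexed by \<open>(\<nu>, j)\<close> with \<open>\<nu> \<le> N\<close> and \<open>j \<le> m\<close>. The
  truncated subtraction makes the cell of \<open>\<nu> = 0\<close> start at \<open>0\<close>.\<close>
definition node :: "nat \<Rightarrow> nat \<Rightarrow> nat \<times> nat \<Rightarrow> real" where
  "node N m = (\<lambda>(\<nu>, j). (real (\<nu> - 1) + real j / real (m + 1)) / real N)"

definition basis_fun :: "nat \<Rightarrow> nat \<Rightarrow> nat \<times> nat \<Rightarrow> real \<Rightarrow> real" where
  "basis_fun N m = (\<lambda>(\<nu>, j) t. hat (real N * t - real \<nu>) * lagrange m j (real N * t - real (\<nu> - 1)))"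

definition index_set :: "nat \<Rightarrow> nat \<Rightarrow> (nat \<times> nat) set" where
  "index_set N m = {..N} \<times> {..m}"

lemma finite_index_set [simp]: "finite (index_set N m)"
  by (simp add: index_set_def)

lemma card_index_set: "card (index_set N m) = (N + 1) * (m + 1)"
  by (simp add: index_set_def card_cartesian_product)

lemma node_range:
  assumes "N \<ge> 1" "a \<in> index_set N m"
  shows "0 \<le> node N m a" "node N m a \<le> 1"
proof -
  obtain \<nu> j where a: "a = (\<nu>, j)" "\<nu> \<le> N" "j \<le> m" using assms by (auto simp: index_set_def)
  have j: "real j / real (m + 1) \<le> 1" using a by simp
  have "real (\<nu> - 1) \<le> real N - 1" using a assms(1) by linarith
  then have "real (\<nu> - 1) + real j / real (m + 1) \<le> real N" using j by linarith
  then show "0 \<le> node N m a" "node N m a \<le> 1" using a assms(1) by (auto simp: node_def divide_le_eq)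
qed

text \<open>The hat at \<nu> lives strictly between \<nu> - 1 and \<nu> + 1, so the local coordinate
  lies in [0, 2]. At \<nu> = 0 the truncated subtraction starts the cell at 0, which is where t
  \<ge> 0 enters.\<close>

lemma hat_support:
  assumes "N \<ge> 1" "0 \<le> t" "hat (real N * t - real \<nu>) \<noteq> 0"
  shows "0 \<le> real N * t - real (\<nu> - 1)" "real N * t - real (\<nu> - 1) \<le> 2"
proof -
  have "\<bar>real N * t - real \<nu>\<bar> < 1" using assms(3) by (auto simp: hat_def max_def split: if_splits)
  then show "0 \<le> real N * t - real (\<nu> - 1)" "real N * t - real (\<nu> - 1) \<le> 2"
    using assms by (cases \<nu>; auto)+
qed

text \<open>A bound for the Lebesgue constant of the local interpolation on [0, 2]: m + 1 basis
  polynomials, each at most (2 * (m + 1))^m.\<close>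

definition leb_const :: "nat \<Rightarrow> real" where
  "leb_const m = real (m + 1) * (2 * real (m + 1)) ^ m"

lemma leb_const_ge_1: "1 \<le> leb_const m"
proof -
  have "1 * 1 \<le> leb_const m" unfolding leb_const_def by (intro mult_mono one_le_power) auto
  then show ?thesis by simp
qed

lemma sum_basis_fun_le:
  assumes N: "N \<ge> 1" and t: "0 \<le> t" "t \<le> 1"
  shows "(\<Sum>a\<in>index_set N m. \<bar>basis_fun N m a t\<bar>) \<le> leb_const m"
proof -
  have "(\<Sum>a\<in>index_set N m. \<bar>basis_fun N m a t\<bar>) =
      (\<Sum>\<nu>\<le>N. \<Sum>j\<le>m. hat (real N * t - real \<nu>) * \<bar>lagrange m j (real N * t - real (\<nu> - 1))\<bar>)"
    unfolding index_set_def sum.cartesian_product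
        by (intro sum.cong) (auto simp: basis_fun_def abs_mult hat_def)
  also have "\<dots> \<le> (\<Sum>\<nu>\<le>N. \<Sum>j\<le>m. hat (real N * t - real \<nu>) * (2 * real (m + 1)) ^ m)"
  proof (intro sum_mono)
    fix \<nu> j assume "\<nu> \<in> {..N}" "j \<in> {..m}"
    show "hat (real N * t - real \<nu>) * \<bar>lagrange m j (real N * t - real (\<nu> - 1))\<bar> \<le>
        hat (real N * t - real \<nu>) * (2 * real (m + 1)) ^ m"
    proof (cases "hat (real N * t - real \<nu>) = 0")
      case False
      then show ?thesis using hat_support[OF N t(1) False] \<open>j \<in> {..m}\<close>
        by (intro mult_left_mono abs_lagrange_le) (auto simp: hat_def)
    qed simp
  qed
  also have "\<dots> = (\<Sum>\<nu>\<le>N. hat (real N * t - real \<nu>) * leb_const m)"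
    by (intro sum.cong) (simp_all add: leb_const_def mult_ac)
  also have "\<dots> = (\<Sum>\<nu>\<le>N. hat (real N * t - real \<nu>)) * leb_const m"
    by (rule sum_distrib_right[symmetric])
  also have "(\<Sum>\<nu>\<le>N. hat (real N * t - real \<nu>)) = 1"
    using t by (intro sum_hat) (auto simp: mult_left_le)
  finally show ?thesis by simp
qed

text \<open>Local interpolation reproduces the Taylor polynomial of the cell, so only the Taylor
  remainder is interpolated, at the cost of the factor 1 + \<open>leb_const m\<close>. The hats
  average the local interpolants with weights summing to 1; this glues them continuously without
  enlarging the error.\<close>

lemma interpolation_error:
  fixes G :: "nat \<Rightarrow> real \<Rightarrow> real"
  assumes N: "N \<ge> 1" and t: "0 \<le> t" "t \<le> 1" and \<alpha>: "0 < \<alpha>"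
    and G: "\<And>k y. k < m \<Longrightarrow> y \<in> {0..1} \<Longrightarrow> (G k has_field_derivative G (Suc k) y) (at y within {0..1})"
    and H: "\<And>x y. x \<in> {0..1} \<Longrightarrow> y \<in> {0..1} \<Longrightarrow> \<bar>G m x - G m y\<bar> \<le> \<bar>x - y\<bar> powr \<alpha>"
  shows "\<bar>G 0 t - (\<Sum>a\<in>index_set N m. G 0 (node N m a) * basis_fun N m a t)\<bar> \<le>
      (1 + leb_const m) * (2 / real N) powr (real m + \<alpha>)"
proof -
  define e where "e = (2 / real N) powr (real m + \<alpha>)"
  define h where "h \<nu> = hat (real N * t - real \<nu>)" for \<nu>
  define g where "g \<nu> = (\<Sum>j\<le>m. G 0 (node N m (\<nu>, j)) * lagrange m j (real N * t - real (\<nu> - 1)))" for \<nu>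
  have h0: "0 \<le> h \<nu>" for \<nu> by (simp add: h_def hat_def)
  have h1: "(\<Sum>\<nu>\<le>N. h \<nu>) = 1" unfolding h_def using t by (intro sum_hat) (auto simp: mult_left_le)
  have cell: "\<bar>G 0 t - g \<nu>\<bar> \<le> (1 + leb_const m) * e" if \<nu>: "\<nu> \<le> N" "h \<nu> \<noteq> 0" for \<nu>
  proof -
    define z where "z = real (\<nu> - 1) / real N"
    have w: "0 \<le> real N * t - real (\<nu> - 1)" "real N * t - real (\<nu> - 1) \<le> 2"
      using hat_support[OF N t(1)] \<nu>(2) by (auto simp: h_def)
    have "real (\<nu> - 1) \<le> real N - 1" using \<nu>(1) N by linarith
    then have z: "0 \<le> z" "z \<le> 1" using N by (auto simp: z_def divide_le_eq)
    have tz: "z \<le> t" "t - z \<le> 2 / real N"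
    proof -
      have "t - z = (real N * t - real (\<nu> - 1)) / real N" using N by (simp add: z_def diff_divide_distrib)
      then have "0 \<le> t - z \<and> t - z \<le> 2 / real N" using w N by (simp add: divide_right_mono)
      then show "z \<le> t" "t - z \<le> 2 / real N" by auto
    qed
    obtain P where P: "degree P \<le> m" "\<And>y. y \<in> {z..1} \<Longrightarrow> \<bar>G 0 y - poly P y\<bar> \<le> (y - z) ^ m * (y - z) powr \<alpha>"
    proof (rule taylor_holder[of m z 1 G \<alpha>])
      fix k y assume "k < m" "y \<in> {z..1}"
      then show "(G k has_field_derivative G (Suc k) y) (at y within {z..1})"
        using z by (intro DERIV_subset[OF G]) auto
    next
      fix y assume "y \<in> {z..1}"
      then show "\<bar>G m y - G m z\<bar> \<le> (y - z) powr \<alpha>" using H[of y z] z by auto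
    qed (use \<alpha> in auto)
    have R: "\<bar>G 0 y - poly P y\<bar> \<le> e" if y: "z \<le> y" "y \<le> 1" "y - z \<le> 2 / real N" for y
    proof -
      have "\<bar>G 0 y - poly P y\<bar> \<le> (y - z) ^ m * (y - z) powr \<alpha>" using P(2) y by simp
      also have "\<dots> \<le> (2 / real N) ^ m * (2 / real N) powr \<alpha>"
        using y \<alpha> by (intro mult_mono power_mono powr_mono2) auto
      also have "\<dots> = e" using N by (simp add: e_def powr_add powr_realpow)
      finally show ?thesis .
    qed
    \<comment> \<open>P in the local coordinate of the cell, so that reproduction from the nodes k /
      (m + 1) applies.\<close>
    define Q where "Q = pcompose P [:z, 1 / real N:]"
    have "degree Q \<le> m" unfolding Q_def
      by (rule order_trans[OF degree_pcompose_le]) (use P(1) in \<open>auto intro: order_trans[OF mult_le_mono2[of _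
          1]]\<close>)
    note rep = lagrange_reproduces[OF this, of "real N * t - real (\<nu> - 1)"]
    have "poly P t = (\<Sum>j\<le>m. poly P (node N m (\<nu>, j)) * lagrange m j (real N * t - real (\<nu> - 1)))"
    proof -
      have Q: "poly Q s = poly P (z + s / real N)" for s by (simp add: Q_def poly_pcompose)
      have "z + (real N * t - real (\<nu> - 1)) / real N = t" using N by (simp add: z_def diff_divide_distrib)
      moreover have "z + (real j / real (m + 1)) / real N = node N m (\<nu>, j)" for j
        by (simp add: node_def z_def add_divide_distrib)
      ultimately show ?thesis using rep by (simp only: Q)
    qed
    then have eq: "G 0 t - g \<nu> = (G 0 t - poly P t) - (\<Sum>j\<le>m. (G 0 (node N m (\<nu>, j)) - poly P (node N m (\<nu>, j)))
        * lagrange m j (real N * t - real (\<nu> - 1)))"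
      by (simp add: g_def left_diff_distrib sum_subtractf)
    have 1: "\<bar>G 0 t - poly P t\<bar> \<le> e" using R tz t by simp
    have 2: "\<bar>\<Sum>j\<le>m. (G 0 (node N m (\<nu>, j)) - poly P (node N m (\<nu>, j)))
        * lagrange m j (real N * t - real (\<nu> - 1))\<bar> \<le> (\<Sum>j\<le>m. e * (2 * real (m + 1)) ^ m)"
    proof (intro order_trans[OF sum_abs] sum_mono)
      fix j assume j: "j \<in> {..m}"
      have nd: "node N m (\<nu>, j) = z + real j / real (m + 1) / real N"
        by (simp add: node_def z_def add_divide_distrib)
      have "real j / real (m + 1) \<le> 1" using j by simp
      then have "real j / real (m + 1) \<le> 2" by linarith
      then have "real j / real (m + 1) / real N \<le> 2 / real N" by (rule divide_right_mono) simp
      moreover have "node N m (\<nu>, j) \<le> 1" using node_range[of N "(\<nu>, j)" m] N \<nu> j by (simp add: index_set_def)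
      moreover have "0 \<le> real j / real (m + 1) / real N" by simp
      ultimately have "\<bar>G 0 (node N m (\<nu>, j)) - poly P (node N m (\<nu>, j))\<bar> \<le> e" by (intro R) (auto simp: nd)
      moreover have "\<bar>lagrange m j (real N * t - real (\<nu> - 1))\<bar> \<le> (2 * real (m + 1)) ^ m"
        using w j by (intro abs_lagrange_le) auto
      ultimately show "\<bar>(G 0 (node N m (\<nu>, j)) - poly P (node N m (\<nu>, j)))
          * lagrange m j (real N * t - real (\<nu> - 1))\<bar> \<le> e * (2 * real (m + 1)) ^ m"
        unfolding abs_mult by (intro mult_mono) auto
    qed
    have "\<bar>G 0 t - g \<nu>\<bar> \<le> e + (\<Sum>j\<le>m. e * (2 * real (m + 1)) ^ m)"
      unfolding eq by (rule order_trans[OF abs_triangle_ineq4 add_mono[OF 1 2]])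
    also have "\<dots> = (1 + leb_const m) * e" by (simp add: leb_const_def algebra_simps)
    finally show ?thesis .
  qed
  have "(\<Sum>a\<in>index_set N m. G 0 (node N m a) * basis_fun N m a t) = (\<Sum>\<nu>\<le>N. h \<nu> * g \<nu>)"
    unfolding index_set_def g_def h_def sum_distrib_left sum.cartesian_product
    by (intro sum.cong) (auto simp: basis_fun_def)
  moreover have "G 0 t = (\<Sum>\<nu>\<le>N. h \<nu> * G 0 t)" using h1 by (simp flip: sum_distrib_right)
  ultimately have "G 0 t - (\<Sum>a\<in>index_set N m. G 0 (node N m a) * basis_fun N m a t) =
      (\<Sum>\<nu>\<le>N. h \<nu> * (G 0 t - g \<nu>))"
    by (simp add: right_diff_distrib sum_subtractf)
  also have "\<bar>\<dots>\<bar> \<le> (\<Sum>\<nu>\<le>N. h \<nu> * ((1 + leb_const m) * e))"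
  proof (intro order_trans[OF sum_abs] sum_mono)
    fix \<nu> assume "\<nu> \<in> {..N}"
    then show "\<bar>h \<nu> * (G 0 t - g \<nu>)\<bar> \<le> h \<nu> * ((1 + leb_const m) * e)"
      using cell[of \<nu>] h0[of \<nu>] by (cases "h \<nu> = 0") (auto simp: abs_mult intro!: mult_left_mono)
  qed
  also have "\<dots> = (1 + leb_const m) * e" using h1 by (simp flip: sum_distrib_right)
  finally show ?thesis by (simp add: e_def)
qed

section \<open>Tensor product interpolation\<close>

lemma cont_diff_partial_deriv_iter:
  "cont_diff (k + m) f \<Longrightarrow> cont_diff m ((partial_deriv i ^^ k) f)"
proof (induction k arbitrary: f)
  case (Suc k)
  then show ?case using Suc.IH[of "partial_deriv i f"] by (simp add: funpow_swap1)
qed simp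

definition set_coord :: "'d::finite \<Rightarrow> real \<Rightarrow> real ^ 'd \<Rightarrow> real ^ 'd" where
  "set_coord i t x = (\<chi> j. if j = i then t else vec_nth x j)"

lemma set_coord_cube: "x \<in> unit_cube \<Longrightarrow> 0 \<le> t \<Longrightarrow> t \<le> 1 \<Longrightarrow> set_coord i t x \<in> unit_cube"
  by (auto simp: set_coord_def mem_box_cart)

lemma partial_deriv_line:
  fixes f :: "real ^ 'd::finite \<Rightarrow> real"
  assumes f: "\<forall>x\<in>unit_cube. f differentiable (at x within unit_cube)" and x: "x \<in> unit_cube" and t: "t \<in> {0..1}"
  shows "((\<lambda>t. f (set_coord i t x)) has_field_derivative partial_deriv i f (set_coord i t x)) (at t within
      {0..1})"
proof -
  have line: "set_coord i s x = x + (s - vec_nth x i) *\<^sub>R axis i 1" for s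
    by (auto simp: set_coord_def Finite_Cartesian_Product.vec_eq_iff axis_def)
  define f' where "f' = frechet_derivative f (at (set_coord i t x) within unit_cube)"
  have f': "(f has_derivative f') (at (set_coord i t x) within unit_cube)"
    using f set_coord_cube[OF x] t unfolding f'_def by (simp add: frechet_derivative_works)
  have "((\<lambda>s. set_coord i s x) has_derivative (\<lambda>h. h *\<^sub>R axis i 1)) (at t within {0..1})"
    unfolding line by (auto intro!: derivative_eq_intros)
  moreover have "(f has_derivative f') (at (set_coord i t x) within ((\<lambda>s. set_coord i s x) ` {0..1}))"
    using f' by (rule has_derivative_subset) (auto intro!: set_coord_cube x)
  ultimately have "((\<lambda>s. f (set_coord i s x)) has_derivative (\<lambda>h. f' (h *\<^sub>R axis i 1))) (at t within {0..1})"
    by (rule has_derivative_in_compose)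
  moreover have "f' (h *\<^sub>R axis i 1) = h * partial_deriv i f (set_coord i t x)" for h
    using has_derivative_linear[OF f'] by (simp add: linear_cmul partial_deriv_def f'_def)
  ultimately show ?thesis by (simp add: has_field_derivative_def mult.commute[of _ "partial_deriv i f
      (set_coord i t x)"])
qed

text \<open>Along a line parallel to an axis the derivatives of f are its pure partial derivatives,
  so the one-dimensional estimate applies with \<open>G k\<close> the k-th of them.\<close>

lemma holder_ball_line_interpolation:
  fixes f :: "real ^ 'd::finite \<Rightarrow> real"
  assumes f: "f \<in> holder_ball m \<alpha>" and \<alpha>: "0 < \<alpha>" and N: "N \<ge> 1" and x: "x \<in> unit_cube" and t: "0 \<le> t" "t \<le> 1"
  shows "\<bar>f (set_coord i t x) - (\<Sum>a\<in>index_set N m. f (set_coord i (node N m a) x) * basis_fun N m a t)\<bar>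
    \<le> (1 + leb_const m) * (2 / real N) powr (real m + \<alpha>)"
proof -
  define G where "G k s = (partial_deriv i ^^ k) f (set_coord i s x)" for k s
  have "\<bar>G 0 t - (\<Sum>a\<in>index_set N m. G 0 (node N m a) * basis_fun N m a t)\<bar> \<le>
      (1 + leb_const m) * (2 / real N) powr (real m + \<alpha>)"
  proof (rule interpolation_error[OF N t \<alpha>])
    fix k y assume k: "k < m" and y: "y \<in> {0..1::real}"
    have "cont_diff (Suc (m - Suc k)) ((partial_deriv i ^^ k) f)"
      using holder_ballD(1)[OF f] k by (intro cont_diff_partial_deriv_iter) simp
    then show "(G k has_field_derivative G (Suc k) y) (at y within {0..1})"
      unfolding G_def using partial_deriv_line[of "(partial_deriv i ^^ k) f" x y i] x y by simp
  next
    fix s y :: real assume sy: "s \<in> {0..1}" "y \<in> {0..1}"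
    have "set_coord i s x - set_coord i y x = (s - y) *\<^sub>R axis i 1"
      by (auto simp: set_coord_def Finite_Cartesian_Product.vec_eq_iff axis_def)
    then have "norm (set_coord i s x - set_coord i y x) = \<bar>s - y\<bar>" by simp
    then show "\<bar>G m s - G m y\<bar> \<le> \<bar>s - y\<bar> powr \<alpha>"
      using holder_ballD(4)[OF f set_coord_cube[OF x] set_coord_cube[OF x], of s y i i i] sy
          by (simp add: G_def)
  qed
  then show ?thesis by (simp add: G_def)
qed

definition set_coords :: "('d::finite \<Rightarrow> real) \<Rightarrow> 'd set \<Rightarrow> real ^ 'd \<Rightarrow> real ^ 'd" where
  "set_coords y U x = (\<chi> i. if i \<in> U then y i else vec_nth x i)"

text \<open>Coordinates are interpolated one after the other. Passing from U to
  \<open>insert i U\<close> interpolates f itself along coordinate i, at points whose other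
  coordinates are nodes or coordinates of x, so the smoothness of partial interpolants is never an
  issue. The weights of the coordinates already treated have absolute sum at most a power of
  \<open>leb_const m\<close>.\<close>

lemma holder_ball_interpolation:
  fixes f :: "real ^ 'd::finite \<Rightarrow> real"
  assumes f: "f \<in> holder_ball m \<alpha>" and \<alpha>: "0 < \<alpha>" and N: "N \<ge> 1" and x: "x \<in> unit_cube"
  shows "\<bar>f x - (\<Sum>a\<in>PiE UNIV (\<lambda>_. index_set N m). f (\<chi> i. node N m (a i))
      * (\<Prod>i\<in>UNIV. basis_fun N m (a i) (vec_nth x i)))\<bar>
    \<le> real CARD('d) * (leb_const m ^ CARD('d) * ((1 + leb_const m) * (2 / real N) powr (real m + \<alpha>)))"
proof -
  define e where "e = (1 + leb_const m) * (2 / real N) powr (real m + \<alpha>)"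
  define I where "I U = (\<Sum>a\<in>PiE U (\<lambda>_. index_set N m). f (set_coords (\<lambda>i. node N m (a i)) U x)
      * (\<Prod>i\<in>U. basis_fun N m (a i) (vec_nth x i)))" for U
  have e0: "0 \<le> e" using leb_const_ge_1[of m] by (simp add: e_def)
  have x01: "0 \<le> vec_nth x i" "vec_nth x i \<le> 1" for i using x by (auto simp: mem_box_cart)
  have "\<bar>f x - I U\<bar> \<le> real (card U) * (leb_const m ^ CARD('d) * e)" for U
  proof (induction U rule: finite_induct[OF finite])
    case 1
    \<comment> \<open>The empty product has exactly one index, whose values are never
      consulted.\<close>
    have "set_coords (\<lambda>i. node N m (undefined i)) {} x = x" for undefined by (simp add: set_coords_def)
    then show ?case by (simp add: I_def)
  next
    case (2 i U)
    define F where "F a = f (set_coords (\<lambda>i. node N m (a i)) U x)" for a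
    define b where "b a = (\<Prod>i\<in>U. basis_fun N m (a i) (vec_nth x i))" for a
    have upd: "set_coords (\<lambda>k. node N m ((a(i := c)) k)) (insert i U) x =
        set_coord i (node N m c) (set_coords (\<lambda>k. node N m (a k)) U x)" for a c
      by (auto simp: set_coords_def set_coord_def Finite_Cartesian_Product.vec_eq_iff)
    have bupd: "(\<Prod>k\<in>insert i U. basis_fun N m ((a(i := c)) k) (vec_nth x k)) =
        basis_fun N m c (vec_nth x i) * b a" for a c
    proof -
      have "(\<Prod>k\<in>U. basis_fun N m ((a(i := c)) k) (vec_nth x k)) = b a"
        unfolding b_def using 2 by (intro prod.cong) auto
      then show ?thesis using 2 by simp
    qed
    have "I (insert i U) = (\<Sum>(c, a)\<in>index_set N m \<times> PiE U (\<lambda>_. index_set N m).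
        f (set_coord i (node N m c) (set_coords (\<lambda>k. node N m (a k)) U x)) * (basis_fun N m c (vec_nth x i)
            * b a))"
      unfolding I_def PiE_insert_eq
      by (subst sum.reindex[OF inj_combinator[OF 2(2)]])
        (auto intro!: sum.cong simp: upd bupd simp del: fun_upd_apply)
    also have "\<dots> = (\<Sum>a\<in>PiE U (\<lambda>_. index_set N m). b a * (\<Sum>c\<in>index_set N m.
        f (set_coord i (node N m c) (set_coords (\<lambda>k. node N m (a k)) U x)) * basis_fun N m c (vec_nth x i)))"
      unfolding sum.cartesian_product[symmetric]
      by (subst sum.swap) (simp add: sum_distrib_left mult_ac)
    finally have I1: "I (insert i U) = (\<Sum>a\<in>PiE U (\<lambda>_. index_set N m). b a * (\<Sum>c\<in>index_set N m.
        f (set_coord i (node N m c) (set_coords (\<lambda>k. node N m (a k)) U x)) * basis_fun N m c (vec_nth x i)))" .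
    have "\<bar>I U - I (insert i U)\<bar> = \<bar>\<Sum>a\<in>PiE U (\<lambda>_. index_set N m). b a * (F a - (\<Sum>c\<in>index_set N m.
        f (set_coord i (node N m c) (set_coords (\<lambda>k. node N m (a k)) U x)) * basis_fun N m c (vec_nth x i)))\<bar>"
      unfolding I1 by (simp add: I_def F_def b_def sum_subtractf right_diff_distrib mult_ac)
    also have "\<dots> \<le> (\<Sum>a\<in>PiE U (\<lambda>_. index_set N m). \<bar>b a\<bar> * e)"
    proof (intro order_trans[OF sum_abs] sum_mono)
      fix a assume a: "a \<in> PiE U (\<lambda>_. index_set N m)"
      define x' where "x' = set_coords (\<lambda>k. node N m (a k)) U x"
      have x': "x' \<in> unit_cube"
        using x01 node_range[OF N] a by (auto simp: x'_def set_coords_def mem_box_cart PiE_iff)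
      have "set_coord i (vec_nth x i) x' = x'" using 2(2)
          by (auto simp: set_coord_def x'_def set_coords_def Finite_Cartesian_Product.vec_eq_iff)
      then have "\<bar>F a - (\<Sum>c\<in>index_set N m. f (set_coord i (node N m c) x') * basis_fun N m c (vec_nth x i))\<bar> \<le>
          e"
        using holder_ball_line_interpolation[OF f \<alpha> N x' x01(1)[of i] x01(2)[of i], of i]
            by (simp add: F_def x'_def[symmetric] e_def)
      then show "\<bar>b a * (F a - (\<Sum>c\<in>index_set N m. f (set_coord i (node N m c) (set_coords (\<lambda>k. node N m (a k))
          U x)) * basis_fun N m c (vec_nth x i)))\<bar> \<le> \<bar>b a\<bar> * e"
        unfolding abs_mult x'_def[symmetric] by (intro mult_left_mono) auto
    qed
    also have "\<dots> = (\<Prod>i\<in>U. \<Sum>c\<in>index_set N m. \<bar>basis_fun N m c (vec_nth x i)\<bar>) * e"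
      unfolding b_def sum_distrib_right[symmetric] abs_prod by (subst prod_sum_PiE) auto
    also have "\<dots> \<le> leb_const m ^ card U * e"
    proof -
      have "(\<Prod>i\<in>U. \<Sum>c\<in>index_set N m. \<bar>basis_fun N m c (vec_nth x i)\<bar>) \<le> (\<Prod>i\<in>U. leb_const m)"
        using sum_basis_fun_le[OF N x01] by (intro prod_mono) (auto intro: sum_nonneg)
      then show ?thesis using e0 by (intro mult_right_mono) auto
    qed
    also have "\<dots> \<le> leb_const m ^ CARD('d) * e"
      using e0 leb_const_ge_1 by (intro mult_right_mono power_increasing card_mono) auto
    finally show ?case using 2 by (simp add: algebra_simps)
  qed
  from this[of UNIV] show ?thesis by (simp add: I_def set_coords_def e_def)
qed

section \<open>Approximation of the Hoelder ball by networks\<close>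

text \<open>Product networks need factors in [-1, 1]. The factors of a Lagrange polynomial are
  therefore scaled to half the distance from a node, and the constants split off are collected here,
  to be put into the output weights.\<close>

definition basis_scale :: "nat \<Rightarrow> nat \<Rightarrow> real" where
  "basis_scale m j = (\<Prod>k\<in>{..m} - {j}. 2 / (real j / real (m + 1) - real k / real (m + 1)))"

text \<open>The local variable of cell \<open>\<nu>\<close>, clamped to the interval \<open>[0, 2]\<close>.\<close>
definition cell_coord :: "nat \<Rightarrow> nat \<Rightarrow> real \<Rightarrow> real" where
  "cell_coord N \<nu> t = relu (real N * t - real (\<nu> - 1)) - relu (real N * t - (real (\<nu> - 1) + 2))"

definition node_factor :: "nat \<Rightarrow> nat \<Rightarrow> nat \<Rightarrow> nat \<Rightarrow> real \<Rightarrow> real" where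
  "node_factor N m \<nu> k t = (cell_coord N \<nu> t - real k / real (m + 1)) / 2"

definition hat_factor :: "nat \<Rightarrow> nat \<Rightarrow> real \<Rightarrow> real" where
  "hat_factor N \<nu> t = hat (real N * t - real \<nu>)"

lemma abs_basis_scale_le:
  assumes "j \<le> m"
  shows "\<bar>basis_scale m j\<bar> \<le> (2 * real (m + 1)) ^ m"
proof -
  have "\<bar>basis_scale m j\<bar> = (\<Prod>k\<in>{..m} - {j}. \<bar>2 / (real j / real (m + 1) - real k / real (m + 1))\<bar>)"
    unfolding basis_scale_def by (rule abs_prod)
  also have "\<dots> \<le> (\<Prod>k\<in>{..m} - {j}. 2 * real (m + 1))"
  proof (rule prod_mono)
    fix k assume k: "k \<in> {..m} - {j}"
    have "1 \<le> \<bar>real j - real k\<bar>" using k by (auto simp: abs_if)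
    then have "1 / real (m + 1) \<le> \<bar>real j / real (m + 1) - real k / real (m + 1)\<bar>"
      by (simp add: divide_right_mono flip: diff_divide_distrib)
    then have "\<bar>2 / (real j / real (m + 1) - real k / real (m + 1))\<bar> \<le> 2 / (1 / real (m + 1))"
      unfolding abs_divide by (intro frac_le) auto
    then show "0 \<le> \<bar>2 / (real j / real (m + 1) - real k / real (m + 1))\<bar> \<and>
      \<bar>2 / (real j / real (m + 1) - real k / real (m + 1))\<bar> \<le> 2 * real (m + 1)" by simp
  qed
  also have "\<dots> = (2 * real (m + 1)) ^ m" using assms by (simp add: card_Diff_singleton)
  finally show ?thesis .
qed

text \<open>Where the hat is nonzero the clamp is inactive and the factors are those of the Lagrange
  polynomial; elsewhere both sides vanish. The clamp bounds the factors far from the cell, where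
  they would otherwise grow with N.\<close>

lemma basis_fun_factors:
  assumes "N \<ge> 1" "0 \<le> t"
  shows "basis_fun N m (\<nu>, j) t = basis_scale m j * (hat_factor N \<nu> t * (\<Prod>k\<in>{..m} - {j}. node_factor N m \<nu> k
      t))"
proof (cases "hat_factor N \<nu> t = 0")
  case False
  define w where "w = real N * t - real (\<nu> - 1)"
  have "0 \<le> w" "w \<le> 2" using hat_support[OF assms, of \<nu>] False by (auto simp: hat_factor_def w_def)
  then have c: "cell_coord N \<nu> t = w" by (simp add: cell_coord_def relu_def w_def)
  have "lagrange m j w = basis_scale m j * (\<Prod>k\<in>{..m} - {j}. node_factor N m \<nu> k t)"
  proof -
    have eq: "2 / x * (y / 2) = y / x" for x y :: real by simp
    show ?thesis unfolding lagrange_def basis_scale_def prod.distrib[symmetric] node_factor_def c eq ..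
  qed
  then show ?thesis by (simp add: basis_fun_def hat_factor_def w_def)
qed (simp add: basis_fun_def hat_factor_def)

lemma hat_factor_range: "0 \<le> hat_factor N \<nu> t" "hat_factor N \<nu> t \<le> 1"
  by (auto simp: hat_factor_def hat_def)

lemma node_factor_range:
  assumes "k \<le> m"
  shows "\<bar>node_factor N m \<nu> k t\<bar> \<le> 1"
proof -
  define c where "c = cell_coord N \<nu> t"
  define \<sigma> where "\<sigma> = real k / real (m + 1)"
  have c: "0 \<le> c" "c \<le> 2" by (auto simp: c_def cell_coord_def relu_def)
  have \<sigma>: "0 \<le> \<sigma>" "\<sigma> \<le> 1" using assms by (auto simp: \<sigma>_def)
  have eq: "node_factor N m \<nu> k t = (c - \<sigma>) / 2" by (simp add: node_factor_def c_def \<sigma>_def)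
  show ?thesis unfolding eq by (rule abs_leI) (use c \<sigma> in auto)
qed

text \<open>The kinks of five first-layer neurons: 0, 1, 2 belong to the hat, 3 and 4 to the clamp.
  At \<nu> = 0 the left kink of the hat is at -1, by real subtraction, whereas the cell starts at
  0.\<close>

definition offset :: "nat \<Rightarrow> nat \<Rightarrow> real" where
  "offset \<nu> k = (if k = 0 then real \<nu> - 1 else if k = 1 then real \<nu> else if k = 2 then real \<nu> + 1
     else if k = 3 then real (\<nu> - 1) else real (\<nu> - 1) + 2)"

text \<open>Each coordinate contributes m + 1 factors, one hat and m node factors, all affine
  combinations of its five first-layer neurons. The largest combination is the hat, a second
  difference with coefficients 1, -2, 1, which explains 3 and 4; the fan-in 6 is twice 3, for sums
  of two such combinations.\<close>

lemma net_basis_product: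
  fixes a :: "'d::finite \<Rightarrow> nat \<times> nat"
  assumes a: "\<And>i. a i \<in> index_set N m" and N: "N \<ge> 1" and B: "8 \<le> B" "2 * real N + 2 \<le> B"
  shows "\<exists>F p. net 6 B (5 * CARD('d) + 6) (1 + (CARD('d) * (m + 1) - 1) * (T + 2)) F \<and> aff_comb 3 4 F p \<and>
    (\<forall>x\<in>unit_cube. \<bar>p x - (\<Prod>i\<in>UNIV. hat_factor N (fst (a i)) (vec_nth x i) *
       (\<Prod>k\<in>{..m} - {snd (a i)}. node_factor N m (fst (a i)) k (vec_nth x i)))\<bar> \<le>
           real (CARD('d) * (m + 1)) / 4 ^ Suc T)"
proof -
  have a': "fst (a i) \<le> N" "snd (a i) \<le> m" for i using a[of i] by (auto simp: index_set_def)
  define s where "s = (\<lambda>(i, k) (x :: real ^ 'd). relu (real N * vec_nth x i - offset (fst (a i)) k))"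
  define S where "S = s ` (UNIV \<times> {..<5})"
  have s_in: "s (i, k) \<in> S" if "k < 5" for i k using that by (auto simp: S_def)
  have cardS: "card S \<le> 5 * CARD('d)"
    unfolding S_def by (rule order_trans[OF card_image_le]) (auto simp: card_cartesian_product)
  have net1: "net 6 B (5 * CARD('d) + 6) 1 S"
  proof -
    have "\<exists>h. aff_comb 6 B (range (\<lambda>i x. vec_nth x i)) h \<and> (\<forall>x\<in>unit_cube. f x = relu (h x))" if fS: "f \<in> S"
        for f
    proof -
      obtain i k where f: "f = s (i, k)" using fS by (auto simp: S_def)
      define c where "c = offset (fst (a i)) k"
      have c: "\<bar>c\<bar> \<le> real N + 2" using a'(1)[of i] by (auto simp: c_def offset_def)
      have "aff_comb (1 + 0) (\<bar>real N\<bar> * 1 + (real N + 2)) (range (\<lambda>i x. vec_nth x i)) (\<lambda>x :: real ^ 'd. real N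
          * vec_nth x i + (- c))"
        using c by (intro aff_comb_add aff_comb_scale aff_comb_gen aff_comb_const) auto
      then have "aff_comb 6 B (range (\<lambda>i x. vec_nth x i)) (\<lambda>x :: real ^ 'd. real N * vec_nth x i + (- c))"
        using B by (elim aff_comb_mono) auto
      then show ?thesis by (intro exI[of _ "\<lambda>x. real N * vec_nth x i + (- c)"]) (auto simp: f s_def c_def)
    qed
    moreover have "s (undefined, 0) \<in> S" by (rule s_in) simp
    then have "S \<noteq> {}" by blast
    moreover have "finite S" by (simp add: S_def)
    moreover have "card S \<le> 5 * CARD('d) + 6" using cardS by simp
    ultimately show ?thesis by simp
  qed
  have S0: "0 \<le> f x" if "f \<in> S" for f x using that by (auto simp: S_def s_def relu_def)
  define hf where "hf i x = hat_factor N (fst (a i)) (vec_nth x i)" for i and x :: "real ^ 'd"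
  define nf where "nf i k x = node_factor N m (fst (a i)) k (vec_nth x i)" for i k and x :: "real ^ 'd"
  have hfc: "aff_comb 3 4 S (hf i)" for i
  proof (rule aff_comb_cong)
    have "aff_comb (1 + (1 + 1)) (1 + (\<bar>- 2\<bar> * 1 + 1)) S (\<lambda>x. s (i, 0) x + (- 2 * s (i, 1) x + s (i, 2) x))"
      by (intro aff_comb_add aff_comb_scale aff_comb_gen s_in) auto
    then show "aff_comb 3 4 S (\<lambda>x. s (i, 0) x + (- 2 * s (i, 1) x + s (i, 2) x))"
      by (elim aff_comb_mono) auto
    show "s (i, 0) x + (- 2 * s (i, 1) x + s (i, 2) x) = hf i x" for x
      by (simp add: s_def hf_def hat_factor_def hat_def offset_def relu_def max_def abs_if)
  qed
  have nfc: "aff_comb 3 4 S (nf i k)" if "k \<le> m" for i k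
  proof (rule aff_comb_cong)
    have "real k / real (m + 1) \<le> 1" using that by simp
    then have "\<bar>- (real k / real (m + 1) / 2)\<bar> \<le> 1 / 2" by simp
    then have "aff_comb (1 + (1 + 0)) (\<bar>1 / 2\<bar> * 1 + (\<bar>- 1 / 2\<bar> * 1 + 1 / 2)) S
        (\<lambda>x. 1 / 2 * s (i, 3) x + (- 1 / 2 * s (i, 4) x + (- (real k / real (m + 1) / 2))))"
      by (intro aff_comb_add aff_comb_scale aff_comb_gen aff_comb_const s_in) auto
    then show "aff_comb 3 4 S (\<lambda>x. 1 / 2 * s (i, 3) x + (- 1 / 2 * s (i, 4) x + (- (real k / real (m + 1)
        / 2))))"
      by (elim aff_comb_mono) auto
    show "1 / 2 * s (i, 3) x + (- 1 / 2 * s (i, 4) x + (- (real k / real (m + 1) / 2))) = nf i k x" for x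
      by (simp add: s_def nf_def node_factor_def cell_coord_def offset_def diff_divide_distrib)
  qed
  obtain cs :: "'d list" where cs: "set cs = UNIV" "distinct cs"
      using finite_distinct_list[OF finite_class.finite_UNIV] by blast
  define ks where "ks i = filter (\<lambda>k. k \<noteq> snd (a i)) [0..<m + 1]" for i
  have ks: "set (ks i) = {..m} - {snd (a i)}" "distinct (ks i)" for i by (auto simp: ks_def)
  have lks: "length (ks i) = m" for i
    using distinct_card[OF ks(2)[of i]] ks(1)[of i] a'(2)[of i] by (simp add: card_Diff_singleton)
  define qs where "qs = concat (map (\<lambda>i. hf i # map (nf i) (ks i)) cs)"
  have lenqs: "length qs = CARD('d) * (m + 1)"
  proof -
    have "length qs = (\<Sum>i\<leftarrow>cs. m + 1)" by (simp add: qs_def length_concat comp_def lks)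
    also have "\<dots> = CARD('d) * (m + 1)" using distinct_card[OF cs(2)] cs(1) by (simp add: sum_list_triv)
    finally show ?thesis .
  qed
  have prod_concat: "(\<Prod>q\<leftarrow>concat (map (\<lambda>i. hf i # map (nf i) (ks i)) cs'). q x) =
      (\<Prod>i\<leftarrow>cs'. hf i x * (\<Prod>k\<leftarrow>ks i. nf i k x))" for cs' x
    by (induction cs') (auto simp: comp_def mult.assoc)
  have qs_prod: "(\<Prod>q\<leftarrow>qs. q x) = (\<Prod>i\<in>UNIV. hf i x * (\<Prod>k\<in>{..m} - {snd (a i)}. nf i k x))" for x
  proof -
    have ks_prod: "(\<Prod>k\<leftarrow>ks i. nf i k x) = (\<Prod>k\<in>{..m} - {snd (a i)}. nf i k x)" for i
      using ks by (metis prod.distinct_set_conv_list)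
    have cs_prod: "(\<Prod>i\<leftarrow>cs. g i) = (\<Prod>i\<in>UNIV. g i)" for g :: "'d \<Rightarrow> real"
      using cs by (metis prod.distinct_set_conv_list)
    show ?thesis unfolding qs_def prod_concat ks_prod cs_prod ..
  qed
  have "qs \<noteq> []" using lenqs by auto
  moreover have "aff_comb 3 4 S q" if "q \<in> set qs" for q
    using that hfc nfc ks(1) by (auto simp: qs_def)
  moreover have "\<bar>q x\<bar> \<le> 1" if "q \<in> set qs" for q x
  proof -
    consider i where "q = hf i" | i k where "q = nf i k" "k \<le> m" using \<open>q \<in> set qs\<close> ks(1) by (auto simp: qs_def)
    then show ?thesis
    proof cases
      case 1
      then show ?thesis using hat_factor_range[of N "fst (a i)" "vec_nth x i"] by (simp add: hf_def)
    next
      case 2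
      then show ?thesis using node_factor_range[OF 2(2)] by (simp add: nf_def)
    qed
  qed
  ultimately have "\<exists>F p. net 6 B (5 * CARD('d) + 6) (1 + (length qs - 1) * (T + 2)) F \<and> aff_comb 3 4 F p \<and>
    (\<forall>x\<in>unit_cube. \<bar>p x - (\<Prod>q\<leftarrow>qs. q x)\<bar> \<le> real (length qs) / 4 ^ Suc T)"
  proof (intro net_product[OF net1])
    show "0 \<le> f x" if "f \<in> S" for f x using S0[OF that] .
    show "card S + 6 \<le> 5 * CARD('d) + 6" using cardS by simp
  qed (use B in auto)
  then show ?thesis unfolding lenqs qs_prod by (simp only: hf_def nf_def)
qed

text \<open>All J product networks run side by side and only the output layer mixes them, so its
  large fan-in enters the count once. Its weights are node values of f times the collected scales.
  The error splits into the interpolation error and J * \<kappa> times the error of one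
  product.\<close>

lemma holder_ball_network:
  fixes f :: "real ^ 'd::finite \<Rightarrow> real"
  assumes f: "f \<in> holder_ball m \<alpha>" and \<alpha>: "0 < \<alpha>" and N: "N \<ge> 1"
  defines "J \<equiv> ((N + 1) * (m + 1)) ^ CARD('d)" and "\<kappa> \<equiv> ((2 * real (m + 1)) ^ m) ^ CARD('d)"
      and "D \<equiv> CARD('d) * (m + 1)"
  assumes B: "8 \<le> B" "2 * real N + 2 \<le> B" "4 * real J * \<kappa> \<le> B"
  shows "\<exists>W. valid_weights W \<and> length W = Suc (1 + (D - 1) * (T + 2)) \<and> d_in W = CARD('d) \<and> d_out W = 1 \<and>
    weights_l0 W \<le> (1 + (D - 1) * (T + 2)) * (J * (5 * CARD('d) + 6) * 7) + (J * 3 + 1) \<and>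
        weights_linf W \<le> 2 * B \<and>
    (\<forall>x\<in>unit_cube. \<bar>f x - vec_index (realization W (to_vec x)) 0\<bar> \<le>
      real CARD('d) * (leb_const m ^ CARD('d) * ((1 + leb_const m) * (2 / real N) powr (real m + \<alpha>))) +
      real J * \<kappa> * real D / 4 ^ Suc T)"
proof -
  define P where "P = PiE (UNIV :: 'd set) (\<lambda>_. index_set N m)"
  have P: "finite P" "card P = J" "P \<noteq> {}"
    by (auto simp: P_def card_PiE card_index_set J_def finite_PiE index_set_def PiE_eq_empty_iff)
  define pr where "pr a x = (\<Prod>i\<in>UNIV. hat_factor N (fst (a i)) (vec_nth x i) *
       (\<Prod>k\<in>{..m} - {snd (a i)}. node_factor N m (fst (a i)) k (vec_nth x i)))" for a and x :: "real ^ 'd"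
  define l where "l = 1 + (D - 1) * (T + 2)"
  have "\<exists>F p. net 6 B (5 * CARD('d) + 6) l F \<and> aff_comb 3 4 F p \<and>
      (\<forall>x\<in>unit_cube. \<bar>p x - pr a x\<bar> \<le> real D / 4 ^ Suc T)"
    if "a \<in> P" for a
    unfolding pr_def D_def l_def using that by (intro net_basis_product N B) (auto simp: P_def)
  then obtain F p where F: "\<And>a. a \<in> P \<Longrightarrow> net 6 B (5 * CARD('d) + 6) l (F a)"
    and p: "\<And>a. a \<in> P \<Longrightarrow> aff_comb 3 4 (F a) (p a)"
    and err: "\<And>a x. a \<in> P \<Longrightarrow> x \<in> unit_cube \<Longrightarrow> \<bar>p a x - pr a x\<bar> \<le> real D / 4 ^ Suc T"
    by metis
  define c where "c a = f (\<chi> i. node N m (a i)) * (\<Prod>i\<in>UNIV. basis_scale m (snd (a i)))" for a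
  have c: "\<bar>c a\<bar> \<le> \<kappa>" if a: "a \<in> P" for a
  proof -
    have ai: "a i \<in> index_set N m" for i using a by (auto simp: P_def)
    then have aj: "snd (a i) \<le> m" for i by (cases "a i") (metis index_set_def mem_Sigma_iff atMost_iff snd_conv)
    have "(\<chi> i. node N m (a i)) \<in> unit_cube" using node_range[OF N ai] by (auto simp: mem_box_cart)
    then have "\<bar>f (\<chi> i. node N m (a i))\<bar> \<le> 1" using holder_ballD(3)[OF f] by blast
    moreover have "\<bar>\<Prod>i\<in>UNIV. basis_scale m (snd (a i))\<bar> \<le> (\<Prod>i\<in>(UNIV :: 'd set). (2 * real (m + 1)) ^ m)"
      unfolding abs_prod using aj by (intro prod_mono conjI abs_basis_scale_le) auto
    ultimately have "\<bar>c a\<bar> \<le> 1 * (\<Prod>i\<in>(UNIV :: 'd set). (2 * real (m + 1)) ^ m)"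
      unfolding c_def abs_mult by (intro mult_mono) auto
    then show ?thesis by (simp add: \<kappa>_def)
  qed
  have \<kappa>0: "0 \<le> \<kappa>" by (simp add: \<kappa>_def)
  define g where "g x = (\<Sum>a\<in>P. c a * p a x)" for x
  have "net 6 B (card P * (5 * CARD('d) + 6)) l (\<Union>a\<in>P. F a)" using P F by (intro net_UN)
  then have netF: "net 6 B (J * (5 * CARD('d) + 6)) l (\<Union>a\<in>P. F a)" by (simp add: P)
  have "aff_comb (card P * 3) (real (card P) * (\<kappa> * 4)) (\<Union>a\<in>P. F a) g"
    unfolding g_def
  proof (rule aff_comb_sum[OF P(1)])
    fix a assume a: "a \<in> P"
    have "aff_comb 3 (\<bar>c a\<bar> * 4) (F a) (\<lambda>x. c a * p a x)" by (rule aff_comb_scale[OF p[OF a]])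
    then show "aff_comb 3 (\<kappa> * 4) (\<Union>a\<in>P. F a) (\<lambda>x. c a * p a x)" using c[OF a] a by (elim aff_comb_mono) auto
  qed
  then have "aff_comb (J * 3) B (\<Union>a\<in>P. F a) g"
    using B(3) by (elim aff_comb_mono) (auto simp: P mult_ac)
  then obtain W where W: "valid_weights W" "length W = Suc l" "d_in W = CARD('d)" "d_out W = length [g]"
    "weights_l0 W \<le> l * (J * (5 * CARD('d) + 6) * (6 + 1)) + length [g] * (J * 3 + 1)" "weights_linf W \<le> 2 * B"
    "\<forall>x\<in>unit_cube. realization W (to_vec x) = Matrix.vec (length [g]) (\<lambda>i. ([g] ! i) x)"
    using net_realization[OF netF, of "[g]" "J * 3"] by auto
  have "\<bar>f x - g x\<bar> \<le> real CARD('d) * (leb_const m ^ CARD('d) * ((1 + leb_const m)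
      * (2 / real N) powr (real m + \<alpha>))) +
      real J * \<kappa> * real D / 4 ^ Suc T" if x: "x \<in> unit_cube" for x
  proof -
    have x0: "0 \<le> vec_nth x i" for i using x by (auto simp: mem_box_cart)
    have cp: "c a * pr a x = f (\<chi> i. node N m (a i)) * (\<Prod>i\<in>UNIV. basis_fun N m (a i) (vec_nth x i))" for a
    proof -
      have "(\<Prod>i\<in>UNIV. basis_fun N m (a i) (vec_nth x i)) = (\<Prod>i\<in>UNIV. basis_scale m (snd (a i))) * pr a x"
        unfolding pr_def prod.distrib[symmetric]
      proof (rule prod.cong)
        fix i
        show "basis_fun N m (a i) (vec_nth x i) =
            basis_scale m (snd (a i)) * (hat_factor N (fst (a i)) (vec_nth x i) *
            (\<Prod>k\<in>{..m} - {snd (a i)}. node_factor N m (fst (a i)) k (vec_nth x i)))"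
          using basis_fun_factors[OF N x0[of i], of m "fst (a i)" "snd (a i)"] by simp
      qed simp
      then show ?thesis by (simp add: c_def)
    qed
    have 1: "\<bar>f x - (\<Sum>a\<in>P. c a * pr a x)\<bar> \<le> real CARD('d) * (leb_const m ^ CARD('d) * ((1 + leb_const m)
        * (2 / real N) powr (real m + \<alpha>)))"
      unfolding cp P_def by (rule holder_ball_interpolation[OF f \<alpha> N x])
    have "\<bar>(\<Sum>a\<in>P. c a * pr a x) - g x\<bar> = \<bar>\<Sum>a\<in>P. c a * (pr a x - p a x)\<bar>"
      by (simp add: g_def sum_subtractf right_diff_distrib)
    also have "\<dots> \<le> (\<Sum>a\<in>P. \<kappa> * (real D / 4 ^ Suc T))"
    proof (intro order_trans[OF sum_abs] sum_mono)
      fix a assume a: "a \<in> P"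
      show "\<bar>c a * (pr a x - p a x)\<bar> \<le> \<kappa> * (real D / 4 ^ Suc T)"
        unfolding abs_mult using c[OF a] err[OF a x] \<kappa>0 by (intro mult_mono) (auto simp: abs_minus_commute)
    qed
    also have "\<dots> = real J * \<kappa> * real D / 4 ^ Suc T" by (simp add: P)
    finally show ?thesis using 1 by linarith
  qed
  then show ?thesis using W by (intro exI[of _ W]) (auto simp: l_def)
qed

text \<open>With about n^q cells per axis, q = t / r, the interpolation error is of order n^-t,
  while the number of product networks is of order n^(q d) with q d < 1. Each has size and depth of
  order ln n, so for large n the total size stays below n and the depth below the cube of 1 + ln
  n.\<close>

lemma NN_approximates:
  fixes \<alpha> t :: real
  assumes \<alpha>: "0 < \<alpha>" and t: "0 < t" "t < (real m + \<alpha>) / real CARD('d)"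
  shows "\<exists>C>0. \<forall>n\<ge>1. \<forall>f \<in> holder_ball m \<alpha>. \<exists>g \<in> NN 3 n. \<forall>x \<in> unit_cube.
    \<bar>f x - g (x :: real ^ 'd::finite)\<bar> \<le> C * real n powr - t"
proof -
  define r where "r = real m + \<alpha>"
  define d where "d = CARD('d)"
  define D where "D = d * (m + 1)"
  define \<kappa> where "\<kappa> = ((2 * real (m + 1)) ^ m) ^ d"
  define \<Lambda> where "\<Lambda> = real d * (leb_const m ^ d * (1 + leb_const m))"
  define q where "q = t / r"
  define cJ where "cJ = (2 * real (m + 1)) ^ d"
  have r: "r > 0" and d: "d \<ge> 1" using \<alpha> by (auto simp: r_def d_def Suc_le_eq)
  have D1: "D \<ge> 1" using d by (simp add: D_def Suc_le_eq)
  have \<kappa>0: "0 \<le> \<kappa>" and \<Lambda>0: "0 \<le> \<Lambda>" and cJ: "0 \<le> cJ"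
    using leb_const_ge_1[of m] by (auto simp: \<kappa>_def \<Lambda>_def cJ_def)
  have qd: "0 < q" "q * real d < 1"
    using t r d by (auto simp: q_def r_def d_def field_simps)
  then have q1: "q < 1" using d by (metis less_trans linorder_not_less mult_left_le_one_le mult_le_cancel_left1
      nle_le of_nat_1 of_nat_le_iff order_le_less_trans)
  define NN' where "NN' n = nat \<lfloor>real n powr q\<rfloor>" for n :: nat
  \<comment> \<open>Makes 4^-T at most n^-(t + 2), which meets the rate n^-t even after
    multiplication by the number of summands, itself at most of order n.\<close>
  define T where "T n = nat \<lceil>(t + 2) * ln (real n)\<rceil>" for n :: nat
  define J where "J n = ((NN' n + 1) * (m + 1)) ^ d" for n
  define C1 where "C1 = \<Lambda> * 4 powr r + cJ * \<kappa> * real D"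
  have N1: "NN' n \<ge> 1" "real (NN' n) \<le> real n powr q" "real n powr q \<le> 2 * real (NN' n)" if n: "n \<ge> 1" for n
  proof -
    have "1 \<le> real n powr q" using n qd by (intro ge_one_powr_ge_zero) auto
    then have "1 \<le> \<lfloor>real n powr q\<rfloor>" by simp
    then show 1: "NN' n \<ge> 1" by (simp add: NN'_def le_nat_iff)
    show "real (NN' n) \<le> real n powr q" unfolding NN'_def by (rule of_nat_floor) simp
    have "real n powr q < real (NN' n) + 1" unfolding NN'_def by linarith
    then show "real n powr q \<le> 2 * real (NN' n)" using 1 by linarith
  qed
  have Jle: "real (J n) \<le> cJ * real n powr (q * real d)" if n: "n \<ge> 1" for n
  proof -
    have "real (J n) = (real (NN' n + 1) * real (m + 1)) ^ d"
      by (simp only: J_def of_nat_power of_nat_mult)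
    also have "\<dots> \<le> ((2 * real n powr q) * real (m + 1)) ^ d"
      using N1[OF n] by (intro power_mono mult_right_mono) auto
    also have "\<dots> = cJ * (real n powr q) ^ d" 
      by (simp only: cJ_def power_mult_distrib[symmetric] mult_ac)
    also have "(real n powr q) ^ d = real n powr (q * real d)"
      using n by (simp add: powr_powr flip: powr_realpow)
    finally show ?thesis .
  qed
  have Tle: "real (T n) \<le> (t + 2) * ln (real n) + 1" "(t + 2) * ln (real n) \<le> real (T n)" if n: "n \<ge> 1" for n
  proof -
    have "0 \<le> (t + 2) * ln (real n)" using n t by simp
    then show "real (T n) \<le> (t + 2) * ln (real n) + 1" "(t + 2) * ln (real n) \<le> real (T n)"
      unfolding T_def by linarith+
  qed
  have ev: "eventually (\<lambda>n::nat. 8 \<le> real n \<and> 2 * real n powr q + 2 \<le> real n \<and>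
      4 * (cJ * real n powr (q * real d)) * \<kappa> \<le> real n \<and>
      real D * ((t + 2) * ln (real n) + 3) + 2 \<le> (1 + ln (real n)) ^ 3 \<and>
      (real D * ((t + 2) * ln (real n) + 3) + 1) * (cJ * real n powr (q * real d) * (7 * (5 * real d + 6)))
          + (cJ * real n powr (q * real d) * 3 + 1) \<le> real n) sequentially"
  proof (intro eventually_conj)
    define s where "s = q * real d"
    define D' where "D' = real D"
    define e where "e = 7 * (5 * real d + 6)"
    have s: "0 < s" "s < 1" and D': "0 < D'" and e: "0 < e" using qd d D1 by (auto simp: s_def D'_def e_def)
    have cJ0: "0 < cJ" and \<kappa>p: "0 < \<kappa>" by (auto simp: cJ_def \<kappa>_def)
    show "\<forall>\<^sub>F n::nat in sequentially. 8 \<le> real n" by real_asymp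
    show "\<forall>\<^sub>F n::nat in sequentially. 2 * real n powr q + 2 \<le> real n" using qd q1 by real_asymp
    show "\<forall>\<^sub>F n::nat in sequentially. 4 * (cJ * real n powr (q * real d)) * \<kappa> \<le> real n"
      unfolding s_def[symmetric] using s cJ0 \<kappa>p by real_asymp
    show "\<forall>\<^sub>F n::nat in sequentially. real D * ((t + 2) * ln (real n) + 3) + 2 \<le> (1 + ln (real n)) ^ 3"
      unfolding D'_def[symmetric] using t D' by real_asymp
    show "\<forall>\<^sub>F n::nat in sequentially. (real D * ((t + 2) * ln (real n) + 3) + 1)
        * (cJ * real n powr (q * real d) * (7 * (5 * real d + 6))) + (cJ * real n powr (q * real d) * 3 + 1) \<le>
        real n"
      unfolding D'_def[symmetric] s_def[symmetric] e_def[symmetric] using t D' s e cJ0 by real_asymp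
  qed
  obtain n0 where n0: "\<And>n. n \<ge> n0 \<Longrightarrow> 8 \<le> real n \<and> 2 * real n powr q + 2 \<le> real n \<and>
      4 * (cJ * real n powr (q * real d)) * \<kappa> \<le> real n \<and>
      real D * ((t + 2) * ln (real n) + 3) + 2 \<le> (1 + ln (real n)) ^ 3 \<and>
      (real D * ((t + 2) * ln (real n) + 3) + 1) * (cJ * real n powr (q * real d) * (7 * (5 * real d + 6)))
          + (cJ * real n powr (q * real d) * 3 + 1) \<le> real n"
    using ev unfolding eventually_sequentially by blast
  \<comment> \<open>The second term covers n < n0, where the zero network has error at most
    1.\<close>
  define C where "C = max C1 (real (n0 + 1) powr t)"
  have C0: "0 < C" unfolding C_def by (intro less_max_iff_disj[THEN iffD2] disjI2) simp
  have "\<exists>g \<in> NN 3 n. \<forall>x \<in> unit_cube. \<bar>f x - g x\<bar> \<le> C * real n powr - t"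
    if n: "n \<ge> 1" and f: "f \<in> holder_ball m \<alpha>" for n and f :: "real ^ 'd \<Rightarrow> real"
  proof (cases "n \<ge> n0")
    case False
    have "\<bar>f x - 0\<bar> \<le> C * real n powr - t" if x: "x \<in> unit_cube" for x
    proof -
      have "real n powr t \<le> real (n0 + 1) powr t" using False t by (intro powr_mono2) auto
      then have "1 \<le> real (n0 + 1) powr t * real n powr - t" using n by (simp add: powr_minus field_simps)
      also have "\<dots> \<le> C * real n powr - t" by (intro mult_right_mono) (auto simp: C_def)
      finally show ?thesis using holder_ballD(3)[OF f x] by simp
    qed
    then show ?thesis by (intro bexI[OF _ zero_in_NN[OF n]]) auto
  next
    case True
    note E = n0[OF True]
    have N: "NN' n \<ge> 1" by (rule N1(1)[OF n])
    have B: "8 \<le> real n" "2 * real (NN' n) + 2 \<le> real n" "4 * real (J n) * \<kappa> \<le> real n"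
    proof -
      show "2 * real (NN' n) + 2 \<le> real n" using N1(2)[OF n] E by linarith
      have "4 * real (J n) * \<kappa> \<le> 4 * (cJ * real n powr (q * real d)) * \<kappa>"
        using Jle[OF n] \<kappa>0 by (intro mult_right_mono mult_left_mono) auto
      then show "4 * real (J n) * \<kappa> \<le> real n" using E by linarith
    qed (use E in auto)
    obtain W where W: "valid_weights W" "length W = Suc (1 + (D - 1) * (T n + 2))" "d_in W = d" "d_out W = 1"
      "weights_l0 W \<le> (1 + (D - 1) * (T n + 2)) * (J n * (5 * d + 6) * 7) + (J n * 3 + 1)"
          "weights_linf W \<le> 2 * real n"
      "\<forall>x\<in>unit_cube. \<bar>f x - vec_index (realization W (to_vec x)) 0\<bar> \<le>
        real d * (leb_const m ^ d * ((1 + leb_const m) * (2 / real (NN' n)) powr (real m + \<alpha>))) + real (J n)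
            * \<kappa> * real D / 4 ^ Suc (T n)"
      using holder_ball_network[OF f \<alpha> N B(1,2), of "T n", folded d_def, folded D_def J_def \<kappa>_def, OF B(3)]
      by blast
    define X where "X = (D - 1) * (T n + 2)"
    define Y where "Y = real D * ((t + 2) * ln (real n) + 3)"
    have lev: "real X \<le> Y"
    proof -
      have "real X \<le> real D * (real (T n) + 2)"
        unfolding X_def of_nat_mult by (intro mult_mono) auto
      also have "\<dots> \<le> Y" unfolding Y_def using Tle[OF n] by (intro mult_left_mono) auto
      finally show ?thesis .
    qed
    have Y0: "0 \<le> Y" by (rule order_trans[OF _ lev]) simp
    have "real (length W) \<le> ln (exp 1 * real n) ^ 3"
    proof -
      have "real (length W) = 2 + real X" unfolding W(2) X_def[symmetric] by simp
      also have "\<dots> \<le> (1 + ln (real n)) ^ 3" using lev E unfolding Y_def by linarith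
      finally show ?thesis using n by (simp add: ln_mult)
    qed
    moreover have "weights_l0 W \<le> n"
    proof -
      have "real (weights_l0 W) \<le> real ((1 + X) * (J n * (5 * d + 6) * 7) + (J n * 3 + 1))"
        using W(5) unfolding X_def[symmetric] by (simp only: of_nat_le_iff)
      also have "\<dots> = (real X + 1) * (real (J n) * (7 * (5 * real d + 6))) + (real (J n) * 3 + 1)"
        by (simp add: algebra_simps)
      also have "\<dots> \<le> (Y + 1) * (cJ * real n powr (q * real d) * (7 * (5 * real d + 6)))
          + (cJ * real n powr (q * real d) * 3 + 1)"
        using lev Jle[OF n] Y0 by (intro add_mono mult_mono mult_right_mono) auto
      also have "\<dots> \<le> real n" using E unfolding Y_def by blast
      finally show ?thesis by simp
    qed
    moreover have "weights_linf W \<le> real 3 * real n ^ 3"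
    proof -
      have "real n ^ 1 \<le> real n ^ 3" using n by (intro power_increasing) auto
      then have "2 * real n \<le> 3 * real n ^ 3" using of_nat_0_le_iff[of n, where 'a = real]
          unfolding power_one_right by linarith
      then show ?thesis using W(6) by simp
    qed
    ultimately have mem: "(\<lambda>x. vec_index (realization W (to_vec x)) 0) \<in> (NN 3 n :: (real ^ 'd \<Rightarrow> real) set)"
      unfolding NN_def using W(1,3,4) unfolding d_def by blast
    have err: "\<bar>f x - vec_index (realization W (to_vec x)) 0\<bar> \<le> C * real n powr - t" if x: "x \<in> unit_cube" for x
    proof -
      have 1: "(2 / real (NN' n)) powr r \<le> 4 powr r * real n powr - t"
      proof -
        have "2 / real (NN' n) \<le> 4 / real n powr q" using N1[OF n] n by (simp add: field_simps)
        then have "(2 / real (NN' n)) powr r \<le> (4 / real n powr q) powr r" using r by (intro powr_mono2) auto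
        also have "\<dots> = 4 powr r * real n powr - t"
          using r n by (simp add: powr_divide powr_powr q_def powr_minus field_simps)
        finally show ?thesis .
      qed
      have 2: "1 / 4 ^ Suc (T n) \<le> real n powr - (t + 2)"
      proof -
        have "real n powr (t + 2) = exp ((t + 2) * ln (real n))" using n by (simp add: powr_def)
        also have "\<dots> \<le> exp (real (T n))" using Tle[OF n] by simp
        also have "\<dots> = exp 1 ^ T n" by (simp flip: exp_of_nat_mult)
        also have "\<dots> \<le> 4 ^ T n" using exp_le by (intro power_mono) auto
        also have "\<dots> \<le> 4 ^ Suc (T n)" by simp
        finally have "1 / 4 ^ Suc (T n) \<le> 1 / real n powr (t + 2)"
          using n by (intro divide_left_mono) auto
        then show ?thesis by (simp only: powr_minus_divide)
      qed
      have J: "real (J n) * real n powr - (t + 2) \<le> cJ * real n powr - t"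
      proof -
        have "real (J n) * real n powr - (t + 2) \<le> cJ * real n powr (q * real d) * real n powr - (t + 2)"
          using Jle[OF n] by (intro mult_right_mono) auto
        also have "\<dots> = cJ * real n powr (q * real d - (t + 2))"
            by (simp only: diff_conv_add_uminus powr_add mult.assoc)
        also have "\<dots> \<le> cJ * real n powr - t" using qd n cJ by (intro mult_left_mono powr_mono) auto
        finally show ?thesis .
      qed
      have "\<bar>f x - vec_index (realization W (to_vec x)) 0\<bar> \<le>
          \<Lambda> * (2 / real (NN' n)) powr r + \<kappa> * real D * (real (J n) * (1 / 4 ^ Suc (T n)))"
        using bspec[OF W(7) x] by (simp add: \<Lambda>_def r_def mult_ac)
      also have "\<dots> \<le> \<Lambda> * (4 powr r * real n powr - t) + \<kappa> * real D * (cJ * real n powr - t)"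
      proof -
        have "real (J n) * (1 / 4 ^ Suc (T n)) \<le> cJ * real n powr - t"
          by (rule order_trans[OF mult_left_mono[OF 2] J]) simp
        moreover have "0 \<le> \<kappa> * real D" using \<kappa>0 by simp
        ultimately show ?thesis using 1 \<Lambda>0 by (intro add_mono mult_left_mono)
      qed
      also have "\<dots> = C1 * real n powr - t" by (simp add: C1_def algebra_simps)
      also have "\<dots> \<le> C * real n powr - t" by (intro mult_right_mono) (auto simp: C_def)
      finally show ?thesis .
    qed
    show ?thesis by (intro bexI[OF _ mem] ballI err)
  qed
  then show ?thesis using C0 by blast
qed

section \<open>Bump functions\<close>

definition pos_power :: "nat \<Rightarrow> real \<Rightarrow> real" where
  "pos_power a t = max 0 t ^ a"

lemma DERIV_pos_power:
  assumes "a \<ge> 2"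
  shows "(pos_power a has_field_derivative real a * pos_power (a - 1) t) (at t)"
proof -
  consider "t > 0" | "t < 0" | "t = 0" by linarith
  then show ?thesis
  proof cases
    case 1
    have "((\<lambda>t. t ^ a) has_field_derivative real a * pos_power (a - 1) t) (at t)"
      using 1 by (auto intro!: derivative_eq_intros simp: pos_power_def)
    then show ?thesis
      by (rule has_field_derivative_transform_within_open[of _ _ _ "{0<..}"]) (use 1 in \<open>auto simp:
          pos_power_def\<close>)
  next
    case 2
    have "((\<lambda>t. 0) has_field_derivative real a * pos_power (a - 1) t) (at t)"
      using 2 assms by (auto intro!: derivative_eq_intros simp: pos_power_def power_0_left)
    then show ?thesis
      by (rule has_field_derivative_transform_within_open[of _ _ _ "{..<0}"]) (use 2 assms in \<open>auto simp:
          pos_power_def\<close>)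
  next
    case 3
    \<comment> \<open>At the kink the difference quotient is at most |h| for small h, as a \<ge>
      2.\<close>
    have "((\<lambda>h. (pos_power a (0 + h) - pos_power a 0) / h) \<longlongrightarrow> 0) (at 0)"
    proof (rule Lim_null_comparison)
      have "norm ((pos_power a (0 + h) - pos_power a 0) / h) \<le> \<bar>h\<bar>" if "h \<noteq> 0" "dist h 0 < 1" for h
      proof -
        have "pos_power a h \<le> \<bar>h\<bar> ^ a" unfolding pos_power_def by (intro power_mono) auto
        also have "\<dots> \<le> \<bar>h\<bar> ^ 2" using that assms by (intro power_decreasing) auto
        finally have "pos_power a h \<le> \<bar>h\<bar> * \<bar>h\<bar>" by (simp add: power2_eq_square)
        moreover have "0 \<le> pos_power a h" "pos_power a 0 = 0" using assms by (auto simp: pos_power_def)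
        ultimately show ?thesis using that by (simp add: divide_le_eq)
      qed
      then show "\<forall>\<^sub>F h in at 0. norm ((pos_power a (0 + h) - pos_power a 0) / h) \<le> \<bar>h\<bar>"
        unfolding eventually_at by (intro exI[of _ 1]) auto
      show "((\<lambda>h::real. \<bar>h\<bar>) \<longlongrightarrow> 0) (at 0)" by (intro tendsto_eq_intros) auto
    qed
    then show ?thesis using 3 assms by (simp add: DERIV_def pos_power_def power_0_left)
  qed
qed

text \<open>Functions with q derivatives that, together with these, are bounded and vanish outside
  (0, 1). Recursion on the derivative suits closure under linear combinations, and that closure is
  how the product rule is exploited.\<close>

primrec bump_class :: "nat \<Rightarrow> (real \<Rightarrow> real) \<Rightarrow> bool" where
  "bump_class 0 g \<longleftrightarrow> (\<exists>C. \<forall>t. \<bar>g t\<bar> \<le> C) \<and> (\<forall>t. t \<le> 0 \<or> 1 \<le> t \<longrightarrow> g t = 0)"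
| "bump_class (Suc q) g \<longleftrightarrow> (\<exists>C. \<forall>t. \<bar>g t\<bar> \<le> C) \<and> (\<forall>t. t \<le> 0 \<or> 1 \<le> t \<longrightarrow> g t = 0) \<and>
     (\<exists>g'. (\<forall>t. (g has_field_derivative g' t) (at t)) \<and> bump_class q g')"

lemma bump_class_lincomb:
  "bump_class q g \<Longrightarrow> bump_class q h \<Longrightarrow> bump_class q (\<lambda>t. c * g t + e * h t)"
proof (induction q arbitrary: g h)
  have bounded: "\<exists>C. \<forall>t. \<bar>c * g t + e * h t\<bar> \<le> C"
    if bds: "\<exists>C. \<forall>t. \<bar>g t\<bar> \<le> C" "\<exists>C. \<forall>t. \<bar>h t\<bar> \<le> C" for g h :: "real \<Rightarrow> real"
  proof -
    obtain C1 C2 where C: "\<And>t. \<bar>g t\<bar> \<le> C1" "\<And>t. \<bar>h t\<bar> \<le> C2" using bds by blast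
    have "\<bar>c * g t + e * h t\<bar> \<le> \<bar>c\<bar> * C1 + \<bar>e\<bar> * C2" for t
      by (rule order_trans[OF abs_triangle_ineq]) (auto simp: abs_mult intro!: add_mono mult_left_mono C)
    then show ?thesis by blast
  qed
  {
    case 0
    then show ?case using bounded[of g h] by simp
  next
    case (Suc q)
    obtain g' h' where "\<And>t. (g has_field_derivative g' t) (at t)" "bump_class q g'"
      "\<And>t. (h has_field_derivative h' t) (at t)" "bump_class q h'" using Suc.prems by auto
    then have "\<And>t. ((\<lambda>t. c * g t + e * h t) has_field_derivative c * g' t + e * h' t) (at t)"
      "bump_class q (\<lambda>t. c * g' t + e * h' t)"
      by (auto intro!: derivative_eq_intros Suc.IH)
    then show ?case using Suc.prems bounded[of g h] by (auto intro!: exI[of _ "\<lambda>t. c * g' t + e * h' t"])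
  }
qed

text \<open>Differentiation lowers one of the two exponents by 1 and stays within combinations of
  the same shape, so the induction has to range over all exponents above q.\<close>

lemma bump_class_pos_power:
  "Suc q \<le> a \<Longrightarrow> Suc q \<le> b \<Longrightarrow> bump_class q (\<lambda>t. pos_power a t * pos_power b (1 - t))"
proof (induction q arbitrary: a b)
  have bounded: "\<exists>C. \<forall>t. \<bar>pos_power a t * pos_power b (1 - t)\<bar> \<le> C" if "1 \<le> a" "1 \<le> b" for a b
  proof -
    have "\<bar>pos_power a t * pos_power b (1 - t)\<bar> \<le> 1" for t
    proof (cases "0 \<le> t \<and> t \<le> 1")
      case True
      then have "pos_power a t * pos_power b (1 - t) \<le> 1 * 1"
        unfolding pos_power_def by (intro mult_mono power_le_one) auto
      then show ?thesis using True by (simp add: pos_power_def)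
    next
      case False
      then show ?thesis using that by (auto simp: pos_power_def max_def power_0_left)
    qed
    then show ?thesis by blast
  qed
  have zero: "t \<le> 0 \<or> 1 \<le> t \<Longrightarrow> pos_power a t * pos_power b (1 - t) = 0" if "1 \<le> a" "1 \<le> b" for a b t
    using that by (auto simp: pos_power_def max_def)
  {
    case 0
    then show ?case using bounded zero by auto
  next
    case (Suc q)
    have D: "((\<lambda>t. pos_power a t * pos_power b (1 - t)) has_field_derivative
        real a * (pos_power (a - 1) t * pos_power b (1 - t)) + (- real b)
            * (pos_power a t * pos_power (b - 1) (1 - t))) (at t)" for t
    proof -
      have "((\<lambda>t. pos_power b (1 - t)) has_field_derivative (real b * pos_power (b - 1) (1 - t))
          * (- 1)) (at t)"
        using Suc.prems by (intro DERIV_chain2[OF DERIV_pos_power]) (auto intro!: derivative_eq_intros)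
      from DERIV_mult[OF DERIV_pos_power this, of a] Suc.prems show ?thesis by (simp add: algebra_simps)
    qed
    have B: "bump_class q (\<lambda>t. real a * (pos_power (a - 1) t * pos_power b (1 - t)) + (- real b)
        * (pos_power a t * pos_power (b - 1) (1 - t)))"
      using Suc.prems by (intro bump_class_lincomb Suc.IH) auto
    show ?case unfolding bump_class.simps
    proof (intro conjI)
      show "\<exists>C. \<forall>t. \<bar>pos_power a t * pos_power b (1 - t)\<bar> \<le> C" using Suc.prems by (intro bounded) auto
      show "\<forall>t. t \<le> 0 \<or> 1 \<le> t \<longrightarrow> pos_power a t * pos_power b (1 - t) = 0" using Suc.prems zero[of a b] by simp
      show "\<exists>g'. (\<forall>t. ((\<lambda>t. pos_power a t * pos_power b (1 - t)) has_field_derivative g' t) (at t)) \<and>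
          bump_class q g'"
        by (rule exI, rule conjI, rule allI, rule D, rule B)
    qed
  }
qed

lemma bump_class_derivatives:
  "bump_class k g \<Longrightarrow> \<exists>\<beta>. \<beta> 0 = g \<and> (\<forall>q\<le>k. bump_class 0 (\<beta> q)) \<and>
      (\<forall>q<k. \<forall>t. (\<beta> q has_field_derivative \<beta> (Suc q) t) (at t))"
proof (induction k arbitrary: g)
  case 0
  then show ?case by (intro exI[of _ "\<lambda>_. g"]) simp
next
  case (Suc k)
  then obtain g' where g': "\<forall>t. (g has_field_derivative g' t) (at t)" "bump_class k g'" by auto
  obtain \<beta> where \<beta>: "\<beta> 0 = g'" "\<forall>q\<le>k. bump_class 0 (\<beta> q)"
      "\<forall>q<k. \<forall>t. (\<beta> q has_field_derivative \<beta> (Suc q) t) (at t)"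
    using Suc.IH[OF g'(2)] by blast
  have "bump_class 0 g" using Suc.prems by simp
  then show ?case using g'(1) \<beta>
    by (intro exI[of _ "case_nat g \<beta>"]) (auto simp del: bump_class.simps split: nat.splits)
qed

text \<open>Exponent m + 2 leaves m + 1 derivatives, one more than m, so that the derivatives of
  order m are Lipschitz. The lower bound on the middle half is what later separates different
  signs.\<close>

lemma bump_exists:
  obtains \<beta> :: "nat \<Rightarrow> real \<Rightarrow> real" and C c where "1 \<le> C" "0 < c"
    "\<And>q t. q \<le> Suc m \<Longrightarrow> \<bar>\<beta> q t\<bar> \<le> C" "\<And>q t. q \<le> Suc m \<Longrightarrow> t \<le> 0 \<or> 1 \<le> t \<Longrightarrow> \<beta> q t = 0"
    "\<And>q t. q \<le> m \<Longrightarrow> (\<beta> q has_field_derivative \<beta> (Suc q) t) (at t)"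
    "\<And>t. 1 / 4 \<le> t \<Longrightarrow> t \<le> 3 / 4 \<Longrightarrow> c \<le> \<beta> 0 t"
proof -
  define g where "g t = pos_power (m + 2) t * pos_power (m + 2) (1 - t)" for t
  have "bump_class (Suc m) g" unfolding g_def by (rule bump_class_pos_power) auto
  then obtain \<beta> where \<beta>: "\<beta> 0 = g" "\<And>q. q \<le> Suc m \<Longrightarrow> bump_class 0 (\<beta> q)"
    "\<And>q t. q < Suc m \<Longrightarrow> (\<beta> q has_field_derivative \<beta> (Suc q) t) (at t)"
    using bump_class_derivatives[of "Suc m" g] by blast
  have "\<forall>q. \<exists>C. q \<le> Suc m \<longrightarrow> (\<forall>t. \<bar>\<beta> q t\<bar> \<le> C)" using \<beta>(2) by auto
  then obtain C where C: "\<And>q t. q \<le> Suc m \<Longrightarrow> \<bar>\<beta> q t\<bar> \<le> C q" by metis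
  define C' where "C' = Max (insert 1 (C ` {..Suc m}))"
  have "C q \<le> C'" if "q \<le> Suc m" for q unfolding C'_def using that by (intro Max_ge) auto
  then have "\<bar>\<beta> q t\<bar> \<le> C'" if "q \<le> Suc m" for q t using C that order_trans by blast
  moreover have "1 \<le> C'" unfolding C'_def by (intro Max_ge) auto
  moreover have "\<beta> q t = 0" if "q \<le> Suc m" "t \<le> 0 \<or> 1 \<le> t" for q t using \<beta>(2)[OF that(1)] that(2) by auto
  moreover have "(1 / 4) ^ (m + 2) * (1 / 4) ^ (m + 2) \<le> \<beta> 0 t" if "1 / 4 \<le> t" "t \<le> 3 / 4" for t
    unfolding \<beta>(1) g_def pos_power_def using that by (intro mult_mono power_mono) auto
  ultimately show thesis using \<beta>(3)
    by (intro that[of C' "(1 / 4) ^ (m + 2) * (1 / 4) ^ (m + 2)" \<beta>]) auto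
qed

section \<open>Superpositions of bumps at all dyadic scales\<close>

text \<open>\<open>\<beta> q\<close> stands for the q-th derivative of one bump. The phantom
  argument fixes the dimension of the cube.\<close>

locale bump_series =
  fixes m :: nat and \<alpha> :: real and \<beta> :: "nat \<Rightarrow> real \<Rightarrow> real" and C c :: real
    and dim :: "'d::finite itself"
  assumes \<alpha>: "0 < \<alpha>" "\<alpha> \<le> 1" and C: "1 \<le> C" and c: "0 < c"
    and bound: "\<And>q t. q \<le> Suc m \<Longrightarrow> \<bar>\<beta> q t\<bar> \<le> C"
    and support: "\<And>q t. q \<le> Suc m \<Longrightarrow> t \<le> 0 \<or> 1 \<le> t \<Longrightarrow> \<beta> q t = 0"
    and deriv: "\<And>q t. q \<le> m \<Longrightarrow> (\<beta> q has_field_derivative \<beta> (Suc q) t) (at t)"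
    and lower: "\<And>t. 1 / 4 \<le> t \<Longrightarrow> t \<le> 3 / 4 \<Longrightarrow> c \<le> \<beta> 0 t"
begin

definition grid :: "nat \<Rightarrow> ('d \<Rightarrow> nat) set" where
  "grid j = PiE UNIV (\<lambda>_. {..<2 ^ j})"

text \<open>The derivative of the j-th layer of bumps along the word ws, divided by 2^(j * length
  ws), so that its bounds do not depend on j. Counting letters gives the order in each
  coordinate.\<close>

definition level :: "(nat \<Rightarrow> ('d \<Rightarrow> nat) \<Rightarrow> real) \<Rightarrow> nat \<Rightarrow> 'd list \<Rightarrow> real ^ 'd \<Rightarrow> real" where
  "level \<sigma> j ws x = (\<Sum>k\<in>grid j. \<sigma> j k * (\<Prod>i\<in>UNIV. \<beta> (count_list ws i) (2 ^ j * vec_nth x i - real (k i))))"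

lemma finite_grid [simp]: "finite (grid j)"
  by (auto simp: grid_def finite_PiE)

lemma card_grid: "card (grid j) = 2 ^ (j * CARD('d))"
  by (simp add: grid_def card_PiE power_mult)

lemma count_le: "length ws \<le> n \<Longrightarrow> count_list ws i \<le> n"
  using count_le_length[of ws i] by simp

text \<open>The bumps of one level have disjoint supports: at each point only the cube with the
  rounded-down index can contribute.\<close>

lemma level_single:
  assumes "length ws \<le> Suc m"
  obtains k0 where "\<And>k. k \<in> grid j \<Longrightarrow> k \<noteq> k0 \<Longrightarrow>
      (\<Prod>i\<in>UNIV. \<beta> (count_list ws i) (2 ^ j * vec_nth x i - real (k i))) = 0"
proof (rule that[of "\<lambda>i. nat \<lfloor>2 ^ j * vec_nth x i\<rfloor>"])
  fix k assume "k \<in> grid j" "k \<noteq> (\<lambda>i. nat \<lfloor>2 ^ j * vec_nth x i\<rfloor>)"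
  then obtain i where i: "k i \<noteq> nat \<lfloor>2 ^ j * vec_nth x i\<rfloor>" by auto
  have "2 ^ j * vec_nth x i - real (k i) \<le> 0 \<or> 1 \<le> 2 ^ j * vec_nth x i - real (k i)"
  proof (rule ccontr)
    assume "\<not> ?thesis"
    then have "\<lfloor>2 ^ j * vec_nth x i\<rfloor> = int (k i)" by (intro floor_unique) auto
    then show False using i by simp
  qed
  then have "\<beta> (count_list ws i) (2 ^ j * vec_nth x i - real (k i)) = 0"
    using count_le[OF assms] by (intro support) auto
  then show "(\<Prod>i\<in>UNIV. \<beta> (count_list ws i) (2 ^ j * vec_nth x i - real (k i))) = 0"
    by (intro prod_zero) auto
qed

lemma abs_level_le:
  assumes \<sigma>: "\<And>j k. \<bar>\<sigma> j k\<bar> \<le> 1" and ws: "length ws \<le> Suc m"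
  shows "\<bar>level \<sigma> j ws x\<bar> \<le> C ^ CARD('d)"
proof -
  define b where "b k = (\<Prod>i\<in>UNIV. \<beta> (count_list ws i) (2 ^ j * vec_nth x i - real (k i)))" for k :: "'d \<Rightarrow> nat"
  obtain k0 where k0: "\<And>k. k \<in> grid j \<Longrightarrow> k \<noteq> k0 \<Longrightarrow> b k = 0"
    using level_single[OF ws, of j x] unfolding b_def by metis
  have b: "\<bar>b k\<bar> \<le> C ^ CARD('d)" for k
  proof -
    have "\<bar>b k\<bar> \<le> (\<Prod>i\<in>(UNIV :: 'd set). C)"
      unfolding b_def abs_prod using count_le[OF ws] by (intro prod_mono conjI bound) auto
    then show ?thesis by simp
  qed
  have "level \<sigma> j ws x = (\<Sum>k\<in>grid j \<inter> {k0}. \<sigma> j k * b k)"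
    unfolding level_def b_def[symmetric] using k0 by (intro sum.mono_neutral_right) auto
  also have "\<bar>\<dots>\<bar> \<le> C ^ CARD('d)"
  proof (cases "k0 \<in> grid j")
    case True
    have "\<bar>\<sigma> j k0\<bar> * \<bar>b k0\<bar> \<le> 1 * C ^ CARD('d)" using \<sigma> b by (intro mult_mono) auto
    then show ?thesis using True by (simp add: abs_mult)
  qed (use C in simp)
  finally show ?thesis .
qed

lemma level_has_derivative:
  assumes ws: "length ws \<le> m"
  shows "(level \<sigma> j ws has_derivative (\<lambda>h. \<Sum>i\<in>UNIV. (2 ^ j * level \<sigma> j (i # ws) x)
      * vec_nth h i)) (at x within S)"
proof -
  define b where "b ws k i x = \<beta> (count_list ws i) (2 ^ j * vec_nth x i - real (k i))" for ws k i
      and x :: "real ^ 'd"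
  have bd: "(b ws k i has_derivative (\<lambda>h. \<beta> (Suc (count_list ws i)) (2 ^ j * vec_nth x i - real (k i))
      * (2 ^ j * vec_nth h i))) (at x within S)" for k i
  proof -
    have "((\<lambda>x. 2 ^ j * vec_nth x i - real (k i)) has_derivative (\<lambda>h. 2 ^ j * vec_nth h i)) (at x within S)"
      by (auto intro!: derivative_eq_intros bounded_linear_imp_has_derivative bounded_linear_vec_nth)
    from has_derivative_compose[OF this deriv[unfolded has_field_derivative_def, of "count_list ws i"]]
    show ?thesis unfolding b_def using count_le[OF ws] by simp
  qed
  have prod: "((\<lambda>x. \<Prod>i\<in>UNIV. b ws k i x) has_derivative (\<lambda>h. \<Sum>i\<in>UNIV. (2 ^ j * (\<Prod>l\<in>UNIV. b (i # ws) k l x))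
      * vec_nth h i)) (at x within S)" for k
  proof -
    have "((\<lambda>x. \<Prod>i\<in>UNIV. b ws k i x) has_derivative
        (\<lambda>h. \<Sum>i\<in>UNIV. (\<beta> (Suc (count_list ws i)) (2 ^ j * vec_nth x i - real (k i)) * (2 ^ j * vec_nth h i))
            * (\<Prod>l\<in>UNIV - {i}. b ws k l x))) (at x within S)"
      by (rule has_derivative_prod) (rule bd)
    moreover have "(\<Prod>l\<in>UNIV. b (i # ws) k l x) =
        \<beta> (Suc (count_list ws i)) (2 ^ j * vec_nth x i - real (k i)) * (\<Prod>l\<in>UNIV - {i}. b ws k l x)" for i
      by (subst prod.remove[of UNIV i]) (auto simp: b_def intro!: prod.cong)
    ultimately show ?thesis by (simp add: mult_ac)
  qed
  have "((\<lambda>x. \<Sum>k\<in>grid j. \<sigma> j k * (\<Prod>i\<in>UNIV. b ws k i x)) has_derivative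
      (\<lambda>h. \<Sum>k\<in>grid j. \<sigma> j k * (\<Sum>i\<in>UNIV. (2 ^ j * (\<Prod>l\<in>UNIV. b (i # ws) k l x)) * vec_nth h i))) (at x within S)"
    by (intro has_derivative_sum has_derivative_mult_right prod)
  moreover have "(\<Sum>k\<in>grid j. \<sigma> j k * (\<Sum>i\<in>UNIV. (2 ^ j * (\<Prod>l\<in>UNIV. b (i # ws) k l x)) * vec_nth h i)) =
      (\<Sum>i\<in>UNIV. (2 ^ j * level \<sigma> j (i # ws) x) * vec_nth h i)" for h
    unfolding level_def b_def[symmetric] sum_distrib_left sum_distrib_right
    by (subst sum.swap) (simp add: mult_ac)
  ultimately show ?thesis unfolding level_def b_def by simp
qed

lemma level_lipschitz:
  assumes \<sigma>: "\<And>j k. \<bar>\<sigma> j k\<bar> \<le> 1" and ws: "length ws \<le> m"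
  shows "\<bar>level \<sigma> j ws x - level \<sigma> j ws y\<bar> \<le> real CARD('d) * (2 ^ j * C ^ CARD('d)) * norm (x - y)"
proof -
  have "norm (level \<sigma> j ws x - level \<sigma> j ws y) \<le> (real CARD('d) * (2 ^ j * C ^ CARD('d))) * norm (x - y)"
  proof (rule differentiable_bound[of UNIV])
    fix x
    show "(level \<sigma> j ws has_derivative (\<lambda>h. \<Sum>i\<in>UNIV. (2 ^ j * level \<sigma> j (i # ws) x)
        * vec_nth h i)) (at x within UNIV)"
      by (rule level_has_derivative[OF ws])
    show "onorm (\<lambda>h. \<Sum>i\<in>UNIV. (2 ^ j * level \<sigma> j (i # ws) x) * vec_nth h i) \<le>
        real CARD('d) * (2 ^ j * C ^ CARD('d))"
    proof (rule onorm_le)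
      fix h :: "real ^ 'd"
      have "norm (\<Sum>i\<in>UNIV. (2 ^ j * level \<sigma> j (i # ws) x) * vec_nth h i) \<le>
          (\<Sum>i\<in>(UNIV :: 'd set). (2 ^ j * C ^ CARD('d)) * norm h)"
      proof (intro order_trans[OF norm_sum] sum_mono)
        fix i :: 'd
        have "\<bar>level \<sigma> j (i # ws) x\<bar> \<le> C ^ CARD('d)" using abs_level_le[OF \<sigma>, of "i # ws"] ws by simp
        then show "norm ((2 ^ j * level \<sigma> j (i # ws) x) * vec_nth h i) \<le> (2 ^ j * C ^ CARD('d)) * norm h"
          using component_le_norm_cart[of h i] unfolding real_norm_def abs_mult by (intro mult_mono) auto
      qed
      then show "norm (\<Sum>i\<in>UNIV. (2 ^ j * level \<sigma> j (i # ws) x) * vec_nth h i) \<le>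
          real CARD('d) * (2 ^ j * C ^ CARD('d)) * norm h"
        by simp
    qed
  qed auto
  then show ?thesis by simp
qed

section \<open>Coefficients, convergence and Hoelder regularity of the series\<close>

definition r :: real where "r = real m + \<alpha>"

text \<open>Summable, so that all levels together stay in the Hoelder ball, yet of polynomial decay,
  so that level j keeps the amplitude 2^(-r j) up to a power of the logarithm of the scale.\<close>

definition weight :: "nat \<Rightarrow> real" where
  "weight j = (1 / real (Suc j))\<^sup>2"

lemma summable_weight: "summable weight"
proof -
  have "summable (\<lambda>j. inverse (real (Suc j)) ^ 2)"
    using inverse_power_summable[of 2, where 'a = real] by (subst summable_Suc_iff) (simp add: power_inverse)
  then show ?thesis by (simp add: weight_def[abs_def] inverse_eq_divide)
qed

lemma weight_pos: "0 < weight j"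
  by (simp add: weight_def)

text \<open>Normalizes the sum over j of the Hoelder constants in \<open>layer_term_holder\<close>
  to exactly 1.\<close>

definition amplitude :: real where
  "amplitude = 1 / (2 * real CARD('d) * C ^ CARD('d) * suminf weight)"

lemma suminf_weight_pos: "0 < suminf weight"
  using suminf_pos[OF summable_weight weight_pos] .

lemma amplitude_pos: "0 < amplitude"
  unfolding amplitude_def using suminf_weight_pos C by simp

definition coeff_at :: "nat \<Rightarrow> real" where
  "coeff_at j = amplitude * 2 powr (- r * real j) * weight j"

definition layer_term :: "(nat \<Rightarrow> ('d \<Rightarrow> nat) \<Rightarrow> real) \<Rightarrow> 'd list \<Rightarrow> nat \<Rightarrow> real ^ 'd \<Rightarrow> real" where
  "layer_term \<sigma> ws j x = coeff_at j * 2 ^ (j * length ws) * level \<sigma> j ws x"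

definition series :: "(nat \<Rightarrow> ('d \<Rightarrow> nat) \<Rightarrow> real) \<Rightarrow> 'd list \<Rightarrow> real ^ 'd \<Rightarrow> real" where
  "series \<sigma> ws x = (\<Sum>j. layer_term \<sigma> ws j x)"

lemma coeff_at_pos: "0 < coeff_at j"
  unfolding coeff_at_def using amplitude_pos weight_pos by simp

lemma coeff_scale:
  "length ws = n \<Longrightarrow> coeff_at j * 2 ^ (j * length ws) = amplitude * weight j * 2 powr (real j * (real n - r))"
proof -
  assume n: "length ws = n"
  have "(2 :: real) ^ (j * n) = 2 powr (real j * real n)" using powr_realpow[of 2 "j * n"] by simp
  moreover have "(2 :: real) powr (real j * (real n - r)) = 2 powr (real j * real n) * 2 powr (- r * real j)"
    by (simp add: powr_add[symmetric] algebra_simps)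
  ultimately show ?thesis by (simp add: coeff_at_def n)
qed

lemma abs_layer_term_le:
  assumes \<sigma>: "\<And>j k. \<bar>\<sigma> j k\<bar> \<le> 1" and ws: "length ws \<le> m"
  shows "\<bar>layer_term \<sigma> ws j x\<bar> \<le> amplitude * C ^ CARD('d) * weight j"
proof -
  have "real j * (real (length ws) - r) \<le> 0"
    using ws \<alpha> by (intro mult_nonneg_nonpos) (auto simp: r_def)
  then have "2 powr (real j * (real (length ws) - r)) \<le> 2 powr 0" by (intro powr_mono) auto
  then have "coeff_at j * 2 ^ (j * length ws) \<le> amplitude * weight j * 1"
    unfolding coeff_scale[OF refl] using amplitude_pos weight_pos[of j] by (intro mult_left_mono) auto
  moreover have "\<bar>level \<sigma> j ws x\<bar> \<le> C ^ CARD('d)" using ws by (intro abs_level_le \<sigma>) auto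
  ultimately have "(coeff_at j * 2 ^ (j * length ws)) * \<bar>level \<sigma> j ws x\<bar> \<le>
      (amplitude * weight j * 1) * C ^ CARD('d)"
    using coeff_at_pos[of j] amplitude_pos weight_pos[of j] by - (rule mult_mono, auto)
  then show ?thesis using coeff_at_pos[of j] by (simp add: layer_term_def abs_mult mult_ac)
qed

lemma summable_layer_term:
  assumes \<sigma>: "\<And>j k. \<bar>\<sigma> j k\<bar> \<le> 1" and ws: "length ws \<le> m"
  shows "summable (\<lambda>j. layer_term \<sigma> ws j x)"
  by (rule summable_comparison_test'[OF summable_mult[OF summable_weight, of "amplitude * C ^ CARD('d)"], of 0])
    (use abs_layer_term_le[OF assms] in auto)

text \<open>Interpolation between two bounds: the Lipschitz bound if 2^j * |x - y| \<le> 1 and the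
  sup bound otherwise; both are at most a multiple of (2^j * |x - y|)^\<alpha>. The scaled
  coefficient contributes 2^(-j \<alpha>), which cancels 2^(j \<alpha>) and leaves the summable
  weight.\<close>

lemma layer_term_holder:
  assumes \<sigma>: "\<And>j k. \<bar>\<sigma> j k\<bar> \<le> 1" and ws: "length ws = m"
  shows "\<bar>layer_term \<sigma> ws j x - layer_term \<sigma> ws j y\<bar> \<le>
      (2 * real CARD('d) * amplitude * C ^ CARD('d) * norm (x - y) powr \<alpha>) * weight j"
proof (cases "x = y")
  case False
  define \<delta> where "\<delta> = norm (x - y)"
  define A where "A = amplitude * weight j * 2 powr (- real j * \<alpha>)"
  define K where "K = C ^ CARD('d)"
  have \<delta>: "0 < \<delta>" using False by (simp add: \<delta>_def)
  have K: "0 \<le> K" and A: "0 < A" using C amplitude_pos weight_pos[of j] by (auto simp: K_def A_def)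
  have sc: "coeff_at j * 2 ^ (j * length ws) = A"
    unfolding coeff_scale[OF ws] by (simp add: A_def r_def algebra_simps)
  have "layer_term \<sigma> ws j x - layer_term \<sigma> ws j y = A * (level \<sigma> j ws x - level \<sigma> j ws y)"
    unfolding layer_term_def sc by (simp add: algebra_simps)
  then have eq: "\<bar>layer_term \<sigma> ws j x - layer_term \<sigma> ws j y\<bar> = A * \<bar>level \<sigma> j ws x - level \<sigma> j ws y\<bar>"
    using A by (simp add: abs_mult)
  have d: "1 \<le> real CARD('d)" by (simp add: Suc_le_eq)
  have "\<bar>level \<sigma> j ws x - level \<sigma> j ws y\<bar> \<le> 2 * real CARD('d) * K * (2 ^ j * \<delta>) powr \<alpha>"
  proof (cases "2 ^ j * \<delta> \<le> 1")
    case True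
    have "\<bar>level \<sigma> j ws x - level \<sigma> j ws y\<bar> \<le> real CARD('d) * K * (2 ^ j * \<delta>)"
      using level_lipschitz[OF \<sigma>, where ws = ws and j = j and x = x and y = y] ws
          by (simp add: \<delta>_def K_def mult_ac)
    also have "\<dots> \<le> real CARD('d) * K * (2 ^ j * \<delta>) powr \<alpha>"
      using powr_mono'[of \<alpha> 1 "2 ^ j * \<delta>"] True \<delta> \<alpha> K by (intro mult_left_mono) auto
    also have "\<dots> \<le> 2 * real CARD('d) * K * (2 ^ j * \<delta>) powr \<alpha>" using K by simp
    finally show ?thesis .
  next
    case False
    then have 1: "1 \<le> (2 ^ j * \<delta>) powr \<alpha>" using \<alpha> by (intro ge_one_powr_ge_zero) auto
    have "\<bar>level \<sigma> j ws x - level \<sigma> j ws y\<bar> \<le> \<bar>level \<sigma> j ws x\<bar> + \<bar>level \<sigma> j ws y\<bar>" by (rule abs_triangle_ineq4)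
    also have "\<dots> \<le> K + K" unfolding K_def using ws by (intro add_mono abs_level_le \<sigma>) auto
    also have "\<dots> = 2 * 1 * K * 1" by simp
    also have "\<dots> \<le> 2 * real CARD('d) * K * (2 ^ j * \<delta>) powr \<alpha>" using 1 d K by (intro mult_mono) auto
    finally show ?thesis .
  qed
  then have "A * \<bar>level \<sigma> j ws x - level \<sigma> j ws y\<bar> \<le> A * (2 * real CARD('d) * K * (2 ^ j * \<delta>) powr \<alpha>)"
    using A by (intro mult_left_mono) auto
  also have "\<dots> = (2 * real CARD('d) * amplitude * K * \<delta> powr \<alpha>) * weight j * (2 powr (- real j * \<alpha>)
      * (2 ^ j) powr \<alpha>)"
    using \<delta> by (simp add: A_def powr_mult)
  also have "2 powr (- real j * \<alpha>) * (2 ^ j) powr \<alpha> = (1 :: real)"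
    by (simp add: powr_realpow[symmetric] powr_powr powr_minus)
  finally show ?thesis unfolding eq by (simp add: K_def \<delta>_def)
qed simp

lemma series_holder:
  assumes \<sigma>: "\<And>j k. \<bar>\<sigma> j k\<bar> \<le> 1" and ws: "length ws = m"
  shows "\<bar>series \<sigma> ws x - series \<sigma> ws y\<bar> \<le> norm (x - y) powr \<alpha>"
proof -
  define H where "H = 2 * real CARD('d) * amplitude * C ^ CARD('d) * norm (x - y) powr \<alpha>"
  have s: "summable (\<lambda>j. layer_term \<sigma> ws j x)" "summable (\<lambda>j. layer_term \<sigma> ws j y)"
    by (rule summable_layer_term[OF \<sigma>], simp add: ws)+
  have sH: "summable (\<lambda>j. H * weight j)" by (intro summable_mult summable_weight)
  have le: "\<bar>layer_term \<sigma> ws j x - layer_term \<sigma> ws j y\<bar> \<le> H * weight j" for j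
    unfolding H_def by (rule layer_term_holder[OF \<sigma> ws])
  have sa: "summable (\<lambda>j. \<bar>layer_term \<sigma> ws j x - layer_term \<sigma> ws j y\<bar>)"
    by (rule summable_comparison_test'[OF sH, of 0]) (use le in auto)
  have "series \<sigma> ws x - series \<sigma> ws y = (\<Sum>j. layer_term \<sigma> ws j x - layer_term \<sigma> ws j y)"
    unfolding series_def by (rule suminf_diff[OF s])
  also have "\<bar>\<dots>\<bar> \<le> (\<Sum>j. \<bar>layer_term \<sigma> ws j x - layer_term \<sigma> ws j y\<bar>)"
    by (rule summable_rabs[OF sa])
  also have "\<dots> \<le> (\<Sum>j. H * weight j)" by (intro suminf_le le sa sH)
  also have "\<dots> = H * suminf weight" by (rule suminf_mult[OF summable_weight])
  also have "\<dots> = norm (x - y) powr \<alpha>"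
    unfolding H_def amplitude_def using suminf_weight_pos C by simp
  finally show ?thesis .
qed

lemma abs_series_le:
  assumes \<sigma>: "\<And>j k. \<bar>\<sigma> j k\<bar> \<le> 1"
  shows "\<bar>series \<sigma> [] x\<bar> \<le> 1"
proof -
  have s: "summable (\<lambda>j. amplitude * C ^ CARD('d) * weight j)" by (intro summable_mult summable_weight)
  have sa: "summable (\<lambda>j. \<bar>layer_term \<sigma> [] j x\<bar>)"
    by (rule summable_comparison_test'[OF s, of 0]) (use abs_layer_term_le[OF \<sigma>, of "[]"] in auto)
  have "\<bar>series \<sigma> [] x\<bar> \<le> (\<Sum>j. \<bar>layer_term \<sigma> [] j x\<bar>)" unfolding series_def by (rule summable_rabs[OF sa])
  also have "\<dots> \<le> (\<Sum>j. amplitude * C ^ CARD('d) * weight j)"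
    using abs_layer_term_le[OF \<sigma>, of "[]"] by (intro suminf_le sa s) auto
  also have "\<dots> = amplitude * C ^ CARD('d) * suminf weight" by (rule suminf_mult[OF summable_weight])
  also have "\<dots> = 1 / (2 * real CARD('d))" unfolding amplitude_def using suminf_weight_pos C by simp
  also have "\<dots> \<le> 1" by (simp add: divide_le_eq) (use zero_less_card_finite[where 'a = 'd] in linarith)
  finally show ?thesis .
qed

text \<open>The remainder is bounded uniformly in the point, the signs and the word. This serves
  termwise differentiation as well as approximation by finitely many coins.\<close>

lemma series_tail:
  assumes \<sigma>: "\<And>j k. \<bar>\<sigma> j k\<bar> \<le> 1" and vs: "length vs \<le> m"
  shows "\<bar>(\<Sum>n<M. layer_term \<sigma> vs n y) - series \<sigma> vs y\<bar> \<le>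
      amplitude * C ^ CARD('d) * (suminf weight - (\<Sum>n<M. weight n))"
proof -
  define K where "K = amplitude * C ^ CARD('d)"
  have sT: "summable (\<lambda>n. K * weight (n + M))"
      by (intro summable_mult) (use summable_weight summable_iff_shift[of weight M] in simp)
  have le: "\<bar>layer_term \<sigma> vs (n + M) y\<bar> \<le> K * weight (n + M)" for n
    unfolding K_def by (rule abs_layer_term_le[OF \<sigma> vs])
  have sA: "summable (\<lambda>n. \<bar>layer_term \<sigma> vs (n + M) y\<bar>)"
    by (rule summable_comparison_test'[OF sT, of 0]) (use le in auto)
  have "series \<sigma> vs y - (\<Sum>n<M. layer_term \<sigma> vs n y) = (\<Sum>n. layer_term \<sigma> vs (n + M) y)"
    unfolding series_def using suminf_split_initial_segment[OF summable_layer_term[where \<sigma> = \<sigma> and x =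
        y, OF \<sigma> vs], of M] by simp
  also have "\<bar>\<dots>\<bar> \<le> (\<Sum>n. \<bar>layer_term \<sigma> vs (n + M) y\<bar>)" by (rule summable_rabs[OF sA])
  also have "\<dots> \<le> (\<Sum>n. K * weight (n + M))" by (intro suminf_le le sA sT)
  also have "\<dots> = K * (\<Sum>n. weight (n + M))"
    using summable_weight by (intro suminf_mult) (simp add: summable_iff_shift)
  also have "(\<Sum>n. weight (n + M)) = suminf weight - (\<Sum>n<M. weight n)"
    using suminf_split_initial_segment[OF summable_weight, of M] by simp
  finally show ?thesis by (simp add: abs_minus_commute K_def)
qed

lemma series_has_derivative:
  assumes \<sigma>: "\<And>j k. \<bar>\<sigma> j k\<bar> \<le> 1" and ws: "length ws < m" and x: "x \<in> unit_cube"
  shows "(series \<sigma> ws has_derivative (\<lambda>h. \<Sum>i\<in>UNIV. series \<sigma> (i # ws) x * vec_nth h i)) (at x within unit_cube)"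
proof -
  define K where "K = amplitude * C ^ CARD('d)"
  have K: "0 \<le> K" using amplitude_pos C by (simp add: K_def)
  define D where "D n x h = (\<Sum>i\<in>UNIV. layer_term \<sigma> (i # ws) n x * vec_nth h i)" for n x and h :: "real ^ 'd"
  have der: "(layer_term \<sigma> ws n has_derivative D n x) (at x within unit_cube)" for n x
  proof -
    have "(layer_term \<sigma> ws n has_derivative (\<lambda>h. coeff_at n * 2 ^ (n * length ws)
        * (\<Sum>i\<in>UNIV. (2 ^ n * level \<sigma> n (i # ws) x) * vec_nth h i))) (at x within unit_cube)"
      unfolding layer_term_def[abs_def] using ws by (intro has_derivative_mult_right level_has_derivative) simp
    moreover have "coeff_at n * 2 ^ (n * length ws) * (\<Sum>i\<in>UNIV. (2 ^ n * level \<sigma> n (i # ws) x) * vec_nth h i) =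
        D n x h" for h
      unfolding D_def sum_distrib_left by (intro sum.cong) (simp_all add: layer_term_def power_add mult_ac)
    ultimately show ?thesis by simp
  qed
  have sums: "(\<lambda>n. layer_term \<sigma> vs n y) sums series \<sigma> vs y" if "length vs \<le> m" for vs y
    unfolding series_def by (intro summable_sums summable_layer_term \<sigma> that)
  note tail = series_tail[where \<sigma> = \<sigma>, OF \<sigma>, folded K_def]
  \<comment> \<open>Words one letter longer still have length at most m, so the differentiated
    series converges uniformly with the same tail bound.\<close>
  have "\<exists>g. \<forall>x\<in>unit_cube. (\<lambda>n. layer_term \<sigma> ws n x) sums (g x) \<and>
      (g has_derivative (\<lambda>h. \<Sum>i\<in>UNIV. series \<sigma> (i # ws) x * vec_nth h i)) (at x within unit_cube)"
  proof (rule has_derivative_series[where f' = D, OF _ der _ x sums])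
    show "convex (unit_cube :: (real ^ 'd) set)" by simp
    show "length ws \<le> m" using ws by simp
    fix e :: real assume e: "e > 0"
    have "(\<lambda>M. real CARD('d) * (K * (suminf weight - (\<Sum>n<M. weight n)))) \<longlonglongrightarrow> real CARD('d)
        * (K * (suminf weight - suminf weight))"
      using summable_LIMSEQ[OF summable_weight] by (intro tendsto_intros)
    then have "\<forall>\<^sub>F M in sequentially. real CARD('d) * (K * (suminf weight - (\<Sum>n<M. weight n))) < e"
      using e by (intro order_tendstoD(2)[of _ 0]) auto
    then show "\<forall>\<^sub>F M in sequentially. \<forall>x\<in>unit_cube. \<forall>h. norm ((\<Sum>i<M. D i x h)
        - (\<Sum>i\<in>UNIV. series \<sigma> (i # ws) x * vec_nth h i)) \<le> e * norm h"
    proof eventually_elim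
      case (elim M)
      show ?case
      proof (intro ballI allI)
        fix x h :: "real ^ 'd"
        have "(\<Sum>n<M. D n x h) - (\<Sum>i\<in>UNIV. series \<sigma> (i # ws) x * vec_nth h i) =
            (\<Sum>i\<in>UNIV. ((\<Sum>n<M. layer_term \<sigma> (i # ws) n x) - series \<sigma> (i # ws) x) * vec_nth h i)"
          unfolding D_def by (subst sum.swap) (simp add: sum_subtractf left_diff_distrib sum_distrib_right)
        also have "norm \<dots> \<le> (\<Sum>i\<in>(UNIV :: 'd set). (K * (suminf weight - (\<Sum>n<M. weight n))) * norm h)"
        proof (intro order_trans[OF norm_sum] sum_mono)
          fix i :: 'd
          have "\<bar>(\<Sum>n<M. layer_term \<sigma> (i # ws) n x) - series \<sigma> (i # ws) x\<bar> \<le>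
              K * (suminf weight - (\<Sum>n<M. weight n))"
            using ws by (intro tail) simp
          moreover from this have "0 \<le> K * (suminf weight - (\<Sum>n<M. weight n))" by linarith
          ultimately show "norm (((\<Sum>n<M. layer_term \<sigma> (i # ws) n x) - series \<sigma> (i # ws) x) * vec_nth h i) \<le>
              (K * (suminf weight - (\<Sum>n<M. weight n))) * norm h"
            using component_le_norm_cart[of h i] unfolding real_norm_def abs_mult by (intro mult_mono) auto
        qed
        also have "\<dots> = (real CARD('d) * (K * (suminf weight - (\<Sum>n<M. weight n)))) * norm h" by simp
        also have "\<dots> \<le> e * norm h" using elim by (intro mult_right_mono) auto
        finally show "norm ((\<Sum>i<M. D i x h) - (\<Sum>i\<in>UNIV. series \<sigma> (i # ws) x * vec_nth h i)) \<le> e * norm h" .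
      qed
    qed
  qed
  then obtain g where g: "\<And>x. x \<in> unit_cube \<Longrightarrow> (\<lambda>n. layer_term \<sigma> ws n x) sums (g x)"
    "\<And>x. x \<in> unit_cube \<Longrightarrow> (g has_derivative (\<lambda>h. \<Sum>i\<in>UNIV. series \<sigma> (i # ws) x * vec_nth h i)) (at x within
        unit_cube)"
    by blast
  \<comment> \<open>Termwise differentiation yields some limit function g; uniqueness of sums
    identifies it on the cube.\<close>
  have "g y = series \<sigma> ws y" if "y \<in> unit_cube" for y
    using g(1)[OF that] sums[of ws y] ws sums_unique2 by simp
  then show ?thesis using has_derivative_cube_cong[of g "series \<sigma> ws" x] g(2)[OF x] x by blast
qed

lemma series_in_holder_ball:
  assumes \<sigma>: "\<And>j k. \<bar>\<sigma> j k\<bar> \<le> 1"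
  shows "series \<sigma> [] \<in> holder_ball m \<alpha>"
proof -
  interpret jet m "series \<sigma>"
  proof
    fix ws :: "'d list" assume ws: "length ws = m"
    show "continuous_on unit_cube (series \<sigma> ws)"
      unfolding continuous_on_def
    proof
      fix x :: "real ^ 'd"
      have "((\<lambda>y. norm (y - x)) \<longlongrightarrow> 0) (at x within unit_cube)" by (auto intro!: tendsto_eq_intros)
      then have lim: "((\<lambda>y. norm (y - x) powr \<alpha>) \<longlongrightarrow> 0) (at x within unit_cube)"
        using \<alpha> by (intro tendsto_zero_powrI) auto
      have le: "norm (series \<sigma> ws y - series \<sigma> ws x) \<le> norm (y - x) powr \<alpha>" for y
        using series_holder[OF \<sigma> ws] by simp
      have "((\<lambda>y. series \<sigma> ws y - series \<sigma> ws x) \<longlongrightarrow> 0) (at x within unit_cube)"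
        by (rule Lim_null_comparison[OF always_eventually lim]) (use le in simp)
      then show "(series \<sigma> ws \<longlongrightarrow> series \<sigma> ws x) (at x within unit_cube)" by (rule LIM_zero_cancel)
    qed
  qed (use series_has_derivative[OF \<sigma>] in auto)
  show ?thesis by (rule holder_ball_jet) (rule abs_series_le[OF \<sigma>], rule series_holder[OF \<sigma>])
qed

end

section \<open>Fair coins\<close>

definition coin_space :: "('i \<Rightarrow> bool) measure" where
  "coin_space = PiM UNIV (\<lambda>_. measure_pmf (pmf_of_set UNIV))"

definition flip :: "'i set \<Rightarrow> ('i \<Rightarrow> bool) \<Rightarrow> 'i \<Rightarrow> bool" where
  "flip A \<omega> i = (if i \<in> A then \<not> \<omega> i else \<omega> i)"

lemma space_coin_space [simp]: "space coin_space = UNIV"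
  by (simp add: coin_space_def space_PiM)

lemma product_prob_space_coins: "product_prob_space (\<lambda>_. measure_pmf (pmf_of_set (UNIV :: bool set)))"
  by (intro product_prob_spaceI prob_space_measure_pmf)

lemma prob_space_coin_space: "prob_space coin_space"
  unfolding coin_space_def by (intro prob_space_PiM prob_space_measure_pmf)

lemma measurable_coin: "(\<lambda>\<omega>. \<omega> i) \<in> measurable coin_space (count_space UNIV)"
proof -
  have "(\<lambda>\<omega>. \<omega> i) \<in> measurable coin_space (measure_pmf (pmf_of_set UNIV))"
    unfolding coin_space_def by (rule measurable_component_singleton) simp
  then show ?thesis by (simp cong: measurable_cong_sets)
qed

lemma emeasure_coin_Not: "emeasure (measure_pmf (pmf_of_set UNIV)) (Not -` F) =
    emeasure (measure_pmf (pmf_of_set UNIV)) F"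
proof -
  have "range Not = UNIV" by (auto simp: UNIV_bool)
  then have "map_pmf Not (pmf_of_set UNIV) = pmf_of_set (UNIV :: bool set)"
    using map_pmf_of_set_inj[of Not "UNIV :: bool set"] by (simp add: inj_on_def)
  then show ?thesis by (metis emeasure_map_pmf)
qed

lemma measurable_flip: "flip A \<in> measurable coin_space coin_space"
proof -
  have "(\<lambda>\<omega>. flip A \<omega> i) \<in> measurable coin_space (measure_pmf (pmf_of_set UNIV))" for i
  proof -
    have "(\<lambda>\<omega>. \<not> \<omega> i) \<in> measurable coin_space (count_space UNIV)"
      by (rule measurable_compose[OF measurable_coin]) simp
    then show ?thesis using measurable_coin[of i]
      by (cases "i \<in> A") (simp_all add: flip_def cong: measurable_cong_sets)
  qed
  then have "(\<lambda>\<omega>. \<lambda>i\<in>UNIV. flip A \<omega> i) \<in> measurable coin_space (PiM UNIV (\<lambda>_. measure_pmf (pmf_of_set UNIV)))"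
    by (intro measurable_restrict) auto
  moreover have "(\<lambda>\<omega>. \<lambda>i\<in>UNIV. flip A \<omega> i) = flip A" by (intro ext) (simp add: restrict_def)
  ultimately show ?thesis by (simp add: coin_space_def)
qed

text \<open>The preimage of a cylinder under a flip is a cylinder with some sides complemented, and
  a fair coin gives both outcomes equal weight; cylinders determine the product measure.\<close>

lemma distr_flip: "distr coin_space coin_space (flip A) = (coin_space :: ('i \<Rightarrow> bool) measure)"
proof -
  let ?M = "measure_pmf (pmf_of_set (UNIV :: bool set))"
  interpret product_prob_space "\<lambda>_ :: 'i. ?M" UNIV by (rule product_prob_space_coins)
  show ?thesis
  proof (subst (3) coin_space_def, rule PiM_eq)
    show "sets (distr coin_space coin_space (flip A)) = sets (PiM UNIV (\<lambda>_ :: 'i. ?M))"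
        by (simp add: coin_space_def)
  next
    fix J :: "'i set" and F assume J: "finite J" and F: "\<And>j. j \<in> J \<Longrightarrow> F j \<in> sets ?M"
    define F' where "F' i = (if i \<in> A then Not -` F i else F i)" for i
    have emb_sets: "prod_emb UNIV (\<lambda>_. ?M) J (PiE J G) \<in> sets coin_space" for G
      unfolding coin_space_def using J by (intro sets_PiM_I) auto
    have "emeasure (distr coin_space coin_space (flip A)) (prod_emb UNIV (\<lambda>_. ?M) J (PiE J F)) =
        emeasure coin_space (flip A -` prod_emb UNIV (\<lambda>_. ?M) J (PiE J F) \<inter> space coin_space)"
      by (rule emeasure_distr[OF measurable_flip emb_sets])
    also have "flip A -` prod_emb UNIV (\<lambda>_. ?M) J (PiE J F) \<inter> space coin_space =
        prod_emb UNIV (\<lambda>_. ?M) J (PiE J F')"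
      by (auto simp: prod_emb_def PiE_iff flip_def F'_def restrict_def extensional_def split: if_splits)
    also have "emeasure coin_space \<dots> = (\<Prod>j\<in>J. emeasure ?M (F' j))"
      unfolding coin_space_def using J by (intro emeasure_PiM_emb) auto
    also have "\<dots> = (\<Prod>j\<in>J. emeasure ?M (F j))"
      by (intro prod.cong) (auto simp: F'_def emeasure_coin_Not)
    finally show "emeasure (distr coin_space coin_space (flip A)) (prod_emb UNIV (\<lambda>_. ?M) J (PiE J F)) =
        (\<Prod>j\<in>J. emeasure ?M (F j))" .
  qed
qed

text \<open>P is an arbitrary predicate: the event is a finite union over the patterns on I, each of
  them measurable. Coins outside I are frozen at \<open>True\<close>.\<close>

lemma finite_coin_event:
  assumes "finite I"
  shows "{\<omega>. P (\<lambda>i. if i \<in> I then \<omega> i else True)} \<in> sets coin_space"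
proof -
  have "{\<omega>. P (\<lambda>i. if i \<in> I then \<omega> i else True)} =
      (\<Union>A\<in>{A\<in>Pow I. P (\<lambda>i. i \<in> I \<longrightarrow> i \<in> A)}. {\<omega>. \<forall>i\<in>I. \<omega> i = (i \<in> A)})"
  proof (rule Set.set_eqI, rule iffI)
    fix \<omega> assume "\<omega> \<in> {\<omega>. P (\<lambda>i. if i \<in> I then \<omega> i else True)}"
    moreover have "(\<lambda>i. if i \<in> I then \<omega> i else True) = (\<lambda>i. i \<in> I \<longrightarrow> i \<in> {i\<in>I. \<omega> i})" by auto
    ultimately show "\<omega> \<in> (\<Union>A\<in>{A\<in>Pow I. P (\<lambda>i. i \<in> I \<longrightarrow> i \<in> A)}. {\<omega>. \<forall>i\<in>I. \<omega> i = (i \<in> A)})"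
      by (intro UN_I[of "{i\<in>I. \<omega> i}"]) auto
  next
    fix \<omega> assume "\<omega> \<in> (\<Union>A\<in>{A\<in>Pow I. P (\<lambda>i. i \<in> I \<longrightarrow> i \<in> A)}. {\<omega>. \<forall>i\<in>I. \<omega> i = (i \<in> A)})"
    then obtain A where A: "P (\<lambda>i. i \<in> I \<longrightarrow> i \<in> A)" "\<forall>i\<in>I. \<omega> i = (i \<in> A)" by auto
    then have "(\<lambda>i. if i \<in> I then \<omega> i else True) = (\<lambda>i. i \<in> I \<longrightarrow> i \<in> A)" by auto
    then show "\<omega> \<in> {\<omega>. P (\<lambda>i. if i \<in> I then \<omega> i else True)}" using A(1) by simp
  qed
  moreover have "{\<omega>. \<forall>i\<in>I. \<omega> i = (i \<in> A)} \<in> sets coin_space" for A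
  proof -
    have "{\<omega>\<in>space coin_space. \<omega> i = (i \<in> A)} \<in> sets coin_space" for i
      using measurable_sets[OF measurable_coin, of "{i \<in> A}" i] by (simp add: vimage_def)
    then have "{\<omega>\<in>space coin_space. \<forall>i\<in>I. \<omega> i = (i \<in> A)} \<in> sets coin_space"
      using assms by (intro sets.sets_Collect_finite_All) auto
    then show ?thesis by simp
  qed
  ultimately show ?thesis using assms by (auto intro!: sets.finite_UN)
qed

text \<open>Exponential weighting: under (1/8)^(card B) a set with at most an eighth of the elements
  has weight at least (1/8)^(card K / 8), while all subsets together have weight (9/8)^(card
  K).\<close>

lemma card_small_subsets:
  assumes "finite K"
  shows "real (card {B \<in> Pow K. 8 * card B \<le> card K}) \<le> (9 / 8 * 8 powr (1 / 8)) ^ card K"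
proof -
  let ?S = "{B \<in> Pow K. 8 * card B \<le> card K}"
  have "real (card ?S) * (1 / 8) powr (real (card K) / 8) = (\<Sum>B\<in>?S. (1 / 8) powr (real (card K) / 8))" by simp
  also have "\<dots> \<le> (\<Sum>B\<in>?S. (1 / 8) ^ card B)"
  proof (rule sum_mono)
    fix B assume "B \<in> ?S"
    then have "real (card B) \<le> real (card K) / 8" by auto
    then have "(1 / 8 :: real) powr (real (card K) / 8) \<le> (1 / 8) powr real (card B)" by (intro powr_mono') auto
    then show "(1 / 8 :: real) powr (real (card K) / 8) \<le> (1 / 8) ^ card B" by (simp add: powr_realpow)
  qed
  also have "\<dots> \<le> (\<Sum>B\<in>Pow K. (1 / 8) ^ card B)" using assms by (intro sum_mono2) auto
  also have "\<dots> = (\<Prod>x\<in>K. 1 / 8 + 1)" using assms by (subst prod_add) auto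
  also have "\<dots> = (9 / 8) ^ card K" by simp
  finally have "real (card ?S) * (1 / 8) powr (real (card K) / 8) \<le> (9 / 8) ^ card K" .
  moreover have "(1 / 8 :: real) powr (real (card K) / 8) = 1 / (8 powr (1 / 8)) ^ card K"
    by (simp add: powr_divide powr_powr flip: powr_realpow)
  ultimately show ?thesis unfolding power_mult_distrib by (simp add: divide_le_eq)
qed

text \<open>The base of the preceding count divided by 2: its power \<open>card K\<close> bounds the
  proportion of small subsets. The threshold 1/8 is small enough to bring it below 1.\<close>

definition flip_base :: real where
  "flip_base = 9 / 16 * 8 powr (1 / 8)"

lemma flip_base: "0 < flip_base" "flip_base < 1"
proof -
  show "0 < flip_base" by (simp add: flip_base_def)
  have "((8 :: real) powr (1 / 8)) ^ 8 = 8 powr (1 / 8 * 8)"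
    using powr_realpow[of "8 powr (1 / 8) :: real" 8] powr_powr[of "8 :: real" "1 / 8" 8] by simp
  then have "flip_base ^ 8 = (9 / 16) ^ 8 * 8" unfolding flip_base_def power_mult_distrib by simp
  also have "\<dots> < 1" by (simp add: power_divide)
  finally show "flip_base < 1" by (meson linorder_not_less one_le_power)
qed

text \<open>By flip invariance, the probability of \<open>E\<close> is the expected proportion of the sets \<open>A \<subseteq> K\<close> with
  \<open>flip A \<omega> \<in> E\<close>; for each outcome, these sets lie in a Hamming ball.\<close>
lemma flip_small_event:
  fixes K :: "'i set"
  assumes K: "finite K" and E: "E \<in> sets coin_space"
    and close: "\<And>\<omega> A A'. A \<subseteq> K \<Longrightarrow> A' \<subseteq> K \<Longrightarrow> flip A \<omega> \<in> E \<Longrightarrow> flip A' \<omega> \<in> E \<Longrightarrow> 8 * card (sym_diff A A') \<le> card K"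
  shows "emeasure coin_space E \<le> ennreal (flip_base ^ card K)"
proof -
  interpret prob_space "coin_space :: ('i \<Rightarrow> bool) measure" by (rule prob_space_coin_space)
  define b :: real where "b = (9 / 8 * 8 powr (1 / 8)) ^ card K"
  have b0: "0 \<le> b" by (simp add: b_def)
  have cnt: "real (card {A\<in>Pow K. flip A \<omega> \<in> E}) \<le> b" for \<omega>
  proof (cases "{A\<in>Pow K. flip A \<omega> \<in> E} = {}")
    case False
    then obtain A0 where A0: "A0 \<subseteq> K" "flip A0 \<omega> \<in> E" by auto
    have "card {A\<in>Pow K. flip A \<omega> \<in> E} \<le> card {B \<in> Pow K. 8 * card B \<le> card K}"
    proof (rule card_inj_on_le[of "\<lambda>A. sym_diff A A0"])
      show "inj_on (\<lambda>A. sym_diff A A0) {A\<in>Pow K. flip A \<omega> \<in> E}" by (intro inj_onI) blast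
      show "(\<lambda>A. sym_diff A A0) ` {A\<in>Pow K. flip A \<omega> \<in> E} \<subseteq> {B \<in> Pow K. 8 * card B \<le> card K}"
        using close[OF _ A0(1) _ A0(2)] A0(1) by auto
    qed (use K in auto)
    then show ?thesis using card_small_subsets[OF K] unfolding b_def by linarith
  next
    case True
    then show ?thesis unfolding True using b0 by simp
  qed
  have meas: "flip A -` E \<in> sets coin_space" for A
    using measurable_sets[OF measurable_flip E, of A] by simp
  have eq: "emeasure coin_space (flip A -` E) = emeasure coin_space E" for A
    using emeasure_distr[OF measurable_flip E, of A] by (simp add: distr_flip)
  have "of_nat (2 ^ card K) * emeasure coin_space E = (\<Sum>A\<in>Pow K. emeasure coin_space (flip A -` E))"
    using K by (simp add: eq card_Pow)
  also have "\<dots> = (\<Sum>A\<in>Pow K. \<integral>\<^sup>+ \<omega>. indicator (flip A -` E) \<omega> \<partial>coin_space)" using meas by simp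
  also have "\<dots> = (\<integral>\<^sup>+ \<omega>. (\<Sum>A\<in>Pow K. indicator (flip A -` E) \<omega>) \<partial>coin_space)"
    using meas by (intro nn_integral_sum[symmetric]) auto
  also have "\<dots> \<le> (\<integral>\<^sup>+ \<omega>. ennreal b \<partial>(coin_space :: ('i \<Rightarrow> bool) measure))"
  proof (rule nn_integral_mono)
    fix \<omega> :: "'i \<Rightarrow> bool"
    have "(\<Sum>A\<in>Pow K. indicator (flip A -` E) \<omega>) = (\<Sum>A\<in>{A\<in>Pow K. flip A \<omega> \<in> E}. 1 :: ennreal)"
      using K by (intro sum.mono_neutral_cong_right) (auto simp: indicator_def)
    also have "\<dots> = ennreal (real (card {A\<in>Pow K. flip A \<omega> \<in> E}))" by (simp add: ennreal_of_nat_eq_real_of_nat)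
    also have "\<dots> \<le> ennreal b" using cnt by (rule ennreal_leI)
    finally show "(\<Sum>A\<in>Pow K. indicator (flip A -` E) \<omega>) \<le> ennreal b" .
  qed
  also have "\<dots> = ennreal b" using emeasure_space_1 by simp
  finally have "of_nat (2 ^ card K) * emeasure coin_space E \<le> ennreal b" .
  then have "ennreal (2 ^ card K * prob E) \<le> ennreal b"
    by (simp add: emeasure_eq_measure ennreal_of_nat_eq_real_of_nat ennreal_mult')
  then have "2 ^ card K * prob E \<le> b" using b0 by simp
  moreover have "b = 2 ^ card K * flip_base ^ card K"
    by (simp add: b_def flip_base_def flip: power_mult_distrib)
  ultimately have "prob E \<le> flip_base ^ card K" by simp
  then show ?thesis by (simp add: emeasure_eq_measure ennreal_leI)
qed

section \<open>The distribution of a random bump series\<close>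

context bump_series
begin

definition coin_sign :: "(nat \<times> ('d \<Rightarrow> nat) \<Rightarrow> bool) \<Rightarrow> nat \<Rightarrow> ('d \<Rightarrow> nat) \<Rightarrow> real" where
  "coin_sign \<omega> j k = (if \<omega> (j, k) then 1 else - 1)"

definition random_fun :: "(nat \<times> ('d \<Rightarrow> nat) \<Rightarrow> bool) \<Rightarrow> real ^ 'd \<Rightarrow> real" where
  "random_fun \<omega> = series (coin_sign \<omega>) []"

lemma abs_coin_sign: "\<bar>coin_sign \<omega> j k\<bar> \<le> 1"
  by (simp add: coin_sign_def)

lemma random_fun_in_holder_ball: "random_fun \<omega> \<in> holder_ball m \<alpha>"
  unfolding random_fun_def by (intro series_in_holder_ball abs_coin_sign)

definition tail_bound :: "nat \<Rightarrow> real" where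
  "tail_bound n = 2 * (amplitude * C ^ CARD('d) * (suminf weight - (\<Sum>n<n. weight n)))"

lemma tail_bound_tendsto: "tail_bound \<longlonglongrightarrow> 0"
proof -
  have "(\<lambda>n. 2 * (amplitude * C ^ CARD('d) * (suminf weight - (\<Sum>n<n. weight n)))) \<longlonglongrightarrow>
      2 * (amplitude * C ^ CARD('d) * (suminf weight - suminf weight))"
    using summable_LIMSEQ[OF summable_weight] by (intro tendsto_intros)
  then show ?thesis by (simp add: tail_bound_def[abs_def])
qed

lemma random_fun_tail:
  assumes "\<And>j k. j < n \<Longrightarrow> k \<in> grid j \<Longrightarrow> \<omega> (j, k) = \<omega>' (j, k)"
  shows "\<bar>random_fun \<omega> x - random_fun \<omega>' x\<bar> \<le> tail_bound n"
proof -
  have "layer_term (coin_sign \<omega>) [] j x = layer_term (coin_sign \<omega>') [] j x" if "j < n" for j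
    unfolding layer_term_def level_def using assms[OF that] by (auto simp: coin_sign_def intro!: sum.cong)
  then have "(\<Sum>j<n. layer_term (coin_sign \<omega>) [] j x) = (\<Sum>j<n. layer_term (coin_sign \<omega>') [] j x)" by simp
  moreover have tail: "\<bar>(\<Sum>j<n. layer_term (coin_sign \<omega>) [] j x) - random_fun \<omega> x\<bar> \<le> tail_bound n / 2" for \<omega>
    using series_tail[of "coin_sign \<omega>" "[]" x n, OF abs_coin_sign] by (simp add: tail_bound_def random_fun_def)
  ultimately show ?thesis using tail[of \<omega>] tail[of \<omega>'] by linarith
qed

text \<open>The middle half of a dyadic cube in every direction, where its bump is at least
  c^d.\<close>

definition core :: "nat \<Rightarrow> ('d \<Rightarrow> nat) \<Rightarrow> (real ^ 'd) set" where
  "core j k = cbox (\<chi> i. (real (k i) + 1 / 4) / 2 ^ j) (\<chi> i. (real (k i) + 3 / 4) / 2 ^ j)"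

lemma in_core: "x \<in> core j k \<longleftrightarrow> (\<forall>i. real (k i) + 1 / 4 \<le> 2 ^ j * vec_nth x i \<and>
    2 ^ j * vec_nth x i \<le> real (k i) + 3 / 4)"
  by (simp add: core_def mem_box_cart divide_le_eq le_divide_eq mult.commute)

lemma core_unique:
  assumes "x \<in> core j k" "x \<in> core j k'"
  shows "k = k'"
proof
  fix i
  have "real (k i) + 1 / 4 \<le> 2 ^ j * vec_nth x i" "2 ^ j * vec_nth x i \<le> real (k i) + 3 / 4"
    "real (k' i) + 1 / 4 \<le> 2 ^ j * vec_nth x i" "2 ^ j * vec_nth x i \<le> real (k' i) + 3 / 4"
    using assms by (auto simp: in_core)
  then show "k i = k' i" by linarith
qed

lemma core_subset: "k \<in> grid j \<Longrightarrow> core j k \<subseteq> unit_cube"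
proof
  fix x assume k: "k \<in> grid j" and x: "x \<in> core j k"
  have "0 \<le> vec_nth x i \<and> vec_nth x i \<le> 1" for i
  proof -
    have "k i < 2 ^ j" using k by (auto simp: grid_def)
    then have "real (k i) + 1 \<le> 2 ^ j" by (metis Suc_leI of_nat_Suc of_nat_le_iff of_nat_numeral of_nat_power
        add.commute)
    moreover have "real (k i) + 1 / 4 \<le> 2 ^ j * vec_nth x i" "2 ^ j * vec_nth x i \<le> real (k i) + 3 / 4"
      using x by (auto simp: in_core)
    ultimately have "0 \<le> 2 ^ j * vec_nth x i" "2 ^ j * vec_nth x i \<le> 2 ^ j * 1" by linarith+
    then have "2 ^ j * 0 \<le> 2 ^ j * vec_nth x i" "2 ^ j * vec_nth x i \<le> 2 ^ j * 1" by simp_all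
    moreover have "(0 :: real) < 2 ^ j" by simp
    ultimately show ?thesis by (simp only: mult_le_cancel_left_pos)
  qed
  then show "x \<in> unit_cube" by (simp add: mem_box_cart)
qed

lemma measure_core: "measure lebesgue (core j k) = (1 / 2 ^ Suc j) ^ CARD('d)"
proof -
  have "(\<chi> i. (real (k i) + 1 / 2) / 2 ^ j) \<in> core j k" by (simp add: in_core)
  then have "core j k \<noteq> {}" by blast
  then show ?thesis unfolding core_def
    by (subst measure_completion, simp, subst content_cbox_cart) (simp_all add: diff_divide_distrib[symmetric]
        divide_divide_eq_left)
qed

text \<open>The signs of all other levels agree, so these cancel exactly and only level J remains.
  On the cores of the cubes in D exactly one bump is active, with opposite signs in the two
  functions; the total measure of these cores gives the factor with \<open>card D\<close>.\<close>

lemma random_fun_separated: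
  assumes D: "D \<subseteq> grid J" and diff: "\<And>j k. \<omega> (j, k) \<noteq> \<omega>' (j, k) \<longleftrightarrow> j = J \<and> k \<in> D" and p: "1 \<le> p"
  shows "2 * coeff_at J * c ^ CARD('d) * (real (card D) * (1 / 2 ^ Suc J) ^ CARD('d)) \<le>
      Lp_norm p (\<lambda>x. random_fun \<omega> x - random_fun \<omega>' x)"
proof -
  have fD: "finite D" using D finite_grid by (rule finite_subset)
  have fdiff: "random_fun \<omega> x - random_fun \<omega>' x =
      layer_term (coin_sign \<omega>) [] J x - layer_term (coin_sign \<omega>') [] J x" for x
  proof -
    have "random_fun \<omega> x - random_fun \<omega>' x =
        (\<Sum>j. layer_term (coin_sign \<omega>) [] j x - layer_term (coin_sign \<omega>') [] j x)"
      unfolding random_fun_def series_def by (intro suminf_diff summable_layer_term abs_coin_sign) auto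
    also have "\<dots> = (\<Sum>j\<in>{J}. layer_term (coin_sign \<omega>) [] j x - layer_term (coin_sign \<omega>') [] j x)"
    proof (rule suminf_finite)
      fix j assume "j \<notin> {J}"
      then have "coin_sign \<omega> j k = coin_sign \<omega>' j k" for k using diff[of j k] by (auto simp: coin_sign_def)
      then show "layer_term (coin_sign \<omega>) [] j x - layer_term (coin_sign \<omega>') [] j x = 0"
        by (simp add: layer_term_def level_def)
    qed simp
    finally show ?thesis by simp
  qed
  have big: "2 * coeff_at J * c ^ CARD('d) \<le> \<bar>random_fun \<omega> x - random_fun \<omega>' x\<bar>" if x: "x \<in> (\<Union>k\<in>D. core J k)"
      for x
  proof -
    obtain k where k: "k \<in> D" "x \<in> core J k" using x by auto
    define b where "b l = (\<Prod>i\<in>UNIV. \<beta> 0 (2 ^ J * vec_nth x i - real (l i)))" for l :: "'d \<Rightarrow> nat"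
    obtain k0 where k0: "\<And>l. l \<in> grid J \<Longrightarrow> l \<noteq> k0 \<Longrightarrow> b l = 0"
      using level_single[of "[]" J x] unfolding b_def by auto
    have "c \<le> \<beta> 0 (2 ^ J * vec_nth x i - real (k i))" for i
    proof (rule lower)
      have "real (k i) + 1 / 4 \<le> 2 ^ J * vec_nth x i \<and> 2 ^ J * vec_nth x i \<le> real (k i) + 3 / 4"
        using k(2) by (simp add: in_core)
      then show "1 / 4 \<le> 2 ^ J * vec_nth x i - real (k i)" "2 ^ J * vec_nth x i - real (k i) \<le> 3 / 4"
          by linarith+
    qed
    then have "(\<Prod>i\<in>(UNIV :: 'd set). c) \<le> b k" unfolding b_def using c by (intro prod_mono) auto
    then have bk: "c ^ CARD('d) \<le> b k" by simp
    moreover have "0 < c ^ CARD('d)" using c by simp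
    ultimately have "b k \<noteq> 0" by linarith
    then have "k = k0" using k0[of k] k(1) D by auto
    have sgn: "\<bar>coin_sign \<omega> J k - coin_sign \<omega>' J k\<bar> = 2" using diff[of J k] k(1) by (auto simp: coin_sign_def)
    have "level (coin_sign \<omega>) J [] x - level (coin_sign \<omega>') J [] x =
        (\<Sum>l\<in>grid J. (coin_sign \<omega> J l - coin_sign \<omega>' J l) * b l)"
      by (simp add: level_def b_def sum_subtractf left_diff_distrib)
    also have "\<dots> = (\<Sum>l\<in>{k}. (coin_sign \<omega> J l - coin_sign \<omega>' J l) * b l)"
      using k(1) D k0 \<open>k = k0\<close> by (intro sum.mono_neutral_right) auto
    finally have lv: "\<bar>level (coin_sign \<omega>) J [] x - level (coin_sign \<omega>') J [] x\<bar> = 2 * \<bar>b k\<bar>" using sgn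
        by (simp add: abs_mult)
    have "random_fun \<omega> x - random_fun \<omega>' x =
        coeff_at J * (level (coin_sign \<omega>) J [] x - level (coin_sign \<omega>') J [] x)"
      unfolding fdiff by (simp add: layer_term_def algebra_simps)
    then have "\<bar>random_fun \<omega> x - random_fun \<omega>' x\<bar> = coeff_at J * (2 * \<bar>b k\<bar>)"
      using coeff_at_pos[of J] lv by (simp add: abs_mult)
    also have "\<dots> \<ge> coeff_at J * (2 * c ^ CARD('d))" using bk coeff_at_pos[of J] by (intro mult_left_mono) auto
    finally show ?thesis by (simp add: mult_ac)
  qed
  have "measure lebesgue (\<Union>k\<in>D. core J k) = (\<Sum>k\<in>D. measure lebesgue (core J k))"
  proof (rule measure_finite_Union[OF fD])
    show "disjoint_family_on (core J) D" by (auto simp: disjoint_family_on_def dest: core_unique)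
    show "emeasure lebesgue (core J k) \<noteq> \<infinity>" for k by (simp add: core_def emeasure_lborel_cbox_eq)
  qed (auto simp: core_def)
  also have "\<dots> = real (card D) * (1 / 2 ^ Suc J) ^ CARD('d)" by (simp add: measure_core)
  finally have meas: "measure lebesgue (\<Union>k\<in>D. core J k) = real (card D) * (1 / 2 ^ Suc J) ^ CARD('d)" .
  have "(2 * coeff_at J * c ^ CARD('d)) * measure lebesgue (\<Union>k\<in>D. core J k) \<le>
      Lp_norm p (\<lambda>x. random_fun \<omega> x - random_fun \<omega>' x)"
  proof (rule Lp_norm_ge[OF p])
    show "(\<lambda>x. random_fun \<omega> x - random_fun \<omega>' x) \<in> Lp_functions p"
      using holder_ballD(2)[OF random_fun_in_holder_ball] by (intro continuous_on_cube_Lp p continuous_intros)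
    show "0 \<le> 2 * coeff_at J * c ^ CARD('d)" using coeff_at_pos[of J] c by simp
    show "(\<Union>k\<in>D. core J k) \<in> sets lebesgue" using fD by (auto simp: core_def intro!: sets.finite_UN)
    show "(\<Union>k\<in>D. core J k) \<subseteq> unit_cube" using core_subset D by blast
  qed (rule big)
  then show ?thesis unfolding meas by simp
qed

section \<open>The random class: measurability and small balls\<close>

definition random_class :: "ennreal \<Rightarrow> (nat \<times> ('d \<Rightarrow> nat) \<Rightarrow> bool) \<Rightarrow> (real ^ 'd \<Rightarrow> real) set" where
  "random_class p \<omega> = Lp_class p (random_fun \<omega>)"

lemma random_fun_Lp: "1 \<le> p \<Longrightarrow> random_fun \<omega> \<in> Lp_functions p"
  by (rule continuous_on_cube_Lp[OF _ holder_ballD(2)[OF random_fun_in_holder_ball]])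

lemma random_class_mspace: "1 \<le> p \<Longrightarrow> random_class p \<omega> \<in> mspace (Lp p)"
  unfolding random_class_def by (intro Lp_class_mem random_fun_Lp)

lemma mdist_random_class:
  "1 \<le> p \<Longrightarrow> mdist (Lp p) (random_class p \<omega>) (random_class p \<omega>') =
      Lp_norm p (\<lambda>x. random_fun \<omega> x - random_fun \<omega>' x)"
  unfolding random_class_def by (simp add: mdist_Lp Lp_dist_class random_fun_Lp)

text \<open>The random class is a uniform limit of functions of finitely many coins, so preimages of open sets
  are countable unions of events of this kind.\<close>
lemma measurable_random_class:
  assumes p: "1 \<le> p"
  shows "random_class p \<in> measurable coin_space (metric_borel (Lp p :: (real ^ 'd \<Rightarrow> real) set metric))"
  unfolding metric_borel_def
proof (rule measurable_measure_of)
  let ?X = "Lp p :: (real ^ 'd \<Rightarrow> real) set metric"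
  interpret M: Metric_space "mspace ?X" "mdist ?X" by simp
  show "{U. openin (mtopology_of ?X) U} \<subseteq> Pow (mspace ?X)"
    using openin_subset topspace_mtopology_of by fastforce
  show "random_class p \<in> space coin_space \<rightarrow> mspace ?X" using random_class_mspace[OF p] by auto
  fix U assume "U \<in> {U. openin (mtopology_of ?X) U}"
  then have U: "openin M.mtopology U" by (simp add: mtopology_of_def)
  define I where "I n = (SIGMA j:{..<n}. grid j)" for n
  define tr where "tr n \<omega> = (\<lambda>i. if i \<in> I n then \<omega> i else True)" for n and \<omega> :: "nat \<times> ('d \<Rightarrow> nat) \<Rightarrow> bool"
  have near: "mdist ?X (random_class p (tr n \<omega>)) (random_class p \<omega>) \<le> tail_bound n" for n \<omega>
  proof -
    have le: "\<bar>random_fun (tr n \<omega>) x - random_fun \<omega> x\<bar> \<le> tail_bound n" for x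
      by (rule random_fun_tail) (auto simp: tr_def I_def)
    then have "0 \<le> tail_bound n" using abs_ge_zero order_trans by blast
    then show ?thesis unfolding random_class_def using le by (intro mdist_Lp_class_le p random_fun_Lp) auto
  qed
  \<comment> \<open>The radius does not depend on the outcome, so each event on the right is decided
    by the coins in \<open>I n\<close>. As the radii tend to 0, some such ball around a truncation
    fits into U.\<close>
  have "random_class p -` U = (\<Union>n. {\<omega>. M.mcball (random_class p (tr n \<omega>)) (tail_bound n) \<subseteq> U})"
  proof (intro Set.set_eqI iffI)
    fix \<omega> assume "\<omega> \<in> random_class p -` U"
    then obtain e where e: "e > 0" "M.mball (random_class p \<omega>) e \<subseteq> U"
      using U unfolding M.openin_mtopology by auto
    have "\<forall>\<^sub>F n in sequentially. tail_bound n < e / 2"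
      using tail_bound_tendsto e(1) by (intro order_tendstoD(2)) auto
    then obtain n where n: "tail_bound n < e / 2" by (auto simp: eventually_sequentially)
    have "M.mcball (random_class p (tr n \<omega>)) (tail_bound n) \<subseteq> M.mball (random_class p \<omega>) e"
    proof
      fix y assume y: "y \<in> M.mcball (random_class p (tr n \<omega>)) (tail_bound n)"
      then have "mdist ?X (random_class p \<omega>) y \<le>
          mdist ?X (random_class p \<omega>) (random_class p (tr n \<omega>)) + mdist ?X (random_class p (tr n \<omega>)) y"
        using random_class_mspace[OF p] by (intro M.triangle) auto
      also have "\<dots> \<le> tail_bound n + tail_bound n" using y near by (intro add_mono) (auto simp: M.commute)
      also have "\<dots> < e" using n by simp
      finally show "y \<in> M.mball (random_class p \<omega>) e" using y random_class_mspace[OF p] by auto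
    qed
    then show "\<omega> \<in> (\<Union>n. {\<omega>. M.mcball (random_class p (tr n \<omega>)) (tail_bound n) \<subseteq> U})" using e(2) by blast
  next
    fix \<omega> assume "\<omega> \<in> (\<Union>n. {\<omega>. M.mcball (random_class p (tr n \<omega>)) (tail_bound n) \<subseteq> U})"
    then obtain n where "M.mcball (random_class p (tr n \<omega>)) (tail_bound n) \<subseteq> U" by auto
    moreover have "random_class p \<omega> \<in> M.mcball (random_class p (tr n \<omega>)) (tail_bound n)"
      using near random_class_mspace[OF p] by auto
    ultimately show "\<omega> \<in> random_class p -` U" by auto
  qed
  moreover have "{\<omega>. M.mcball (random_class p (tr n \<omega>)) (tail_bound n) \<subseteq> U} \<in> sets coin_space" for n
    unfolding tr_def by (rule finite_coin_event[where P =
        "\<lambda>\<omega>. M.mcball (random_class p \<omega>) (tail_bound n) \<subseteq> U"]) (simp add: I_def)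
  ultimately show "random_class p -` U \<inter> space coin_space \<in> sets coin_space" by auto
qed

text \<open>Two outcomes in the ball are at distance at most 2 * \<rho>, which by separation lets at
  most an eighth of the signs of level J differ. The radius condition is this computation; the
  factor (1/2)^d is the share of the cores in their dyadic cubes.\<close>

lemma random_class_small_ball:
  assumes p: "1 \<le> p" and E: "random_class p -` metric_ball (Lp p) x \<rho> \<in> sets coin_space"
    and \<rho>: "8 * \<rho> \<le> coeff_at J * (c / 2) ^ CARD('d)"
  shows "emeasure coin_space (random_class p -` metric_ball (Lp p) x \<rho>) \<le>
      ennreal (flip_base ^ (2 ^ (J * CARD('d))))"
proof -
  let ?X = "Lp p :: (real ^ 'd \<Rightarrow> real) set metric"
  interpret M: Metric_space "mspace ?X" "mdist ?X" by simp
  define K where "K = Pair J ` grid J"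
  have K: "finite K" "card K = 2 ^ (J * CARD('d))"
    by (auto simp: K_def card_image inj_on_def card_grid)
  have "emeasure coin_space (random_class p -` metric_ball ?X x \<rho>) \<le> ennreal (flip_base ^ card K)"
  proof (rule flip_small_event[OF K(1) E])
    fix \<omega> A A' assume A: "A \<subseteq> K" "A' \<subseteq> K" and E: "flip A \<omega> \<in> random_class p -` metric_ball ?X x \<rho>"
        "flip A' \<omega> \<in> random_class p -` metric_ball ?X x \<rho>"
    define D where "D = {k. (J, k) \<in> sym_diff A A'}"
    have D: "D \<subseteq> grid J" using A by (auto simp: D_def K_def)
    have AD: "sym_diff A A' = Pair J ` D" using A by (auto simp: D_def K_def)
    then have cardD: "card (sym_diff A A') = card D" by (simp add: card_image inj_on_def)
    have "mdist ?X (random_class p (flip A \<omega>)) (random_class p (flip A' \<omega>)) \<le>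
        mdist ?X (random_class p (flip A \<omega>)) x + mdist ?X x (random_class p (flip A' \<omega>))"
      using E by (intro M.triangle) auto
    also have "\<dots> \<le> 2 * \<rho>" using E by (auto simp: M.commute)
    finally have le: "Lp_norm p (\<lambda>x. random_fun (flip A \<omega>) x - random_fun (flip A' \<omega>) x) \<le> 2 * \<rho>"
      unfolding mdist_random_class[OF p] .
    have "flip A \<omega> (j, k) \<noteq> flip A' \<omega> (j, k) \<longleftrightarrow> j = J \<and> k \<in> D" for j k
    proof -
      have "flip A \<omega> (j, k) \<noteq> flip A' \<omega> (j, k) \<longleftrightarrow> (j, k) \<in> sym_diff A A'" by (auto simp: flip_def)
      then show ?thesis unfolding AD by auto
    qed
    from random_fun_separated[OF D this p]
    have "2 * coeff_at J * c ^ CARD('d) * (real (card D) * (1 / 2 ^ Suc J) ^ CARD('d)) \<le> 2 * \<rho>" using le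
        by linarith
    moreover have "2 * coeff_at J * c ^ CARD('d) * (real (card D) * (1 / 2 ^ Suc J) ^ CARD('d)) =
        2 * (coeff_at J * (c / 2) ^ CARD('d)) * (real (card D) / 2 ^ (J * CARD('d)))"
      by (simp add: power_divide power_mult power_mult_distrib)
    ultimately have "2 * (coeff_at J * (c / 2) ^ CARD('d)) * (real (card D) / 2 ^ (J * CARD('d))) \<le>
        2 * (coeff_at J * (c / 2) ^ CARD('d)) * (1 / 8)"
      using \<rho> by linarith
    moreover have "0 < 2 * (coeff_at J * (c / 2) ^ CARD('d))" using coeff_at_pos[of J] c by simp
    ultimately have "real (card D) / 2 ^ (J * CARD('d)) \<le> 1 / 8" by (simp only: mult_le_cancel_left_pos)
    then have "8 * real (card D) \<le> 2 ^ (J * CARD('d))" by (simp add: field_simps)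
    then have "real (8 * card D) \<le> real (2 ^ (J * CARD('d)))" by simp
    then show "8 * card (sym_diff A A') \<le> card K" unfolding cardD K(2) of_nat_le_iff .
  qed
  then show ?thesis by (simp add: K)
qed

end

text \<open>J is the integer part of (s / d) * log2 (1 / \<rho>), so that 2^(J d) reaches (1 /
  \<rho>)^s up to the factor 2^-d. The radius condition holds since r * s / d < 1: the spare power
  of \<rho> beats the squared logarithm coming from the weights.\<close>

lemma dyadic_scale:
  fixes B d r s :: real
  assumes B: "0 < B" and d: "0 < d" and r: "0 < r" and s: "0 < s" "s < d / r"
  obtains r0 where "0 < r0" "r0 \<le> 1"
    "\<And>\<rho>. 0 < \<rho> \<Longrightarrow> \<rho> < r0 \<Longrightarrow> \<exists>J::nat. \<rho> \<le> B * 2 powr (- r * real J) * (1 / real (Suc J))\<^sup>2 \<and>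
       2 powr (- d) * (1 / \<rho>) powr s \<le> 2 powr (real J * d)"
proof -
  define k where "k = s / d"
  define u where "u = 1 - r * k"
  have k: "0 < k" and u: "0 < u" using assms by (auto simp: k_def u_def field_simps)
  have "((\<lambda>\<rho>. \<rho> powr u * (k * log 2 (1 / \<rho>) + 1)\<^sup>2) \<longlongrightarrow> 0) (at_right 0)"
    using k u by real_asymp
  then have "\<forall>\<^sub>F \<rho> in at_right 0. \<rho> powr u * (k * log 2 (1 / \<rho>) + 1)\<^sup>2 < B"
    using B by (rule order_tendstoD(2))
  then obtain b where b: "b > 0" "\<And>\<rho>. 0 < \<rho> \<Longrightarrow> \<rho> < b \<Longrightarrow> \<rho> powr u * (k * log 2 (1 / \<rho>) + 1)\<^sup>2 < B"
    unfolding eventually_at_right_field by auto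
  have main: "\<exists>J::nat. \<rho> \<le> B * 2 powr (- r * real J) * (1 / real (Suc J))\<^sup>2 \<and>
       2 powr (- d) * (1 / \<rho>) powr s \<le> 2 powr (real J * d)" if \<rho>: "0 < \<rho>" "\<rho> < min b 1" for \<rho>
  proof -
    define L where "L = k * log 2 (1 / \<rho>)"
    have L0: "0 \<le> L" unfolding L_def using k \<rho> by simp
    define J where "J = nat \<lfloor>L\<rfloor>"
    have J: "real J \<le> L" "L < real J + 1" using L0 by (simp_all add: J_def)
    have pow: "2 powr (x * log 2 (1 / \<rho>)) = (1 / \<rho>) powr x" for x
      using \<rho> by (simp add: powr_def log_def)
    have "\<rho> powr u * (L + 1)\<^sup>2 \<le> B" using b(2)[of \<rho>] \<rho> by (simp add: L_def less_imp_le)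
    then have "\<rho> powr u \<le> B * (1 / (L + 1))\<^sup>2" using L0 by (simp add: power_divide pos_le_divide_eq)
    then have "\<rho> powr u * \<rho> powr (r * k) \<le> B * (1 / (L + 1))\<^sup>2 * \<rho> powr (r * k)" by (intro mult_right_mono) auto
    moreover have "\<rho> powr u * \<rho> powr (r * k) = \<rho>" using \<rho> by (simp add: u_def flip: powr_add)
    moreover have "\<rho> powr (r * k) = 2 powr (- r * L)"
      using pow[of "- r * k"] \<rho> by (simp add: L_def powr_divide powr_minus_divide mult.assoc)
    ultimately have "\<rho> \<le> B * (1 / (L + 1))\<^sup>2 * 2 powr (- r * L)" by (simp only:)
    also have "\<dots> \<le> B * (1 / real (Suc J))\<^sup>2 * 2 powr (- r * real J)"
    proof (rule mult_mono)
      show "B * (1 / (L + 1))\<^sup>2 \<le> B * (1 / real (Suc J))\<^sup>2"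
        using B J(1) by (intro mult_left_mono power_mono divide_left_mono) auto
      show "2 powr (- r * L) \<le> 2 powr (- r * real J)" using J(1) r by (intro powr_mono) auto
    qed (use B in auto)
    finally have 1: "\<rho> \<le> B * 2 powr (- r * real J) * (1 / real (Suc J))\<^sup>2" by (simp add: mult_ac)
    have "2 powr (- d) * (1 / \<rho>) powr s = 2 powr ((L - 1) * d)"
    proof -
      have "- d + s * log 2 (1 / \<rho>) = (L - 1) * d" using d by (simp add: L_def k_def algebra_simps)
      then show ?thesis unfolding pow[symmetric] powr_add[symmetric] by simp
    qed
    also have "\<dots> \<le> 2 powr (real J * d)" using J d by (intro powr_mono mult_right_mono) auto
    finally show ?thesis using 1 by blast
  qed
  show thesis by (rule that[of "min b 1"]) (use b(1) main in auto)
qed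

section \<open>The critical measure and the final assembly\<close>

lemma metric_ball_in_borel: "metric_ball X x \<rho> \<in> sets (metric_borel X)"
proof -
  interpret M: Metric_space "mspace X" "mdist X" by simp
  have "openin M.mtopology (mspace X - M.mcball x \<rho>)"
    using M.closedin_mcball[of x \<rho>] by (simp add: closedin_def)
  moreover have "{U. openin (mtopology_of X) U} \<subseteq> Pow (mspace X)"
    using openin_subset topspace_mtopology_of by fastforce
  ultimately have "mspace X - M.mcball x \<rho> \<in> sets (metric_borel X)"
    by (auto simp: metric_borel_def mtopology_of_def)
  then have "space (metric_borel X) - (mspace X - M.mcball x \<rho>) \<in> sets (metric_borel X)"
      by (rule sets.compl_sets)
  moreover have "space (metric_borel X) - (mspace X - M.mcball x \<rho>) = metric_ball X x \<rho>"
    by (auto simp: metric_borel_def space_measure_of_conv metric_ball_def)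
  ultimately show ?thesis by simp
qed

text \<open>The law of the random class, the same for every s. Measurability of the Hoelder class is
  bypassed: each measurable superset contains all outcomes, so the outer measure is at least
  1.\<close>

lemma exists_small_ball_measure:
  fixes \<alpha> :: real
  assumes p: "1 \<le> p" and \<alpha>: "0 < \<alpha>" "\<alpha> \<le> 1"
  obtains \<mu> where "borel_prob_on (Lp p) \<mu>" "outer_measure_of \<mu> (Lp_class p ` (holder_ball m \<alpha> :: (real ^
      'd::finite \<Rightarrow> real) set)) > 0"
    "\<And>s. 0 < s \<Longrightarrow> s < real CARD('d) / (real m + \<alpha>) \<Longrightarrow>
      \<exists>c>0. \<exists>r0>0. \<forall>x\<in>mspace (Lp p). \<forall>\<rho>. 0 < \<rho> \<and> \<rho> < r0 \<longrightarrow>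
        outer_measure_of \<mu> (metric_ball (Lp p) x \<rho>) \<le> ennreal (exp (- c * (1 / \<rho>) powr s))"
proof -
  let ?X = "Lp p :: (real ^ 'd \<Rightarrow> real) set metric"
  let ?d = "real CARD('d)"
  obtain \<beta> :: "nat \<Rightarrow> real \<Rightarrow> real" and C c where \<beta>: "1 \<le> C" "0 < c"
    "\<And>q t. q \<le> Suc m \<Longrightarrow> \<bar>\<beta> q t\<bar> \<le> C" "\<And>q t. q \<le> Suc m \<Longrightarrow> t \<le> 0 \<or> 1 \<le> t \<Longrightarrow> \<beta> q t = 0"
    "\<And>q t. q \<le> m \<Longrightarrow> (\<beta> q has_field_derivative \<beta> (Suc q) t) (at t)"
    "\<And>t. 1 / 4 \<le> t \<Longrightarrow> t \<le> 3 / 4 \<Longrightarrow> c \<le> \<beta> 0 t"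
    by (rule bump_exists[of m]) blast
  interpret S: bump_series m \<alpha> \<beta> C c "TYPE('d)" by unfold_locales (use \<alpha> \<beta> in auto)
  interpret P: prob_space "coin_space :: (nat \<times> ('d \<Rightarrow> nat) \<Rightarrow> bool) measure" by (rule prob_space_coin_space)
  define \<mu> where "\<mu> = distr coin_space (metric_borel ?X) (S.random_class p)"
  have meas: "S.random_class p \<in> measurable coin_space (metric_borel ?X)"
      by (rule S.measurable_random_class[OF p])
  have sets: "sets \<mu> = sets (metric_borel ?X)" by (simp add: \<mu>_def)
  have prob: "borel_prob_on ?X \<mu>" unfolding borel_prob_on_def
    using P.prob_space_distr[OF meas] sets by (simp add: \<mu>_def)
  have em: "emeasure \<mu> A = emeasure coin_space (S.random_class p -` A)" if "A \<in> sets \<mu>" for A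
    using emeasure_distr[OF meas, of A] that unfolding sets by (simp add: \<mu>_def)
  have "1 \<le> outer_measure_of \<mu> (Lp_class p ` holder_ball m \<alpha>)"
    unfolding outer_measure_of_def
  proof (rule INF_greatest)
    fix A assume A: "A \<in> {B \<in> sets \<mu>. Lp_class p ` holder_ball m \<alpha> \<subseteq> B}"
    then have "S.random_class p -` A = UNIV"
      unfolding S.random_class_def using S.random_fun_in_holder_ball by blast
    then show "1 \<le> emeasure \<mu> A" using em[of A] A P.emeasure_space_1 by simp
  qed
  then have pos: "outer_measure_of \<mu> (Lp_class p ` (holder_ball m \<alpha> :: (real ^ 'd \<Rightarrow> real) set)) > 0"
    by (rule order_less_le_trans[OF zero_less_one_class.zero_less_one])
  show thesis
  proof (rule that[OF prob pos])
    fix s assume s: "0 < s" "s < ?d / (real m + \<alpha>)"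
    define B where "B = S.amplitude * (c / 2) ^ CARD('d) / 8"
    have B: "0 < B" unfolding B_def using S.amplitude_pos \<beta>(2) by simp
    have r: "0 < S.r" and s': "s < ?d / S.r" using \<alpha> s by (auto simp: S.r_def)
    obtain r0 where r0: "0 < r0" "\<And>\<rho>. 0 < \<rho> \<Longrightarrow> \<rho> < r0 \<Longrightarrow>
        \<exists>J::nat. \<rho> \<le> B * 2 powr (- S.r * real J) * (1 / real (Suc J))\<^sup>2 \<and>
       2 powr (- ?d) * (1 / \<rho>) powr s \<le> 2 powr (real J * ?d)"
      by (rule dyadic_scale[OF B _ r s(1) s']) (simp, blast)
    \<comment> \<open>From \<open>flip_base\<close>^(2^(J d)) = exp (ln \<open>flip_base\<close> *
      2^(J d)) and 2^(J d) \<ge> 2^-d * (1 / \<rho>)^s; it is positive because ln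
      \<open>flip_base\<close> < 0.\<close>
    define k where "k = - ln flip_base * 2 powr (- ?d)"
    have "ln flip_base < 0" using flip_base by simp
    then have k: "0 < k" unfolding k_def by (intro mult_pos_pos) auto
    have "outer_measure_of \<mu> (metric_ball ?X x \<rho>) \<le> ennreal (exp (- k * (1 / \<rho>) powr s))"
      if \<rho>: "0 < \<rho>" "\<rho> < r0" for x \<rho>
    proof -
      obtain J :: nat where J: "\<rho> \<le> B * 2 powr (- S.r * real J) * (1 / real (Suc J))\<^sup>2"
        "2 powr (- ?d) * (1 / \<rho>) powr s \<le> 2 powr (real J * ?d)" using r0(2)[OF \<rho>] by blast
      have ball: "metric_ball ?X x \<rho> \<in> sets \<mu>" unfolding sets by (rule metric_ball_in_borel)
      have "outer_measure_of \<mu> (metric_ball ?X x \<rho>) =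
          emeasure coin_space (S.random_class p -` metric_ball ?X x \<rho>)"
        by (simp add: ball em)
      also have "\<dots> \<le> ennreal (flip_base ^ (2 ^ (J * CARD('d))))"
      proof (rule S.random_class_small_ball[OF p])
        show "S.random_class p -` metric_ball ?X x \<rho> \<in> sets coin_space"
          using measurable_sets[OF meas, of "metric_ball ?X x \<rho>"] ball by (simp add: sets)
        show "8 * \<rho> \<le> S.coeff_at J * (c / 2) ^ CARD('d)"
          using J(1) by (simp add: B_def S.coeff_at_def S.weight_def mult_ac)
      qed
      also have "\<dots> \<le> ennreal (exp (- k * (1 / \<rho>) powr s))"
      proof (rule ennreal_leI)
        have "flip_base ^ (2 ^ (J * CARD('d))) = exp (ln flip_base * 2 powr (real J * ?d))"
          using flip_base(1) powr_realpow[of 2 "J * CARD('d)"]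
          by (simp add: powr_realpow[symmetric] powr_def mult_ac)
        also have "\<dots> \<le> exp (ln flip_base * (2 powr (- ?d) * (1 / \<rho>) powr s))"
          using J(2) \<open>ln flip_base < 0\<close> by (simp add: mult_left_mono_neg)
        finally show "flip_base ^ (2 ^ (J * CARD('d))) \<le> exp (- k * (1 / \<rho>) powr s)"
            by (simp add: k_def mult_ac)
      qed
      finally show ?thesis .
    qed
    then show "\<exists>c>0. \<exists>r0>0. \<forall>x\<in>mspace ?X. \<forall>\<rho>. 0 < \<rho> \<and> \<rho> < r0 \<longrightarrow>
        outer_measure_of \<mu> (metric_ball ?X x \<rho>) \<le> ennreal (exp (- c * (1 / \<rho>) powr s))"
      using k r0(1) by blast
  qed
qed

lemma approximates_NN:
  fixes \<alpha> t :: real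
  assumes p: "1 \<le> p" and \<alpha>: "0 < \<alpha>" and t: "0 \<le> t" "t < (real m + \<alpha>) / real CARD('d)"
  shows "approximates_at_rate (Lp p) (Lp_class p ` (holder_ball m \<alpha> :: (real ^ 'd::finite \<Rightarrow> real) set))
    (\<lambda>n. Lp_class p ` NN 3 n) t"
proof -
  have "\<exists>C>0. \<forall>n\<ge>1. \<forall>f \<in> holder_ball m \<alpha>. \<exists>g \<in> NN 3 n. \<forall>x \<in> unit_cube.
    \<bar>f x - g (x :: real ^ 'd::finite)\<bar> \<le> C * real n powr - t"
  proof (cases "t = 0")
    \<comment> \<open>The construction needs a positive rate. At t = 0 the zero network suffices, as
      functions in the Hoelder ball are bounded by 1.\<close>
    case True
    have "\<forall>n\<ge>1. \<forall>f \<in> holder_ball m \<alpha>. \<exists>g \<in> NN 3 n. \<forall>x \<in> unit_cube. \<bar>f x - g (x :: real ^ 'd)\<bar> \<le>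
        1 * real n powr - t"
    proof (intro allI impI ballI)
      fix n :: nat and f :: "real ^ 'd \<Rightarrow> real"
      assume n: "1 \<le> n" and f: "f \<in> holder_ball m \<alpha>"
      show "\<exists>g \<in> NN 3 n. \<forall>x \<in> unit_cube. \<bar>f x - g x\<bar> \<le> 1 * real n powr - t"
        by (rule bexI[OF _ zero_in_NN[OF n]], rule ballI) (use True n holder_ballD(3)[OF f] in simp)
    qed
    then show ?thesis by (intro exI[of _ 1] conjI zero_less_one_class.zero_less_one)
  next
    case False
    then show ?thesis using NN_approximates[OF \<alpha> _ t(2)] t(1) by auto
  qed
  then obtain C where C: "C > 0" "\<And>n f. n \<ge> 1 \<Longrightarrow> f \<in> holder_ball m \<alpha> \<Longrightarrow> \<exists>g \<in> NN 3 n. \<forall>x \<in> unit_cube.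
    \<bar>f x - g (x :: real ^ 'd)\<bar> \<le> C * real n powr - t" by blast
  have "dist_to (Lp p) (Lp_class p f) (Lp_class p ` NN 3 n) \<le> C * real n powr - t"
    if n: "n \<ge> 1" and f: "f \<in> holder_ball m \<alpha>" for n and f :: "real ^ 'd \<Rightarrow> real"
  proof -
    obtain g where g: "g \<in> NN 3 n" "\<And>x. x \<in> unit_cube \<Longrightarrow> \<bar>f x - g x\<bar> \<le> C * real n powr - t" using C(2)[OF n f]
        by blast
    have "dist_to (Lp p) (Lp_class p f) (Lp_class p ` NN 3 n) \<le> mdist (Lp p) (Lp_class p f) (Lp_class p g)"
      using g(1) by (intro dist_to_le) auto
    also have "\<dots> \<le> C * real n powr - t"
      using C(1) g by (intro mdist_Lp_class_le p continuous_on_cube_Lp holder_ballD(2)[OF f] NN_continuous) auto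
    finally show ?thesis .
  qed
  then show ?thesis unfolding approximates_at_rate_def using C(1)
    by (intro exI[of _ C] conjI allI impI SUP_least) auto
qed

theorem proposition1p17:
  fixes p :: ennreal and m :: nat and \<alpha> r :: real
    and X :: "(real ^ 'd::finite \<Rightarrow> real) set metric"
    and \<C> :: "(real ^ 'd \<Rightarrow> real) set set"
    and \<A> :: "nat \<Rightarrow> (real ^ 'd \<Rightarrow> real) set set"
  assumes p: "1 \<le> p"
    and \<alpha>: "0 < \<alpha>" "\<alpha> \<le> 1"
    and r: "r = real m + \<alpha>"
    and X: "X = Lp p"
    and \<C>: "\<C> = Lp_class p ` {f \<in> holder_space m \<alpha>. holder_norm m \<alpha> f \<le> 1}"
    and \<A>: "\<A> = (\<lambda>n. Lp_class p ` NN 3 n)"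
  shows "(dim_exp_exists X \<C> \<and> dim_exp X \<C> = ereal (real CARD('d) / r)) \<and>
    (\<exists>\<mu>. borel_prob_on X \<mu> \<and> critical X \<mu> \<C>) \<and>
    optimal_for X \<C> \<A> \<and>
    (\<forall>t. 0 \<le> t \<and> t < r / real CARD('d) \<longrightarrow> approximates_at_rate X \<C> \<A> t) \<and>
    (\<forall>\<mu> \<B>. borel_prob_on X \<mu> \<and> critical X \<mu> \<C> \<and> controlled_complexity X \<B> \<longrightarrow>
      outer_measure_of \<mu> (\<Union>t\<in>{r / real CARD('d)<..}.
        {f \<in> \<C>. bdd_above ((\<lambda>n. real n powr t * dist_to X f (\<B> n)) ` {1..})}) = 0)"
proof -
  have \<C>': "\<C> = Lp_class p ` holder_ball m \<alpha>" by (simp add: \<C> holder_ball_def)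
  have rpos: "0 < r" using \<alpha> r by simp
  define D where "D = real CARD('d) / r"
  have D: "0 < D" and D_inv: "1 / D = r / real CARD('d)" using rpos by (auto simp: D_def)
  define x0 :: "(real ^ 'd \<Rightarrow> real) set" where "x0 = Lp_class p (\<lambda>_. 0)"
  have x0: "x0 \<in> mspace X" unfolding x0_def X by (intro Lp_class_mem p continuous_on_cube_Lp continuous_intros)
  have ball: "\<C> \<subseteq> metric_ball X x0 1"
  proof
    fix F assume "F \<in> \<C>"
    then obtain f where f: "f \<in> holder_ball m \<alpha>" "F = Lp_class p f" unfolding \<C>' by blast
    have "mdist X x0 F \<le> 1" unfolding f(2) x0_def X
      by (intro mdist_Lp_class_le p continuous_on_cube_Lp holder_ballD(2)[OF f(1)] continuous_intros) (use
          holder_ballD(3)[OF f(1)] in auto)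
    moreover have "F \<in> mspace X" unfolding f(2) X
      by (intro Lp_class_mem p continuous_on_cube_Lp holder_ballD(2)[OF f(1)])
    ultimately show "F \<in> metric_ball X x0 1" using x0 by simp
  qed
  have rate: "approximates_at_rate X \<C> \<A> t" if "0 \<le> t" "t < r / real CARD('d)" for t
    unfolding X \<C>' \<A> using that by (intro approximates_NN p \<alpha>) (auto simp: r)
  have cc: "controlled_complexity X \<A>" unfolding X \<A> by (rule controlled_complexity_NN[OF p]) simp
  have upper: "totally_bounded_in X \<C>" "upper_dim_exp X \<C> \<le> ereal D"
    using upper_dim_exp_le[OF ball _ x0 cc, of "1 / D"] D rate unfolding D_inv by (auto simp flip: D_inv)
  obtain \<mu> where \<mu>: "borel_prob_on X \<mu>" "outer_measure_of \<mu> \<C> > 0"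
    "\<And>s. 0 < s \<Longrightarrow> s < D \<Longrightarrow> \<exists>c>0. \<exists>r0>0. \<forall>x\<in>mspace X. \<forall>\<rho>. 0 < \<rho> \<and> \<rho> < r0 \<longrightarrow>
        outer_measure_of \<mu> (metric_ball X x \<rho>) \<le> ennreal (exp (- c * (1 / \<rho>) powr s))"
    unfolding X \<C>' D_def r by (rule exists_small_ball_measure[OF p \<alpha>, where m = m]) blast
  have sub: "\<C> \<subseteq> mspace X" using ball by auto
  \<comment> \<open>The small-ball bound is available for s < D only, so D is reached as a limit; D
    / 2 in the choice of s keeps it positive.\<close>
  have lower: "ereal D \<le> lower_dim_exp X \<C>"
  proof (rule dense_le)
    fix y :: ereal assume y: "y < ereal D"
    show "y \<le> lower_dim_exp X \<C>"
    proof -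
      obtain s where s: "y \<le> ereal s" "0 < s" "s < D"
      proof (cases y)
        case (real z)
        then show thesis using y D by (intro that[of "max z (D / 2)"]) auto
      next
        case MInf
        then show thesis using D by (intro that[of "D / 2"]) auto
      qed (use y in auto)
      from \<mu>(3)[OF s(2,3)] obtain c r0 where "c > 0" "r0 > 0" "\<And>x \<rho>. x \<in> mspace X \<Longrightarrow> 0 < \<rho> \<Longrightarrow> \<rho> < r0 \<Longrightarrow>
          outer_measure_of \<mu> (metric_ball X x \<rho>) \<le> ennreal (exp (- c * (1 / \<rho>) powr s))" by blast
      from lower_dim_exp_ge[OF \<mu>(1) sub \<mu>(2) s(2) this] s(1) show ?thesis by (rule order_trans[rotated])
    qed
  qed
  have le: "lower_dim_exp X \<C> \<le> upper_dim_exp X \<C>"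
    unfolding lower_dim_exp_def upper_dim_exp_def by (simp add: Liminf_le_Limsup)
  have dims: "lower_dim_exp X \<C> = ereal D" "upper_dim_exp X \<C> = ereal D"
    using lower le upper(2) by (auto intro: antisym order_trans)
  \<comment> \<open>Criticality quantifies over exponents below the lower dimension, so it becomes
    accessible once that dimension is known to be D.\<close>
  have crit: "critical X \<mu> \<C>" unfolding critical_def dims using \<mu>(2,3) by auto
  have bounded: "bounded_in X \<C>"
  proof -
    interpret M: Metric_space "mspace X" "mdist X" by simp
    show ?thesis unfolding bounded_in_def M.mbounded_def using ball unfolding metric_ball_def by blast
  qed
  have nonempty: "\<C> \<noteq> {}" using zero_in_holder_ball unfolding \<C>' by blast
  have opt: "optimal_for X \<C> \<A>" unfolding optimal_for_def dims
  proof (intro conjI allI impI bounded nonempty cc)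
    fix t :: real assume "0 \<le> t" "ereal t < inverse (ereal D)"
    then show "approximates_at_rate X \<C> \<A> t" using D D_inv by (intro rate) (auto simp: inverse_eq_divide)
  qed
  have null: "outer_measure_of \<nu> (\<Union>t\<in>{r / real CARD('d)<..}.
        {f \<in> \<C>. bdd_above ((\<lambda>n. real n powr t * dist_to X f (\<B> n)) ` {1..})}) = 0"
    if "borel_prob_on X \<nu>" "critical X \<nu> \<C>" "controlled_complexity X \<B>" for \<nu> \<B>
    using null_superrate_set[OF that(1,2) ball _ x0 dims(1) D that(3)] unfolding D_inv by simp
  have "dim_exp_exists X \<C>" "dim_exp X \<C> = ereal (real CARD('d) / r)"
    unfolding dim_exp_exists_def dim_exp_def dims D_def by simp_all
  then show ?thesis using \<mu>(1) crit opt rate null by blast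
qed

end
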